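(* Let $V(x)=x^2$ on $\mathbb R$ and consider the Gaussian $\beta$-ensemble, i.e. the probability measure on $\mathbb R^N$ $$\mathbb P_N[d\mathbf x]=\frac1{\mathrm Z_N^{(V)}}\exp\Big(-\beta\sum_{1\le i<j\le N}\log|x_i-x_j|^{-1}-\sum_{j=1}^Nx_j^2\Big)dx_1\cdots dx_N,$$ in the regime where $\beta N\to\gamma$ with $\gamma\ge0$ as $N\to+\infty$. Let $$\xi_N:=2\Big(\sqrt{\log N}\max_{j=1,\dots,N}x_j-\log N\Big)-\frac{\beta N-1}2\log\log N+\log(2\mathrm L_\gamma).$$ Then the random variable $\xi_N$ converges in distribution to a standard Gumbel random variable (with distribution function $t\mapsto\exp(-e^{-t})$ on $\mathbb R$).
   Context: Here $\beta=\beta_N>0$ may depend on $N$ and $\mathrm Z_N^{(V)}$ is the normalizing constant. The constant $\mathrm L_\gamma>0$: let $\mathrm g(u,x)=\log|x-u|^{-1}$, $\vartheta(x)=\log(1+|x|)$, $\widetilde{\mathrm g}(u,x)=\mathrm g(u,x)+\vartheta(u)+\vartheta(x)\ge0$ for $u,x\in\mathbb R$, let $\nu_\gamma$ be the probability measure proportional to $e^{-x^2+\gamma\vartheta(x)}dx$, let $\mathrm H(\mu|\nu)=\int\log\frac{d\mu}{d\nu}d\mu$ if $\mu\ll\nu$ and $+\infty$ otherwise, and $\mathscr F_\gamma(\mu)=\frac\gamma2\iint\widetilde{\mathrm g}(x,z)\mu(dz)\mu(dx)+\mathrm H(\mu|\nu_\gamma)$ for Borel probability measures $\mu$ on $\mathbb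 R$. The functional $\mathscr F_\gamma$ has a unique minimizer $\mu_\gamma$, whose Lebesgue density satisfies $\mu_\gamma(x)=\mathrm L_\gamma^{-1}e^{-\gamma\mathscr U^{\mu_\gamma}(x)-x^2}$ with $\mathscr U^{\mu_\gamma}(x)=\int\log|x-z|^{-1}\mu_\gamma(dz)$; thus $\mathrm L_\gamma=\int e^{-\gamma\mathscr U^{\mu_\gamma}(x)-x^2}dx$. *)

theory Defs
  imports "HOL-Probability.Probability"
begin

section \<open>The constant \<open>L\<^sub>\<gamma>\<close>\<close>

definition borel_prob_measures :: "real measure set" where
  "borel_prob_measures = {\<mu>. prob_space \<mu> \<and> sets \<mu> = sets borel}"

text \<open>Extended-real valued, so that the kernel is \<open>+\<infinity>\<close> on the diagonal (the real function
  \<^const>\<open>ln\<close> would give \<open>ln 0 = 0\<close> there, and atoms would carry no energy).\<close>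

definition log_kernel :: "real \<Rightarrow> real \<Rightarrow> ereal" where
  "log_kernel u x = (if x = u then \<infinity> else ereal (ln (inverse \<bar>x - u\<bar>)))"

definition theta :: "real \<Rightarrow> real" where
  "theta x = ln (1 + \<bar>x\<bar>)"

definition log_kernel_tilde :: "real \<Rightarrow> real \<Rightarrow> ereal" where
  "log_kernel_tilde u x = log_kernel u x + ereal (theta u) + ereal (theta x)"

text \<open>Truncation by \<^const>\<open>e2ennreal\<close> loses nothing in the definition of the energy below.\<close>

lemma log_kernel_tilde_nonneg: "0 \<le> log_kernel_tilde u x"
proof (cases "x = u")
  case False
  have "\<bar>x - u\<bar> \<le> (1 + \<bar>u\<bar>) * (1 + \<bar>x\<bar>)"
    by (simp add: distrib_left distrib_right abs_le_iff) (smt (verit) mult_nonneg_nonneg)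
  then have "ln \<bar>x - u\<bar> \<le> ln ((1 + \<bar>u\<bar>) * (1 + \<bar>x\<bar>))"
    using False by simp
  also have "\<dots> = theta u + theta x"
    unfolding theta_def by (subst ln_mult_pos) (auto intro: add_pos_nonneg)
  finally show ?thesis
    using False by (simp add: log_kernel_tilde_def log_kernel_def ln_inverse)
qed (simp add: log_kernel_tilde_def log_kernel_def)

definition log_energy :: "real measure \<Rightarrow> ennreal" where
  "log_energy \<mu> = (\<integral>\<^sup>+ x. (\<integral>\<^sup>+ z. e2ennreal (log_kernel_tilde x z) \<partial>\<mu>) \<partial>\<mu>)"

definition nu_weight :: "real \<Rightarrow> real \<Rightarrow> real" where
  "nu_weight \<gamma> x = exp (- x\<^sup>2 + \<gamma> * theta x)"

definition nu :: "real \<Rightarrow> real measure" where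
  "nu \<gamma> = density lborel (\<lambda>x. ennreal (nu_weight \<gamma> x / (\<integral>y. nu_weight \<gamma> y \<partial>lborel)))"

text \<open>For probability measures \<open>\<mu> \<lless> \<nu>\<close> the integral of \<open>log (d\<mu>/d\<nu>)\<close> always exists in
  \<open>]-\<infinity>, +\<infinity>]\<close>, its negative part being integrable, but may be \<open>+\<infinity>\<close>; it is therefore written
  as the difference of the integrals of the positive and negative parts instead of a Bochner
  integral (as in \<^const>\<open>KL_divergence\<close>), which would be \<open>0\<close> in that case. Note that
  \<^const>\<open>ennreal\<close> maps negative reals to \<open>0\<close>, and that \<open>absolutely_continuous \<nu> \<mu>\<close> means
  \<open>\<mu> \<lless> \<nu>\<close>.\<close>

definition relative_entropy :: "real measure \<Rightarrow> real measure \<Rightarrow> ereal" where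
  "relative_entropy \<mu> \<nu> =
    (if absolutely_continuous \<nu> \<mu> then
       enn2ereal (\<integral>\<^sup>+ x. ennreal (ln (enn2real (RN_deriv \<nu> \<mu> x))) \<partial>\<mu>)
       - enn2ereal (\<integral>\<^sup>+ x. ennreal (- ln (enn2real (RN_deriv \<nu> \<mu> x))) \<partial>\<mu>)
     else \<infinity>)"

text \<open>When \<open>\<gamma> = 0\<close> the convention \<open>0 * \<infinity> = 0\<close> makes this the relative entropy alone.\<close>

definition free_energy :: "real \<Rightarrow> real measure \<Rightarrow> ereal" where
  "free_energy \<gamma> \<mu> = ereal (\<gamma> / 2) * enn2ereal (log_energy \<mu>) + relative_entropy \<mu> (nu \<gamma>)"

definition free_energy_minimizer :: "real \<Rightarrow> real measure \<Rightarrow> bool" where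
  "free_energy_minimizer \<gamma> \<mu> \<longleftrightarrow>
    \<mu> \<in> borel_prob_measures \<and> (\<forall>\<mu>'\<in>borel_prob_measures. free_energy \<gamma> \<mu> \<le> free_energy \<gamma> \<mu>')"

definition equilibrium_measure :: "real \<Rightarrow> real measure" where
  "equilibrium_measure \<gamma> = (THE \<mu>. free_energy_minimizer \<gamma> \<mu>)"

text \<open>The real-valued logarithm may be used here, as the value at \<open>z = x\<close> only matters when \<open>\<mu>\<close>
  has an atom at \<open>x\<close>; the equilibrium measure has a Lebesgue density.\<close>

definition log_potential :: "real measure \<Rightarrow> real \<Rightarrow> real" where
  "log_potential \<mu> x = (\<integral>z. ln (inverse \<bar>x - z\<bar>) \<partial>\<mu>)"

definition L_const :: "real \<Rightarrow> real" where
  "L_const \<gamma> = (\<integral>x. exp (- \<gamma> * log_potential (equilibrium_measure \<gamma>) x - x\<^sup>2) \<partial>lborel)"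

section \<open>The Gaussian \<open>\<beta>\<close>-ensemble\<close>

text \<open>Points of \<open>\<real>\<^sup>N\<close> are functions on \<open>{1..N}\<close>, extended by \<^const>\<open>undefined\<close>. Configurations
  with \<open>x i = x j\<close> for some \<open>i \<noteq> j\<close>, where \<open>ln (inverse 0) = 0\<close>, form a Lebesgue null set.\<close>

definition lebesgue_RN :: "nat \<Rightarrow> (nat \<Rightarrow> real) measure" where
  "lebesgue_RN N = (\<Pi>\<^sub>M i\<in>{1..N}. lborel)"

definition beta_weight :: "(real \<Rightarrow> real) \<Rightarrow> real \<Rightarrow> nat \<Rightarrow> (nat \<Rightarrow> real) \<Rightarrow> real" where
  "beta_weight V \<beta> N x =
    exp (- \<beta> * (\<Sum>(i, j)\<in>{(i, j). 1 \<le> i \<and> i < j \<and> j \<le> N}. ln (inverse \<bar>x i - x j\<bar>))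
         - (\<Sum>j\<in>{1..N}. V (x j)))"

definition beta_partition :: "(real \<Rightarrow> real) \<Rightarrow> real \<Rightarrow> nat \<Rightarrow> real" where
  "beta_partition V \<beta> N = (\<integral>x. beta_weight V \<beta> N x \<partial>lebesgue_RN N)"

definition beta_ensemble :: "(real \<Rightarrow> real) \<Rightarrow> real \<Rightarrow> nat \<Rightarrow> (nat \<Rightarrow> real) measure" where
  "beta_ensemble V \<beta> N =
    density (lebesgue_RN N) (\<lambda>x. ennreal (beta_weight V \<beta> N x / beta_partition V \<beta> N))"

definition xi :: "real \<Rightarrow> real \<Rightarrow> nat \<Rightarrow> (nat \<Rightarrow> real) \<Rightarrow> real" where
  "xi \<gamma> \<beta> N x =
    2 * (sqrt (ln (real N)) * Max (x ` {1..N}) - ln (real N))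
    - (\<beta> * real N - 1) / 2 * ln (ln (real N)) + ln (2 * L_const \<gamma>)"

definition standard_gumbel :: "real measure" where
  "standard_gumbel = interval_measure (\<lambda>t. exp (- exp (- t)))"

end

theory Submission
  imports Defs "HOL-Real_Asymp.Real_Asymp"
begin

text \<open>
  The number of particles above the threshold at which \<open>\<xi>\<^sub>N = \<tau>\<close> is asymptotically Poisson of mean
  \<open>e\<^sup>-\<^sup>\<tau>\<close>; that no particle exceeds it is the event \<open>\<xi>\<^sub>N \<le> \<tau>\<close>. The Poisson limit is obtained from
  Stein's equation: by exchangeability one conditions on the last particle, whose density given the
  \<open>n\<close> others is proportional to \<open>exp (\<beta> \<Sum>\<^sub>j ln |x - x\<^sub>j| - x\<^sup>2)\<close>. At the edge this is close to
  \<open>|x|\<^sup>\<beta>\<^sup>n e\<^sup>-\<^sup>x\<^sup>2\<close>, independently of the others, and removing one particle hardly changes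
  the ensemble. The constant is the limit \<open>L\<^sub>\<gamma>\<close> of the ratios \<open>Z\<^sub>n\<^sub>+\<^sub>1 / Z\<^sub>n\<close>.

  That limit rests on a law of large numbers for \<open>\<beta> \<Sum>\<^sub>j ln |x - x\<^sub>j|\<close>. Since the logarithmic kernel
  is positive definite (it is an integral of tent functions), the density of the ensemble with
  respect to the \<open>n\<close>-fold product of the equilibrium measure is at most subexponential, so Chernoff
  bounds for independent variables carry over; uniform integrability follows by dilation. The
  equilibrium measure is the minimizer of the free energy, found by strong convexity of the entropy
  and identified through its Euler--Lagrange equation.
\<close>

section \<open>Positive definiteness of the logarithmic kernel\<close>

text \<open>Only b n -> \<gamma> is known, without a rate, so the comparison with a product measure
  holds up to a factor exp(o(n)). This is enough for exponentially small events, hence for the law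
  of large numbers at a fixed point, but says nothing about events of probability 1/N such as a
  given particle lying at the edge. Those are treated through the explicit conditional density of
  one particle: at x, replacing |x - y_j| by x costs a relative L1 error O(1/x), and the threshold
  grows like sqrt(ln N). That estimate needs a Gaussian density bound for one particle of the
  conditioning ensemble, which comes from splitting off yet another particle. So \<beta>_N is used
  with N, N - 1 and N - 2 particles, and b and n are kept as separate sequences. The constants in
  \<xi>_N stem from the mean number of exceedances, about N t^(bN - 1) e^(-t^2) / (2 L): the 2
  belongs to the Gaussian tail, and the power of t ~ sqrt(ln N) gives the ln ln N term.\<close>

lemma ennreal_two_mult_le:
  fixes a b :: ennreal
  shows "2 * (a * b) \<le> a * a + b * b"
proof (cases a; cases b)
  fix r s assume [simp]: "a = ennreal r" "0 \<le> r" "b = ennreal s" "0 \<le> s"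
  have "2 * (r * s) \<le> r * r + s * s"
    using sum_squares_bound[of r s] by (simp add: power2_eq_square)
  then have "ennreal (2 * (r * s)) \<le> ennreal (r * r + s * s)"
    by (rule ennreal_leI)
  then show ?thesis
    by (simp add: ennreal_mult ennreal_plus)
qed (auto simp: ennreal_top_mult ennreal_mult_top)

lemma nn_integral_gram:
  fixes \<Phi> :: "'a \<Rightarrow> 'p \<Rightarrow> ennreal"
  assumes A: "sigma_finite_measure A" "sets A = sets S" and B: "sigma_finite_measure B" "sets B = sets S"
    and Q: "sigma_finite_measure Q"
    and m: "case_prod \<Phi> \<in> borel_measurable (S \<Otimes>\<^sub>M Q)"
  shows "(\<integral>\<^sup>+x. (\<integral>\<^sup>+y. (\<integral>\<^sup>+p. \<Phi> x p * \<Phi> y p \<partial>Q) \<partial>B) \<partial>A)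
    = (\<integral>\<^sup>+p. (\<integral>\<^sup>+x. \<Phi> x p \<partial>A) * (\<integral>\<^sup>+y. \<Phi> y p \<partial>B) \<partial>Q)"
proof -
  interpret A: sigma_finite_measure A by fact
  interpret B: sigma_finite_measure B by fact
  interpret Q: sigma_finite_measure Q by fact
  interpret AQ: pair_sigma_finite A Q by standard
  interpret BQ: pair_sigma_finite B Q by standard
  have sA[measurable_cong]: "sets A = sets S" and sB[measurable_cong]: "sets B = sets S" by fact+
  note m[measurable]
  have b: "(\<lambda>p. \<integral>\<^sup>+y. \<Phi> y p \<partial>B) \<in> borel_measurable Q" by measurable
  have "(\<integral>\<^sup>+y. (\<integral>\<^sup>+p. \<Phi> x p * \<Phi> y p \<partial>Q) \<partial>B) = (\<integral>\<^sup>+p. \<Phi> x p * (\<integral>\<^sup>+y. \<Phi> y p \<partial>B) \<partial>Q)"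
    if x: "x \<in> space A" for x
  proof -
    have x': "x \<in> space S" using x sets_eq_imp_space_eq[OF sA] by simp
    have mx[measurable]: "\<Phi> x \<in> borel_measurable Q" using x' by measurable
    have "(\<integral>\<^sup>+y. (\<integral>\<^sup>+p. \<Phi> x p * \<Phi> y p \<partial>Q) \<partial>B) = (\<integral>\<^sup>+p. (\<integral>\<^sup>+y. \<Phi> x p * \<Phi> y p \<partial>B) \<partial>Q)"
      by (rule BQ.Fubini'[symmetric]) measurable
    also have "\<dots> = (\<integral>\<^sup>+p. \<Phi> x p * (\<integral>\<^sup>+y. \<Phi> y p \<partial>B) \<partial>Q)"
      by (intro nn_integral_cong nn_integral_cmult) measurable
    finally show ?thesis .
  qed
  then have "(\<integral>\<^sup>+x. (\<integral>\<^sup>+y. (\<integral>\<^sup>+p. \<Phi> x p * \<Phi> y p \<partial>Q) \<partial>B) \<partial>A)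
      = (\<integral>\<^sup>+x. (\<integral>\<^sup>+p. \<Phi> x p * (\<integral>\<^sup>+y. \<Phi> y p \<partial>B) \<partial>Q) \<partial>A)"
    by (intro nn_integral_cong) simp
  also have "\<dots> = (\<integral>\<^sup>+p. (\<integral>\<^sup>+x. \<Phi> x p * (\<integral>\<^sup>+y. \<Phi> y p \<partial>B) \<partial>A) \<partial>Q)"
    using b by (intro AQ.Fubini'[symmetric]) measurable
  also have "\<dots> = (\<integral>\<^sup>+p. (\<integral>\<^sup>+x. \<Phi> x p \<partial>A) * (\<integral>\<^sup>+y. \<Phi> y p \<partial>B) \<partial>Q)"
    by (intro nn_integral_cong nn_integral_multc) measurable
  finally show ?thesis .
qed

text \<open>By \<open>nn_integral_gram\<close> each double integral is an integral over features p
  of a product of two masses, and 2ab \<le> a^2 + b^2 holds for each p. The signed measure A - B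
  cannot be formed in \<open>ennreal\<close>, so positive definiteness on it is expressed by this
  polarized inequality, which also covers infinite energies.\<close>

lemma nn_integral_gram_psd:
  fixes \<Phi> :: "'a \<Rightarrow> 'p \<Rightarrow> ennreal"
  assumes A: "sigma_finite_measure A" "sets A = sets S" and B: "sigma_finite_measure B" "sets B = sets S"
    and Q: "sigma_finite_measure Q"
    and m: "case_prod \<Phi> \<in> borel_measurable (S \<Otimes>\<^sub>M Q)"
  defines "G \<equiv> \<lambda>x y. \<integral>\<^sup>+p. \<Phi> x p * \<Phi> y p \<partial>Q"
  shows "2 * (\<integral>\<^sup>+x. (\<integral>\<^sup>+y. G x y \<partial>B) \<partial>A) \<le> (\<integral>\<^sup>+x. (\<integral>\<^sup>+y. G x y \<partial>A) \<partial>A) + (\<integral>\<^sup>+x. (\<integral>\<^sup>+y. G x y \<partial>B) \<partial>B)"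
proof -
  interpret A: sigma_finite_measure A by fact
  interpret B: sigma_finite_measure B by fact
  have sA[measurable_cong]: "sets A = sets S" and sB[measurable_cong]: "sets B = sets S" by fact+
  note m[measurable]
  have a[measurable]: "(\<lambda>p. \<integral>\<^sup>+y. \<Phi> y p \<partial>A) \<in> borel_measurable Q" by measurable
  have b[measurable]: "(\<lambda>p. \<integral>\<^sup>+y. \<Phi> y p \<partial>B) \<in> borel_measurable Q" by measurable
  let ?a = "\<lambda>p. \<integral>\<^sup>+y. \<Phi> y p \<partial>A" and ?b = "\<lambda>p. \<integral>\<^sup>+y. \<Phi> y p \<partial>B"
  have "2 * (\<integral>\<^sup>+p. ?a p * ?b p \<partial>Q) = (\<integral>\<^sup>+p. 2 * (?a p * ?b p) \<partial>Q)"
    by (intro nn_integral_cmult[symmetric]) measurable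
  also have "\<dots> \<le> (\<integral>\<^sup>+p. ?a p * ?a p + ?b p * ?b p \<partial>Q)"
    by (intro nn_integral_mono ennreal_two_mult_le)
  also have "\<dots> = (\<integral>\<^sup>+p. ?a p * ?a p \<partial>Q) + (\<integral>\<^sup>+p. ?b p * ?b p \<partial>Q)"
    by (intro nn_integral_add) measurable
  finally show ?thesis
    unfolding G_def nn_integral_gram[OF A B Q m] nn_integral_gram[OF A A Q m] nn_integral_gram[OF B B Q m] .
qed

text \<open>A feature p = (s, u) is the interval [u, u + s], of length s between e and R, with
  weight 1/s. Two points lie in a common interval of length s for a set of left ends u of measure (s
  - |x - y|)_+, so the kernel is an integral of the tents (s - |x - y|)_+ / s^2 over s. On short
  scales it behaves like -ln |x - y|.\<close>

definition tent_feature :: "real \<Rightarrow> real \<Rightarrow> real \<Rightarrow> real \<times> real \<Rightarrow> ennreal" where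
  "tent_feature e R x p =
    indicator {e<..R} (fst p) * indicator {snd p..snd p + fst p} x * ennreal (1 / fst p)"

definition tent_kernel :: "real \<Rightarrow> real \<Rightarrow> real \<Rightarrow> real \<Rightarrow> ennreal" where
  "tent_kernel e R x y = (\<integral>\<^sup>+p. tent_feature e R x p * tent_feature e R y p \<partial>(lborel \<Otimes>\<^sub>M lborel))"

lemma tent_feature_measurable [measurable]:
  "case_prod (tent_feature e R) \<in> borel_measurable (borel \<Otimes>\<^sub>M (lborel \<Otimes>\<^sub>M lborel))"
  unfolding tent_feature_def atLeastAtMost_iff greaterThanAtMost_iff indicator_def of_bool_def
  by measurable

lemma tent_kernel_measurable [measurable]:
  "case_prod (tent_kernel e R) \<in> borel_measurable (borel \<Otimes>\<^sub>M borel)"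
proof -
  interpret pair_sigma_finite "lborel :: real measure" "lborel :: real measure" ..
  show ?thesis
    unfolding tent_kernel_def by measurable
qed

lemma tent_kernel_eq_nn_integral:
  assumes e: "0 \<le> e"
  shows "tent_kernel e R x y = (\<integral>\<^sup>+s. ennreal ((s - \<bar>x - y\<bar>) / s\<^sup>2) * indicator {e<..R} s \<partial>lborel)"
proof -
  interpret pair_sigma_finite "lborel :: real measure" "lborel :: real measure" ..
  have [measurable]: "tent_feature e R z \<in> borel_measurable (lborel \<Otimes>\<^sub>M lborel)" for z
    unfolding tent_feature_def atLeastAtMost_iff greaterThanAtMost_iff indicator_def of_bool_def
    by measurable
  have "tent_kernel e R x y = (\<integral>\<^sup>+s. (\<integral>\<^sup>+u. tent_feature e R x (s, u) * tent_feature e R y (s, u) \<partial>lborel) \<partial>lborel)"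
    unfolding tent_kernel_def by (rule lborel.nn_integral_fst[symmetric]) measurable
  also have "\<dots> = (\<integral>\<^sup>+s. ennreal ((s - \<bar>x - y\<bar>) / s\<^sup>2) * indicator {e<..R} s \<partial>lborel)"
  proof (rule nn_integral_cong)
    fix s :: real
    show "(\<integral>\<^sup>+u. tent_feature e R x (s, u) * tent_feature e R y (s, u) \<partial>lborel)
      = ennreal ((s - \<bar>x - y\<bar>) / s\<^sup>2) * indicator {e<..R} s"
    proof (cases "s \<in> {e<..R}")
      case True
      then have s: "0 < s" using e by auto
      have "tent_feature e R x (s, u) * tent_feature e R y (s, u)
        = ennreal (1 / s\<^sup>2) * indicator {max x y - s..min x y} u" for u
        using True s by (auto simp: tent_feature_def indicator_def power2_eq_square ennreal_mult[symmetric])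
      then have "(\<integral>\<^sup>+u. tent_feature e R x (s, u) * tent_feature e R y (s, u) \<partial>lborel)
        = ennreal (1 / s\<^sup>2) * emeasure lborel {max x y - s..min x y}"
        by (simp add: nn_integral_cmult_indicator)
      \<comment> \<open>\<open>ennreal\<close> sends a negative length to 0 and so supplies the
        positive part of s - |x - y|.\<close>
      also have "emeasure lborel {max x y - s..min x y} = ennreal (s - \<bar>x - y\<bar>)"
        by (cases "max x y - s \<le> min x y") (auto simp: max_def min_def abs_if ennreal_neg split: if_splits)
      also have "ennreal (1 / s\<^sup>2) * ennreal (s - \<bar>x - y\<bar>) = ennreal ((s - \<bar>x - y\<bar>) / s\<^sup>2)"
        by (subst ennreal_mult'[symmetric]) auto
      finally show ?thesis using True by simp
    next
      case False
      then have "tent_feature e R x (s, u) * tent_feature e R y (s, u) = 0" for u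
        by (auto simp: tent_feature_def)
      then have "(\<integral>\<^sup>+u. tent_feature e R x (s, u) * tent_feature e R y (s, u) \<partial>lborel) = (\<integral>\<^sup>+(u::real). 0 \<partial>lborel)"
        by (intro nn_integral_cong)
      then show ?thesis using False by simp
    qed
  qed
  finally show ?thesis .
qed

text \<open>The tent vanishes for s below d = |x - y|, so the integral effectively starts at max e
  d, and ln s + d / s is an antiderivative of (s - d) / s^2. For e = 0 and x = y the integral
  diverges, which is why that case is excluded.\<close>

lemma tent_kernel_eq:
  assumes e: "0 \<le> e" "e \<le> R" and d: "0 < e \<or> x \<noteq> y"
  defines "d \<equiv> \<bar>x - y\<bar>" and "m \<equiv> max e \<bar>x - y\<bar>"
  shows "tent_kernel e R x y = ennreal (if d \<le> R then ln R + d / R - ln m - d / m else 0)"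
proof (cases "d \<le> R")
  case True
  have m: "0 < m" "m \<le> R" "e \<le> m" "d \<le> m" using e d True by (auto simp: m_def d_def)
  have ae: "AE s in lborel. s \<noteq> m" by (rule AE_lborel_singleton)
  have "tent_kernel e R x y = (\<integral>\<^sup>+s. ennreal ((s - d) / s\<^sup>2) * indicator {m..R} s \<partial>lborel)"
    unfolding tent_kernel_eq_nn_integral[OF e(1)] d_def[symmetric]
  proof (intro nn_integral_cong_AE, use ae in eventually_elim)
    case (elim s)
    show ?case
      using elim m by (auto simp: indicator_def m_def d_def ennreal_neg divide_nonpos_nonneg max_def split: if_splits)
  qed
  also have "\<dots> = ennreal ((ln R + d / R) - (ln m + d / m))"
  proof (rule nn_integral_FTC_Icc)
    fix s assume s: "s \<in> {m..R}"
    then have "0 < s" using m by auto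
    then show "((\<lambda>s. ln s + d / s) has_real_derivative (s - d) / s\<^sup>2) (at s)"
      by (auto intro!: derivative_eq_intros simp: field_simps power2_eq_square)
    show "0 \<le> (s - d) / s\<^sup>2" using s m by simp
  qed (use m in auto)
  finally show ?thesis using True by (simp add: algebra_simps)
next
  case False
  have "tent_kernel e R x y = (\<integral>\<^sup>+(s::real). 0 \<partial>lborel)"
    unfolding tent_kernel_eq_nn_integral[OF e(1)] d_def[symmetric]
    using False by (intro nn_integral_cong) (auto simp: indicator_def ennreal_neg divide_nonpos_nonneg)
  then show ?thesis using False by simp
qed

text \<open>Below distance \<open>e\<close> the logarithm is replaced by its tangent line; \<open>e = 0\<close> is the kernel
  of the paper away from the diagonal.\<close>

definition kt :: "real \<Rightarrow> real \<Rightarrow> real \<Rightarrow> real" where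
  "kt e x y = (if e \<le> \<bar>x - y\<bar> then - ln \<bar>x - y\<bar> else 1 - ln e - \<bar>x - y\<bar> / e) + theta x + theta y"

lemma theta_nonneg [simp]: "0 \<le> theta x"
  by (simp add: theta_def)

lemma theta_le_abs: "theta x \<le> \<bar>x\<bar>"
  unfolding theta_def by (rule ln_add_one_self_le_self) simp

lemma theta_measurable [measurable]: "theta \<in> borel_measurable borel"
  unfolding theta_def[abs_def] by measurable

lemma ln_abs_diff_le: "ln \<bar>x - y\<bar> \<le> theta x + theta y"
proof (cases "x = y")
  case False
  have "\<bar>x - y\<bar> \<le> (1 + \<bar>x\<bar>) * (1 + \<bar>y\<bar>)"
    by (simp add: distrib_left distrib_right abs_le_iff) (smt (verit) mult_nonneg_nonneg)
  then have "ln \<bar>x - y\<bar> \<le> ln ((1 + \<bar>x\<bar>) * (1 + \<bar>y\<bar>))"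
    using False by simp
  also have "\<dots> = theta x + theta y"
    unfolding theta_def by (subst ln_mult_pos) (auto intro: add_pos_nonneg)
  finally show ?thesis .
qed simp

lemma kt_measurable [measurable]: "case_prod (kt e) \<in> borel_measurable (borel \<Otimes>\<^sub>M borel)"
  unfolding kt_def by measurable

lemma kt_nonneg:
  assumes "0 \<le> e" "e \<le> 1"
  shows "0 \<le> kt e x y"
proof (cases "e \<le> \<bar>x - y\<bar>")
  case True
  then show ?thesis using ln_abs_diff_le[of x y] by (simp add: kt_def)
next
  case False
  then have e0: "0 < e" by linarith
  then have "ln e \<le> 0" "\<bar>x - y\<bar> / e \<le> 1" using assms False by (auto simp: field_simps)
  then have "0 \<le> 1 - ln e - \<bar>x - y\<bar> / e + theta x + theta y"
    using theta_nonneg[of x] theta_nonneg[of y] by linarith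
  then show ?thesis using False by (simp add: kt_def)
qed

lemma kt_commute: "kt e x y = kt e y x"
  by (simp add: kt_def abs_minus_commute)

text \<open>With m = max e d the tent kernel is ln R + d/R - ln m - d/m. For d \<ge> e this is (ln R
  - 1) - ln d + d/R; for d < e it is (ln R - 1) plus the tangent of -ln at e plus d/R. Dropping the
  short intervals thus produces exactly the truncation in \<open>kt\<close>. Beyond d = R the
  inequalities follow from ln t \<le> t - 1. The bound R \<ge> 3 makes ln R - 1 nonnegative, so
  \<open>ennreal\<close> does not truncate it.\<close>

lemma kt_tent_sandwich:
  assumes e: "0 \<le> e" "e \<le> 1" and d: "0 < e \<or> x \<noteq> y" and R: "3 \<le> R"
  shows "ennreal (kt e x y) + ennreal (ln R - 1) \<le> tent_kernel e R x y + ennreal (theta x) + ennreal (theta y)"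
    and "tent_kernel e R x y + ennreal (theta x) + ennreal (theta y)
      \<le> ennreal (kt e x y) + ennreal (ln R - 1) + ennreal (\<bar>x\<bar> / R) + ennreal (\<bar>y\<bar> / R)"
proof -
  define d where "d = \<bar>x - y\<bar>"
  define g where "g = (if d \<le> R then ln R + d / R - ln (max e d) - d / max e d else 0)"
  have l1: "1 \<le> ln R"
    using R exp_le by (metis dual_order.trans exp_gt_zero ln_exp ln_le_cancel_iff less_le_trans)
  have tk: "tent_kernel e R x y = ennreal g"
    unfolding g_def d_def using e d R by (intro tent_kernel_eq) auto
  have dd: "d \<le> \<bar>x\<bar> + \<bar>y\<bar>" "0 \<le> d" by (auto simp: d_def)
  have dR: "d / R \<le> \<bar>x\<bar> / R + \<bar>y\<bar> / R" "0 \<le> d / R"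
    using divide_right_mono[OF dd(1), of R] R dd by (auto simp: add_divide_distrib)
  have k0: "0 \<le> kt e x y" using kt_nonneg[OF e] .
  have main: "0 \<le> g \<and> kt e x y + (ln R - 1) \<le> g + theta x + theta y
    \<and> g + theta x + theta y \<le> kt e x y + (ln R - 1) + \<bar>x\<bar> / R + \<bar>y\<bar> / R"
  proof (cases "d \<le> R")
    case True
    define m where "m = max e d"
    have m: "0 < m" "m \<le> R" "d \<le> m" using e d R True dd by (auto simp: m_def d_def)
    have kte: "kt e x y + (ln R - 1) + d / R = g + theta x + theta y"
      using True m e by (auto simp: g_def kt_def d_def[symmetric] m_def[symmetric]) (auto simp: m_def max_def)
    have "0 \<le> g"
    proof -
      have "ln (m / R) \<le> m / R - 1" using m by (intro ln_le_minus_one) simp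
      then have "ln m - ln R \<le> m / R - 1" using m by (simp add: ln_div)
      moreover have "(m - d) * (1 / m - 1 / R) \<ge> 0"
        using m by (intro mult_nonneg_nonneg) (auto simp: field_simps)
      then have "1 - m / R - d / m + d / R \<ge> 0" using m by (simp add: field_simps)
      ultimately show ?thesis using True by (simp add: g_def m_def[symmetric])
    qed
    with kte dR show ?thesis by linarith
  next
    case False
    then have g: "g = 0" by (simp add: g_def)
    have dpos: "0 < d" "e \<le> d" using False R e by auto
    have kte: "kt e x y = - ln d + theta x + theta y"
      using dpos by (simp add: kt_def d_def)
    have "ln (d / R) \<le> d / R - 1" using dpos R by (intro ln_le_minus_one) simp
    then have a: "ln d - ln R \<le> d / R - 1" using dpos R by (simp add: ln_div)
    have b: "ln R \<le> ln d" using False R by simp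
    show ?thesis using a b g kte dR by linarith
  qed
  have R0: "0 \<le> \<bar>x\<bar> / R" "0 \<le> \<bar>y\<bar> / R" using R by auto
  show "ennreal (kt e x y) + ennreal (ln R - 1) \<le> tent_kernel e R x y + ennreal (theta x) + ennreal (theta y)"
    unfolding tk using main k0 l1 by (simp add: ennreal_plus[symmetric] del: ennreal_plus)
  show "tent_kernel e R x y + ennreal (theta x) + ennreal (theta y)
      \<le> ennreal (kt e x y) + ennreal (ln R - 1) + ennreal (\<bar>x\<bar> / R) + ennreal (\<bar>y\<bar> / R)"
    unfolding tk using main k0 l1 R0 by (simp add: ennreal_plus[symmetric] del: ennreal_plus)
qed

text \<open>Both measures have mass 1, so the constant ln R - 1 and the \<open>theta\<close> terms
  occur equally on the two sides and cancel. The error of the sandwich is at most a sum of first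
  moments divided by R and disappears as R grows. For e = 0 the tent kernel is infinite on the
  diagonal, which therefore has to be null.\<close>

lemma kt_energy_psd:
  assumes M: "prob_space M" "sets M = sets borel" "(\<integral>\<^sup>+x. ennreal \<bar>x\<bar> \<partial>M) < \<infinity>"
    and N: "prob_space N" "sets N = sets borel" "(\<integral>\<^sup>+x. ennreal \<bar>x\<bar> \<partial>N) < \<infinity>"
    and e: "0 \<le> e" "e \<le> 1" "e = 0 \<Longrightarrow> (\<forall>x. emeasure M {x} = 0 \<and> emeasure N {x} = 0)"
  defines "E \<equiv> \<lambda>A B. \<integral>\<^sup>+x. (\<integral>\<^sup>+y. ennreal (kt e x y) \<partial>B) \<partial>A"
  shows "2 * E M N \<le> E M M + E N N"
proof -
  define P where "P = (\<lambda>A. prob_space A \<and> sets A = sets borel \<and> (\<integral>\<^sup>+x. ennreal \<bar>x\<bar> \<partial>A) < \<infinity>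
    \<and> (e = 0 \<longrightarrow> (\<forall>x. emeasure A {x} = 0)))"
  have PM: "P M" and PN: "P N" using M N e by (auto simp: P_def)
  define m where "m = (\<lambda>A. \<integral>\<^sup>+x. ennreal \<bar>x\<bar> \<partial>(A::real measure))"
  define th where "th = (\<lambda>A. \<integral>\<^sup>+x. ennreal (theta x) \<partial>(A::real measure))"
  define G where "G = (\<lambda>R A B. \<integral>\<^sup>+x. (\<integral>\<^sup>+y. tent_kernel e R x y \<partial>B) \<partial>A)"
  have mfin: "m A < \<infinity>" if "P A" for A using that by (simp add: P_def m_def)
  have thfin: "th A < \<infinity>" if "P A" for A
  proof -
    have "th A \<le> m A" unfolding th_def m_def by (intro nn_integral_mono ennreal_leI theta_le_abs)
    from this mfin[OF that] show ?thesis by (rule le_less_trans)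
  qed
  have sw: "E A B + ennreal (ln R - 1) \<le> G R A B + (th A + th B) \<and>
      G R A B + (th A + th B) \<le> E A B + ennreal (ln R - 1) + (m A + m B) * ennreal (1 / R)"
    if PA: "P A" and PB: "P B" and R: "3 \<le> R" for A B R
  proof -
    interpret A: prob_space A using PA by (simp add: P_def)
    interpret B: prob_space B using PB by (simp add: P_def)
    have sA[measurable_cong]: "sets A = sets borel" and sB[measurable_cong]: "sets B = sets borel"
      using PA PB by (auto simp: P_def)
    have ae: "AE y in B. 0 < e \<or> x \<noteq> y" for x
    proof (cases "e = 0")
      case True
      then have "emeasure B {x} = 0" using PB by (simp add: P_def)
      then have "{x} \<in> null_sets B" by (auto simp: null_sets_def sB)
      then have "AE y in B. y \<notin> {x}" by (rule AE_not_in)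
      then show ?thesis by eventually_elim auto
    qed (use e in auto)
    have div: "ennreal (\<bar>x\<bar> / R) = ennreal \<bar>x\<bar> * ennreal (1 / R)" for x
      using R by (subst ennreal_mult[symmetric]) auto
    have 1: "E A B + ennreal (ln R - 1) = (\<integral>\<^sup>+x. (\<integral>\<^sup>+y. ennreal (kt e x y) + ennreal (ln R - 1) \<partial>B) \<partial>A)"
      unfolding E_def by (simp add: nn_integral_add A.emeasure_space_1 B.emeasure_space_1)
    have 2: "G R A B + (th A + th B) = (\<integral>\<^sup>+x. (\<integral>\<^sup>+y. tent_kernel e R x y + ennreal (theta x) + ennreal (theta y) \<partial>B) \<partial>A)"
      unfolding G_def th_def by (simp add: nn_integral_add A.emeasure_space_1 B.emeasure_space_1 add.assoc)
    have 3: "E A B + ennreal (ln R - 1) + (m A + m B) * ennreal (1 / R)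
      = (\<integral>\<^sup>+x. (\<integral>\<^sup>+y. ennreal (kt e x y) + ennreal (ln R - 1) + ennreal (\<bar>x\<bar> / R) + ennreal (\<bar>y\<bar> / R) \<partial>B) \<partial>A)"
      unfolding E_def m_def div
      by (simp add: nn_integral_add nn_integral_multc A.emeasure_space_1 B.emeasure_space_1 distrib_right add.assoc)
    show ?thesis
      unfolding 3 unfolding 2 unfolding 1
    proof (rule conjI; rule nn_integral_mono; rule nn_integral_mono_AE)
      fix x
      show "AE y in B. ennreal (kt e x y) + ennreal (ln R - 1) \<le> tent_kernel e R x y + ennreal (theta x) + ennreal (theta y)"
        using ae[of x] by eventually_elim (rule kt_tent_sandwich(1)[OF e(1,2) _ R])
      show "AE y in B. tent_kernel e R x y + ennreal (theta x) + ennreal (theta y)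
        \<le> ennreal (kt e x y) + ennreal (ln R - 1) + ennreal (\<bar>x\<bar> / R) + ennreal (\<bar>y\<bar> / R)"
        using ae[of x] by eventually_elim (rule kt_tent_sandwich(2)[OF e(1,2) _ R])
    qed
  qed
  have psd: "2 * G R M N \<le> G R M M + G R N N" for R
  proof -
    have P: "sigma_finite_measure (lborel \<Otimes>\<^sub>M lborel :: (real \<times> real) measure)"
      unfolding lborel_prod by (rule lborel.sigma_finite_measure_axioms)
    show ?thesis
      unfolding G_def tent_kernel_def
      using M N
      by (intro nn_integral_gram_psd[where S = borel] prob_space_imp_sigma_finite P
          tent_feature_measurable)
  qed
  define c where "c = (m M + m M + m N + m N)"
  have "c < \<infinity>" using mfin[OF PM] mfin[OF PN] by (simp add: c_def ennreal_add_eq_top less_top)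
  then obtain cr where cr: "c = ennreal cr" "0 \<le> cr" by (cases c) auto
  have key: "2 * E M N \<le> E M M + E N N + c * ennreal (1 / R)" if R: "3 \<le> R" for R
  proof -
    let ?l = "ennreal (ln R - 1)"
    have "2 * E M N + 2 * ?l \<le> 2 * (E M N + ?l)" by (simp add: distrib_left)
    also have "\<dots> \<le> 2 * (G R M N + (th M + th N))"
      using sw[OF PM PN R] by (intro mult_left_mono) auto
    also have "\<dots> = 2 * G R M N + 2 * (th M + th N)" by (simp add: distrib_left)
    also have "\<dots> \<le> (G R M M + G R N N) + 2 * (th M + th N)"
      by (intro add_right_mono psd)
    also have "\<dots> = (G R M M + (th M + th M)) + (G R N N + (th N + th N))"
      by (simp add: mult_2 mult_2_right algebra_simps)
    also have "\<dots> \<le> (E M M + ?l + (m M + m M) * ennreal (1 / R)) + (E N N + ?l + (m N + m N) * ennreal (1 / R))"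
      by (rule add_mono[OF conjunct2[OF sw[OF PM PM R]] conjunct2[OF sw[OF PN PN R]]])
    also have "\<dots> = (E M M + E N N + c * ennreal (1 / R)) + 2 * ?l"
      by (simp add: c_def mult_2 algebra_simps)
    finally have "2 * ?l + 2 * E M N \<le> 2 * ?l + (E M M + E N N + c * ennreal (1 / R))"
      by (simp only: add.commute)
    \<comment> \<open>In \<open>ennreal\<close> only a finite summand may be cancelled.\<close>
    moreover have "2 * ?l \<noteq> \<infinity>"
      by (simp add: ennreal_mult_eq_top_iff)
    ultimately show ?thesis
      unfolding ennreal_add_left_cancel_le by blast
  qed
  show ?thesis
  proof (rule ennreal_le_epsilon)
    fix d :: real assume d: "0 < d"
    define R where "R = max 3 (cr / d)"
    have R: "3 \<le> R" "cr / R \<le> d" using d cr by (auto simp: R_def field_simps max_def)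
    have "c * ennreal (1 / R) = ennreal (cr / R)" using cr R by (simp add: ennreal_mult[symmetric])
    also have "\<dots> \<le> ennreal d" using R by (intro ennreal_leI)
    finally show "2 * E M N \<le> E M M + E N N + ennreal d"
      using key[OF R(1)] by (meson add_left_mono order_trans)
  qed
qed

section \<open>The Euler--Lagrange equation\<close>

text \<open>This is ln t \<le> t - 1 at t = sqrt (b / a). Integrated, it bounds the squared
  Hellinger distance by the relative entropy, so that vanishing entropy forces equality of
  densities. With the square dropped it is Young's inequality a ln b \<le> a ln a - a + b, used for
  moments and for lower bounds of the entropy.\<close>

lemma entropy_hellinger_le:
  fixes a b :: real
  assumes "0 \<le> a" "0 < b"
  shows "(sqrt a - sqrt b)\<^sup>2 \<le> a * ln (a / b) - a + b"
proof (cases "a = 0")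
  case False
  then have a: "0 < a" using assms by simp
  have "ln (sqrt b / sqrt a) \<le> sqrt b / sqrt a - 1"
    using a assms by (intro ln_le_minus_one) simp
  then have "(ln b - ln a) / 2 \<le> sqrt b / sqrt a - 1"
    using a assms by (simp add: ln_div ln_sqrt diff_divide_distrib)
  then have "a * ((ln b - ln a) / 2) \<le> a * (sqrt b / sqrt a - 1)"
    using a by (intro mult_left_mono) auto
  also have "\<dots> = sqrt a * sqrt b - a"
    using a by (simp add: field_simps)
  finally have "a * ((ln b - ln a) / 2) \<le> sqrt a * sqrt b - a" .
  moreover have "2 * (a * ((ln b - ln a) / 2)) = a * ln b - a * ln a"
    by (simp add: field_simps)
  ultimately have "a * ln b - a * ln a \<le> 2 * (sqrt a * sqrt b) - 2 * a" by linarith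
  moreover have "(sqrt a - sqrt b)\<^sup>2 = a + b - 2 * (sqrt a * sqrt b)"
    using a assms by (simp add: power2_diff)
  moreover have "a * ln (a / b) = a * ln a - a * ln b"
    using a assms by (simp add: ln_div algebra_simps)
  ultimately show ?thesis by linarith
qed (use assms in auto)

text \<open>The entropies of a and of b relative to their midpoint c add up to a ln a + b ln b - 2 c
  ln c, since the linear terms cancel. Each is at least (sqrt x - sqrt c)^2 \<ge> (x - c)^2 / (4 M),
  because (sqrt x + sqrt c)^2 \<le> 4 M; and (x - c)^2 = (a - b)^2 / 4 gives the constant
  16.\<close>

lemma xlnx_midpoint:
  fixes a b M :: real
  assumes a: "0 \<le> a" "a \<le> M" and b: "0 \<le> b" "b \<le> M" and M: "0 < M"
  defines "c \<equiv> (a + b) / 2"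
  shows "c * ln c \<le> (a * ln a + b * ln b) / 2 - (a - b)\<^sup>2 / (16 * M)"
proof (cases "c = 0")
  case True
  then have "a = 0 \<and> b = 0" using a b by (auto simp: c_def)
  then show ?thesis by (auto simp: c_def)
next
  case False
  then have c: "0 < c" "c \<le> M" using a b by (auto simp: c_def)
  have *: "(a - b)\<^sup>2 / (16 * M) \<le> x * ln (x / c) - x + c" if x: "0 \<le> x" "x \<le> M" "(x - c)\<^sup>2 = (a - b)\<^sup>2 / 4" for x
  proof -
    have "(x - c)\<^sup>2 = (sqrt x - sqrt c)\<^sup>2 * (sqrt x + sqrt c)\<^sup>2"
      using x c by (simp add: power_mult_distrib[symmetric] algebra_simps)
    also have "(sqrt x + sqrt c)\<^sup>2 \<le> 2 * (x + c)"
      using x c sum_squares_bound[of "sqrt x" "sqrt c"] by (simp add: power2_sum)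
    then have "(sqrt x - sqrt c)\<^sup>2 * (sqrt x + sqrt c)\<^sup>2 \<le> (sqrt x - sqrt c)\<^sup>2 * (4 * M)"
      using x c by (intro mult_left_mono) auto
    finally have "(x - c)\<^sup>2 / (4 * M) \<le> (sqrt x - sqrt c)\<^sup>2"
      using M by (simp add: field_simps)
    also have "\<dots> \<le> x * ln (x / c) - x + c" by (rule entropy_hellinger_le) (use x c in auto)
    finally show ?thesis using x(3) M by simp
  qed
  have 1: "(a - b)\<^sup>2 / (16 * M) \<le> a * ln (a / c) - a + c"
    by (rule *) (use a in \<open>auto simp: c_def power2_eq_square field_simps\<close>)
  have 2: "(a - b)\<^sup>2 / (16 * M) \<le> b * ln (b / c) - b + c"
    by (rule *) (use b in \<open>auto simp: c_def power2_eq_square field_simps\<close>)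
  have 3: "x * ln (x / c) = x * ln x - x * ln c" if "0 \<le> x" for x
    using that c by (cases "x = 0") (auto simp: ln_div algebra_simps)
  have "a - c + (b - c) = 0" by (simp add: c_def)
  moreover have "a * ln c + b * ln c = 2 * (c * ln c)" by (simp add: c_def algebra_simps)
  moreover define q where "q = (a - b)\<^sup>2 / (16 * M)"
  ultimately show ?thesis
    using 1 2 unfolding 3[OF a(1)] 3[OF b(1)] q_def[symmetric] by argo
qed

text \<open>\<open>ennreal\<close> discards the negative values of the logarithm and leaves the
  window |x - z| < e; on each side of x, u + u ln (e / u) is an antiderivative with increment e. The
  bound is uniform in x and linear in e: a bounded density feels the singularity only by O(1), and
  truncating it at distance e costs O(e).\<close>

lemma nn_integral_ln_le:
  assumes e: "0 < e"
  shows "(\<integral>\<^sup>+z. ennreal (ln (e / \<bar>x - z\<bar>)) \<partial>lborel) \<le> ennreal (2 * e)"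
proof -
  define h where "h = (\<lambda>u::real. ennreal (ln (e / u)) * indicator {0<..<e} u)"
  have [measurable]: "h \<in> borel_measurable borel" unfolding h_def by measurable
  have ev: "einterval 0 (ereal e) = {0<..<e}"
    by (auto simp: einterval_def)
  have lim0: "((\<lambda>u. u + u * ln (e / u)) \<longlongrightarrow> 0) (at_right 0)"
  proof -
    have "((\<lambda>u. u + u * ln e - u * ln u) \<longlongrightarrow> 0 + 0 * ln e - 0) (at_right (0::real))"
      by real_asymp
    moreover have "\<forall>\<^sub>F u in at_right 0. u + u * ln e - u * ln u = u + u * ln (e / u)"
      using e by (auto simp: eventually_at_filter ln_div algebra_simps)
    ultimately show ?thesis by (simp add: tendsto_cong)
  qed
  have lime: "((\<lambda>u. u + u * ln (e / u)) \<longlongrightarrow> e) (at_left e)"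
    using e by (auto intro!: tendsto_eq_intros)
  have 1: "0 < ereal e" using e by simp
  have 2: "DERIV (\<lambda>u. u + u * ln (e / u)) u :> ln (e / u)" if "0 < ereal u" "ereal u < ereal e" for u
    using that e by (auto intro!: derivative_eq_intros simp: field_simps)
  have 3: "isCont (\<lambda>u. ln (e / u)) u" if "0 < ereal u" "ereal u < ereal e" for u
    using that e by (auto intro!: continuous_intros)
  have 4: "AE u in lborel. 0 < ereal u \<longrightarrow> ereal u < ereal e \<longrightarrow> 0 \<le> ln (e / u)"
    using e by (intro AE_I2) auto
  have 5: "(((\<lambda>u. u + u * ln (e / u)) \<circ> real_of_ereal) \<longlongrightarrow> 0) (at_right 0)"
    using lim0 by (simp add: zero_ereal_def ereal_tendsto_simps1)
  have 6: "(((\<lambda>u. u + u * ln (e / u)) \<circ> real_of_ereal) \<longlongrightarrow> e) (at_left (ereal e))"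
    using lime by (simp add: ereal_tendsto_simps1)
  note FTC = interval_integral_FTC_nonneg[OF 1 2 3 4 5 6]
  have "(\<integral>\<^sup>+u. h u \<partial>lborel) = (\<integral>\<^sup>+u. ennreal (indicator {0<..<e} u *\<^sub>R ln (e / u)) \<partial>lborel)"
    by (intro nn_integral_cong) (auto simp: h_def indicator_def)
  also have "\<dots> = ennreal (\<integral>u. indicator {0<..<e} u *\<^sub>R ln (e / u) \<partial>lborel)"
    using FTC(1) e by (intro nn_integral_eq_integral) (auto simp: set_integrable_def ev indicator_def)
  also have "(\<integral>u. indicator {0<..<e} u *\<^sub>R ln (e / u) \<partial>lborel) = e"
    using FTC(2) e by (simp add: interval_lebesgue_integral_def set_lebesgue_integral_def ev)
  finally have ih: "(\<integral>\<^sup>+u. h u \<partial>lborel) = ennreal e" .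
  have "(\<integral>\<^sup>+z. ennreal (ln (e / \<bar>x - z\<bar>)) \<partial>lborel) \<le> (\<integral>\<^sup>+z. h (x + (-1) * z) + h (- x + 1 * z) \<partial>lborel)"
  proof (rule nn_integral_mono)
    fix z
    have neg: "ennreal (ln (e / u)) = 0" if "e \<le> u" for u
      using that e by (intro ennreal_neg) (auto simp: ln_div)
    show "ennreal (ln (e / \<bar>x - z\<bar>)) \<le> h (x + (-1) * z) + h (- x + 1 * z)"
      using neg[of "\<bar>x - z\<bar>"] by (cases "x = z"; cases "x < z") (auto simp: h_def indicator_def abs_if)
  qed
  also have "\<dots> = (\<integral>\<^sup>+z. h (x + (-1) * z) \<partial>lborel) + (\<integral>\<^sup>+z. h (- x + 1 * z) \<partial>lborel)"
    by (intro nn_integral_add) measurable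
  also have "(\<integral>\<^sup>+z. h (x + (-1) * z) \<partial>lborel) = (\<integral>\<^sup>+u. h u \<partial>lborel)"
    by (subst nn_integral_real_affine[of h "-1" x]) simp_all
  also have "(\<integral>\<^sup>+z. h (- x + 1 * z) \<partial>lborel) = (\<integral>\<^sup>+u. h u \<partial>lborel)"
    by (subst nn_integral_real_affine[of h 1 "-x"]) simp_all
  finally show ?thesis using ih e by (simp add: ennreal_plus[symmetric] del: ennreal_plus)
qed

section \<open>The reference measure \<open>nu \<gamma>\<close> and its Gaussian tails\<close>

lemma nu_weight_pos [simp]: "0 < nu_weight \<gamma> x"
  by (simp add: nu_weight_def)

lemma nu_weight_measurable [measurable]: "nu_weight \<gamma> \<in> borel_measurable borel"
  unfolding nu_weight_def[abs_def] by measurable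

lemma integrable_exp_minus_half_square: "integrable lborel (\<lambda>x::real. exp (- x\<^sup>2 / 2))"
proof -
  have "integrable lborel (\<lambda>x. sqrt (2 * pi) * std_normal_density x)"
    by (intro integrable_mult_right integrable_normal_density) simp
  then show ?thesis by (simp add: std_normal_density_def)
qed

locale high_temperature =
  fixes \<gamma> :: real
  assumes gamma_nonneg: "0 \<le> \<gamma>"
begin

text \<open>Half of the Gaussian absorbs the other factors: complete the square in |x|, after
  \<open>theta x\<close> \<le> |x|.\<close>

lemma nu_weight_bound:
  assumes "0 \<le> c"
  shows "exp (c * \<bar>x\<bar>) * nu_weight \<gamma> x \<le> exp ((\<gamma> + c)\<^sup>2 / 2) * exp (- x\<^sup>2 / 2)"
proof -
  have "(\<bar>x\<bar> - (\<gamma> + c))\<^sup>2 \<ge> 0" by simp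
  then have "(\<gamma> + c) * \<bar>x\<bar> - x\<^sup>2 / 2 \<le> (\<gamma> + c)\<^sup>2 / 2"
    by (simp add: power2_diff algebra_simps)
  moreover have "\<gamma> * theta x \<le> \<gamma> * \<bar>x\<bar>"
    using gamma_nonneg theta_le_abs by (intro mult_left_mono)
  ultimately have "c * \<bar>x\<bar> + (- x\<^sup>2 + \<gamma> * theta x) \<le> (\<gamma> + c)\<^sup>2 / 2 + - x\<^sup>2 / 2"
    by (simp add: algebra_simps)
  then show ?thesis by (simp add: nu_weight_def exp_add[symmetric])
qed

lemma integrable_exp_nu_weight:
  assumes "0 \<le> c"
  shows "integrable lborel (\<lambda>x. exp (c * \<bar>x\<bar>) * nu_weight \<gamma> x)"
proof (rule Bochner_Integration.integrable_bound)
  show "integrable lborel (\<lambda>x. exp ((\<gamma> + c)\<^sup>2 / 2) * exp (- x\<^sup>2 / 2))"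
    by (intro integrable_mult_right integrable_exp_minus_half_square)
qed (use nu_weight_bound[OF assms] in \<open>auto simp: less_imp_le abs_mult\<close>)

lemma integrable_nu_weight: "integrable lborel (nu_weight \<gamma>)"
  using integrable_exp_nu_weight[of 0] by simp

definition nu_norm :: real where "nu_norm = (\<integral>y. nu_weight \<gamma> y \<partial>lborel)"

lemma nu_norm_pos: "0 < nu_norm"
proof -
  have "nu_norm \<noteq> 0"
  proof
    assume "nu_norm = 0"
    then have "AE x in lborel. nu_weight \<gamma> x = 0"
      unfolding nu_norm_def
      by (subst (asm) integral_nonneg_eq_0_iff_AE) (auto intro: integrable_nu_weight simp: less_imp_le)
    then have "AE x::real in lborel. False"
      by eventually_elim (use nu_weight_pos[of \<gamma>] in \<open>metis less_irrefl\<close>)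
    then show False by (simp add: AE_iff_measurable[of UNIV])
  qed
  moreover have "0 \<le> nu_norm" unfolding nu_norm_def by (intro Bochner_Integration.integral_nonneg) (simp add: less_imp_le)
  ultimately show ?thesis by simp
qed

lemma nu_eq: "nu \<gamma> = density lborel (\<lambda>x. ennreal (nu_weight \<gamma> x / nu_norm))"
  by (simp add: nu_def nu_norm_def)

lemma sets_nu [simp, measurable_cong]: "sets (nu \<gamma>) = sets borel"
  by (simp add: nu_eq)

lemma space_nu [simp]: "space (nu \<gamma>) = UNIV"
  by (simp add: nu_eq)

lemma nu_density_nonneg [simp]: "0 \<le> nu_weight \<gamma> x / nu_norm"
  using nu_norm_pos by (simp add: less_imp_le)

lemma prob_space_nu: "prob_space (nu \<gamma>)"
proof
  have "emeasure (nu \<gamma>) (space (nu \<gamma>)) = (\<integral>\<^sup>+x. ennreal (nu_weight \<gamma> x / nu_norm) \<partial>lborel)"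
    by (simp add: nu_eq emeasure_density)
  also have "\<dots> = ennreal (\<integral>x. nu_weight \<gamma> x / nu_norm \<partial>lborel)"
    by (intro nn_integral_eq_integral integrable_nu_weight integrable_divide_zero) auto
  also have "\<dots> = 1"
    using nu_norm_pos by (simp add: nu_norm_def[symmetric])
  finally show "emeasure (nu \<gamma>) (space (nu \<gamma>)) = 1" .
qed

sublocale nu: prob_space "nu \<gamma>" by (rule prob_space_nu)

lemma integrable_nu_exp_abs: "integrable (nu \<gamma>) (\<lambda>x. exp \<bar>x\<bar>)"
  unfolding nu_eq
  using integrable_exp_nu_weight[of 1] nu_norm_pos
  by (subst integrable_density) (auto simp: mult.commute less_imp_le)

lemma integrable_nu_abs: "integrable (nu \<gamma>) (\<lambda>x. \<bar>x\<bar>)"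
  by (rule Bochner_Integration.integrable_bound[OF integrable_nu_exp_abs])
    (auto intro!: AE_I2, metis abs_ge_self exp_ge_add_one_self add_increasing linear zero_le_one order_trans add.commute le_add_same_cancel1)

lemma integrable_nu_theta: "integrable (nu \<gamma>) theta"
  by (rule Bochner_Integration.integrable_bound[OF integrable_nu_abs]) (auto intro!: AE_I2 theta_le_abs)

lemma integrable_nu_exp_theta: "integrable (nu \<gamma>) (\<lambda>x. exp (theta x))"
  by (rule Bochner_Integration.integrable_bound[OF integrable_nu_exp_abs]) (auto intro!: AE_I2 theta_le_abs)

lemma nu_singleton [simp]: "emeasure (nu \<gamma>) {x} = 0"
proof -
  have "absolutely_continuous lborel (nu \<gamma>)" unfolding nu_eq
    by (intro absolutely_continuousI_density) measurable
  then have "{x} \<in> null_sets (nu \<gamma>)"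
    unfolding absolutely_continuous_def by (rule subsetD) (simp add: null_sets_def)
  then show ?thesis by (rule null_setsD1)
qed

text \<open>The kernel is at most \<open>theta x + theta z\<close> plus the positive part of ln (1 /
  |x - z|). The last term has a bounded integral because \<open>nu\<close> has a bounded density, so
  the potential of \<open>nu\<close> grows no faster than \<open>theta\<close>.\<close>

lemma nn_integral_nu_kt_bound:
  obtains C where "0 \<le> C" "\<And>x. (\<integral>\<^sup>+z. ennreal (kt 0 x z) \<partial>nu \<gamma>) \<le> ennreal (C + theta x)"
proof -
  define B where "B = exp (\<gamma>\<^sup>2 / 2) / nu_norm"
  have B: "0 \<le> B" using nu_norm_pos by (simp add: B_def)
  have dens: "nu_weight \<gamma> x / nu_norm \<le> B" for x
  proof -
    have "nu_weight \<gamma> x \<le> exp (\<gamma>\<^sup>2 / 2) * exp (- x\<^sup>2 / 2)" using nu_weight_bound[of 0 x] by simp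
    also have "\<dots> \<le> exp (\<gamma>\<^sup>2 / 2) * 1" by (intro mult_left_mono) auto
    finally show ?thesis unfolding B_def using nu_norm_pos by (intro divide_right_mono) auto
  qed
  define m where "m = (\<integral>z. theta z \<partial>nu \<gamma>)"
  have m: "0 \<le> m" unfolding m_def by (intro Bochner_Integration.integral_nonneg) simp
  have "(\<integral>\<^sup>+z. ennreal (kt 0 x z) \<partial>nu \<gamma>) \<le> ennreal (m + 2 * B + theta x)" for x
  proof -
    have split: "(\<integral>\<^sup>+z. ennreal (kt 0 x z) \<partial>nu \<gamma>)
      \<le> (\<integral>\<^sup>+z. ennreal (theta x) + ennreal (theta z) + ennreal (ln (1 / \<bar>x - z\<bar>)) \<partial>nu \<gamma>)"
    proof (rule nn_integral_mono)
      fix z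
      have "kt 0 x z = theta x + theta z + ln (1 / \<bar>x - z\<bar>)"
        by (cases "x = z") (auto simp: kt_def ln_div)
      also have "\<dots> \<le> theta x + theta z + max 0 (ln (1 / \<bar>x - z\<bar>))" by simp
      finally have "ennreal (kt 0 x z) \<le> ennreal (theta x + theta z + max 0 (ln (1 / \<bar>x - z\<bar>)))"
        by (rule ennreal_leI)
      then show "ennreal (kt 0 x z) \<le> ennreal (theta x) + ennreal (theta z) + ennreal (ln (1 / \<bar>x - z\<bar>))"
        by (simp add: max_def ennreal_neg split: if_splits)
    qed
    have split2: "(\<integral>\<^sup>+z. ennreal (theta x) + ennreal (theta z) + ennreal (ln (1 / \<bar>x - z\<bar>)) \<partial>nu \<gamma>)
      = ennreal (theta x) + (\<integral>\<^sup>+z. ennreal (theta z) \<partial>nu \<gamma>) + (\<integral>\<^sup>+z. ennreal (ln (1 / \<bar>x - z\<bar>)) \<partial>nu \<gamma>)"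
      using nu.emeasure_space_1 by (simp add: nn_integral_add)
    have split3: "(\<integral>\<^sup>+z. ennreal (theta z) \<partial>nu \<gamma>) = ennreal m"
      unfolding m_def by (intro nn_integral_eq_integral integrable_nu_theta) simp
    have "(\<integral>\<^sup>+z. ennreal (ln (1 / \<bar>x - z\<bar>)) \<partial>nu \<gamma>)
      = (\<integral>\<^sup>+z. ennreal (nu_weight \<gamma> z / nu_norm) * ennreal (ln (1 / \<bar>x - z\<bar>)) \<partial>lborel)"
      unfolding nu_eq by (rule nn_integral_density) measurable
    also have "\<dots> \<le> (\<integral>\<^sup>+z. ennreal B * ennreal (ln (1 / \<bar>x - z\<bar>)) \<partial>lborel)"
      by (intro nn_integral_mono mult_right_mono ennreal_leI dens) simp
    also have "\<dots> = ennreal B * (\<integral>\<^sup>+z. ennreal (ln (1 / \<bar>x - z\<bar>)) \<partial>lborel)"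
      by (intro nn_integral_cmult) measurable
    also have "\<dots> \<le> ennreal B * ennreal (2 * 1)"
      by (intro mult_left_mono nn_integral_ln_le) auto
    finally have fin: "(\<integral>\<^sup>+z. ennreal (ln (1 / \<bar>x - z\<bar>)) \<partial>nu \<gamma>) \<le> ennreal B * ennreal (2 * 1)" .
    have "(\<integral>\<^sup>+z. ennreal (kt 0 x z) \<partial>nu \<gamma>) \<le> ennreal (theta x) + ennreal m + (\<integral>\<^sup>+z. ennreal (ln (1 / \<bar>x - z\<bar>)) \<partial>nu \<gamma>)"
      using split unfolding split2 split3 .
    also have "\<dots> \<le> ennreal (theta x) + ennreal m + ennreal B * ennreal (2 * 1)"
      by (intro add_left_mono fin)
    also have "ennreal B * ennreal (2 * 1) = ennreal (2 * B)"
      using ennreal_mult[of 2 B] B by (simp add: mult.commute)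
    also have "ennreal (theta x) + ennreal m + ennreal (2 * B) = ennreal (theta x + m + 2 * B)"
      using B m by (simp only: ennreal_plus theta_nonneg mult_nonneg_nonneg zero_le_numeral add_nonneg_nonneg)
    also have "theta x + m + 2 * B = m + 2 * B + theta x" by simp
    finally show ?thesis .
  qed
  then show ?thesis using B m by (intro that[of "m + 2 * B"]) auto
qed

definition kt_const :: real where
  "kt_const = (SOME C. 0 \<le> C \<and> (\<forall>x. (\<integral>\<^sup>+z. ennreal (kt 0 x z) \<partial>nu \<gamma>) \<le> ennreal (C + theta x)))"

lemma kt_const: "0 \<le> kt_const" "(\<integral>\<^sup>+z. ennreal (kt 0 x z) \<partial>nu \<gamma>) \<le> ennreal (kt_const + theta x)"
proof -
  have "0 \<le> kt_const \<and> (\<forall>x. (\<integral>\<^sup>+z. ennreal (kt 0 x z) \<partial>nu \<gamma>) \<le> ennreal (kt_const + theta x))"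
    unfolding kt_const_def by (rule someI_ex) (use nn_integral_nu_kt_bound in metis)
  then show "0 \<le> kt_const" "(\<integral>\<^sup>+z. ennreal (kt 0 x z) \<partial>nu \<gamma>) \<le> ennreal (kt_const + theta x)" by auto
qed

lemma kt0_nonneg [simp]: "0 \<le> kt 0 x y"
  by (rule kt_nonneg) auto

lemma integrable_nu_kt: "integrable (nu \<gamma>) (kt 0 x)"
  by (rule integrableI_bounded) (auto intro: le_less_trans[OF kt_const(2)])

lemma integral_nu_kt_le: "(\<integral>z. kt 0 x z \<partial>nu \<gamma>) \<le> kt_const + theta x"
proof -
  have "ennreal (\<integral>z. kt 0 x z \<partial>nu \<gamma>) = (\<integral>\<^sup>+z. ennreal (kt 0 x z) \<partial>nu \<gamma>)"
    by (intro nn_integral_eq_integral[symmetric] integrable_nu_kt) auto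
  also have "\<dots> \<le> ennreal (kt_const + theta x)" by (rule kt_const)
  finally show ?thesis using kt_const(1) theta_nonneg[of x] by (subst (asm) ennreal_le_iff) auto
qed

section \<open>Energy and entropy of bounded densities, for which both are finite\<close>

definition bdd_density :: "real \<Rightarrow> (real \<Rightarrow> real) \<Rightarrow> bool" where
  "bdd_density M f \<longleftrightarrow> f \<in> borel_measurable borel \<and> (\<forall>x. 0 \<le> f x \<and> f x \<le> M)"

definition pot :: "(real \<Rightarrow> real) \<Rightarrow> real \<Rightarrow> real" where
  "pot f x = (\<integral>z. kt 0 x z * f z \<partial>nu \<gamma>)"

definition energy :: "(real \<Rightarrow> real) \<Rightarrow> (real \<Rightarrow> real) \<Rightarrow> real" where
  "energy f g = (\<integral>x. f x * pot g x \<partial>nu \<gamma>)"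

definition entropy :: "(real \<Rightarrow> real) \<Rightarrow> real" where
  "entropy f = (\<integral>x. f x * ln (f x) \<partial>nu \<gamma>)"

lemma bdd_densityD:
  assumes "bdd_density M f"
  shows "f \<in> borel_measurable borel" "0 \<le> f x" "f x \<le> M" "0 \<le> M"
  using assms by (auto simp: bdd_density_def intro: order_trans)

lemma integrable_bdd_density_mult:
  assumes f: "bdd_density M f" and g: "integrable (nu \<gamma>) g"
  shows "integrable (nu \<gamma>) (\<lambda>x. g x * f x)"
proof (rule Bochner_Integration.integrable_bound)
  show "integrable (nu \<gamma>) (\<lambda>x. M * g x)" using g by simp
  have [measurable]: "f \<in> borel_measurable borel" "g \<in> borel_measurable borel"
    using bdd_densityD(1)[OF f] borel_measurable_integrable[OF g] by auto
  show "(\<lambda>x. g x * f x) \<in> borel_measurable (nu \<gamma>)" by measurable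
  show "AE x in nu \<gamma>. norm (g x * f x) \<le> norm (M * g x)"
    using bdd_densityD[OF f] by (intro AE_I2) (auto simp: abs_mult mult.commute[of M] intro!: mult_left_mono)
qed

lemma integrable_bdd_density:
  assumes "bdd_density M f" shows "integrable (nu \<gamma>) f"
  using integrable_bdd_density_mult[OF assms, of "\<lambda>_. 1"] by simp

lemma integrable_pot:
  assumes "bdd_density M f" shows "integrable (nu \<gamma>) (\<lambda>z. kt 0 x z * f z)"
  by (rule integrable_bdd_density_mult[OF assms integrable_nu_kt])

lemma pot_measurable [measurable]:
  assumes "bdd_density M f" shows "pot f \<in> borel_measurable borel"
proof -
  note [measurable] = bdd_densityD(1)[OF assms]
  show ?thesis unfolding pot_def[abs_def] by (rule nu.borel_measurable_lebesgue_integral[of _ borel]) measurable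
qed

lemma pot_bounds:
  assumes f: "bdd_density M f"
  shows "0 \<le> pot f x" "pot f x \<le> M * (kt_const + theta x)"
proof -
  show "0 \<le> pot f x" unfolding pot_def
    using bdd_densityD(2)[OF f] by (intro Bochner_Integration.integral_nonneg) auto
  have "pot f x \<le> (\<integral>z. kt 0 x z * M \<partial>nu \<gamma>)"
    unfolding pot_def using bdd_densityD[OF f]
    by (intro integral_mono integrable_pot[OF f] integrable_mult_left integrable_nu_kt mult_left_mono) auto
  also have "\<dots> = M * (\<integral>z. kt 0 x z \<partial>nu \<gamma>)" by simp
  also have "\<dots> \<le> M * (kt_const + theta x)"
    using bdd_densityD(4)[OF f] by (intro mult_left_mono integral_nu_kt_le)
  finally show "pot f x \<le> M * (kt_const + theta x)" .
qed

lemma integrable_nu_pot: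
  assumes f: "bdd_density M f" shows "integrable (nu \<gamma>) (pot f)"
proof (rule Bochner_Integration.integrable_bound)
  show "integrable (nu \<gamma>) (\<lambda>x. M * (kt_const + theta x))"
    using integrable_nu_theta by simp
  show "pot f \<in> borel_measurable (nu \<gamma>)" using pot_measurable[OF f] by simp
  show "AE x in nu \<gamma>. norm (pot f x) \<le> norm (M * (kt_const + theta x))"
    using pot_bounds[OF f] by (intro AE_I2) (auto intro: order_trans[OF _ abs_ge_self])
qed

lemma integrable_energy:
  assumes "bdd_density M f" "bdd_density M' g"
  shows "integrable (nu \<gamma>) (\<lambda>x. f x * pot g x)"
  using integrable_bdd_density_mult[OF assms(1) integrable_nu_pot[OF assms(2)]] by (simp add: mult.commute)

lemma energy_nonneg:
  assumes "bdd_density M f" "bdd_density M' g" shows "0 \<le> energy f g"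
  unfolding energy_def using bdd_densityD(2)[OF assms(1)] pot_bounds(1)[OF assms(2)]
  by (intro Bochner_Integration.integral_nonneg) auto

lemma nn_integral_pot:
  assumes g: "bdd_density M g"
  shows "(\<integral>\<^sup>+y. ennreal (kt 0 x y) \<partial>density (nu \<gamma>) (\<lambda>x. ennreal (g x))) = ennreal (pot g x)"
proof -
  note [measurable] = bdd_densityD(1)[OF g]
  have "(\<integral>\<^sup>+y. ennreal (kt 0 x y) \<partial>density (nu \<gamma>) (\<lambda>x. ennreal (g x))) = (\<integral>\<^sup>+y. ennreal (kt 0 x y * g y) \<partial>nu \<gamma>)"
    using bdd_densityD(2)[OF g] by (subst nn_integral_density) (auto simp: ennreal_mult mult.commute)
  also have "\<dots> = ennreal (pot g x)"
    unfolding pot_def using bdd_densityD(2)[OF g] by (intro nn_integral_eq_integral integrable_pot[OF g]) auto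
  finally show ?thesis .
qed

lemma nn_integral_energy:
  assumes f: "bdd_density M f" and g: "bdd_density M' g"
  shows "(\<integral>\<^sup>+x. (\<integral>\<^sup>+y. ennreal (kt 0 x y) \<partial>density (nu \<gamma>) (\<lambda>x. ennreal (g x))) \<partial>density (nu \<gamma>) (\<lambda>x. ennreal (f x)))
    = ennreal (energy f g)"
proof -
  note [measurable] = bdd_densityD(1)[OF f] bdd_densityD(1)[OF g] pot_measurable[OF g]
  have "(\<integral>\<^sup>+x. ennreal (pot g x) \<partial>density (nu \<gamma>) (\<lambda>x. ennreal (f x))) = (\<integral>\<^sup>+x. ennreal (f x * pot g x) \<partial>nu \<gamma>)"
    using bdd_densityD(2)[OF f] pot_bounds(1)[OF g] by (subst nn_integral_density) (auto simp: ennreal_mult)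
  also have "\<dots> = ennreal (energy f g)"
    unfolding energy_def using bdd_densityD(2)[OF f] pot_bounds(1)[OF g]
    by (intro nn_integral_eq_integral integrable_energy[OF f g]) auto
  finally show ?thesis by (simp add: nn_integral_pot[OF g])
qed

lemma prob_space_density_nu:
  assumes f: "bdd_density M f" and 1: "(\<integral>x. f x \<partial>nu \<gamma>) = 1"
  shows "prob_space (density (nu \<gamma>) (\<lambda>x. ennreal (f x)))"
proof
  note [measurable] = bdd_densityD(1)[OF f]
  have "(\<integral>\<^sup>+x. ennreal (f x) \<partial>nu \<gamma>) = 1"
    using bdd_densityD(2)[OF f] 1 by (subst nn_integral_eq_integral[OF integrable_bdd_density[OF f]]) auto
  then show "emeasure (density (nu \<gamma>) (\<lambda>x. ennreal (f x))) (space (density (nu \<gamma>) (\<lambda>x. ennreal (f x)))) = 1"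
    by (simp add: emeasure_density)
qed

lemma density_nu_abs_finite:
  assumes f: "bdd_density M f"
  shows "(\<integral>\<^sup>+x. ennreal \<bar>x\<bar> \<partial>density (nu \<gamma>) (\<lambda>x. ennreal (f x))) < \<infinity>"
proof -
  note [measurable] = bdd_densityD(1)[OF f]
  have "(\<integral>\<^sup>+x. ennreal \<bar>x\<bar> \<partial>density (nu \<gamma>) (\<lambda>x. ennreal (f x))) = (\<integral>\<^sup>+x. ennreal (\<bar>x\<bar> * f x) \<partial>nu \<gamma>)"
    using bdd_densityD(2)[OF f] by (subst nn_integral_density) (auto simp: ennreal_mult mult.commute)
  also have "\<dots> = ennreal (\<integral>x. \<bar>x\<bar> * f x \<partial>nu \<gamma>)"
    using bdd_densityD(2)[OF f]
    by (intro nn_integral_eq_integral integrable_bdd_density_mult[OF f integrable_nu_abs]) auto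
  finally show ?thesis by simp
qed

lemma density_nu_singleton:
  assumes "f \<in> borel_measurable borel"
  shows "emeasure (density (nu \<gamma>) f) {x} = 0"
proof -
  have "absolutely_continuous (nu \<gamma>) (density (nu \<gamma>) f)"
    using assms by (intro absolutely_continuousI_density) simp
  then have "{x} \<in> null_sets (density (nu \<gamma>) f)"
    unfolding absolutely_continuous_def by (rule subsetD) (simp add: null_sets_def)
  then show ?thesis by (rule null_setsD1)
qed

text \<open>Measures with bounded density with respect to \<open>nu\<close> have no atoms and a
  finite first moment, so \<open>kt_energy_psd\<close> applies with e = 0.\<close>

lemma energy_psd:
  assumes f: "bdd_density M f" "(\<integral>x. f x \<partial>nu \<gamma>) = 1" and g: "bdd_density M' g" "(\<integral>x. g x \<partial>nu \<gamma>) = 1"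
  shows "2 * energy f g \<le> energy f f + energy g g"
proof -
  note [measurable] = bdd_densityD(1)[OF f(1)] bdd_densityD(1)[OF g(1)]
  let ?D = "\<lambda>f. density (nu \<gamma>) (\<lambda>x. ennreal (f x))"
  have "2 * ennreal (energy f g) \<le> ennreal (energy f f) + ennreal (energy g g)"
    unfolding nn_integral_energy[OF f(1) g(1), symmetric] nn_integral_energy[OF f(1) f(1), symmetric]
      nn_integral_energy[OF g(1) g(1), symmetric]
    by (rule kt_energy_psd)
      (auto intro: prob_space_density_nu[OF f] prob_space_density_nu[OF g]
        density_nu_abs_finite[OF f(1), unfolded infinity_ennreal_def] density_nu_abs_finite[OF g(1), unfolded infinity_ennreal_def] density_nu_singleton)
  then have "ennreal (2 * energy f g) \<le> ennreal (energy f f + energy g g)"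
    using energy_nonneg[OF f(1) f(1)] energy_nonneg[OF g(1) g(1)] energy_nonneg[OF f(1) g(1)]
    by (simp add: ennreal_mult)
  then show ?thesis
    using energy_nonneg[OF f(1) f(1)] energy_nonneg[OF g(1) g(1)] by (subst (asm) ennreal_le_iff) auto
qed

lemma energy_commute:
  assumes f: "bdd_density M f" and g: "bdd_density M' g"
  shows "energy f g = energy g f"
proof -
  note [measurable] = bdd_densityD(1)[OF f] bdd_densityD(1)[OF g]
  let ?D = "\<lambda>f. density (nu \<gamma>) (\<lambda>x. ennreal (f x))"
  have sf: "sigma_finite_measure (?D h)" if "bdd_density M h" for M h
  proof -
    note [measurable] = bdd_densityD(1)[OF that]
    have "finite_measure (?D h)"
    proof
      have "emeasure (?D h) UNIV = (\<integral>\<^sup>+x. ennreal (h x) \<partial>nu \<gamma>)" by (simp add: emeasure_density)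
      also have "\<dots> = ennreal (\<integral>x. h x \<partial>nu \<gamma>)"
        using bdd_densityD(2)[OF that] by (intro nn_integral_eq_integral integrable_bdd_density[OF that]) auto
      finally show "emeasure (?D h) (space (?D h)) \<noteq> \<infinity>" by simp
    qed
    then show ?thesis by (simp add: finite_measure_def)
  qed
  interpret F: sigma_finite_measure "?D f" by (rule sf[OF f])
  interpret G: sigma_finite_measure "?D g" by (rule sf[OF g])
  interpret pair_sigma_finite "?D f" "?D g" ..
  have "ennreal (energy f g) = (\<integral>\<^sup>+x. (\<integral>\<^sup>+y. ennreal (kt 0 x y) \<partial>?D g) \<partial>?D f)"
    by (rule nn_integral_energy[OF f g, symmetric])
  also have "\<dots> = (\<integral>\<^sup>+y. (\<integral>\<^sup>+x. ennreal (kt 0 x y) \<partial>?D f) \<partial>?D g)"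
    by (rule Fubini'[symmetric]) measurable
  also have "\<dots> = (\<integral>\<^sup>+y. (\<integral>\<^sup>+x. ennreal (kt 0 y x) \<partial>?D f) \<partial>?D g)"
    by (simp add: kt_commute)
  also have "\<dots> = ennreal (energy g f)" by (rule nn_integral_energy[OF g f])
  finally show ?thesis using energy_nonneg[OF f g] energy_nonneg[OF g f] by simp
qed

lemma pot_lincomb:
  assumes "bdd_density M f" "bdd_density M' g"
  shows "pot (\<lambda>x. a * f x + b * g x) x = a * pot f x + b * pot g x"
proof -
  have "pot (\<lambda>x. a * f x + b * g x) x = (\<integral>z. a * (kt 0 x z * f z) + b * (kt 0 x z * g z) \<partial>nu \<gamma>)"
    unfolding pot_def by (intro Bochner_Integration.integral_cong) (auto simp: algebra_simps)
  also have "\<dots> = a * pot f x + b * pot g x"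
    unfolding pot_def using integrable_pot[OF assms(1)] integrable_pot[OF assms(2)] by simp
  finally show ?thesis .
qed

lemma energy_lincomb:
  assumes f: "bdd_density M f" and g: "bdd_density M' g"
  shows "energy (\<lambda>x. a * f x + b * g x) (\<lambda>x. a * f x + b * g x)
    = a\<^sup>2 * energy f f + 2 * a * b * energy f g + b\<^sup>2 * energy g g"
proof -
  have "energy (\<lambda>x. a * f x + b * g x) (\<lambda>x. a * f x + b * g x)
    = (\<integral>x. a\<^sup>2 * (f x * pot f x) + a * b * (f x * pot g x) + a * b * (g x * pot f x) + b\<^sup>2 * (g x * pot g x) \<partial>nu \<gamma>)"
    unfolding energy_def pot_lincomb[OF f g]
    by (intro Bochner_Integration.integral_cong) (auto simp: algebra_simps power2_eq_square)
  also have "\<dots> = a\<^sup>2 * energy f f + a * b * energy f g + a * b * energy g f + b\<^sup>2 * energy g g"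
    unfolding energy_def
    using integrable_energy[OF f f] integrable_energy[OF f g] integrable_energy[OF g f] integrable_energy[OF g g]
    by simp
  finally show ?thesis by (simp add: energy_commute[OF g f] algebra_simps)
qed

lemma abs_xlnx_le:
  fixes x M :: real
  assumes "0 \<le> x" "x \<le> M" shows "\<bar>x * ln x\<bar> \<le> 1 + M * M"
proof (cases "x = 0")
  case False
  then have x: "0 < x" using assms by simp
  have a: "ln x \<le> x - 1" using x by (rule ln_le_minus_one)
  have "ln (1 / x) \<le> 1 / x - 1" using x by (intro ln_le_minus_one) simp
  then have "x * - ln x \<le> x * (1 / x - 1)" using x by (intro mult_left_mono) (auto simp: ln_div)
  then have b: "- (x * ln x) \<le> 1" using x by (simp add: algebra_simps)
  have "x * ln x \<le> x * x" using a x by (intro mult_left_mono) auto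
  also have "\<dots> \<le> M * M" using assms by (intro mult_mono) auto
  finally have "x * ln x \<le> M * M" .
  then show ?thesis using b by (auto simp: abs_le_iff intro: add_increasing add_increasing2)
qed simp

lemma integrable_entropy:
  assumes f: "bdd_density M f" shows "integrable (nu \<gamma>) (\<lambda>x. f x * ln (f x))"
proof (rule nu.integrable_const_bound)
  note [measurable] = bdd_densityD(1)[OF f]
  show "AE x in nu \<gamma>. norm (f x * ln (f x)) \<le> 1 + M * M"
    using abs_xlnx_le bdd_densityD(2,3)[OF f] by (intro AE_I2) auto
  show "(\<lambda>x. f x * ln (f x)) \<in> borel_measurable (nu \<gamma>)" by measurable
qed

lemma entropy_nonneg:
  assumes f: "bdd_density M f" "(\<integral>x. f x \<partial>nu \<gamma>) = 1"
  shows "0 \<le> entropy f"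
proof -
  have "(\<integral>x. f x - 1 \<partial>nu \<gamma>) \<le> entropy f"
    unfolding entropy_def
  proof (rule integral_mono)
    show "f x - 1 \<le> f x * ln (f x)" for x
      using order_trans[OF zero_le_power2 entropy_hellinger_le[of "f x" 1]] bdd_densityD(2)[OF f(1)]
      by (simp add: algebra_simps)
  qed (use integrable_bdd_density[OF f(1)] integrable_entropy[OF f(1)] in auto)
  then show ?thesis using f integrable_bdd_density[OF f(1)] nu.prob_space by simp
qed

end

section \<open>Convexity and continuity of x ln x, and the first-order condition\<close>

lemma xlnx_convex:
  fixes a b t :: real
  assumes a: "0 \<le> a" and b: "0 \<le> b" and t: "0 \<le> t" "t \<le> 1"
  defines "c \<equiv> (1 - t) * a + t * b"
  shows "c * ln c \<le> (1 - t) * (a * ln a) + t * (b * ln b)"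
proof (cases "c = 0")
  case True
  then have "(1 - t) * a = 0" "t * b = 0"
    using a b t by (auto simp: c_def add_nonneg_eq_0_iff)
  then have e: "(1 - t) * (a * ln a) = 0" "t * (b * ln b) = 0" by auto
  show ?thesis unfolding e using True by simp
next
  case False
  then have c: "0 < c" using a b t by (simp add: c_def order_less_le)
  have *: "x * ln c + x - c \<le> x * ln x" if "0 \<le> x" for x
    using order_trans[OF zero_le_power2 entropy_hellinger_le[OF that c]] that c
    by (cases "x = 0") (auto simp: ln_div algebra_simps)
  have "(1 - t) * (a * ln c + a - c) + t * (b * ln c + b - c) \<le> (1 - t) * (a * ln a) + t * (b * ln b)"
    using t a b by (intro add_mono mult_left_mono *) auto
  moreover have "(1 - t) * (a * ln c + a - c) + t * (b * ln c + b - c) = c * ln c"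
    by (simp add: c_def algebra_simps)
  ultimately show ?thesis by simp
qed

text \<open>Only x = 0 needs an argument, as \<open>ln\<close> is discontinuous there. The bound |y
  ln y| \<le> 2 sqrt y + y^2 follows from ln t \<le> t - 1 at t = y and at t = 1 / sqrt y.\<close>

lemma tendsto_xlnx:
  fixes X :: "nat \<Rightarrow> real"
  assumes X: "X \<longlonglongrightarrow> x" "\<And>n. 0 \<le> X n"
  shows "(\<lambda>n. X n * ln (X n)) \<longlonglongrightarrow> x * ln x"
proof (cases "x = 0")
  case True
  have bound: "\<bar>y * ln y\<bar> \<le> 2 * sqrt y + y * y" if y: "0 \<le> y" for y :: real
  proof (cases "y = 0")
    case False
    then have y: "0 < y" using y by simp
    have "ln y \<le> y - 1" using y by (rule ln_le_minus_one)
    then have 1: "y * ln y \<le> y * y" using y by (intro mult_left_mono) auto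
    have "ln (1 / sqrt y) \<le> 1 / sqrt y - 1" using y by (intro ln_le_minus_one) simp
    then have "- ln y \<le> 2 * (1 / sqrt y)" using y by (simp add: ln_div ln_sqrt)
    then have "y * - ln y \<le> y * (2 * (1 / sqrt y))" using y by (intro mult_left_mono) auto
    also have "\<dots> = 2 * sqrt y" using y by (simp add: field_simps)
    finally have 2: "- (y * ln y) \<le> 2 * sqrt y" by simp
    have "0 \<le> sqrt y" "0 \<le> y * y" using y by auto
    then show ?thesis using 1 2 by linarith
  qed simp
  have "(\<lambda>n. 2 * sqrt (X n) + X n * X n) \<longlonglongrightarrow> 2 * sqrt x + x * x"
    by (intro tendsto_intros X)
  then have "(\<lambda>n. 2 * sqrt (X n) + X n * X n) \<longlonglongrightarrow> 0" using True by simp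
  then have "(\<lambda>n. X n * ln (X n)) \<longlonglongrightarrow> 0"
    by (rule Lim_null_comparison[rotated]) (auto intro!: always_eventually bound X)
  then show ?thesis using True by simp
next
  case False
  then show ?thesis by (intro tendsto_intros X)
qed

text \<open>The first-order condition at a minimum: after division by t, A is a directional
  derivative and t B the remainder of the quadratic part, which disappears as t tends to 0.\<close>

lemma nonneg_if_nonneg_perturbed:
  fixes A B :: real
  assumes "\<And>t. 0 < t \<Longrightarrow> t \<le> 1 \<Longrightarrow> 0 \<le> A + t * B"
  shows "0 \<le> A"
proof (rule tendsto_lowerbound)
  have "((\<lambda>t. A + t * B) \<longlongrightarrow> A + 0 * B) (at_right 0)" by (intro tendsto_intros)
  then show "((\<lambda>t. A + t * B) \<longlongrightarrow> A) (at_right 0)" by simp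
  have "\<forall>\<^sub>F t in at_right 0. t \<in> {0<..<(1::real)}" by (rule eventually_at_right_real) simp
  then show "\<forall>\<^sub>F t in at_right 0. 0 \<le> A + t * B"
    by eventually_elim (use assms in auto)
qed simp

section \<open>Minimizing the free energy over densities bounded by M\<close>

context high_temperature
begin

definition admissible :: "real \<Rightarrow> (real \<Rightarrow> real) \<Rightarrow> bool" where
  "admissible M f \<longleftrightarrow> bdd_density M f \<and> (\<integral>x. f x \<partial>nu \<gamma>) = 1"

definition functional :: "(real \<Rightarrow> real) \<Rightarrow> real" where
  "functional f = \<gamma> / 2 * energy f f + entropy f"

lemma admissibleD:
  assumes "admissible M f"
  shows "bdd_density M f" "(\<integral>x. f x \<partial>nu \<gamma>) = 1"
  using assms by (auto simp: admissible_def)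

lemma admissible_lincomb:
  assumes f: "admissible M f" and g: "admissible M g" and ab: "0 \<le> a" "0 \<le> b" "a + b = (1::real)"
  shows "admissible M (\<lambda>x. a * f x + b * g x)"
proof -
  note F = bdd_densityD[OF admissibleD(1)[OF f]] and G = bdd_densityD[OF admissibleD(1)[OF g]]
  have "a * f x + b * g x \<le> M" for x
  proof -
    have "a * f x + b * g x \<le> a * M + b * M"
      using F(3)[of x] G(3)[of x] ab by (intro add_mono mult_left_mono) auto
    also have "\<dots> = M" using ab by (simp add: distrib_right[symmetric])
    finally show ?thesis .
  qed
  moreover have "(\<integral>x. a * f x + b * g x \<partial>nu \<gamma>) = 1"
    using integrable_bdd_density[OF admissibleD(1)[OF f]] integrable_bdd_density[OF admissibleD(1)[OF g]]
      admissibleD(2)[OF f] admissibleD(2)[OF g] ab by simp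
  ultimately show ?thesis using F G ab by (auto simp: admissible_def bdd_density_def)
qed

lemma admissible_one: "1 \<le> M \<Longrightarrow> admissible M (\<lambda>_. 1)"
  using nu.prob_space by (auto simp: admissible_def bdd_density_def)

lemma functional_nonneg: "admissible M f \<Longrightarrow> 0 \<le> functional f"
  unfolding functional_def
  using energy_nonneg[of M f M f] entropy_nonneg[of M f] gamma_nonneg admissibleD[of M f] by auto

text \<open>The energy is merely convex, by \<open>energy_psd\<close>. The quadratic gain comes from
  the entropy through \<open>xlnx_midpoint\<close>, with a constant depending on the bound
  M.\<close>

lemma functional_midpoint:
  assumes f: "admissible M f" and g: "admissible M g" and M: "0 < M"
  shows "functional (\<lambda>x. 1 / 2 * f x + 1 / 2 * g x)
    \<le> (functional f + functional g) / 2 - (\<integral>x. (f x - g x)\<^sup>2 \<partial>nu \<gamma>) / (16 * M)"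
proof -
  note bf = admissibleD(1)[OF f] and bg = admissibleD(1)[OF g]
  note F = bdd_densityD[OF bf] and G = bdd_densityD[OF bg]
  note [measurable] = F(1) G(1)
  let ?h = "\<lambda>x. 1 / 2 * f x + 1 / 2 * g x"
  have h: "admissible M ?h" by (rule admissible_lincomb[OF f g]) auto
  have "energy ?h ?h = (1/2)\<^sup>2 * energy f f + 2 * (1/2) * (1/2) * energy f g + (1/2)\<^sup>2 * energy g g"
    by (rule energy_lincomb[OF bf bg])
  also have "\<dots> \<le> (energy f f + energy g g) / 2"
    using energy_psd[OF admissibleD[OF f] admissibleD[OF g]] by (simp add: power2_eq_square)
  finally have "\<gamma> / 2 * energy ?h ?h \<le> \<gamma> / 2 * ((energy f f + energy g g) / 2)"
    using gamma_nonneg by (intro mult_left_mono) auto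
  then have en: "\<gamma> / 2 * energy ?h ?h \<le> (\<gamma> / 2 * energy f f + \<gamma> / 2 * energy g g) / 2"
    by (simp add: algebra_simps add_divide_distrib)
  have sq: "integrable (nu \<gamma>) (\<lambda>x. (f x - g x)\<^sup>2)"
  proof (rule nu.integrable_const_bound)
    show "AE x in nu \<gamma>. norm ((f x - g x)\<^sup>2) \<le> M\<^sup>2"
    proof (rule AE_I2)
      fix x
      have "\<bar>f x - g x\<bar> \<le> M" using F(2,3)[of x] G(2,3)[of x] by linarith
      then show "norm ((f x - g x)\<^sup>2) \<le> M\<^sup>2" using power_mono[of "\<bar>f x - g x\<bar>" M 2] by simp
    qed
  qed measurable
  have "entropy ?h \<le> (\<integral>x. (f x * ln (f x) + g x * ln (g x)) / 2 - (f x - g x)\<^sup>2 / (16 * M) \<partial>nu \<gamma>)"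
    unfolding entropy_def
  proof (rule integral_mono)
    fix x
    have "1 / 2 * f x + 1 / 2 * g x = (f x + g x) / 2" by simp
    then show "(1 / 2 * f x + 1 / 2 * g x) * ln (1 / 2 * f x + 1 / 2 * g x)
      \<le> (f x * ln (f x) + g x * ln (g x)) / 2 - (f x - g x)\<^sup>2 / (16 * M)"
      using xlnx_midpoint[OF F(2,3)[of x] G(2,3)[of x] M] by (simp only:)
  qed (use integrable_entropy[OF bf] integrable_entropy[OF bg] integrable_entropy[OF admissibleD(1)[OF h]] sq in auto)
  also have "\<dots> = (entropy f + entropy g) / 2 - (\<integral>x. (f x - g x)\<^sup>2 \<partial>nu \<gamma>) / (16 * M)"
    unfolding entropy_def using integrable_entropy[OF bf] integrable_entropy[OF bg] sq by simp
  finally have "entropy ?h \<le> (entropy f + entropy g) / 2 - (\<integral>x. (f x - g x)\<^sup>2 \<partial>nu \<gamma>) / (16 * M)" .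
  with en show ?thesis unfolding functional_def by (simp add: add_divide_distrib)
qed

lemma entropy_convex:
  assumes f: "admissible M f" and g: "admissible M g" and t: "0 \<le> t" "t \<le> 1"
  shows "entropy (\<lambda>x. (1 - t) * f x + t * g x) \<le> (1 - t) * entropy f + t * entropy g"
proof -
  note bf = admissibleD(1)[OF f] and bg = admissibleD(1)[OF g]
  have h: "admissible M (\<lambda>x. (1 - t) * f x + t * g x)"
    by (rule admissible_lincomb[OF f g]) (use t in auto)
  have "entropy (\<lambda>x. (1 - t) * f x + t * g x)
    \<le> (\<integral>x. (1 - t) * (f x * ln (f x)) + t * (g x * ln (g x)) \<partial>nu \<gamma>)"
    unfolding entropy_def
    using integrable_entropy[OF bf] integrable_entropy[OF bg] integrable_entropy[OF admissibleD(1)[OF h]]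
      bdd_densityD(2)[OF bf] bdd_densityD(2)[OF bg] t
    by (intro integral_mono xlnx_convex) auto
  also have "\<dots> = (1 - t) * entropy f + t * entropy g"
    unfolding entropy_def using integrable_entropy[OF bf] integrable_entropy[OF bg] by simp
  finally show ?thesis .
qed

lemma functional_tendsto:
  assumes F: "\<And>k. admissible M (F k)" and f: "admissible M f"
    and lim: "AE x in nu \<gamma>. (\<lambda>k. F k x) \<longlonglongrightarrow> f x"
  shows "(\<lambda>k. functional (F k)) \<longlonglongrightarrow> functional f"
proof -
  note bF = admissibleD(1)[OF F] and bf = admissibleD(1)[OF f]
  have [measurable]: "F k \<in> borel_measurable borel" "pot (F k) \<in> borel_measurable borel" for k
    using bdd_densityD(1)[OF bF] pot_measurable[OF bF] by auto
  have [measurable]: "f \<in> borel_measurable borel" "pot f \<in> borel_measurable borel"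
    using bdd_densityD(1)[OF bf] pot_measurable[OF bf] by auto
  have ent: "(\<lambda>k. entropy (F k)) \<longlonglongrightarrow> entropy f"
    unfolding entropy_def
  proof (rule integral_dominated_convergence[where w = "\<lambda>_. 1 + M * M"])
    show "AE x in nu \<gamma>. (\<lambda>k. F k x * ln (F k x)) \<longlonglongrightarrow> f x * ln (f x)"
      using lim by eventually_elim (intro tendsto_xlnx bdd_densityD(2)[OF bF])
    show "AE x in nu \<gamma>. norm (F k x * ln (F k x)) \<le> 1 + M * M" for k
      using abs_xlnx_le bdd_densityD(2,3)[OF bF] by (intro AE_I2) auto
  qed auto
  have pot: "(\<lambda>k. pot (F k) x) \<longlonglongrightarrow> pot f x" for x
    unfolding pot_def
  proof (rule integral_dominated_convergence[where w = "\<lambda>z. kt 0 x z * M"])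
    show "integrable (nu \<gamma>) (\<lambda>z. kt 0 x z * M)" using integrable_nu_kt by simp
    show "AE z in nu \<gamma>. (\<lambda>k. kt 0 x z * F k z) \<longlonglongrightarrow> kt 0 x z * f z"
      using lim by eventually_elim (intro tendsto_intros)
    show "AE z in nu \<gamma>. norm (kt 0 x z * F k z) \<le> kt 0 x z * M" for k
      using bdd_densityD(2,3)[OF bF] by (intro AE_I2) (auto simp: abs_mult intro!: mult_left_mono)
  qed measurable
  have en: "(\<lambda>k. energy (F k) (F k)) \<longlonglongrightarrow> energy f f"
    unfolding energy_def
  proof (rule integral_dominated_convergence[where w = "\<lambda>x. M * (M * (kt_const + theta x))"])
    show "integrable (nu \<gamma>) (\<lambda>x. M * (M * (kt_const + theta x)))" using integrable_nu_theta by simp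
    show "AE x in nu \<gamma>. (\<lambda>k. F k x * pot (F k) x) \<longlonglongrightarrow> f x * pot f x"
      using lim by eventually_elim (intro tendsto_mult pot)
    show "AE x in nu \<gamma>. norm (F k x * pot (F k) x) \<le> M * (M * (kt_const + theta x))" for k
      using bdd_densityD(2,3,4)[OF bF] pot_bounds[OF bF]
      by (intro AE_I2) (auto simp: abs_mult intro!: mult_mono)
  qed auto
  show ?thesis unfolding functional_def by (intro tendsto_intros en ent)
qed

text \<open>The entropy is strongly convex on densities bounded by \<open>M\<close>, so a minimizing sequence is
  Cauchy in \<open>L\<^sup>2\<close> and no weak compactness is needed.\<close>

lemma functional_minimizer_exists:
  assumes M: "1 \<le> M"
  obtains f where "admissible M f" "\<And>g. admissible M g \<Longrightarrow> functional f \<le> functional g"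
proof -
  define I where "I = (INF f\<in>{f. admissible M f}. functional f)"
  have bdd: "bdd_below (functional ` {f. admissible M f})"
    by (rule bdd_belowI[of _ 0]) (auto intro: functional_nonneg)
  have I: "I \<le> functional g" if "admissible M g" for g
    unfolding I_def using that by (intro cINF_lower bdd) auto
  \<comment> \<open>With the rate 1/4^k the squared L2 norms of the increments decay like 1/4^k and
    their L1 norms like 1/2^k, which is summable.\<close>
  have "\<exists>f. admissible M f \<and> functional f < I + (1/4)^k" for k
  proof -
    have "I < I + (1/4)^k" by simp
    moreover have "functional ` {f. admissible M f} \<noteq> {}" using admissible_one[OF M] by auto
    ultimately have "\<exists>y\<in>functional ` {f. admissible M f}. y < I + (1/4)^k"
      unfolding I_def by (intro cInf_lessD) auto
    then show ?thesis by auto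
  qed
  then obtain F where F: "\<And>k. admissible M (F k)" "\<And>k. functional (F k) < I + (1/4)^k" by metis
  note bF = admissibleD(1)[OF F(1)]
  note [measurable] = bdd_densityD(1)[OF bF]
  define h where "h = (\<lambda>k x. F (Suc k) x - F k x)"
  have [measurable]: "h k \<in> borel_measurable borel" for k unfolding h_def by measurable
  have hM: "\<bar>h k x\<bar> \<le> M" for k x
    using bdd_densityD(2,3)[OF bF, of k x] bdd_densityD(2,3)[OF bF, of "Suc k" x] by (auto simp: h_def abs_le_iff)
  have h_sq: "integrable (nu \<gamma>) (\<lambda>x. (h k x)\<^sup>2)" for k
  proof (rule nu.integrable_const_bound)
    show "AE x in nu \<gamma>. norm ((h k x)\<^sup>2) \<le> M\<^sup>2"
      using power_mono[OF hM abs_ge_zero, of _ _ 2] by (intro AE_I2) simp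
  qed measurable
  have h_int: "integrable (nu \<gamma>) (\<lambda>x. \<bar>h k x\<bar>)" for k
    by (rule nu.integrable_const_bound[where B = M]) (use hM in auto)
  have sq: "(\<integral>x. (h k x)\<^sup>2 \<partial>nu \<gamma>) \<le> 16 * M * (1/4)^k" for k
  proof -
    have "I \<le> functional (\<lambda>x. 1/2 * F (Suc k) x + 1/2 * F k x)"
      by (intro I admissible_lincomb F) auto
    also have "\<dots> \<le> (functional (F (Suc k)) + functional (F k)) / 2 - (\<integral>x. (h k x)\<^sup>2 \<partial>nu \<gamma>) / (16 * M)"
      unfolding h_def by (rule functional_midpoint) (use F M in auto)
    finally have "(\<integral>x. (h k x)\<^sup>2 \<partial>nu \<gamma>) / (16 * M) \<le> (functional (F (Suc k)) + functional (F k)) / 2 - I" by simp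
    also have "\<dots> \<le> (1/4)^k"
    proof -
      have "(1/4::real)^Suc k \<le> (1/4)^k" by (intro power_decreasing) auto
      then show ?thesis using F(2)[of k] F(2)[of "Suc k"] by argo
    qed
    finally show ?thesis using M by (simp add: field_simps)
  qed
  have L1: "(\<integral>x. \<bar>h k x\<bar> \<partial>nu \<gamma>) \<le> (8 * M + 1/2) * (1/2)^k" for k
  proof -
    have "(\<integral>x. \<bar>h k x\<bar> \<partial>nu \<gamma>) \<le> (\<integral>x. 2^k / 2 * (h k x)\<^sup>2 + (1/2)^k / 2 \<partial>nu \<gamma>)"
    proof (rule integral_mono)
      fix x
      \<comment> \<open>Young's inequality with weight 2^k: the squared increment, of order 1/4^k,
        is balanced against the constant 1/2^k.\<close>
      have "0 \<le> (2^k * \<bar>h k x\<bar> - 1)\<^sup>2" by simp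
      then have "2 * 2^k * \<bar>h k x\<bar> \<le> 2^k * (2^k * (h k x)\<^sup>2) + 1"
        by (simp add: power2_diff power_mult_distrib power2_eq_square algebra_simps)
      then show "\<bar>h k x\<bar> \<le> 2^k / 2 * (h k x)\<^sup>2 + (1/2)^k / 2"
        by (simp add: power_one_over field_simps)
    qed (use h_int h_sq in auto)
    also have "\<dots> = 2^k / 2 * (\<integral>x. (h k x)\<^sup>2 \<partial>nu \<gamma>) + (1/2)^k / 2"
      using h_sq nu.prob_space by simp
    also have "\<dots> \<le> 2^k / 2 * (16 * M * (1/4)^k) + (1/2)^k / 2"
      by (intro add_right_mono mult_left_mono sq) auto
    also have "\<dots> = (8 * M + 1/2) * (1/2)^k"
      using power_mult_distrib[of "2::real" "1/4" k] by (simp add: field_simps)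
    finally show ?thesis .
  qed
  have "(\<integral>\<^sup>+x. (\<Sum>k. ennreal \<bar>h k x\<bar>) \<partial>nu \<gamma>) = (\<Sum>k. \<integral>\<^sup>+x. ennreal \<bar>h k x\<bar> \<partial>nu \<gamma>)"
    by (rule nn_integral_suminf) measurable
  also have "\<dots> \<le> (\<Sum>k. ennreal ((8 * M + 1/2) * (1/2)^k))"
  proof (intro suminf_le)
    fix k
    have "(\<integral>\<^sup>+x. ennreal \<bar>h k x\<bar> \<partial>nu \<gamma>) = ennreal (\<integral>x. \<bar>h k x\<bar> \<partial>nu \<gamma>)"
      by (intro nn_integral_eq_integral h_int) auto
    then show "(\<integral>\<^sup>+x. ennreal \<bar>h k x\<bar> \<partial>nu \<gamma>) \<le> ennreal ((8 * M + 1/2) * (1/2)^k)"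
      using L1[of k] by (simp add: ennreal_leI)
  qed auto
  also have "\<dots> = ennreal (\<Sum>k. (8 * M + 1/2) * (1/2)^k)"
    using M by (intro suminf_ennreal2) (auto intro!: summable_mult summable_geometric)
  finally have "(\<integral>\<^sup>+x. (\<Sum>k. ennreal \<bar>h k x\<bar>) \<partial>nu \<gamma>) \<noteq> \<infinity>" by (auto simp: top_unique)
  then have "AE x in nu \<gamma>. (\<Sum>k. ennreal \<bar>h k x\<bar>) \<noteq> \<infinity>"
    by (intro nn_integral_PInf_AE) auto
  then have conv: "AE x in nu \<gamma>. convergent (\<lambda>k. F k x)"
  proof eventually_elim
    case (elim x)
    then have "summable (\<lambda>k. \<bar>h k x\<bar>)" by (intro summable_suminf_not_top) auto
    then have "summable (\<lambda>k. h k x)" by (rule summable_rabs_cancel)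
    then have "(\<lambda>n. F 0 x + (\<Sum>k<n. h k x)) \<longlonglongrightarrow> F 0 x + (\<Sum>k. h k x)"
      by (intro tendsto_intros summable_LIMSEQ)
    moreover have "F 0 x + (\<Sum>k<n. h k x) = F n x" for n
      unfolding h_def using sum_lessThan_telescope[of "\<lambda>k. F k x" n] by simp
    ultimately show ?case by (auto simp: convergent_def)
  qed
  \<comment> \<open>The limit exists only almost everywhere; clamping it to [0, M] gives a function
    that satisfies the bounds at every point.\<close>
  define f where "f = (\<lambda>x. max 0 (min M (lim (\<lambda>k. F k x))))"
  have [measurable]: "f \<in> borel_measurable borel"
    unfolding f_def by (intro borel_measurable_max borel_measurable_min borel_measurable_lim_metric) auto
  have lim: "AE x in nu \<gamma>. (\<lambda>k. F k x) \<longlonglongrightarrow> f x"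
    using conv
  proof eventually_elim
    case (elim x)
    then have l: "(\<lambda>k. F k x) \<longlonglongrightarrow> lim (\<lambda>k. F k x)" by (simp add: convergent_LIMSEQ_iff)
    have "0 \<le> lim (\<lambda>k. F k x)" "lim (\<lambda>k. F k x) \<le> M"
      using bdd_densityD(2,3)[OF bF]
      by (auto intro: LIMSEQ_le_const[OF l] LIMSEQ_le_const2[OF l])
    then show ?case using l by (simp add: f_def)
  qed
  have bf: "bdd_density M f" using M by (auto simp: bdd_density_def f_def)
  have "(\<lambda>k. \<integral>x. F k x \<partial>nu \<gamma>) \<longlonglongrightarrow> (\<integral>x. f x \<partial>nu \<gamma>)"
    by (rule integral_dominated_convergence[where w = "\<lambda>_. M"])
      (use lim bdd_densityD(2,3)[OF bF] in auto)
  then have "(\<integral>x. f x \<partial>nu \<gamma>) = 1"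
    using admissibleD(2)[OF F(1)] by (simp add: LIMSEQ_const_iff)
  with bf have f: "admissible M f" by (simp add: admissible_def)
  have "(\<lambda>k. functional (F k)) \<longlonglongrightarrow> functional f" by (rule functional_tendsto[OF F(1) f lim])
  moreover have "(\<lambda>k. I + (1/4)^k) \<longlonglongrightarrow> I + 0"
    by (intro tendsto_intros LIMSEQ_realpow_zero) auto
  ultimately have "functional f \<le> I + 0"
    by (rule LIMSEQ_le) (use F(2) in \<open>auto intro!: exI[of _ 0] less_imp_le\<close>)
  then show ?thesis using I f by (intro that[of f]) (auto intro: order_trans)
qed

text \<open>The Gibbs density with respect to \<open>nu\<close> in the field created by f. Its fixed
  points are the solutions of the Euler-Lagrange equation.\<close>

definition tilt :: "(real \<Rightarrow> real) \<Rightarrow> real \<Rightarrow> real" where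
  "tilt f x = exp (- \<gamma> * pot f x) / (\<integral>x. exp (- \<gamma> * pot f x) \<partial>nu \<gamma>)"

text \<open>The second part is Jensen's inequality for exp, obtained from the tangent at the mean m.
  It keeps the normalization away from 0 and hence \<open>tilt f\<close> bounded.\<close>

lemma tilt_norm_bound:
  assumes f: "admissible M f"
  shows "integrable (nu \<gamma>) (\<lambda>x. exp (- \<gamma> * pot f x))"
    and "exp (- \<gamma> * energy f (\<lambda>_. 1)) \<le> (\<integral>x. exp (- \<gamma> * pot f x) \<partial>nu \<gamma>)"
proof -
  note bf = admissibleD(1)[OF f]
  have one: "bdd_density 1 (\<lambda>_. 1)" by (simp add: bdd_density_def)
  note [measurable] = pot_measurable[OF bf]
  show int: "integrable (nu \<gamma>) (\<lambda>x. exp (- \<gamma> * pot f x))"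
    by (rule nu.integrable_const_bound[where B = 1]) (use pot_bounds(1)[OF bf] gamma_nonneg in auto)
  define m where "m = - \<gamma> * energy f (\<lambda>_. 1)"
  have m: "(\<integral>x. - \<gamma> * pot f x \<partial>nu \<gamma>) = m"
    unfolding m_def energy_commute[OF bf one] by (simp add: energy_def)
  have "exp m = (\<integral>x. exp m * (1 + (- \<gamma> * pot f x - m)) \<partial>nu \<gamma>)"
    using m integrable_nu_pot[OF bf] nu.prob_space by simp
  also have "\<dots> \<le> (\<integral>x. exp (- \<gamma> * pot f x) \<partial>nu \<gamma>)"
  proof (rule integral_mono[OF _ int])
    show "integrable (nu \<gamma>) (\<lambda>x. exp m * (1 + (- \<gamma> * pot f x - m)))"
      using integrable_nu_pot[OF bf] by simp
    fix x
    have "exp m * (1 + (- \<gamma> * pot f x - m)) \<le> exp m * exp (- \<gamma> * pot f x - m)"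
      by (intro mult_left_mono exp_ge_add_one_self) simp
    then show "exp m * (1 + (- \<gamma> * pot f x - m)) \<le> exp (- \<gamma> * pot f x)" by (simp add: exp_add[symmetric])
  qed
  finally show "exp (- \<gamma> * energy f (\<lambda>_. 1)) \<le> (\<integral>x. exp (- \<gamma> * pot f x) \<partial>nu \<gamma>)" by (simp add: m_def)
qed

text \<open>Young's inequality a t \<le> a ln a - a + e^t with a = f x and t =
  \<open>theta x\<close>, integrated.\<close>

lemma integral_theta_le_entropy:
  assumes f: "admissible M f"
  shows "(\<integral>x. theta x * f x \<partial>nu \<gamma>) \<le> entropy f + (\<integral>x. exp (theta x) \<partial>nu \<gamma>)"
proof -
  note bf = admissibleD(1)[OF f]
  have "(\<integral>x. theta x * f x \<partial>nu \<gamma>) \<le> (\<integral>x. f x * ln (f x) + exp (theta x) \<partial>nu \<gamma>)"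
  proof (rule integral_mono)
    fix x
    have "0 \<le> f x * ln (f x / exp (theta x)) - f x + exp (theta x)"
      by (rule order_trans[OF zero_le_power2 entropy_hellinger_le]) (use bdd_densityD(2)[OF bf] in auto)
    moreover have "f x * ln (f x / exp (theta x)) = f x * ln (f x) - theta x * f x"
      using bdd_densityD(2)[OF bf, of x] by (cases "f x = 0") (auto simp: ln_div algebra_simps)
    ultimately show "theta x * f x \<le> f x * ln (f x) + exp (theta x)"
      using bdd_densityD(2)[OF bf, of x] by linarith
  qed (use integrable_bdd_density_mult[OF bf integrable_nu_theta] integrable_entropy[OF bf] integrable_nu_exp_theta in auto)
  also have "\<dots> = entropy f + (\<integral>x. exp (theta x) \<partial>nu \<gamma>)"
    unfolding entropy_def using integrable_entropy[OF bf] integrable_nu_exp_theta by simp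
  finally show ?thesis .
qed

text \<open>A minimizer f under the constraint f \<le> M might touch the constraint. This is met by
  choosing M, from quantities not involving M, so large that T = \<open>tilt f\<close> is itself
  bounded by M and hence an admissible competitor. Moving from f towards T cannot lower the
  functional, and the resulting first-order condition says that the entropy of f relative to T is at
  most 0; so f = T almost everywhere.\<close>

lemma Euler_Lagrange_exists:
  obtains M T where "admissible M T" "\<And>x. T x = tilt T x"
proof -
  have one: "bdd_density 1 (\<lambda>_. 1)" by (simp add: bdd_density_def)
  \<comment> \<open>K bounds the mutual energy of f and the density 1 for every minimizer f:
    comparison with the density 1 bounds the entropy of f, the entropy bounds the integral of
    \<open>theta\<close>, and the potential of \<open>nu\<close> is at most
    \<open>kt_const + theta\<close>. By Jensen's inequality \<open>tilt f\<close> is then at most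
    exp (\<gamma> K) = M.\<close>
  define K where "K = kt_const + (\<gamma> / 2 * energy (\<lambda>_. 1) (\<lambda>_. 1) + (\<integral>x. exp (theta x) \<partial>nu \<gamma>))"
  define M where "M = exp (\<gamma> * K)"
  have "0 \<le> K"
    unfolding K_def using kt_const(1) energy_nonneg[OF one one] gamma_nonneg
    by (intro add_nonneg_nonneg mult_nonneg_nonneg Bochner_Integration.integral_nonneg) auto
  then have M: "1 \<le> M" unfolding M_def using gamma_nonneg by simp
  obtain f where f: "admissible M f" and fmin: "\<And>g. admissible M g \<Longrightarrow> functional f \<le> functional g"
    using functional_minimizer_exists[OF M] by metis
  note bf = admissibleD(1)[OF f]
  define Z where "Z = (\<integral>x. exp (- \<gamma> * pot f x) \<partial>nu \<gamma>)"
  have "entropy f \<le> functional f"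
    unfolding functional_def using energy_nonneg[OF bf bf] gamma_nonneg by simp
  also have "\<dots> \<le> functional (\<lambda>_. 1)" by (intro fmin admissible_one M)
  finally have ent: "entropy f \<le> \<gamma> / 2 * energy (\<lambda>_. 1) (\<lambda>_. 1)" by (simp add: functional_def entropy_def)
  have "energy f (\<lambda>_. 1) \<le> (\<integral>x. kt_const * f x + theta x * f x \<partial>nu \<gamma>)"
    unfolding energy_def
  proof (rule integral_mono)
    show "f x * pot (\<lambda>_. 1) x \<le> kt_const * f x + theta x * f x" for x
      using mult_left_mono[OF pot_bounds(2)[OF one, of x] bdd_densityD(2)[OF bf, of x]] by (simp add: algebra_simps)
  qed (use integrable_energy[OF bf one] integrable_bdd_density[OF bf] integrable_bdd_density_mult[OF bf integrable_nu_theta] in auto)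
  also have "\<dots> = kt_const + (\<integral>x. theta x * f x \<partial>nu \<gamma>)"
    using integrable_bdd_density[OF bf] integrable_bdd_density_mult[OF bf integrable_nu_theta] admissibleD(2)[OF f] by simp
  also have "\<dots> \<le> K"
    unfolding K_def using integral_theta_le_entropy[OF f] ent by simp
  finally have "- (\<gamma> * K) \<le> - \<gamma> * energy f (\<lambda>_. 1)"
    using gamma_nonneg by (simp add: mult_left_mono)
  then have "exp (- (\<gamma> * K)) \<le> exp (- \<gamma> * energy f (\<lambda>_. 1))" by simp
  also have "\<dots> \<le> Z" unfolding Z_def by (rule tilt_norm_bound[OF f])
  finally have ZM: "exp (- (\<gamma> * K)) \<le> Z" .
  then have Z: "0 < Z" using exp_gt_zero less_le_trans by blast
  have ZM': "1 / Z \<le> M"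
    using ZM Z by (simp add: M_def exp_minus field_simps)
  define T where "T = tilt f"
  have T_eq: "T x = exp (- \<gamma> * pot f x) / Z" for x by (simp add: T_def tilt_def Z_def)
  have T_pos: "0 < T x" for x using Z by (simp add: T_eq)
  note [measurable] = pot_measurable[OF bf] bdd_densityD(1)[OF bf]
  have "T x \<le> M" for x
  proof -
    have "T x \<le> 1 / Z" unfolding T_eq using pot_bounds(1)[OF bf, of x] gamma_nonneg Z by (intro divide_right_mono) auto
    with ZM' show ?thesis by simp
  qed
  then have bT: "bdd_density M T"
    unfolding bdd_density_def using T_pos by (auto simp: T_eq[abs_def] intro: less_imp_le)
  have T1: "(\<integral>x. T x \<partial>nu \<gamma>) = 1" 
  proof -
    have "(\<integral>x. T x \<partial>nu \<gamma>) = Z / Z" unfolding T_eq Z_def by (rule integral_divide_zero)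
    then show ?thesis using Z by simp
  qed
  have T: "admissible M T" using bT T1 by (simp add: admissible_def)
  note [measurable] = bdd_densityD(1)[OF bT]
  have lnT: "ln (T x) = - \<gamma> * pot f x - ln Z" for x unfolding T_eq using Z by (simp add: ln_div)
  have HT: "entropy T = - \<gamma> * energy f T - ln Z"
  proof -
    have "entropy T = (\<integral>x. - \<gamma> * (T x * pot f x) - ln Z * T x \<partial>nu \<gamma>)"
      unfolding entropy_def lnT by (intro Bochner_Integration.integral_cong) (auto simp: algebra_simps)
    also have "\<dots> = - \<gamma> * energy T f - ln Z"
      unfolding energy_def using integrable_energy[OF bT bf] integrable_bdd_density[OF bT] T1 by simp
    finally show ?thesis by (simp add: energy_commute[OF bT bf])
  qed
  \<comment> \<open>The slope at t = 0 of an upper bound for the functional along (1 - t) f + t T: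
    the quadratic energy is differentiated and the entropy is replaced by its chord.\<close>
  define A where "A = \<gamma> * (energy f T - energy f f) + entropy T - entropy f"
  have "0 \<le> A"
  proof (rule nonneg_if_nonneg_perturbed)
    fix t :: real assume t: "0 < t" "t \<le> 1"
    have "functional f \<le> functional (\<lambda>x. (1 - t) * f x + t * T x)"
      by (intro fmin admissible_lincomb f T) (use t in auto)
    also have "\<dots> \<le> \<gamma> / 2 * ((1 - t)\<^sup>2 * energy f f + 2 * (1 - t) * t * energy f T + t\<^sup>2 * energy T T)
        + ((1 - t) * entropy f + t * entropy T)"
      unfolding functional_def energy_lincomb[OF bf bT]
      using t by (intro add_mono order_refl entropy_convex[OF f T]) auto
    finally have "0 \<le> t * (A + t * (\<gamma> / 2 * (energy f f - 2 * energy f T + energy T T)))"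
      unfolding functional_def A_def by (simp add: algebra_simps power2_eq_square)
    then show "0 \<le> A + t * (\<gamma> / 2 * (energy f f - 2 * energy f T + energy T T))"
      using t by (simp add: zero_le_mult_iff)
  qed
  \<comment> \<open>The left side is the entropy of f relative to T.\<close>
  then have A: "entropy f + \<gamma> * energy f f + ln Z \<le> 0" by (simp add: A_def HT algebra_simps)
  have flnfT: "f x * ln (f x / T x) - f x + T x
    = f x * ln (f x) + \<gamma> * (f x * pot f x) + ln Z * f x - f x + T x" for x
  proof -
    have "f x * ln (f x / T x) = f x * ln (f x) - f x * ln (T x)"
      using T_pos[of x] bdd_densityD(2)[OF bf, of x] by (cases "f x = 0") (auto simp: ln_div algebra_simps)
    then show ?thesis by (simp add: lnT algebra_simps)
  qed
  have i1: "integrable (nu \<gamma>) (\<lambda>x. f x * ln (f x / T x) - f x + T x)"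
    unfolding flnfT using integrable_entropy[OF bf] integrable_energy[OF bf bf] integrable_bdd_density[OF bf]
      integrable_bdd_density[OF bT] by simp
  have ge: "(sqrt (f x) - sqrt (T x))\<^sup>2 \<le> f x * ln (f x / T x) - f x + T x" for x
    by (rule entropy_hellinger_le) (use bdd_densityD(2)[OF bf] T_pos in auto)
  have i2: "integrable (nu \<gamma>) (\<lambda>x. (sqrt (f x) - sqrt (T x))\<^sup>2)"
    by (rule Bochner_Integration.integrable_bound[OF i1]) (auto intro!: AE_I2 order_trans[OF ge])
  have "(\<integral>x. (sqrt (f x) - sqrt (T x))\<^sup>2 \<partial>nu \<gamma>) \<le> (\<integral>x. f x * ln (f x / T x) - f x + T x \<partial>nu \<gamma>)"
    by (intro integral_mono i1 i2 ge)
  also have "\<dots> = entropy f + \<gamma> * energy f f + ln Z - 1 + 1"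
    unfolding flnfT entropy_def energy_def
    using integrable_entropy[OF bf] integrable_energy[OF bf bf] integrable_bdd_density[OF bf]
      integrable_bdd_density[OF bT] T1 admissibleD(2)[OF f] by simp
  finally have "(\<integral>x. (sqrt (f x) - sqrt (T x))\<^sup>2 \<partial>nu \<gamma>) \<le> 0" using A by simp
  then have "(\<integral>x. (sqrt (f x) - sqrt (T x))\<^sup>2 \<partial>nu \<gamma>) = 0"
    by (intro antisym Bochner_Integration.integral_nonneg) auto
  then have "AE x in nu \<gamma>. (sqrt (f x) - sqrt (T x))\<^sup>2 = 0"
    using i2 by (subst (asm) integral_nonneg_eq_0_iff_AE) auto
  then have ae: "AE x in nu \<gamma>. f x = T x" by eventually_elim auto
  \<comment> \<open>Equality almost everywhere makes the potentials agree at every point. So T,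
    which is given by a formula in \<open>pot f\<close>, solves the equation pointwise.\<close>
  have "pot f x = pot T x" for x
    unfolding pot_def by (intro integral_cong_AE, measurable) (use ae in eventually_elim, auto)
  then have "T x = tilt T x" for x unfolding T_def by (simp add: tilt_def)
  then show ?thesis using T by (intro that[of M T])
qed

end

section \<open>The equilibrium measure\<close>

lemma e2ennreal_log_kernel_tilde:
  assumes "x \<noteq> z"
  shows "e2ennreal (log_kernel_tilde x z) = ennreal (kt 0 x z)"
proof -
  have "log_kernel_tilde x z = ereal (kt 0 x z)"
    using assms by (simp add: log_kernel_tilde_def log_kernel_def kt_def ln_inverse abs_minus_commute)
  then show ?thesis by simp
qed

lemma log_energy_eq:
  assumes "sets \<mu> = sets borel" "\<And>x. emeasure \<mu> {x} = 0"
  shows "log_energy \<mu> = (\<integral>\<^sup>+x. (\<integral>\<^sup>+z. ennreal (kt 0 x z) \<partial>\<mu>) \<partial>\<mu>)"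
  unfolding log_energy_def
proof (rule nn_integral_cong, rule nn_integral_cong_AE)
  fix x
  have "{x} \<in> null_sets \<mu>" using assms by (auto simp: null_sets_def)
  then have "AE z in \<mu>. z \<notin> {x}" by (rule AE_not_in)
  then show "AE z in \<mu>. e2ennreal (log_kernel_tilde x z) = ennreal (kt 0 x z)"
    by eventually_elim (rule e2ennreal_log_kernel_tilde, auto)
qed

section \<open>Minimality and uniqueness among all Borel probability measures\<close>

context high_temperature
begin

lemma relative_entropy_density:
  assumes [measurable]: "r \<in> borel_measurable borel" and r: "\<And>x. 0 \<le> r x"
  shows "relative_entropy (density (nu \<gamma>) (\<lambda>x. ennreal (r x))) (nu \<gamma>)
    = enn2ereal (\<integral>\<^sup>+x. ennreal (r x * ln (r x)) \<partial>nu \<gamma>) - enn2ereal (\<integral>\<^sup>+x. ennreal (- (r x * ln (r x))) \<partial>nu \<gamma>)"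
proof -
  let ?D = "density (nu \<gamma>) (\<lambda>x. ennreal (r x))"
  have ac: "absolutely_continuous (nu \<gamma>) ?D" by (intro absolutely_continuousI_density) measurable
  have ae: "AE x in nu \<gamma>. ennreal (r x) = RN_deriv (nu \<gamma>) ?D x"
    by (rule nu.RN_deriv_unique) auto
  have *: "(\<integral>\<^sup>+x. ennreal (c * ln (enn2real (RN_deriv (nu \<gamma>) ?D x))) \<partial>?D) = (\<integral>\<^sup>+x. ennreal (c * (r x * ln (r x))) \<partial>nu \<gamma>)" for c
  proof -
    have "(\<integral>\<^sup>+x. ennreal (c * ln (enn2real (RN_deriv (nu \<gamma>) ?D x))) \<partial>?D)
      = (\<integral>\<^sup>+x. ennreal (r x) * ennreal (c * ln (enn2real (RN_deriv (nu \<gamma>) ?D x))) \<partial>nu \<gamma>)"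
      by (rule nn_integral_density) measurable
    also have "\<dots> = (\<integral>\<^sup>+x. ennreal (c * (r x * ln (r x))) \<partial>nu \<gamma>)"
    proof (rule nn_integral_cong_AE)
      show "AE x in nu \<gamma>. ennreal (r x) * ennreal (c * ln (enn2real (RN_deriv (nu \<gamma>) ?D x))) = ennreal (c * (r x * ln (r x)))"
        using ae
      proof eventually_elim
        case (elim x)
        then have "enn2real (RN_deriv (nu \<gamma>) ?D x) = r x" using r[of x] by (metis enn2real_ennreal)
        then show ?case using r[of x] by (simp add: ennreal_mult'[symmetric] mult.left_commute)
      qed
    qed
    finally show ?thesis .
  qed
  show ?thesis
    unfolding relative_entropy_def using ac *[of 1] *[of "-1"] by simp
qed

text \<open>From t ln t \<ge> t - 1 \<ge> -1. The negative part being finite, the difference in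
  \<open>relative_entropy\<close> is never infinity minus infinity.\<close>

lemma nn_integral_neg_xlnx_le:
  assumes "\<And>x. 0 \<le> r x"
  shows "(\<integral>\<^sup>+x. ennreal (- (r x * ln (r x))) \<partial>nu \<gamma>) \<le> 1"
proof -
  have "- (r x * ln (r x)) \<le> 1" for x
    using order_trans[OF zero_le_power2 entropy_hellinger_le[of "r x" 1]] assms[of x] by (simp add: algebra_simps)
  then have "(\<integral>\<^sup>+x. ennreal (- (r x * ln (r x))) \<partial>nu \<gamma>) \<le> (\<integral>\<^sup>+x. ennreal 1 \<partial>nu \<gamma>)"
    by (intro nn_integral_mono ennreal_leI)
  then show ?thesis using nu.emeasure_space_1 by simp
qed

lemma relative_entropy_density_integrable:
  assumes [measurable]: "r \<in> borel_measurable borel" and r: "\<And>x. 0 \<le> r x"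
    and int: "integrable (nu \<gamma>) (\<lambda>x. r x * ln (r x))"
  shows "relative_entropy (density (nu \<gamma>) (\<lambda>x. ennreal (r x))) (nu \<gamma>) = ereal (\<integral>x. r x * ln (r x) \<partial>nu \<gamma>)"
proof -
  define p where "p = (\<integral>\<^sup>+x. ennreal (r x * ln (r x)) \<partial>nu \<gamma>)"
  define q where "q = (\<integral>\<^sup>+x. ennreal (- (r x * ln (r x))) \<partial>nu \<gamma>)"
  have fin: "p \<noteq> \<infinity>" "q \<noteq> \<infinity>" using int by (auto simp: real_integrable_def p_def q_def)
  then obtain p' q' where pq: "p = ennreal p'" "0 \<le> p'" "q = ennreal q'" "0 \<le> q'"
    by (cases p; cases q) auto
  have "(\<integral>x. r x * ln (r x) \<partial>nu \<gamma>) = enn2real p - enn2real q"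
    unfolding p_def q_def by (rule real_lebesgue_integral_def[OF int])
  then show ?thesis
    unfolding relative_entropy_density[OF assms(1,2)] p_def[symmetric] q_def[symmetric] using pq by simp
qed

context
  fixes M T Z
  assumes T: "admissible M T" and tilt: "\<And>x. T x = tilt T x"
  defines "Z \<equiv> \<integral>x. exp (- \<gamma> * pot T x) \<partial>nu \<gamma>"
begin

lemma tilt_norm_pos: "0 < Z"
  unfolding Z_def using tilt_norm_bound(2)[OF T] exp_gt_zero less_le_trans by blast

lemma T_eq: "T x = exp (- \<gamma> * pot T x) / Z"
  using tilt[of x] by (simp add: tilt_def Z_def)

lemma T_pos: "0 < T x"
  using tilt_norm_pos by (subst T_eq) simp

lemma T_measurable [measurable]: "T \<in> borel_measurable borel" "pot T \<in> borel_measurable borel"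
  using bdd_densityD(1)[OF admissibleD(1)[OF T]] pot_measurable[OF admissibleD(1)[OF T]] by auto

lemma ln_T: "ln (T x) = - \<gamma> * pot T x - ln Z"
  using tilt_norm_pos by (subst T_eq) (simp add: ln_div)

lemma entropy_T: "entropy T = - \<gamma> * energy T T - ln Z"
proof -
  note bT = admissibleD(1)[OF T]
  have "entropy T = (\<integral>x. - \<gamma> * (T x * pot T x) - ln Z * T x \<partial>nu \<gamma>)"
    unfolding entropy_def ln_T by (intro Bochner_Integration.integral_cong) (auto simp: algebra_simps)
  also have "\<dots> = - \<gamma> * energy T T - ln Z"
    unfolding energy_def using integrable_energy[OF bT bT] integrable_bdd_density[OF bT] admissibleD(2)[OF T] by simp
  finally show ?thesis .
qed

abbreviation "\<mu> \<equiv> density (nu \<gamma>) (\<lambda>x. ennreal (T x))"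

lemma mu_borel_prob: "\<mu> \<in> borel_prob_measures"
  using prob_space_density_nu[OF admissibleD[OF T]] by (simp add: borel_prob_measures_def)

lemma free_energy_mu: "free_energy \<gamma> \<mu> = ereal (\<gamma> / 2 * energy T T + entropy T)"
proof -
  note bT = admissibleD(1)[OF T]
  have "log_energy \<mu> = ennreal (energy T T)"
    using nn_integral_energy[OF bT bT] density_nu_singleton[of "\<lambda>x. ennreal (T x)"] by (subst log_energy_eq) auto
  moreover have "relative_entropy \<mu> (nu \<gamma>) = ereal (entropy T)"
    unfolding entropy_def using integrable_entropy[OF bT] T_pos by (intro relative_entropy_density_integrable) (auto intro: less_imp_le)
  ultimately show ?thesis
    unfolding free_energy_def using energy_nonneg[OF bT bT] by simp
qed

text \<open>By the Euler--Lagrange equation \<open>F(\<mu>') - F(\<mu>)\<close> is the relative entropy of \<open>\<mu>'\<close> with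
  respect to \<open>\<mu>\<close> plus a multiple of the (nonnegative) logarithmic energy of \<open>\<mu>' - \<mu>\<close>.\<close>

lemma free_energy_mu_less:
  assumes mu': "\<mu>' \<in> borel_prob_measures" and fin: "free_energy \<gamma> \<mu>' \<noteq> \<infinity>"
  obtains r where "r \<in> borel_measurable borel" "\<And>x. 0 \<le> r x" "\<mu>' = density (nu \<gamma>) (\<lambda>x. ennreal (r x))"
    "integrable (nu \<gamma>) (\<lambda>x. (sqrt (r x) - sqrt (T x))\<^sup>2)"
    "free_energy \<gamma> \<mu> + ereal (\<integral>x. (sqrt (r x) - sqrt (T x))\<^sup>2 \<partial>nu \<gamma>) \<le> free_energy \<gamma> \<mu>'"
proof -
  note bT = admissibleD(1)[OF T]
  have pm: "prob_space \<mu>'" and sm: "sets \<mu>' = sets borel" using mu' by (auto simp: borel_prob_measures_def)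
  interpret mu': prob_space \<mu>' by fact
  have ac: "absolutely_continuous (nu \<gamma>) \<mu>'"
  proof (rule ccontr)
    assume "\<not> ?thesis"
    then show False using fin by (simp add: free_energy_def relative_entropy_def)
  qed
  define r where "r = (\<lambda>x. enn2real (RN_deriv (nu \<gamma>) \<mu>' x))"
  have [measurable]: "r \<in> borel_measurable borel"
    using borel_measurable_RN_deriv[of "nu \<gamma>" \<mu>'] unfolding r_def by simp
  have r0: "0 \<le> r x" for x by (simp add: r_def)
  have "AE x in nu \<gamma>. RN_deriv (nu \<gamma>) \<mu>' x \<noteq> \<infinity>"
    by (rule nu.RN_deriv_finite) (use ac sm in \<open>auto intro: mu'.sigma_finite_measure_axioms\<close>)
  then have "AE x in nu \<gamma>. RN_deriv (nu \<gamma>) \<mu>' x = ennreal (r x)"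
    by eventually_elim (auto simp: r_def less_top)
  then have "density (nu \<gamma>) (RN_deriv (nu \<gamma>) \<mu>') = density (nu \<gamma>) (\<lambda>x. ennreal (r x))"
    by (intro density_cong) auto
  then have mu_eq: "\<mu>' = density (nu \<gamma>) (\<lambda>x. ennreal (r x))"
    using nu.density_RN_deriv[OF ac] sm by simp
  have "(\<integral>\<^sup>+x. ennreal (r x) \<partial>nu \<gamma>) = emeasure \<mu>' UNIV"
    unfolding mu_eq by (simp add: emeasure_density)
  also have "\<dots> = 1" using mu'.emeasure_space_1 sets_eq_imp_space_eq[OF sm] by simp
  finally have r1: "(\<integral>\<^sup>+x. ennreal (r x) \<partial>nu \<gamma>) = 1" .
  have ir: "integrable (nu \<gamma>) r"
    using r1 r0 by (intro integrableI_nonneg) auto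
  have r1': "(\<integral>x. r x \<partial>nu \<gamma>) = 1"
    using r1 r0 by (subst integral_eq_nn_integral) auto
  define p where "p = (\<integral>\<^sup>+x. ennreal (r x * ln (r x)) \<partial>nu \<gamma>)"
  define q where "q = (\<integral>\<^sup>+x. ennreal (- (r x * ln (r x))) \<partial>nu \<gamma>)"
  have "q \<le> 1" unfolding q_def by (rule nn_integral_neg_xlnx_le) (rule r0)
  then obtain q' where q': "q = ennreal q'" "0 \<le> q'" by (cases q) (auto simp: top_unique)
  have re: "relative_entropy \<mu>' (nu \<gamma>) = enn2ereal p - enn2ereal q"
    unfolding mu_eq p_def q_def by (rule relative_entropy_density) (auto simp: r0)
  have "p \<noteq> \<infinity>"
  proof
    assume "p = \<infinity>"
    then have "relative_entropy \<mu>' (nu \<gamma>) = \<infinity>" unfolding re using q' by simp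
    then show False using fin by (simp add: free_energy_def)
  qed
  then have il: "integrable (nu \<gamma>) (\<lambda>x. r x * ln (r x))"
    using q' by (auto simp: real_integrable_def p_def[symmetric] q_def[symmetric])
  define H where "H = (\<integral>x. r x * ln (r x) \<partial>nu \<gamma>)"
  have re': "relative_entropy \<mu>' (nu \<gamma>) = ereal H"
    unfolding mu_eq H_def by (rule relative_entropy_density_integrable) (auto simp: r0 il)
  \<comment> \<open>Finite entropy yields a finite first moment, by Young's inequality against exp
    |x|, which is integrable under \<open>nu\<close>. The positive definiteness of the kernel rests
    on this moment.\<close>
  have irx: "integrable (nu \<gamma>) (\<lambda>x. \<bar>x\<bar> * r x)"
  proof (rule Bochner_Integration.integrable_bound)
    show "integrable (nu \<gamma>) (\<lambda>x. \<bar>r x * ln (r x)\<bar> + exp \<bar>x\<bar>)"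
      using il integrable_nu_exp_abs by auto
    have "\<bar>x\<bar> * r x \<le> \<bar>r x * ln (r x)\<bar> + exp \<bar>x\<bar>" for x
    proof -
      have "0 \<le> r x * ln (r x / exp \<bar>x\<bar>) - r x + exp \<bar>x\<bar>"
        by (rule order_trans[OF zero_le_power2 entropy_hellinger_le]) (use r0 in auto)
      moreover have "r x * ln (r x / exp \<bar>x\<bar>) = r x * ln (r x) - \<bar>x\<bar> * r x"
        using r0[of x] by (cases "r x = 0") (auto simp: ln_div algebra_simps)
      ultimately show ?thesis using r0[of x] by linarith
    qed
    then show "AE x in nu \<gamma>. norm (\<bar>x\<bar> * r x) \<le> norm (\<bar>r x * ln (r x)\<bar> + exp \<bar>x\<bar>)"
      using r0 by (intro AE_I2) (auto simp: abs_mult intro: order_trans[OF _ abs_ge_self])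
  qed measurable
  have irp: "integrable (nu \<gamma>) (\<lambda>x. r x * pot T x)"
  proof (rule Bochner_Integration.integrable_bound)
    show "integrable (nu \<gamma>) (\<lambda>x. M * kt_const * r x + M * (\<bar>x\<bar> * r x))" using ir irx by auto
    have "r x * pot T x \<le> M * kt_const * r x + M * (\<bar>x\<bar> * r x)" for x
    proof -
      have "pot T x \<le> M * (kt_const + theta x)" by (rule pot_bounds(2)[OF bT])
      also have "\<dots> \<le> M * (kt_const + \<bar>x\<bar>)"
        using bdd_densityD(4)[OF bT] theta_le_abs[of x] by (intro mult_left_mono) auto
      finally have "r x * pot T x \<le> r x * (M * (kt_const + \<bar>x\<bar>))" by (intro mult_left_mono r0)
      then show ?thesis by (simp add: algebra_simps)
    qed
    then show "AE x in nu \<gamma>. norm (r x * pot T x) \<le> norm (M * kt_const * r x + M * (\<bar>x\<bar> * r x))"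
      using r0 pot_bounds(1)[OF bT] by (intro AE_I2) (auto simp: abs_mult intro: order_trans[OF _ abs_ge_self])
  qed measurable
  define X where "X = (\<integral>x. r x * pot T x \<partial>nu \<gamma>)"
  have X0: "0 \<le> X" unfolding X_def using r0 pot_bounds(1)[OF bT] by (intro Bochner_Integration.integral_nonneg) auto
  define E where "E = log_energy \<mu>'"
  have sing: "emeasure \<mu>' {x} = 0" for x unfolding mu_eq by (rule density_nu_singleton) measurable
  have Eeq: "E = (\<integral>\<^sup>+x. (\<integral>\<^sup>+z. ennreal (kt 0 x z) \<partial>\<mu>') \<partial>\<mu>')"
    unfolding E_def by (rule log_energy_eq[OF sm sing])
  have Xeq: "(\<integral>\<^sup>+x. (\<integral>\<^sup>+y. ennreal (kt 0 x y) \<partial>\<mu>) \<partial>\<mu>') = ennreal X"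
  proof -
    have "(\<integral>\<^sup>+x. (\<integral>\<^sup>+y. ennreal (kt 0 x y) \<partial>\<mu>) \<partial>\<mu>') = (\<integral>\<^sup>+x. ennreal (pot T x) \<partial>\<mu>')"
      by (simp add: nn_integral_pot[OF bT])
    also have "\<dots> = (\<integral>\<^sup>+x. ennreal (r x * pot T x) \<partial>nu \<gamma>)"
      unfolding mu_eq using r0 pot_bounds(1)[OF bT] by (subst nn_integral_density) (auto simp: ennreal_mult)
    also have "\<dots> = ennreal X"
      unfolding X_def using r0 pot_bounds(1)[OF bT] by (intro nn_integral_eq_integral irp) auto
    finally show ?thesis .
  qed
  have first_moment: "(\<integral>\<^sup>+x. ennreal \<bar>x\<bar> \<partial>\<mu>') < \<infinity>"
  proof -
    have "(\<integral>\<^sup>+x. ennreal \<bar>x\<bar> \<partial>\<mu>') = (\<integral>\<^sup>+x. ennreal (\<bar>x\<bar> * r x) \<partial>nu \<gamma>)"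
      unfolding mu_eq using r0 by (subst nn_integral_density) (auto simp: ennreal_mult mult.commute)
    also have "\<dots> = ennreal (\<integral>x. \<bar>x\<bar> * r x \<partial>nu \<gamma>)" using r0 by (intro nn_integral_eq_integral irx) auto
    finally show ?thesis by simp
  qed
  have psd: "2 * ennreal X \<le> E + ennreal (energy T T)"
    unfolding Xeq[symmetric] Eeq nn_integral_energy[OF bT bT, symmetric]
  proof (rule kt_energy_psd[OF pm sm first_moment prob_space_density_nu[OF admissibleD[OF T]] _ density_nu_abs_finite[OF bT]])
    show "0 = (0::real) \<Longrightarrow> \<forall>x. emeasure \<mu>' {x} = 0 \<and> emeasure \<mu> {x} = 0"
      using sing by (auto intro!: density_nu_singleton)
  qed auto
  \<comment> \<open>The quadratic energy lies above its tangent at T. An infinite E makes this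
    trivial for \<gamma> > 0; for \<gamma> = 0 it rests on the convention that 0 times infinity is
    0.\<close>
  have low: "ereal (\<gamma> * X - \<gamma> / 2 * energy T T) \<le> ereal (\<gamma> / 2) * enn2ereal E"
  proof (cases "\<gamma> = 0")
    case False
    then have g: "0 < \<gamma>" using gamma_nonneg by simp
    show ?thesis
    proof (cases E)
      case (real e)
      have "ennreal (2 * X) \<le> ennreal (e + energy T T)"
        using psd X0 real energy_nonneg[OF bT bT] by (simp add: ennreal_mult)
      then have "2 * X \<le> e + energy T T"
        using real energy_nonneg[OF bT bT] by (subst (asm) ennreal_le_iff) auto
      then have "\<gamma> / 2 * (2 * X) \<le> \<gamma> / 2 * (e + energy T T)" using g by (intro mult_left_mono) auto
      then show ?thesis using real by (simp add: algebra_simps)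
    next
      case top
      then show ?thesis using g by simp
    qed
  next
    case True
    have z: "ereal (\<gamma> / 2) = 0" "ereal (\<gamma> * X - \<gamma> / 2 * energy T T) = 0"
      unfolding True zero_ereal_def by simp_all
    show ?thesis unfolding z by simp
  qed
  have flnfT: "r x * ln (r x / T x) - r x + T x
    = r x * ln (r x) + \<gamma> * (r x * pot T x) + ln Z * r x - r x + T x" for x
  proof -
    have "r x * ln (r x / T x) = r x * ln (r x) - r x * ln (T x)"
      using T_pos[of x] r0[of x] by (cases "r x = 0") (auto simp: ln_div algebra_simps)
    then show ?thesis by (simp add: ln_T algebra_simps)
  qed
  have i1: "integrable (nu \<gamma>) (\<lambda>x. r x * ln (r x / T x) - r x + T x)"
    unfolding flnfT using il irp ir integrable_bdd_density[OF bT] by simp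
  have ge: "(sqrt (r x) - sqrt (T x))\<^sup>2 \<le> r x * ln (r x / T x) - r x + T x" for x
    by (rule entropy_hellinger_le) (use r0 T_pos in auto)
  have i2: "integrable (nu \<gamma>) (\<lambda>x. (sqrt (r x) - sqrt (T x))\<^sup>2)"
    by (rule Bochner_Integration.integrable_bound[OF i1]) (auto intro!: AE_I2 order_trans[OF ge])
  have "(\<integral>x. (sqrt (r x) - sqrt (T x))\<^sup>2 \<partial>nu \<gamma>) \<le> (\<integral>x. r x * ln (r x / T x) - r x + T x \<partial>nu \<gamma>)"
    by (intro integral_mono i1 i2 ge)
  \<comment> \<open>Both densities have integral 1 and ln T = -\<gamma> pot T - ln Z, so this is the
    entropy of r relative to T.\<close>
  also have "\<dots> = H + \<gamma> * X + ln Z - 1 + 1"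
    unfolding flnfT H_def X_def
    using il irp ir integrable_bdd_density[OF bT] r1' admissibleD(2)[OF T] by simp
  finally have D: "(\<integral>x. (sqrt (r x) - sqrt (T x))\<^sup>2 \<partial>nu \<gamma>) \<le> H + \<gamma> * X + ln Z" by simp
  have "free_energy \<gamma> \<mu> + ereal (\<integral>x. (sqrt (r x) - sqrt (T x))\<^sup>2 \<partial>nu \<gamma>)
    \<le> ereal (\<gamma> * X - \<gamma> / 2 * energy T T) + ereal H"
    using D by (simp add: free_energy_mu entropy_T algebra_simps)
  also have "\<dots> \<le> ereal (\<gamma> / 2) * enn2ereal E + ereal H" by (intro add_right_mono low)
  also have "\<dots> = free_energy \<gamma> \<mu>'" by (simp add: free_energy_def E_def re')
  finally show ?thesis
    using r0 mu_eq i2 by (intro that[of r]) auto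
qed

text \<open>The definite description needs uniqueness: by \<open>free_energy_mu_less\<close> the
  density of a second minimizer is at Hellinger distance 0 from T, so the two measures
  coincide.\<close>

lemma equilibrium_measure_eq: "equilibrium_measure \<gamma> = \<mu>"
  unfolding equilibrium_measure_def
proof (rule the_equality)
  show "free_energy_minimizer \<gamma> \<mu>"
    unfolding free_energy_minimizer_def
  proof (intro conjI ballI mu_borel_prob)
    fix \<mu>' assume mu': "\<mu>' \<in> borel_prob_measures"
    show "free_energy \<gamma> \<mu> \<le> free_energy \<gamma> \<mu>'"
    proof (cases "free_energy \<gamma> \<mu>' = \<infinity>")
      case False
      obtain r where r: "free_energy \<gamma> \<mu> + ereal (\<integral>x. (sqrt (r x) - sqrt (T x))\<^sup>2 \<partial>nu \<gamma>) \<le> free_energy \<gamma> \<mu>'"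
        by (rule free_energy_mu_less[OF mu' False]) auto
      have "free_energy \<gamma> \<mu> + 0 \<le> free_energy \<gamma> \<mu> + ereal (\<integral>x. (sqrt (r x) - sqrt (T x))\<^sup>2 \<partial>nu \<gamma>)"
        by (intro add_left_mono) simp
      with r show ?thesis by simp
    qed simp
  qed
  fix \<mu>' assume min: "free_energy_minimizer \<gamma> \<mu>'"
  then have mu': "\<mu>' \<in> borel_prob_measures" and le: "free_energy \<gamma> \<mu>' \<le> free_energy \<gamma> \<mu>"
    using mu_borel_prob by (auto simp: free_energy_minimizer_def)
  have fin: "free_energy \<gamma> \<mu>' \<noteq> \<infinity>" using le by (auto simp: free_energy_mu)
  obtain r where [measurable]: "r \<in> borel_measurable borel" and r: "\<And>x. 0 \<le> r x" "\<mu>' = density (nu \<gamma>) (\<lambda>x. ennreal (r x))"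
    "integrable (nu \<gamma>) (\<lambda>x. (sqrt (r x) - sqrt (T x))\<^sup>2)"
    "free_energy \<gamma> \<mu> + ereal (\<integral>x. (sqrt (r x) - sqrt (T x))\<^sup>2 \<partial>nu \<gamma>) \<le> free_energy \<gamma> \<mu>'"
    by (rule free_energy_mu_less[OF mu' fin]) (rule that)
  have "(\<integral>x. (sqrt (r x) - sqrt (T x))\<^sup>2 \<partial>nu \<gamma>) \<le> 0"
    using order_trans[OF r(4) le] by (simp add: free_energy_mu)
  then have "(\<integral>x. (sqrt (r x) - sqrt (T x))\<^sup>2 \<partial>nu \<gamma>) = 0"
    by (intro antisym Bochner_Integration.integral_nonneg) auto
  then have "AE x in nu \<gamma>. (sqrt (r x) - sqrt (T x))\<^sup>2 = 0"
    using r(3) by (subst (asm) integral_nonneg_eq_0_iff_AE) auto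
  then have "AE x in nu \<gamma>. ennreal (r x) = ennreal (T x)" by eventually_elim auto
  then show "\<mu>' = \<mu>" unfolding r(2) by (intro density_cong) auto
qed

text \<open>Against a probability density the two \<open>theta\<close> terms of the kernel integrate
  to \<open>theta x\<close> and to the constant m; subtracting them from \<open>pot T\<close> leaves
  the plain logarithmic potential.\<close>

lemma log_potential_mu:
  defines "m \<equiv> \<integral>x. theta x * T x \<partial>nu \<gamma>"
  shows "integrable (nu \<gamma>) (\<lambda>z. ln \<bar>x - z\<bar> * T z)"
    "log_potential \<mu> x = pot T x - theta x - m"
    "(\<integral>z. ln \<bar>x - z\<bar> * T z \<partial>nu \<gamma>) = - log_potential \<mu> x"
proof -
  note bT = admissibleD(1)[OF T]
  have eq: "ln \<bar>x - z\<bar> * T z = theta x * T z + theta z * T z - kt 0 x z * T z" for z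
    by (simp add: kt_def algebra_simps)
  note ints = integrable_bdd_density[OF bT] integrable_bdd_density_mult[OF bT integrable_nu_theta] integrable_pot[OF bT, of x]
  show int: "integrable (nu \<gamma>) (\<lambda>z. ln \<bar>x - z\<bar> * T z)"
    unfolding eq using ints by simp
  have i: "(\<integral>z. ln \<bar>x - z\<bar> * T z \<partial>nu \<gamma>) = theta x + m - pot T x"
    unfolding eq using ints admissibleD(2)[OF T] by (simp add: m_def pot_def)
  have "log_potential \<mu> x = (\<integral>z. T z * ln (inverse \<bar>x - z\<bar>) \<partial>nu \<gamma>)"
    unfolding log_potential_def using T_pos by (subst integral_density) (auto intro: less_imp_le)
  also have "\<dots> = (\<integral>z. - (ln \<bar>x - z\<bar> * T z) \<partial>nu \<gamma>)"
    by (intro Bochner_Integration.integral_cong) (auto simp: ln_inverse)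
  also have "\<dots> = pot T x - theta x - m" using i by simp
  finally show 1: "log_potential \<mu> x = pot T x - theta x - m" .
  show "(\<integral>z. ln \<bar>x - z\<bar> * T z \<partial>nu \<gamma>) = - log_potential \<mu> x"
    unfolding 1 i by simp
qed

end

text \<open>These properties are all that the particle system needs from the variational problem. In
  the passage from \<open>nu\<close> to Lebesgue measure the factor exp (\<gamma> theta) of
  \<open>nu_weight\<close> cancels the \<open>theta\<close> term of \<open>pot T\<close>, and f
  having integral 1 identifies the remaining constant with \<open>L_const\<close>.\<close>

lemma equilibrium_density_exists:
  obtains U f C where
    "0 < L_const \<gamma>" "\<And>x. f x = exp (- \<gamma> * U x - x\<^sup>2) / L_const \<gamma>"
    "U \<in> borel_measurable borel" "integrable lborel f" "(\<integral>x. f x \<partial>lborel) = 1"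
    "0 < C" "\<And>x. f x \<le> C" "\<And>x. - (C + theta x) \<le> U x" "\<And>x. U x \<le> C * (1 + theta x)"
    "\<And>x. integrable lborel (\<lambda>z. ln \<bar>x - z\<bar> * f z)" "\<And>x. U x = - (\<integral>z. ln \<bar>x - z\<bar> * f z \<partial>lborel)"
    "integrable lborel (\<lambda>x. \<bar>x\<bar> * f x)"
proof -
  obtain M T where T: "admissible M T" and tilt: "\<And>x. T x = tilt T x"
    using Euler_Lagrange_exists by metis
  note bT = admissibleD(1)[OF T]
  define Z where "Z = (\<integral>x. exp (- \<gamma> * pot T x) \<partial>nu \<gamma>)"
  note Zpos = tilt_norm_pos[OF T tilt, folded Z_def] and Teq = T_eq[OF T tilt, folded Z_def]
  define m where "m = (\<integral>x. theta x * T x \<partial>nu \<gamma>)"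
  define U where "U = (\<lambda>x. pot T x - theta x - m)"
  define w where "w = (\<lambda>x. nu_weight \<gamma> x / nu_norm)"
  have w0: "0 \<le> w x" for x by (simp add: w_def)
  have [measurable]: "w \<in> borel_measurable borel" unfolding w_def by measurable
  define f where "f = (\<lambda>x. w x * T x)"
  \<comment> \<open>The factors are the normalizations of \<open>tilt\<close> and of
    \<open>nu\<close>, and the contribution of the constant m that separates \<open>pot T\<close>
    from U.\<close>
  define L where "L = Z * nu_norm * exp (\<gamma> * m)"
  have L: "0 < L" using Zpos nu_norm_pos by (simp add: L_def)
  note [measurable] = bdd_densityD(1)[OF bT] pot_measurable[OF bT]
  have feq: "f x = exp (- \<gamma> * U x - x\<^sup>2) / L" for x
  proof -
    have "f x = (exp (- x\<^sup>2 + \<gamma> * theta x) * exp (- \<gamma> * pot T x)) / (nu_norm * Z)"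
      unfolding f_def w_def nu_weight_def by (subst Teq) simp
    also have "exp (- x\<^sup>2 + \<gamma> * theta x) * exp (- \<gamma> * pot T x) = exp (- \<gamma> * U x - x\<^sup>2) / exp (\<gamma> * m)"
      by (simp add: exp_add[symmetric] exp_diff[symmetric] U_def algebra_simps)
    finally show ?thesis by (simp add: L_def mult_ac)
  qed
  have nuw: "nu \<gamma> = density lborel (\<lambda>x. ennreal (w x))" by (simp add: nu_eq w_def)
  have dens: "integrable lborel (\<lambda>x. w x * h x) \<longleftrightarrow> integrable (nu \<gamma>) h"
    "(\<integral>x. w x * h x \<partial>lborel) = (\<integral>x. h x \<partial>nu \<gamma>)" if "h \<in> borel_measurable borel" for h :: "real \<Rightarrow> real"
    using integrable_density[of h lborel w] integral_density[of h lborel w] that w0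
    unfolding nuw by auto
  have lp: "log_potential (density (nu \<gamma>) (\<lambda>x. ennreal (T x))) = U"
    using log_potential_mu(2)[OF T tilt] by (auto simp: U_def m_def)
  have if1: "integrable lborel f" "(\<integral>x. f x \<partial>lborel) = 1"
    unfolding f_def using dens[of T] integrable_bdd_density[OF bT] admissibleD(2)[OF T] by auto
  have LL: "L_const \<gamma> = L"
  proof -
    have "L_const \<gamma> = (\<integral>x. L * f x \<partial>lborel)"
      unfolding L_const_def equilibrium_measure_eq[OF T tilt] lp feq using L by simp
    then show ?thesis using if1 by simp
  qed
  define C where "C = 1 + exp (\<gamma>\<^sup>2 / 2) / nu_norm * M + \<bar>m\<bar> + M * kt_const + M"
  have M0: "0 \<le> M" by (rule bdd_densityD(4)[OF bT])
  have parts: "0 \<le> exp (\<gamma>\<^sup>2 / 2) / nu_norm * M" "0 \<le> M * kt_const"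
    using M0 nu_norm_pos kt_const(1) by auto
  show ?thesis
  proof (rule that[of f U C, unfolded LL])
    show "0 < L" "f x = exp (- \<gamma> * U x - x\<^sup>2) / L" for x by fact+
    show "U \<in> borel_measurable borel" unfolding U_def by measurable
    show "integrable lborel f" "(\<integral>x. f x \<partial>lborel) = 1" by fact+
    show "0 < C" unfolding C_def using M0 parts by linarith
    show "f x \<le> C" for x
    proof -
      have "w x \<le> exp (\<gamma>\<^sup>2 / 2) / nu_norm"
      proof -
        have "nu_weight \<gamma> x \<le> exp (\<gamma>\<^sup>2 / 2) * exp (- x\<^sup>2 / 2)" using nu_weight_bound[of 0 x] by simp
        also have "\<dots> \<le> exp (\<gamma>\<^sup>2 / 2) * 1" by (intro mult_left_mono) auto
        finally show ?thesis unfolding w_def using nu_norm_pos by (intro divide_right_mono) auto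
      qed
      then have "f x \<le> exp (\<gamma>\<^sup>2 / 2) / nu_norm * M"
        unfolding f_def using bdd_densityD(2,3)[OF bT, of x] nu_norm_pos by (intro mult_mono) auto
      then show ?thesis unfolding C_def using M0 parts by linarith
    qed
    show "- (C + theta x) \<le> U x" for x
      unfolding U_def C_def using pot_bounds(1)[OF bT, of x] M0 parts by linarith
    show "U x \<le> C * (1 + theta x)" for x
    proof -
      have "U x \<le> M * kt_const + M * theta x + \<bar>m\<bar>"
      proof -
        have "pot T x \<le> M * kt_const + M * theta x"
          using pot_bounds(2)[OF bT, of x] by (simp add: algebra_simps)
        then show ?thesis unfolding U_def using theta_nonneg[of x] by linarith
      qed
      also have "\<dots> \<le> C + C * theta x"
      proof -
        have "M \<le> C" "M * kt_const + \<bar>m\<bar> \<le> C" unfolding C_def using M0 parts by linarith+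
        moreover from \<open>M \<le> C\<close> have "M * theta x \<le> C * theta x" by (intro mult_right_mono) auto
        ultimately show ?thesis by linarith
      qed
      finally show ?thesis by (simp add: algebra_simps)
    qed
    have *: "(\<lambda>z. ln \<bar>x - z\<bar> * f z) = (\<lambda>z. w z * (ln \<bar>x - z\<bar> * T z))" for x
      by (simp add: f_def mult_ac)
    show "integrable lborel (\<lambda>z. ln \<bar>x - z\<bar> * f z)" for x
      unfolding * using dens(1)[of "\<lambda>z. ln \<bar>x - z\<bar> * T z"] log_potential_mu(1)[OF T tilt, of x] by simp
    show "U x = - (\<integral>z. ln \<bar>x - z\<bar> * f z \<partial>lborel)" for x
      unfolding * using dens(2)[of "\<lambda>z. ln \<bar>x - z\<bar> * T z"] log_potential_mu(3)[OF T tilt, of x] lp by simp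
    have **: "(\<lambda>x. \<bar>x\<bar> * f x) = (\<lambda>x. w x * (\<bar>x\<bar> * T x))" by (simp add: f_def mult_ac)
    show "integrable lborel (\<lambda>x. \<bar>x\<bar> * f x)"
      unfolding ** using dens(1)[of "\<lambda>x. \<bar>x\<bar> * T x"] integrable_bdd_density_mult[OF bT integrable_nu_abs] by simp
  qed
qed

end

section \<open>The Gaussian ensemble at fixed \<open>N\<close>\<close>

interpretation lborel_product: product_sigma_finite "\<lambda>_::nat. lborel :: real measure"
  by standard

abbreviation RN :: "nat \<Rightarrow> (nat \<Rightarrow> real) measure" where "RN \<equiv> lebesgue_RN"

text \<open>The terms with \<open>i = j\<close> vanish because \<open>ln 0 = 0\<close>.\<close>

definition pair_sum :: "nat \<Rightarrow> (nat \<Rightarrow> real) \<Rightarrow> real" where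
  "pair_sum n y = (\<Sum>i\<in>{1..n}. \<Sum>j\<in>{1..n}. ln \<bar>y i - y j\<bar>) / 2"

definition log_sum :: "nat \<Rightarrow> real \<Rightarrow> (nat \<Rightarrow> real) \<Rightarrow> real" where
  "log_sum n x y = (\<Sum>j\<in>{1..n}. ln \<bar>x - y j\<bar>)"

definition gauss_weight :: "real \<Rightarrow> nat \<Rightarrow> (nat \<Rightarrow> real) \<Rightarrow> real" where
  "gauss_weight b n y = exp (b * pair_sum n y - (\<Sum>j\<in>{1..n}. (y j)\<^sup>2))"

lemma pair_sum_0 [simp]: "pair_sum 0 y = 0"
  by (simp add: pair_sum_def)

lemma sum_upd_Suc: "(\<Sum>j\<in>{1..n}. h ((y(Suc n := x)) j)) = (\<Sum>j\<in>{1..n}. h (y j))"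
  by (intro sum.cong) auto

lemma pair_sum_Suc: "pair_sum (Suc n) y = pair_sum n y + log_sum n (y (Suc n)) y"
proof -
  have "(\<Sum>i\<in>{1..Suc n}. \<Sum>j\<in>{1..Suc n}. ln \<bar>y i - y j\<bar>)
    = (\<Sum>i\<in>{1..n}. (\<Sum>j\<in>{1..n}. ln \<bar>y i - y j\<bar>) + ln \<bar>y i - y (Suc n)\<bar>)
      + (\<Sum>j\<in>{1..n}. ln \<bar>y (Suc n) - y j\<bar>)"
    by simp
  also have "\<dots> = (\<Sum>i\<in>{1..n}. \<Sum>j\<in>{1..n}. ln \<bar>y i - y j\<bar>) + 2 * log_sum n (y (Suc n)) y"
    by (simp add: sum.distrib log_sum_def abs_minus_commute)
  finally show ?thesis by (simp add: pair_sum_def add_divide_distrib)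
qed

lemma pair_sum_upd: "pair_sum (Suc n) (y(Suc n := x)) = pair_sum n y + log_sum n x y"
proof -
  have "pair_sum n (y(Suc n := x)) = pair_sum n y"
    unfolding pair_sum_def by (intro arg_cong2[where f = "(/)"] sum.cong refl) auto
  moreover have "log_sum n x (y(Suc n := x)) = log_sum n x y"
    unfolding log_sum_def by (intro sum.cong) auto
  ultimately show ?thesis by (simp add: pair_sum_Suc)
qed

lemma gauss_weight_upd:
  "gauss_weight b (Suc n) (y(Suc n := x)) = gauss_weight b n y * exp (b * log_sum n x y - x\<^sup>2)"
proof -
  have "(\<Sum>j\<in>{1..Suc n}. ((y(Suc n := x)) j)\<^sup>2) = (\<Sum>j\<in>{1..n}. (y j)\<^sup>2) + x\<^sup>2"
    using sum_upd_Suc[of "\<lambda>z. z\<^sup>2" y n x] by simp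
  then show ?thesis
    unfolding gauss_weight_def pair_sum_upd by (simp add: exp_add[symmetric] algebra_simps)
qed

lemma gauss_weight_pos [simp]: "0 < gauss_weight b n y"
  by (simp add: gauss_weight_def)

lemma gauss_weight_nonneg [simp]: "0 \<le> gauss_weight b n y"
  by (simp add: less_imp_le)

lemma beta_weight_eq: "beta_weight (\<lambda>x. x\<^sup>2) b N = gauss_weight b N"
proof
  fix y
  have "(\<Sum>(i, j)\<in>{(i, j). 1 \<le> i \<and> i < j \<and> j \<le> N}. ln (inverse \<bar>y i - y j\<bar>)) = - pair_sum N y"
  proof (induction N)
    case 0
    have "{(i::nat, j). 1 \<le> i \<and> i < j \<and> j \<le> 0} = {}" by auto
    then show ?case by (simp only: sum.empty pair_sum_0 minus_zero)
  next
    case (Suc n)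
    have eq: "{(i, j). 1 \<le> i \<and> i < j \<and> j \<le> Suc n} = {(i, j). 1 \<le> i \<and> i < j \<and> j \<le> n} \<union> (\<lambda>i. (i, Suc n)) ` {1..n}"
      by (auto simp: image_iff)
    have fin: "finite {(i::nat, j). 1 \<le> i \<and> i < j \<and> j \<le> n}"
      by (rule finite_subset[of _ "{1..n} \<times> {1..n}"]) auto
    have "(\<Sum>(i, j)\<in>{(i, j). 1 \<le> i \<and> i < j \<and> j \<le> Suc n}. ln (inverse \<bar>y i - y j\<bar>))
      = - pair_sum n y + (\<Sum>i\<in>{1..n}. ln (inverse \<bar>y i - y (Suc n)\<bar>))"
      unfolding eq using fin Suc.IH
      by (subst sum.union_disjoint) (auto simp: sum.reindex inj_on_def)
    also have "\<dots> = - pair_sum (Suc n) y"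
      by (simp add: pair_sum_Suc log_sum_def ln_inverse sum_negf abs_minus_commute)
    finally show ?case .
  qed
  then show "beta_weight (\<lambda>x. x\<^sup>2) b N y = gauss_weight b N y"
    by (simp add: beta_weight_def gauss_weight_def)
qed

section \<open>Measurability, splitting off the last coordinate, integrability of the weight\<close>

lemma measurable_coord: "i \<in> {1..n} \<Longrightarrow> (\<lambda>y. y i) \<in> borel_measurable (RN n)"
  unfolding lebesgue_RN_def using measurable_component_singleton[of i "{1..n}" "\<lambda>_. lborel :: real measure"] by simp

lemma pair_sum_measurable [measurable]: "pair_sum n \<in> borel_measurable (RN n)"
proof -
  have "(\<lambda>y. ln \<bar>y i - y j\<bar>) \<in> borel_measurable (RN n)" if "i \<in> {1..n}" "j \<in> {1..n}" for i j
    using measurable_coord[OF that(1)] measurable_coord[OF that(2)] by measurable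
  then show ?thesis
    unfolding pair_sum_def[abs_def] by (intro borel_measurable_divide borel_measurable_sum) auto
qed

lemma sum_coord_measurable [measurable]:
  assumes [measurable]: "h \<in> borel_measurable borel"
  shows "(\<lambda>y. \<Sum>j\<in>{1..n}. h (y j) :: real) \<in> borel_measurable (RN n)"
proof (rule borel_measurable_sum)
  fix i assume "i \<in> {1..n}"
  note [measurable] = measurable_coord[OF this]
  show "(\<lambda>y. h (y i)) \<in> borel_measurable (RN n)" by measurable
qed

lemma prod_coord_measurable:
  assumes [measurable]: "h \<in> borel_measurable borel"
  shows "(\<lambda>y. \<Prod>j\<in>{1..n}. h (y j) :: ennreal) \<in> borel_measurable (RN n)"
proof (rule borel_measurable_prod_ennreal)
  fix i assume "i \<in> {1..n}"
  note [measurable] = measurable_coord[OF this]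
  show "(\<lambda>y. h (y i)) \<in> borel_measurable (RN n)" by measurable
qed

lemma log_sum_measurable_pair [measurable]:
  "case_prod (log_sum n) \<in> borel_measurable (borel \<Otimes>\<^sub>M RN n)"
proof -
  have "(\<lambda>p. ln \<bar>fst p - snd p j\<bar>) \<in> borel_measurable (borel \<Otimes>\<^sub>M RN n)" if "j \<in> {1..n}" for j
  proof -
    have [measurable]: "(\<lambda>p. snd p j) \<in> borel_measurable (borel \<Otimes>\<^sub>M RN n)"
      by (rule measurable_compose[OF measurable_snd measurable_coord[OF that]])
    show ?thesis by measurable
  qed
  then show ?thesis
    unfolding log_sum_def case_prod_beta by (intro borel_measurable_sum) auto
qed

lemma gauss_weight_measurable [measurable]: "gauss_weight b n \<in> borel_measurable (RN n)"
  unfolding gauss_weight_def[abs_def] by measurable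

lemma RN_Suc: "RN (Suc n) = PiM (insert (Suc n) {1..n}) (\<lambda>_. lborel)"
proof -
  have "{1..Suc n} = insert (Suc n) {1..n}" by auto
  then show ?thesis unfolding lebesgue_RN_def by simp
qed

lemma sigma_finite_RN: "sigma_finite_measure (RN n)"
  unfolding lebesgue_RN_def by (rule lborel_product.sigma_finite) simp

lemma upd_measurable_pair [measurable]:
  "(\<lambda>(x, y). y(Suc n := x)) \<in> measurable (borel \<Otimes>\<^sub>M RN n) (RN (Suc n))"
proof -
  have "(\<lambda>(f, y). f(Suc n := y)) \<in> measurable (PiM {1..n} (\<lambda>_. lborel) \<Otimes>\<^sub>M lborel) (PiM (insert (Suc n) {1..n}) (\<lambda>_. lborel :: real measure))"
    by (rule measurable_add_dim)
  then have "(\<lambda>(f, y). f(Suc n := y)) \<in> measurable (RN n \<Otimes>\<^sub>M borel) (RN (Suc n))"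
    unfolding RN_Suc unfolding lebesgue_RN_def by (simp cong: measurable_cong_sets)
  from measurable_compose[OF measurable_pair_swap' this] show ?thesis by (simp add: case_prod_beta')
qed

lemma upd_measurable [measurable]: "(\<lambda>y. y(Suc n := x)) \<in> measurable (RN n) (RN (Suc n))"
proof -
  have "(\<lambda>y. case (x, y) of (x, y) \<Rightarrow> y(Suc n := x)) \<in> measurable (RN n) (RN (Suc n))" by measurable
  then show ?thesis by simp
qed

lemma nn_integral_RN_Suc:
  assumes "F \<in> borel_measurable (RN (Suc n))"
  shows "(\<integral>\<^sup>+y. F y \<partial>RN (Suc n)) = (\<integral>\<^sup>+x. (\<integral>\<^sup>+y. F (y(Suc n := x)) \<partial>RN n) \<partial>lborel)"
    and "(\<integral>\<^sup>+y. F y \<partial>RN (Suc n)) = (\<integral>\<^sup>+y. (\<integral>\<^sup>+x. F (y(Suc n := x)) \<partial>lborel) \<partial>RN n)"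
  using assms unfolding RN_Suc unfolding lebesgue_RN_def
  by (auto intro!: lborel_product.product_nn_integral_insert_rev lborel_product.product_nn_integral_insert)

lemma nn_integral_RN_prod:
  assumes "h \<in> borel_measurable borel"
  shows "(\<integral>\<^sup>+y. (\<Prod>j\<in>{1..n}. h (y j)) \<partial>RN n) = (\<integral>\<^sup>+x. h x \<partial>lborel) ^ n"
  unfolding lebesgue_RN_def using assms by (subst lborel_product.product_nn_integral_prod) auto

lemma pair_sum_le: "pair_sum n y \<le> real n * (\<Sum>j\<in>{1..n}. theta (y j))"
proof -
  have "(\<Sum>i\<in>{1..n}. \<Sum>j\<in>{1..n}. ln \<bar>y i - y j\<bar>) \<le> (\<Sum>i\<in>{1..n}. \<Sum>j\<in>{1..n}. theta (y i) + theta (y j))"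
    by (intro sum_mono ln_abs_diff_le)
  also have "\<dots> = 2 * (real n * (\<Sum>j\<in>{1..n}. theta (y j)))"
    by (simp add: sum.distrib sum_distrib_left)
  finally show ?thesis by (simp add: pair_sum_def)
qed

lemma nn_integral_gauss_weight_finite:
  assumes "0 \<le> b"
  shows "(\<integral>\<^sup>+y. ennreal (gauss_weight b n y) \<partial>RN n) < \<infinity>"
proof -
  \<comment> \<open>With b n in the role of \<gamma>, \<open>pair_sum_le\<close> dominates the
    weight by an n-fold product of \<open>nu_weight\<close>, whose integrability is known.\<close>
  interpret high_temperature "b * real n" by standard (use assms in simp)
  have "(\<integral>\<^sup>+y. ennreal (gauss_weight b n y) \<partial>RN n) \<le> (\<integral>\<^sup>+y. (\<Prod>j\<in>{1..n}. ennreal (nu_weight (b * real n) (y j))) \<partial>RN n)"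
  proof (rule nn_integral_mono)
    fix y
    have "gauss_weight b n y \<le> exp (b * (real n * (\<Sum>j\<in>{1..n}. theta (y j))) - (\<Sum>j\<in>{1..n}. (y j)\<^sup>2))"
      unfolding gauss_weight_def using mult_left_mono[OF pair_sum_le assms] by simp
    also have "\<dots> = (\<Prod>j\<in>{1..n}. nu_weight (b * real n) (y j))"
      by (simp add: nu_weight_def exp_sum[symmetric] sum.distrib sum_negf sum_subtractf sum_distrib_left mult.assoc)
    finally show "ennreal (gauss_weight b n y) \<le> (\<Prod>j\<in>{1..n}. ennreal (nu_weight (b * real n) (y j)))"
      by (subst prod_ennreal) (auto intro: ennreal_leI less_imp_le)
  qed
  also have "\<dots> = (\<integral>\<^sup>+x. ennreal (nu_weight (b * real n) x) \<partial>lborel) ^ n"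
    by (rule nn_integral_RN_prod) measurable
  also have "\<dots> < \<infinity>"
  proof -
    have "(\<integral>\<^sup>+x. ennreal (nu_weight (b * real n) x) \<partial>lborel) = ennreal (\<integral>x. nu_weight (b * real n) x \<partial>lborel)"
      by (intro nn_integral_eq_integral integrable_nu_weight) (auto intro!: AE_I2 less_imp_le)
    then show ?thesis by (simp add: power_less_top_ennreal)
  qed
  finally show ?thesis .
qed

section \<open>The partition function and the law of the last particle\<close>

definition partition :: "real \<Rightarrow> nat \<Rightarrow> real" where
  "partition b n = (\<integral>y. gauss_weight b n y \<partial>RN n)"

definition ensemble :: "real \<Rightarrow> nat \<Rightarrow> (nat \<Rightarrow> real) measure" where
  "ensemble b n = density (RN n) (\<lambda>y. ennreal (gauss_weight b n y / partition b n))"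

lemma ensemble_eq_beta_ensemble: "beta_ensemble (\<lambda>x. x\<^sup>2) b n = ensemble b n"
  by (simp add: beta_ensemble_def ensemble_def beta_partition_def partition_def beta_weight_eq)

lemma sets_ensemble [simp, measurable_cong]: "sets (ensemble b n) = sets (RN n)"
  by (simp add: ensemble_def)

lemma space_ensemble [simp]: "space (ensemble b n) = space (RN n)"
  by (simp add: ensemble_def)

lemma nn_integral_gauss_weight:
  assumes "0 \<le> b"
  shows "(\<integral>\<^sup>+y. ennreal (gauss_weight b n y) \<partial>RN n) = ennreal (partition b n)"
  unfolding partition_def
  using nn_integral_gauss_weight_finite[OF assms]
  by (intro nn_integral_eq_integral integrableI_nonneg) (auto intro: less_imp_le)

lemma partition_pos:
  assumes "0 \<le> b"
  shows "0 < partition b n"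
proof -
  have "partition b n \<noteq> 0"
  proof
    assume "partition b n = 0"
    then have "(\<integral>\<^sup>+y. ennreal (gauss_weight b n y) \<partial>RN n) = 0"
      using nn_integral_gauss_weight[OF assms] by simp
    then have "AE y in RN n. ennreal (gauss_weight b n y) = 0"
      by (subst (asm) nn_integral_0_iff_AE) auto
    then have "AE y in RN n. False"
      by eventually_elim (metis gauss_weight_pos ennreal_eq_0_iff not_le)
    then have "emeasure (RN n) (space (RN n)) = 0"
      by (simp add: AE_iff_measurable[of "space (RN n)"])
    moreover have "space (RN n) = (\<Pi>\<^sub>E i\<in>{1..n}. UNIV)" by (simp add: lebesgue_RN_def space_PiM)
    moreover have "emeasure (RN n) (\<Pi>\<^sub>E i\<in>{1..n}. UNIV) = (\<Prod>i\<in>{1..n}. emeasure lborel (UNIV :: real set))"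
      unfolding lebesgue_RN_def by (rule lborel_product.emeasure_PiM) auto
    ultimately show False by (simp add: prod_zero_iff)
  qed
  moreover have "0 \<le> partition b n" unfolding partition_def
    by (intro Bochner_Integration.integral_nonneg) (simp add: less_imp_le)
  ultimately show ?thesis by simp
qed

lemma prob_space_ensemble:
  assumes "0 \<le> b"
  shows "prob_space (ensemble b n)"
proof
  have "emeasure (ensemble b n) (space (ensemble b n)) = (\<integral>\<^sup>+y. ennreal (gauss_weight b n y / partition b n) \<partial>RN n)"
    unfolding ensemble_def by (subst emeasure_density) (auto intro!: nn_integral_cong simp: indicator_def)
  also have "\<dots> = (\<integral>\<^sup>+y. ennreal (gauss_weight b n y) * ennreal (1 / partition b n) \<partial>RN n)"
    using partition_pos[OF assms, of n] by (intro nn_integral_cong) (simp add: ennreal_mult[symmetric] less_imp_le)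
  also have "\<dots> = ennreal (partition b n) * ennreal (1 / partition b n)"
    by (subst nn_integral_multc) (auto simp: nn_integral_gauss_weight[OF assms])
  also have "\<dots> = 1"
    using partition_pos[OF assms, of n] by (simp add: ennreal_mult[symmetric])
  finally show "emeasure (ensemble b n) (space (ensemble b n)) = 1" .
qed

lemma nn_integral_ensemble:
  assumes "0 \<le> b" and [measurable]: "F \<in> borel_measurable (RN n)"
  shows "(\<integral>\<^sup>+y. F y \<partial>ensemble b n) = (\<integral>\<^sup>+y. ennreal (gauss_weight b n y) * F y \<partial>RN n) * ennreal (1 / partition b n)"
proof -
  have "(\<integral>\<^sup>+y. F y \<partial>ensemble b n) = (\<integral>\<^sup>+y. ennreal (gauss_weight b n y / partition b n) * F y \<partial>RN n)"
    unfolding ensemble_def by (rule nn_integral_density) measurable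
  also have "\<dots> = (\<integral>\<^sup>+y. ennreal (gauss_weight b n y) * F y * ennreal (1 / partition b n) \<partial>RN n)"
    using partition_pos[OF assms(1), of n]
    by (intro nn_integral_cong) (simp add: divide_inverse ennreal_mult less_imp_le mult_ac)
  finally show ?thesis by (simp add: nn_integral_multc)
qed

text \<open>By \<open>gauss_weight_upd\<close> the weight is that of the first n coordinates times
  exp (b log_sum - x^2), so Fubini describes the last particle through the n-particle ensemble at
  the same b. The one-particle estimates below are read off from this identity.\<close>

lemma nn_integral_ensemble_Suc:
  assumes b: "0 \<le> b" and F[measurable]: "F \<in> borel_measurable (RN (Suc n))"
  shows "(\<integral>\<^sup>+y. F y \<partial>ensemble b (Suc n))
    = (\<integral>\<^sup>+x. ennreal (partition b n / partition b (Suc n) * exp (- x\<^sup>2))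
        * (\<integral>\<^sup>+y. ennreal (exp (b * log_sum n x y)) * F (y(Suc n := x)) \<partial>ensemble b n) \<partial>lborel)"
proof -
  interpret sigma_finite_measure "RN n" by (rule sigma_finite_RN)
  have p: "0 < partition b n" "0 < partition b (Suc n)" using partition_pos[OF b] by auto
  have [measurable]: "(\<lambda>p. F ((snd p)(Suc n := fst p))) \<in> borel_measurable (borel \<Otimes>\<^sub>M RN n)"
    using measurable_compose[OF upd_measurable_pair F] by (simp add: case_prod_beta')
  have [measurable]: "(\<lambda>y. F (y(Suc n := x))) \<in> borel_measurable (RN n)" for x
    by (rule measurable_compose[OF upd_measurable F])
  have [measurable]: "(\<lambda>p. log_sum n (fst p) (snd p)) \<in> borel_measurable (borel \<Otimes>\<^sub>M RN n)"
    using log_sum_measurable_pair[of n] by (simp add: case_prod_beta')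
  have "(\<integral>\<^sup>+y. F y \<partial>ensemble b (Suc n)) = (\<integral>\<^sup>+x. (\<integral>\<^sup>+y. ennreal (gauss_weight b (Suc n) (y(Suc n := x))) * F (y(Suc n := x)) \<partial>RN n) \<partial>lborel)
      * ennreal (1 / partition b (Suc n))"
    by (subst nn_integral_ensemble[OF b F], subst nn_integral_RN_Suc(1)) measurable
  also have "\<dots> = (\<integral>\<^sup>+x. (\<integral>\<^sup>+y. ennreal (gauss_weight b (Suc n) (y(Suc n := x))) * F (y(Suc n := x)) \<partial>RN n)
      * ennreal (1 / partition b (Suc n)) \<partial>lborel)"
    unfolding gauss_weight_upd by (subst nn_integral_multc) (simp_all add: case_prod_beta')
  also have "\<dots> = (\<integral>\<^sup>+x. ennreal (partition b n / partition b (Suc n) * exp (- x\<^sup>2))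
        * (\<integral>\<^sup>+y. ennreal (exp (b * log_sum n x y)) * F (y(Suc n := x)) \<partial>ensemble b n) \<partial>lborel)"
  proof (rule nn_integral_cong)
    fix x
    let ?I = "\<integral>\<^sup>+y. ennreal (gauss_weight b n y) * (ennreal (exp (b * log_sum n x y)) * F (y(Suc n := x))) \<partial>RN n"
    have "(\<integral>\<^sup>+y. ennreal (gauss_weight b (Suc n) (y(Suc n := x))) * F (y(Suc n := x)) \<partial>RN n)
      = (\<integral>\<^sup>+y. ennreal (exp (- x\<^sup>2)) * (ennreal (gauss_weight b n y) * (ennreal (exp (b * log_sum n x y)) * F (y(Suc n := x)))) \<partial>RN n)"
    proof (rule nn_integral_cong)
      fix y
      have "gauss_weight b (Suc n) (y(Suc n := x)) = exp (- x\<^sup>2) * (gauss_weight b n y * exp (b * log_sum n x y))"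
        unfolding gauss_weight_upd by (simp add: exp_diff exp_minus field_simps)
      then show "ennreal (gauss_weight b (Suc n) (y(Suc n := x))) * F (y(Suc n := x))
        = ennreal (exp (- x\<^sup>2)) * (ennreal (gauss_weight b n y) * (ennreal (exp (b * log_sum n x y)) * F (y(Suc n := x))))"
        by (simp add: ennreal_mult less_imp_le mult.assoc)
    qed
    also have "\<dots> = ennreal (exp (- x\<^sup>2)) * ?I" by (rule nn_integral_cmult) measurable
    finally have 1: "(\<integral>\<^sup>+y. ennreal (gauss_weight b (Suc n) (y(Suc n := x))) * F (y(Suc n := x)) \<partial>RN n) = ennreal (exp (- x\<^sup>2)) * ?I" .
    have 2: "(\<integral>\<^sup>+y. ennreal (exp (b * log_sum n x y)) * F (y(Suc n := x)) \<partial>ensemble b n) = ?I * ennreal (1 / partition b n)"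
      by (rule nn_integral_ensemble[OF b]) measurable
    have 3: "ennreal (1 / partition b (Suc n)) = ennreal (partition b n / partition b (Suc n)) * ennreal (1 / partition b n)"
      using p by (subst ennreal_mult[symmetric]) auto
    show "(\<integral>\<^sup>+y. ennreal (gauss_weight b (Suc n) (y(Suc n := x))) * F (y(Suc n := x)) \<partial>RN n) * ennreal (1 / partition b (Suc n))
      = ennreal (partition b n / partition b (Suc n) * exp (- x\<^sup>2))
        * (\<integral>\<^sup>+y. ennreal (exp (b * log_sum n x y)) * F (y(Suc n := x)) \<partial>ensemble b n)"
      unfolding 1 2 3 using p by (subst ennreal_mult) (auto simp: mult_ac)
  qed
  finally show ?thesis .
qed

section \<open>Exchangeability\<close>

lemma swap_measurable [measurable]:
  assumes "i \<in> {1..n}" "j \<in> {1..n}"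
  shows "(\<lambda>y. \<lambda>k\<in>{1..n}. y (Transposition.transpose i j k)) \<in> measurable (RN n) (RN n)"
  unfolding lebesgue_RN_def
  by (rule measurable_restrict)
    (use assms measurable_coord[of _ n, unfolded lebesgue_RN_def] in \<open>auto simp: Transposition.transpose_def\<close>)

text \<open>It suffices to compare the two measures on boxes, where permuting the factors leaves the
  product unchanged. The restriction to {1..n} keeps the permuted points extensional, as the product
  space demands.\<close>

lemma nn_integral_RN_swap:
  assumes ij: "i \<in> {1..n}" "j \<in> {1..n}" and F[measurable]: "F \<in> borel_measurable (RN n)"
  shows "(\<integral>\<^sup>+y. F (\<lambda>k\<in>{1..n}. y (Transposition.transpose i j k)) \<partial>RN n) = (\<integral>\<^sup>+y. F y \<partial>RN n)"
proof -
  let ?g = "\<lambda>y. \<lambda>k\<in>{1..n}. y (Transposition.transpose i j k)"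
  have g: "?g \<in> measurable (RN n) (RN n)" by (rule swap_measurable[OF ij])
  have bij: "bij_betw (Transposition.transpose i j) {1..n} {1..n}"
    using ij by (intro bij_betwI[where g = "Transposition.transpose i j"]) (auto simp: Transposition.transpose_def)
  have "distr (RN n) (RN n) ?g = PiM {1..n} (\<lambda>_. lborel)"
  proof (rule lborel_product.PiM_eqI)
    fix A :: "nat \<Rightarrow> real set" assume A: "\<And>k. k \<in> {1..n} \<Longrightarrow> A k \<in> sets lborel"
    have s: "Pi\<^sub>E {1..n} A \<in> sets (RN n)" unfolding lebesgue_RN_def using A by (intro sets_PiM_I_finite) auto
    have tij: "Transposition.transpose i j k \<in> {1..n}" if "k \<in> {1..n}" for k using that ij by (auto simp: Transposition.transpose_def)
    have "?g -` Pi\<^sub>E {1..n} A \<inter> space (RN n) = Pi\<^sub>E {1..n} (\<lambda>k. A (Transposition.transpose i j k))"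
    proof (rule set_eqI)
      fix y
      have "(\<forall>k\<in>{1..n}. y (Transposition.transpose i j k) \<in> A k) \<longleftrightarrow> (\<forall>k\<in>{1..n}. y k \<in> A (Transposition.transpose i j k))"
        using tij by (metis Transposition.transpose_involutory)
      then show "y \<in> ?g -` Pi\<^sub>E {1..n} A \<inter> space (RN n) \<longleftrightarrow> y \<in> Pi\<^sub>E {1..n} (\<lambda>k. A (Transposition.transpose i j k))"
        by (auto simp: lebesgue_RN_def space_PiM PiE_iff)
    qed
    then have "emeasure (distr (RN n) (RN n) ?g) (Pi\<^sub>E {1..n} A) = emeasure (RN n) (Pi\<^sub>E {1..n} (\<lambda>k. A (Transposition.transpose i j k)))"
      by (simp only: emeasure_distr[OF g s])
    also have "\<dots> = (\<Prod>k\<in>{1..n}. emeasure lborel (A (Transposition.transpose i j k)))"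
      unfolding lebesgue_RN_def using A tij by (intro lborel_product.emeasure_PiM) auto
    also have "\<dots> = (\<Prod>k\<in>{1..n}. emeasure lborel (A k))"
      by (rule prod.reindex_bij_betw[OF bij])
    finally show "emeasure (distr (RN n) (RN n) ?g) (Pi\<^sub>E {1..n} A) = (\<Prod>k\<in>{1..n}. emeasure lborel (A k))" .
  qed (auto simp: lebesgue_RN_def)
  then have "distr (RN n) (RN n) ?g = RN n" by (simp add: lebesgue_RN_def)
  then have "(\<integral>\<^sup>+y. F y \<partial>RN n) = (\<integral>\<^sup>+y. F y \<partial>distr (RN n) (RN n) ?g)" by simp
  also have "\<dots> = (\<integral>\<^sup>+y. F (?g y) \<partial>RN n)" using nn_integral_distr[OF g, of F] F by simp
  finally show ?thesis by simp
qed

lemma nn_integral_ensemble_swap: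
  assumes b: "0 \<le> b" and ij: "i \<in> {1..n}" "j \<in> {1..n}" and F[measurable]: "F \<in> borel_measurable (RN n)"
  shows "(\<integral>\<^sup>+y. F (\<lambda>k\<in>{1..n}. y (Transposition.transpose i j k)) \<partial>ensemble b n) = (\<integral>\<^sup>+y. F y \<partial>ensemble b n)"
proof -
  let ?g = "\<lambda>y. \<lambda>k\<in>{1..n}. y (Transposition.transpose i j k)"
  note [measurable] = swap_measurable[OF ij]
  have bij: "bij_betw (Transposition.transpose i j) {1..n} {1..n}"
    using ij by (intro bij_betwI[where g = "Transposition.transpose i j"]) (auto simp: Transposition.transpose_def)
  have w: "gauss_weight b n (?g y) = gauss_weight b n y" for y
  proof -
    have "(\<Sum>k\<in>{1..n}. (?g y k)\<^sup>2) = (\<Sum>k\<in>{1..n}. (y (Transposition.transpose i j k))\<^sup>2)" by (intro sum.cong) auto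
    also have "\<dots> = (\<Sum>k\<in>{1..n}. (y k)\<^sup>2)" by (rule sum.reindex_bij_betw[OF bij])
    finally have 1: "(\<Sum>k\<in>{1..n}. (?g y k)\<^sup>2) = (\<Sum>k\<in>{1..n}. (y k)\<^sup>2)" .
    have "pair_sum n (?g y) = (\<Sum>k\<in>{1..n}. \<Sum>l\<in>{1..n}. ln \<bar>y (Transposition.transpose i j k) - y (Transposition.transpose i j l)\<bar>) / 2"
      unfolding pair_sum_def by (intro arg_cong2[where f = "(/)"] sum.cong refl) auto
    also have "\<dots> = (\<Sum>k\<in>{1..n}. \<Sum>l\<in>{1..n}. ln \<bar>y (Transposition.transpose i j k) - y l\<bar>) / 2"
      using sum.reindex_bij_betw[OF bij, of "\<lambda>l. ln \<bar>y (Transposition.transpose i j k) - y l\<bar>" for k] by simp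
    also have "\<dots> = pair_sum n y"
      unfolding pair_sum_def
      using sum.reindex_bij_betw[OF bij, of "\<lambda>k. \<Sum>l\<in>{1..n}. ln \<bar>y k - y l\<bar>"] by simp
    finally show ?thesis using 1 by (simp add: gauss_weight_def)
  qed
  have "(\<integral>\<^sup>+y. ennreal (gauss_weight b n (?g y)) * F (?g y) \<partial>RN n) = (\<integral>\<^sup>+y. ennreal (gauss_weight b n y) * F y \<partial>RN n)"
    by (rule nn_integral_RN_swap[OF ij]) measurable
  then have "(\<integral>\<^sup>+y. ennreal (gauss_weight b n y) * F (?g y) \<partial>RN n) = (\<integral>\<^sup>+y. ennreal (gauss_weight b n y) * F y \<partial>RN n)"
    unfolding w .
  moreover have F': "(\<lambda>y. F (\<lambda>k\<in>{1..n}. y (Transposition.transpose i j k))) \<in> borel_measurable (RN n)"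
    by (rule measurable_compose[OF swap_measurable[OF ij] F])
  ultimately show ?thesis
    unfolding nn_integral_ensemble[OF b F'] nn_integral_ensemble[OF b F] by (simp only:)
qed

text \<open>Each coordinate contributes one factor c by the one-dimensional change of variables; the
  induction on the index set peels the coordinates off one by one.\<close>

lemma nn_integral_PiM_scale:
  fixes c :: real
  assumes c: "0 < c" and I: "finite (I :: nat set)"
    and F: "F \<in> borel_measurable (PiM I (\<lambda>_. lborel))"
  shows "(\<integral>\<^sup>+y. F y \<partial>PiM I (\<lambda>_. lborel)) = ennreal (c ^ card I) * (\<integral>\<^sup>+y. F (\<lambda>i\<in>I. c * y i) \<partial>PiM I (\<lambda>_. lborel))"
  using I F
proof (induction I arbitrary: F)
  case empty
  show ?case by (simp add: PiM_empty nn_integral_count_space_finite)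
next
  case (insert i I)
  note F[measurable] = insert.prems
  have [simp]: "finite I" by fact
  let ?L = "\<lambda>_::nat. lborel :: real measure"
  have m1: "(\<lambda>p. (fst p)(i := snd p)) \<in> measurable (PiM I ?L \<Otimes>\<^sub>M lborel) (PiM (insert i I) ?L)"
    using measurable_add_dim[of i I ?L] by (simp add: case_prod_beta')
  have m2[measurable]: "(\<lambda>p. F ((fst p)(i := snd p))) \<in> borel_measurable (PiM I ?L \<Otimes>\<^sub>M lborel)"
    by (rule measurable_compose[OF m1 F])
  have ms[measurable]: "(\<lambda>y. \<lambda>k\<in>J. c * y k) \<in> measurable (PiM J ?L) (PiM J ?L)" for J
  proof (rule measurable_restrict)
    fix k assume "k \<in> J"
    note [measurable] = measurable_component_singleton[OF this, of ?L, simplified]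
    show "(\<lambda>y. c * y k) \<in> measurable (PiM J ?L) lborel" by measurable
  qed
  define G where "G = (\<lambda>y. \<integral>\<^sup>+x. F (y(i := c * x)) \<partial>lborel)"
  have "(\<lambda>p. F ((fst p)(i := c * snd p))) \<in> borel_measurable (PiM I ?L \<Otimes>\<^sub>M lborel)"
    using measurable_compose[of "\<lambda>p. (fst p, c * snd p)" "PiM I ?L \<Otimes>\<^sub>M lborel" "PiM I ?L \<Otimes>\<^sub>M lborel", OF _ m2] by simp
  then have G: "G \<in> borel_measurable (PiM I ?L)" unfolding G_def by measurable
  have up: "(\<lambda>x. F (y(i := x))) \<in> borel_measurable borel" if "y \<in> space (PiM I ?L)" for y
    using measurable_compose[of "\<lambda>x. (y, x)" lborel "PiM I ?L \<Otimes>\<^sub>M lborel", OF _ m2] that by simp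
  have "(\<integral>\<^sup>+y. F y \<partial>PiM (insert i I) ?L) = (\<integral>\<^sup>+y. (\<integral>\<^sup>+x. F (y(i := x)) \<partial>lborel) \<partial>PiM I ?L)"
    using insert by (intro lborel_product.product_nn_integral_insert) auto
  also have "\<dots> = (\<integral>\<^sup>+y. ennreal c * G y \<partial>PiM I ?L)"
  proof (rule nn_integral_cong)
    fix y assume "y \<in> space (PiM I ?L)"
    from nn_integral_real_affine[OF up[OF this], of c 0] c
    show "(\<integral>\<^sup>+x. F (y(i := x)) \<partial>lborel) = ennreal c * G y" by (simp add: G_def)
  qed
  also have "\<dots> = ennreal c * (\<integral>\<^sup>+y. G y \<partial>PiM I ?L)" by (rule nn_integral_cmult[OF G])
  also have "(\<integral>\<^sup>+y. G y \<partial>PiM I ?L) = ennreal (c ^ card I) * (\<integral>\<^sup>+y. G (\<lambda>k\<in>I. c * y k) \<partial>PiM I ?L)"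
    by (rule insert.IH[OF G])
  also have "(\<integral>\<^sup>+y. G (\<lambda>k\<in>I. c * y k) \<partial>PiM I ?L) = (\<integral>\<^sup>+y. F (\<lambda>k\<in>insert i I. c * y k) \<partial>PiM (insert i I) ?L)"
  proof -
    have "(\<integral>\<^sup>+y. F (\<lambda>k\<in>insert i I. c * y k) \<partial>PiM (insert i I) ?L)
      = (\<integral>\<^sup>+y. (\<integral>\<^sup>+x. F (\<lambda>k\<in>insert i I. c * (y(i := x)) k) \<partial>lborel) \<partial>PiM I ?L)"
      using insert by (intro lborel_product.product_nn_integral_insert) auto
    also have "\<dots> = (\<integral>\<^sup>+y. G (\<lambda>k\<in>I. c * y k) \<partial>PiM I ?L)"
      unfolding G_def
    proof (intro nn_integral_cong arg_cong[where f = F])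
      fix y :: "nat \<Rightarrow> real" and x :: real
      show "(\<lambda>k\<in>insert i I. c * (y(i := x)) k) = (\<lambda>k\<in>I. c * y k)(i := c * x)"
        using insert by (auto simp: restrict_def)
    qed
    finally show ?thesis by simp
  qed
  moreover have "ennreal c * (ennreal (c ^ card I) * X) = ennreal (c ^ card (insert i I)) * X" for X
    using c insert.hyps by (simp add: ennreal_mult mult.assoc)
  ultimately show ?case by (simp only:)
qed

text \<open>Dilating the configuration shows that \<open>\<Sum> y\<^sub>j\<^sup>2\<close> is Gamma distributed under the ensemble;
  only the resulting bound on its exponential moments is needed.\<close>

lemma ensemble_exp_square_bound:
  assumes b: "0 \<le> b" and a: "0 \<le> a" "a \<le> 1 / 2"
  shows "(\<integral>\<^sup>+y. ennreal (exp (a * (\<Sum>j\<in>{1..n}. (y j)\<^sup>2))) \<partial>ensemble b n)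
    \<le> ennreal (exp (a * (real n + b * (real n)\<^sup>2 / 2)))"
proof -
  \<comment> \<open>Since (1 - a) c^2 = 1, this dilation turns exp (-(1 - a) sum y_j^2) back into
    exp (-sum y_j^2).\<close>
  define c where "c = 1 / sqrt (1 - a)"
  have c: "0 < c" "1 \<le> c" using a by (auto simp: c_def)
  have ca: "(1 - a) * c\<^sup>2 = 1" using a by (simp add: c_def power_divide)
  \<comment> \<open>From a \<le> 1/2 follows ln (1 / (1 - a)) \<le> 2 a, and ln c is half of the
    left side.\<close>
  have lnc: "0 \<le> ln c" "ln c \<le> a"
  proof -
    show "0 \<le> ln c" using c by simp
    have "ln (1 / (1 - a)) \<le> 1 / (1 - a) - 1" using a by (intro ln_le_minus_one) auto
    also have "\<dots> = a / (1 - a)" using a by (simp add: field_simps)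
    also have "\<dots> \<le> a / (1 / 2)" using a by (intro divide_left_mono) auto
    finally have "ln (1 / (1 - a)) \<le> 2 * a" by simp
    then show "ln c \<le> a" using a by (simp add: c_def ln_div ln_sqrt)
  qed
  let ?E = "exp (b * (real n * real n / 2) * ln c)"
  let ?F = "\<lambda>y. ennreal (gauss_weight b n y) * ennreal (exp (a * (\<Sum>j\<in>{1..n}. (y j)\<^sup>2)))"
  have mF: "?F \<in> borel_measurable (RN n)" by measurable
  have "(\<integral>\<^sup>+y. ?F y \<partial>RN n) = ennreal (c ^ n) * (\<integral>\<^sup>+y. ?F (\<lambda>i\<in>{1..n}. c * y i) \<partial>RN n)"
    using nn_integral_PiM_scale[OF c(1) finite_atLeastAtMost mF[unfolded lebesgue_RN_def]]
    unfolding lebesgue_RN_def[symmetric] by (simp only: card_atLeastAtMost diff_Suc_1 Suc_eq_plus1[symmetric])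
  also have "(\<integral>\<^sup>+y. ?F (\<lambda>i\<in>{1..n}. c * y i) \<partial>RN n) \<le> (\<integral>\<^sup>+y. ennreal ?E * ennreal (gauss_weight b n y) \<partial>RN n)"
  proof (rule nn_integral_mono)
    fix y
    let ?y = "\<lambda>i\<in>{1..n}. c * y i"
    \<comment> \<open>An inequality and not an equality: diagonal and coincident pairs have
      logarithm 0 before and after the dilation. The diagonal is counted all the same, hence n^2 / 2
      in place of n (n - 1) / 2.\<close>
    have "ln \<bar>?y i - ?y j\<bar> \<le> ln c + ln \<bar>y i - y j\<bar>" if "i \<in> {1..n}" "j \<in> {1..n}" for i j
    proof -
      have "?y i - ?y j = c * (y i - y j)" using that by (simp add: algebra_simps)
      then have *: "\<bar>?y i - ?y j\<bar> = c * \<bar>y i - y j\<bar>" using c by (simp add: abs_mult)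
      show ?thesis unfolding * using c lnc by (cases "y i = y j") (auto simp: ln_mult)
    qed
    then have "(\<Sum>i\<in>{1..n}. \<Sum>j\<in>{1..n}. ln \<bar>?y i - ?y j\<bar>) \<le> (\<Sum>i\<in>{1..n}. \<Sum>j\<in>{1..n}. ln c + ln \<bar>y i - y j\<bar>)"
      by (intro sum_mono) blast
    also have "\<dots> = real n * real n * ln c + (\<Sum>i\<in>{1..n}. \<Sum>j\<in>{1..n}. ln \<bar>y i - y j\<bar>)"
      by (simp add: sum.distrib)
    finally have "pair_sum n ?y \<le> real n * real n / 2 * ln c + pair_sum n y" by (simp add: pair_sum_def)
    then have "b * pair_sum n ?y \<le> b * (real n * real n / 2 * ln c + pair_sum n y)" using b by (rule mult_left_mono)
    moreover have "(a - 1) * (\<Sum>j\<in>{1..n}. (?y j)\<^sup>2) = - (\<Sum>j\<in>{1..n}. (y j)\<^sup>2)"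
    proof -
      have "(\<Sum>j\<in>{1..n}. (?y j)\<^sup>2) = (\<Sum>j\<in>{1..n}. c\<^sup>2 * (y j)\<^sup>2)" by (intro sum.cong) (auto simp: power_mult_distrib)
      also have "\<dots> = c\<^sup>2 * (\<Sum>j\<in>{1..n}. (y j)\<^sup>2)" by (simp add: sum_distrib_left)
      finally have "(a - 1) * (\<Sum>j\<in>{1..n}. (?y j)\<^sup>2) = - ((1 - a) * c\<^sup>2) * (\<Sum>j\<in>{1..n}. (y j)\<^sup>2)"
        by (simp add: algebra_simps)
      then show ?thesis unfolding ca by simp
    qed
    ultimately have "gauss_weight b n ?y * exp (a * (\<Sum>j\<in>{1..n}. (?y j)\<^sup>2)) \<le> ?E * gauss_weight b n y"
      unfolding gauss_weight_def exp_add[symmetric] by (simp add: algebra_simps)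
    then have "ennreal (gauss_weight b n ?y * exp (a * (\<Sum>j\<in>{1..n}. (?y j)\<^sup>2))) \<le> ennreal (?E * gauss_weight b n y)"
      by (rule ennreal_leI)
    then show "?F ?y \<le> ennreal ?E * ennreal (gauss_weight b n y)"
      by (subst (asm) (1 2) ennreal_mult) (auto intro: less_imp_le)
  qed
  also have "(\<integral>\<^sup>+y. ennreal ?E * ennreal (gauss_weight b n y) \<partial>RN n) = ennreal ?E * ennreal (partition b n)"
    by (subst nn_integral_cmult) (auto simp: nn_integral_gauss_weight[OF b])
  finally have le: "(\<integral>\<^sup>+y. ?F y \<partial>RN n) \<le> ennreal (c ^ n) * (ennreal ?E * ennreal (partition b n))"
    by (simp add: mult_left_mono)
  have "(\<integral>\<^sup>+y. ennreal (exp (a * (\<Sum>j\<in>{1..n}. (y j)\<^sup>2))) \<partial>ensemble b n) = (\<integral>\<^sup>+y. ?F y \<partial>RN n) * ennreal (1 / partition b n)"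
    by (rule nn_integral_ensemble[OF b]) measurable
  also have "\<dots> \<le> ennreal (c ^ n) * (ennreal ?E * ennreal (partition b n)) * ennreal (1 / partition b n)"
    using le by (intro mult_right_mono) auto
  also have "\<dots> = ennreal (c ^ n * ?E)"
    using partition_pos[OF b, of n] c by (simp add: ennreal_mult[symmetric] mult.assoc less_imp_le)
  also have "\<dots> \<le> ennreal (exp (a * (real n + b * (real n)\<^sup>2 / 2)))"
  proof (rule ennreal_leI)
    have "c ^ n = exp (real n * ln c)" using c by (simp add: exp_of_nat_mult)
    then have "c ^ n * ?E = exp ((real n + b * (real n)\<^sup>2 / 2) * ln c)"
      by (simp add: exp_add[symmetric] algebra_simps power2_eq_square)
    also have "\<dots> \<le> exp ((real n + b * (real n)\<^sup>2 / 2) * a)"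
      using lnc b by (simp only: exp_le_cancel_iff) (intro mult_left_mono add_nonneg_nonneg, auto)
    finally show "c ^ n * ?E \<le> exp (a * (real n + b * (real n)\<^sup>2 / 2))" by (simp add: mult.commute)
  qed
  finally show ?thesis .
qed

section \<open>Comparison with the product of equilibrium measures\<close>

text \<open>The tangent at e lies below the convex function -ln. On the diagonal the comparison can
  fail, since \<open>kt 0\<close> uses ln 0 = 0 there.\<close>

lemma kt_le_kt0:
  assumes "0 < e" "x \<noteq> z"
  shows "kt e x z \<le> kt 0 x z"
proof (cases "e \<le> \<bar>x - z\<bar>")
  case False
  have "ln (\<bar>x - z\<bar> / e) \<le> \<bar>x - z\<bar> / e - 1" using assms by (intro ln_le_minus_one) auto
  then show ?thesis using assms False by (simp add: kt_def ln_div)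
qed (simp add: kt_def)

lemma kt0_le_kt:
  assumes "0 < e" "e \<le> 1"
  shows "kt 0 x z \<le> kt e x z + max 0 (ln (e / \<bar>x - z\<bar>))"
proof (cases "e \<le> \<bar>x - z\<bar>")
  case False
  have 1: "\<bar>x - z\<bar> / e \<le> 1" "ln e \<le> 0" using False assms by auto
  show ?thesis
  proof (cases "x = z")
    case True
    have "ln e \<le> 1" using 1 by linarith
    then show ?thesis using True assms by (simp add: kt_def)
  next
    case F: False
    then have "ln (e / \<bar>x - z\<bar>) = ln e - ln \<bar>x - z\<bar>" using assms by (simp add: ln_div)
    then show ?thesis using False 1 F by (simp add: kt_def)
  qed
qed (simp add: kt_def)

lemma kt_le_bound:
  assumes "0 < e" "e \<le> 1"
  shows "kt e x z \<le> 1 - ln e + theta x + theta z"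
proof (cases "e \<le> \<bar>x - z\<bar>")
  case True
  then have "ln e \<le> ln \<bar>x - z\<bar>" using assms by simp
  then show ?thesis using True by (simp add: kt_def)
next
  case False
  have "0 \<le> \<bar>x - z\<bar> / e" using assms by simp
  then show ?thesis using False by (simp add: kt_def)
qed

text \<open>A new coordinate has to avoid the finitely many values already present, a Lebesgue null
  set. Coincidences must be excluded because \<open>pair_sum\<close> gives them the value ln 0 = 0
  in place of minus infinity, which spoils upper bounds by the energy.\<close>

lemma AE_RN_distinct:
  "AE y in RN n. \<forall>i\<in>{1..n}. \<forall>j\<in>{1..n}. i \<noteq> j \<longrightarrow> y i \<noteq> y j"
proof (induction n)
  case (Suc n)
  define D where "D = (\<lambda>(n::nat) y. \<forall>i\<in>{1..n}. \<forall>j\<in>{1..n}. i \<noteq> j \<longrightarrow> y i \<noteq> (y j :: real))"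
  have mD: "{y \<in> space (RN n). \<not> D n y} \<in> sets (RN n)" for n
  proof -
    have "{y \<in> space (RN n). \<not> D n y} = (\<Union>i\<in>{1..n}. \<Union>j\<in>{1..n} - {i}. {y \<in> space (RN n). y i = y j})"
    proof (intro set_eqI iffI)
      fix y assume "y \<in> {y \<in> space (RN n). \<not> D n y}"
      then obtain i j where "i \<in> {1..n}" "j \<in> {1..n}" "i \<noteq> j" "y i = y j" "y \<in> space (RN n)"
        unfolding D_def by auto
      then show "y \<in> (\<Union>i\<in>{1..n}. \<Union>j\<in>{1..n} - {i}. {y \<in> space (RN n). y i = y j})"
        by (intro UN_I[of i] UN_I[of j]) auto
    next
      fix y assume "y \<in> (\<Union>i\<in>{1..n}. \<Union>j\<in>{1..n} - {i}. {y \<in> space (RN n). y i = y j})"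
      then obtain i j where ij: "i \<in> {1..n}" "j \<in> {1..n}" "i \<noteq> j" "y i = y j" "y \<in> space (RN n)"
        by (elim UN_E) auto
      have "\<not> D n y"
      proof
        assume "D n y"
        then have 1: "\<forall>i\<in>{1..n}. \<forall>j\<in>{1..n}. i \<noteq> j \<longrightarrow> y i \<noteq> y j" by (simp only: D_def)
        show False using bspec[OF bspec[OF 1 ij(1)] ij(2)] ij(3,4) by simp
      qed
      then show "y \<in> {y \<in> space (RN n). \<not> D n y}" using ij(5) by simp
    qed
    also have "\<dots> \<in> sets (RN n)"
    proof (intro sets.finite_UN finite_Diff finite_atLeastAtMost)
      fix i j assume "i \<in> {1..n}" "j \<in> {1..n} - {i}"
      then have [measurable]: "(\<lambda>y. y i) \<in> borel_measurable (RN n)" "(\<lambda>y. y j) \<in> borel_measurable (RN n)"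
        using measurable_coord by auto
      show "{y \<in> space (RN n). y i = y j} \<in> sets (RN n)" by measurable
    qed
    finally show ?thesis .
  qed
  have "emeasure (RN (Suc n)) {y \<in> space (RN (Suc n)). \<not> D (Suc n) y}
    = (\<integral>\<^sup>+y. indicator {y \<in> space (RN (Suc n)). \<not> D (Suc n) y} y \<partial>RN (Suc n))"
    using mD by simp
  also have "\<dots> = (\<integral>\<^sup>+y. (\<integral>\<^sup>+x. indicator {y \<in> space (RN (Suc n)). \<not> D (Suc n) y} (y(Suc n := x)) \<partial>lborel) \<partial>RN n)"
    using mD[of "Suc n"] by (intro nn_integral_RN_Suc(2)) auto
  also have "\<dots> = (\<integral>\<^sup>+y. 0 \<partial>RN n)"
  proof (rule nn_integral_cong_AE)
    show "AE y in RN n. (\<integral>\<^sup>+x. indicator {y \<in> space (RN (Suc n)). \<not> D (Suc n) y} (y(Suc n := x)) \<partial>lborel) = 0"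
      using Suc.IH
    proof eventually_elim
      case (elim y)
      have "(\<integral>\<^sup>+x. indicator {y \<in> space (RN (Suc n)). \<not> D (Suc n) y} (y(Suc n := x)) \<partial>lborel)
        \<le> (\<integral>\<^sup>+x. indicator (y ` {1..n}) x \<partial>lborel)"
      proof (rule nn_integral_mono)
        fix x
        have "D (Suc n) (y(Suc n := x))" if "x \<notin> y ` {1..n}"
          unfolding D_def
        proof (intro ballI impI)
          fix i j assume ij: "i \<in> {1..Suc n}" "j \<in> {1..Suc n}" "i \<noteq> j"
          then consider "i \<in> {1..n}" "j \<in> {1..n}" | "i = Suc n" "j \<in> {1..n}" | "j = Suc n" "i \<in> {1..n}"
            by (auto simp: le_Suc_eq)
          then show "(y(Suc n := x)) i \<noteq> (y(Suc n := x)) j"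
            using elim ij(3) that by cases (auto simp: image_iff)
        qed
        then show "(indicator {y \<in> space (RN (Suc n)). \<not> D (Suc n) y} (y(Suc n := x)) :: ennreal) \<le> indicator (y ` {1..n}) x"
          by (auto simp: indicator_def)
      qed
      also have "\<dots> = emeasure lborel (y ` {1..n})"
      proof (rule nn_integral_indicator)
        have "y ` {1..n} \<in> sets borel"
          by (intro borel_closed finite_imp_closed finite_imageI finite_atLeastAtMost)
        then show "y ` {1..n} \<in> sets lborel" by simp
      qed
      also have "\<dots> = 0" by (intro emeasure_lborel_countable countable_finite) auto
      finally show ?case by simp
    qed
  qed
  finally have "emeasure (RN (Suc n)) {y \<in> space (RN (Suc n)). \<not> D (Suc n) y} = 0" by simp
  then have "AE y in RN (Suc n). D (Suc n) y"
    using AE_iff_measurable[OF mD[of "Suc n"] refl] by simp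
  then show ?case by (simp only: D_def)
qed simp

text \<open>The interface between the variational problem and the particle system: U is the
  logarithmic potential of the density f. Growth of U no faster than \<open>theta\<close> is what
  keeps its exponential moments finite under Gaussian tails.\<close>

locale equilibrium =
  fixes \<gamma> L C :: real and U f :: "real \<Rightarrow> real"
  assumes gamma_nonneg: "0 \<le> \<gamma>" and L_pos: "0 < L" and C_pos: "0 < C"
    and f_eq: "\<And>x. f x = exp (- \<gamma> * U x - x\<^sup>2) / L"
    and U_measurable [measurable]: "U \<in> borel_measurable borel"
    and f_integrable: "integrable lborel f" and f_integral: "(\<integral>x. f x \<partial>lborel) = 1"
    and f_le: "\<And>x. f x \<le> C" and U_ge: "\<And>x. - (C + theta x) \<le> U x" and U_le: "\<And>x. U x \<le> C * (1 + theta x)"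
    and ln_f_integrable: "\<And>x. integrable lborel (\<lambda>z. ln \<bar>x - z\<bar> * f z)"
    and U_eq: "\<And>x. U x = - (\<integral>z. ln \<bar>x - z\<bar> * f z \<partial>lborel)"
    and abs_f_integrable: "integrable lborel (\<lambda>x. \<bar>x\<bar> * f x)"
begin

lemma f_pos: "0 < f x" and f_nonneg [simp]: "0 \<le> f x"
  using L_pos by (auto simp: f_eq)

lemma f_measurable [measurable]: "f \<in> borel_measurable borel"
  using f_integrable by simp

lemma abs_U_le: "\<bar>U x\<bar> \<le> C + (C + 1) * theta x"
proof -
  have "0 \<le> C * theta x" using C_pos by simp
  moreover have "U x \<le> C + C * theta x" "(C + 1) * theta x = C * theta x + theta x"
    using U_le[of x] by (simp_all add: algebra_simps)
  ultimately show ?thesis using U_ge[of x] theta_nonneg[of x] by linarith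
qed

lemma theta_f_integrable: "integrable lborel (\<lambda>x. theta x * f x)"
  by (rule Bochner_Integration.integrable_bound[OF abs_f_integrable])
    (simp_all add: abs_mult mult_right_mono theta_le_abs)

lemma U_f_integrable: "integrable lborel (\<lambda>x. U x * f x)"
proof (rule Bochner_Integration.integrable_bound)
  show "integrable lborel (\<lambda>x. C * f x + (C + 1) * (theta x * f x))"
    using f_integrable theta_f_integrable by auto
  have "\<bar>U x\<bar> * f x \<le> C * f x + (C + 1) * (theta x * f x)" for x
    using mult_right_mono[OF abs_U_le f_nonneg, of x x] by (simp add: algebra_simps)
  then show "AE x in lborel. norm (U x * f x) \<le> norm (C * f x + (C + 1) * (theta x * f x))"
    by (intro AE_I2) (auto simp: abs_mult intro: order_trans[OF _ abs_ge_self])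
qed measurable

text \<open>The logarithmic energy of the equilibrium measure for the kernel -ln |x - z|, without
  the \<open>theta\<close> terms.\<close>

definition E :: real where "E = (\<integral>x. U x * f x \<partial>lborel)"

text \<open>Jensen's inequality through the tangent of exp at the mean m. Only the exponent is
  assumed integrable; the right side may be infinite.\<close>

lemma exp_integral_le:
  assumes h: "integrable lborel (\<lambda>x. h x * f x)"
  shows "ennreal (exp (\<integral>x. h x * f x \<partial>lborel)) \<le> (\<integral>\<^sup>+x. ennreal (f x * exp (h x)) \<partial>lborel)"
proof -
  define m where "m = (\<integral>x. h x * f x \<partial>lborel)"
  define g where "g = (\<lambda>x. exp m * ((1 - m) * f x + h x * f x))"
  have g: "integrable lborel g" unfolding g_def using h f_integrable by auto
  have "(\<integral>x. g x \<partial>lborel) = exp m"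
    unfolding g_def using h f_integrable f_integral by (simp add: m_def[symmetric])
  moreover have "(\<integral>x. g x \<partial>lborel) \<le> enn2real (\<integral>\<^sup>+x. ennreal (g x) \<partial>lborel)"
    unfolding real_lebesgue_integral_def[OF g] by simp
  moreover have "(\<integral>\<^sup>+x. ennreal (g x) \<partial>lborel) < \<infinity>" using g by (auto simp: real_integrable_def less_top)
  ultimately have "ennreal (exp m) \<le> (\<integral>\<^sup>+x. ennreal (g x) \<partial>lborel)"
    by (metis ennreal_enn2real ennreal_leI infinity_ennreal_def)
  also have "\<dots> \<le> (\<integral>\<^sup>+x. ennreal (f x * exp (h x)) \<partial>lborel)"
  proof (intro nn_integral_mono ennreal_leI)
    fix x
    have "exp m * (1 + (h x - m)) \<le> exp m * exp (h x - m)"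
      by (intro mult_left_mono exp_ge_add_one_self) simp
    also have "\<dots> = exp (h x)" by (simp add: exp_add[symmetric])
    finally have "f x * (exp m * (1 + (h x - m))) \<le> f x * exp (h x)" by (intro mult_left_mono) auto
    then show "g x \<le> f x * exp (h x)" by (simp add: g_def algebra_simps)
  qed
  finally show ?thesis by (simp add: m_def)
qed

text \<open>Jensen's inequality is applied to one particle at a time. Averaging the last one
  replaces \<open>b * log_sum\<close> by -b sum U and its own term a U by a E, so the remaining n
  particles carry the coefficient a - b; this is why a is arbitrary in the induction. Summing the
  shifts gives the term -b E n (n - 1) / 2.\<close>

lemma pair_lower_bound:
  "ennreal (exp (a * real n * E - b * (real n * (real n - 1)) / 2 * E))
    \<le> (\<integral>\<^sup>+y. ennreal ((\<Prod>j\<in>{1..n}. f (y j)) * exp (b * pair_sum n y + a * (\<Sum>j\<in>{1..n}. U (y j)))) \<partial>RN n)"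
proof (induction n arbitrary: a)
  case 0
  have "emeasure (RN 0) (space (RN 0)) = 1"
    by (simp add: lebesgue_RN_def PiM_empty)
  then show ?case by simp
next
  case (Suc n)
  let ?G = "\<lambda>a n y. (\<Prod>j\<in>{1..n}. f (y j)) * exp (b * pair_sum n y + a * (\<Sum>j\<in>{1..n}. U (y j)))"
  have G0: "0 \<le> ?G a n y" for a n y by (intro mult_nonneg_nonneg prod_nonneg) auto
  have mG[measurable]: "(\<lambda>y. ennreal (?G a n y)) \<in> borel_measurable (RN n)" for a n
  proof -
    have [measurable]: "(\<lambda>y. \<Prod>j\<in>{1..n}. f (y j)) \<in> borel_measurable (RN n)"
    proof (rule borel_measurable_prod)
      fix i assume "i \<in> {1..n}"
      note [measurable] = measurable_coord[OF this]
      show "(\<lambda>y. f (y i)) \<in> borel_measurable (RN n)" by measurable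
    qed
    show ?thesis by measurable
  qed
  have step: "ennreal (exp (a * E)) * ennreal (?G (a - b) n y) \<le> (\<integral>\<^sup>+x. ennreal (?G a (Suc n) (y(Suc n := x))) \<partial>lborel)" for y
  proof -
    let ?h = "\<lambda>x. b * log_sum n x y + a * U x"
    have eq: "?h x * f x = b * (\<Sum>j\<in>{1..n}. ln \<bar>y j - x\<bar> * f x) + a * (U x * f x)" for x
      by (simp add: log_sum_def algebra_simps sum_distrib_right sum_distrib_left abs_minus_commute)
    have ih: "integrable lborel (\<lambda>x. ?h x * f x)"
      unfolding eq using ln_f_integrable U_f_integrable by auto
    have vh: "(\<integral>x. ?h x * f x \<partial>lborel) = - b * (\<Sum>j\<in>{1..n}. U (y j)) + a * E"
      unfolding eq using ln_f_integrable U_f_integrable U_eq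
      by (simp add: E_def sum_negf)
    have G': "?G a (Suc n) (y(Suc n := x)) = ?G a n y * (f x * exp (?h x))" for x
    proof -
      have "(\<Prod>j\<in>{1..n}. f ((y(Suc n := x)) j)) = (\<Prod>j\<in>{1..n}. f (y j))" by (intro prod.cong) auto
      then show ?thesis
        using sum_upd_Suc[of U y n x] by (simp add: pair_sum_upd exp_add[symmetric] algebra_simps)
    qed
    have "ennreal (exp (a * E)) * ennreal (?G (a - b) n y) = ennreal (?G a n y) * ennreal (exp (\<integral>x. ?h x * f x \<partial>lborel))"
    proof -
      have aux: "exp u * (P * exp v) = P * exp w * exp z" if "u + v = w + z" for u v w z P :: real
        using that by (metis exp_add mult.assoc mult.commute)
      have "exp (a * E) * ?G (a - b) n y = ?G a n y * exp (- b * (\<Sum>j\<in>{1..n}. U (y j)) + a * E)"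
        by (rule aux) (simp add: algebra_simps)
      then show ?thesis
        unfolding vh using G0[where a = a and n = n and y = y] G0[where a = "a - b" and n = n and y = y]
        by (subst (1 2) ennreal_mult[symmetric]) auto
    qed
    also have "\<dots> \<le> ennreal (?G a n y) * (\<integral>\<^sup>+x. ennreal (f x * exp (?h x)) \<partial>lborel)"
      by (intro mult_left_mono exp_integral_le[OF ih]) auto
    also have "\<dots> = (\<integral>\<^sup>+x. ennreal (?G a n y) * ennreal (f x * exp (?h x)) \<partial>lborel)"
      by (rule nn_integral_cmult[symmetric]) (simp add: log_sum_def)
    also have "\<dots> = (\<integral>\<^sup>+x. ennreal (?G a (Suc n) (y(Suc n := x))) \<partial>lborel)"
      unfolding G' using G0[where a = a and n = n and y = y] by (simp add: ennreal_mult)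
    finally show ?thesis .
  qed
  have "a * real (Suc n) * E - b * (real (Suc n) * (real (Suc n) - 1)) / 2 * E
    = a * E + ((a - b) * real n * E - b * (real n * (real n - 1)) / 2 * E)"
    by (simp add: field_simps)
  then have "ennreal (exp (a * real (Suc n) * E - b * (real (Suc n) * (real (Suc n) - 1)) / 2 * E))
    = ennreal (exp (a * E)) * ennreal (exp ((a - b) * real n * E - b * (real n * (real n - 1)) / 2 * E))"
    by (simp only: exp_add ennreal_mult exp_ge_zero)
  also have "\<dots> \<le> ennreal (exp (a * E)) * (\<integral>\<^sup>+y. ennreal (?G (a - b) n y) \<partial>RN n)"
    by (intro mult_left_mono Suc.IH) auto
  also have "\<dots> = (\<integral>\<^sup>+y. ennreal (exp (a * E)) * ennreal (?G (a - b) n y) \<partial>RN n)"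
    by (rule nn_integral_cmult[symmetric]) (rule mG)
  also have "\<dots> \<le> (\<integral>\<^sup>+y. (\<integral>\<^sup>+x. ennreal (?G a (Suc n) (y(Suc n := x))) \<partial>lborel) \<partial>RN n)"
    by (intro nn_integral_mono step)
  also have "\<dots> = (\<integral>\<^sup>+y. ennreal (?G a (Suc n) y) \<partial>RN (Suc n))"
    by (rule nn_integral_RN_Suc(2)[symmetric]) (rule mG)
  finally show ?case .
qed

text \<open>Positive definiteness of the truncated kernel, applied to the difference of the empirical
  measure of \<open>y\<close> and the equilibrium measure. Truncating at distance \<open>1/n\<close> costs only
  \<open>O(n log n)\<close>.\<close>

lemma pair_sum_upper_bound:
  assumes n: "1 \<le> n" and y: "\<forall>i\<in>{1..n}. \<forall>j\<in>{1..n}. i \<noteq> j \<longrightarrow> y i \<noteq> y j"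
  shows "pair_sum n y \<le> real n * (1 + ln (real n)) / 2 + (real n)\<^sup>2 * E / 2
    - real n * (\<Sum>j\<in>{1..n}. U (y j)) + 2 * C * real n"
proof -
  \<comment> \<open>A positive cutoff is forced because the empirical measure has atoms. Each of the
    n diagonal terms costs 1 - ln e, while the loss of potential per particle is 2 C e; with e = 1/n
    the total stays of order n ln n.\<close>
  define e where "e = 1 / real n"
  have e: "0 < e" "e \<le> 1" "ln e = - ln (real n)" using n by (auto simp: e_def ln_div)
  define \<mu> where "\<mu> = density lborel (\<lambda>z. ennreal (f z))"
  define \<nu> where "\<nu> = distr (uniform_count_measure {1..n}) borel y"
  have sm: "sets \<mu> = sets borel" and sn: "sets \<nu> = sets borel" by (auto simp: \<mu>_def \<nu>_def)
  have pm: "prob_space \<mu>"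
  proof
    have "emeasure \<mu> (space \<mu>) = (\<integral>\<^sup>+z. ennreal (f z) \<partial>lborel)" by (simp add: \<mu>_def emeasure_density)
    also have "\<dots> = ennreal (\<integral>z. f z \<partial>lborel)" by (intro nn_integral_eq_integral f_integrable) simp
    finally show "emeasure \<mu> (space \<mu>) = 1" by (simp add: f_integral)
  qed
  have pn: "prob_space \<nu>"
    unfolding \<nu>_def using n
    by (intro prob_space.prob_space_distr prob_space_uniform_count_measure) (auto simp: uniform_count_measure_def)
  have im: "(\<integral>\<^sup>+z. ennreal (h z) \<partial>\<mu>) = ennreal (\<integral>z. h z * f z \<partial>lborel)"
    if "integrable lborel (\<lambda>z. h z * f z)" "\<And>z. 0 \<le> h z" "h \<in> borel_measurable borel" for h
  proof -
    have "(\<integral>\<^sup>+z. ennreal (h z) \<partial>\<mu>) = (\<integral>\<^sup>+z. ennreal (h z * f z) \<partial>lborel)"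
      unfolding \<mu>_def using that by (subst nn_integral_density) (auto simp: ennreal_mult mult.commute)
    also have "\<dots> = ennreal (\<integral>z. h z * f z \<partial>lborel)"
      using that by (intro nn_integral_eq_integral) auto
    finally show ?thesis .
  qed
  have iv: "(\<integral>\<^sup>+z. ennreal (h z) \<partial>\<nu>) = ennreal ((\<Sum>j\<in>{1..n}. h (y j)) / real n)"
    if "\<And>z. 0 \<le> h z" "h \<in> borel_measurable borel" for h
  proof -
    have "(\<integral>\<^sup>+z. ennreal (h z) \<partial>\<nu>) = (\<integral>\<^sup>+j. ennreal (h (y j)) \<partial>uniform_count_measure {1..n})"
      unfolding \<nu>_def using that by (subst nn_integral_distr) (auto simp: uniform_count_measure_def)
    also have "\<dots> = (\<Sum>j\<in>{1..n}. ennreal (1 / real n) * ennreal (h (y j)))"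
      unfolding uniform_count_measure_def by (subst nn_integral_point_measure_finite) auto
    also have "\<dots> = (\<Sum>j\<in>{1..n}. ennreal (1 / real n * h (y j)))"
      by (intro sum.cong refl ennreal_mult[symmetric]) (auto simp: that)
    also have "\<dots> = ennreal (\<Sum>j\<in>{1..n}. 1 / real n * h (y j))"
      by (intro sum_ennreal) (auto simp: that)
    finally show ?thesis by (simp add: sum_divide_distrib)
  qed
  define m where "m = (\<integral>z. theta z * f z \<partial>lborel)"
  have m0: "0 \<le> m" unfolding m_def by (intro Bochner_Integration.integral_nonneg) simp
  have kmeas[measurable]: "kt e' x \<in> borel_measurable borel" for e' x by measurable
  have int_e: "integrable lborel (\<lambda>z. kt e x z * f z)" for x
  proof (rule Bochner_Integration.integrable_bound)
    show "integrable lborel (\<lambda>z. (1 - ln e + theta x) * f z + theta z * f z)"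
      using f_integrable theta_f_integrable by auto
    have "kt e x z * f z \<le> (1 - ln e + theta x) * f z + theta z * f z" for z
      using mult_right_mono[OF kt_le_bound[OF e(1,2)] f_nonneg, of x z z] by (simp add: algebra_simps)
    then show "AE z in lborel. norm (kt e x z * f z) \<le> norm ((1 - ln e + theta x) * f z + theta z * f z)"
      using kt_nonneg[of e] e by (intro AE_I2) (auto simp: abs_mult intro: order_trans[OF _ abs_ge_self])
  qed measurable
  have eq0: "kt 0 x z * f z = theta x * f z + theta z * f z - ln \<bar>x - z\<bar> * f z" for x z
    by (simp add: kt_def algebra_simps)
  have int_0: "integrable lborel (\<lambda>z. kt 0 x z * f z)" for x
    unfolding eq0 using f_integrable theta_f_integrable ln_f_integrable by auto
  have val_0: "(\<integral>z. kt 0 x z * f z \<partial>lborel) = U x + theta x + m" for x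
    unfolding eq0 using f_integrable theta_f_integrable ln_f_integrable[of x] f_integral U_eq[of x]
    by (simp add: m_def)
  define V where "V = (\<lambda>x. \<integral>z. kt e x z * f z \<partial>lborel)"
  have V0: "0 \<le> V x" for x
    unfolding V_def using kt_nonneg[of e] e by (intro Bochner_Integration.integral_nonneg) auto
  have Vm[measurable]: "V \<in> borel_measurable borel"
    unfolding V_def[abs_def] by (rule lborel.borel_measurable_lebesgue_integral) measurable
  \<comment> \<open>Truncation changes the potential only within distance e of x, where the density
    is at most C and the logarithm integrates to at most 2 e.\<close>
  have V_low: "U x + theta x + m - 2 * C * e \<le> V x" for x
  proof -
    have "ennreal (U x + theta x + m) = (\<integral>\<^sup>+z. ennreal (kt 0 x z * f z) \<partial>lborel)"
      unfolding val_0[symmetric] using kt_nonneg[of 0] by (intro nn_integral_eq_integral[symmetric] int_0) auto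
    also have "\<dots> \<le> (\<integral>\<^sup>+z. ennreal (kt e x z * f z) + ennreal C * ennreal (ln (e / \<bar>x - z\<bar>)) \<partial>lborel)"
    proof (rule nn_integral_mono)
      fix z
      have "kt 0 x z * f z \<le> (kt e x z + max 0 (ln (e / \<bar>x - z\<bar>))) * f z"
        by (intro mult_right_mono kt0_le_kt e) simp
      also have "\<dots> \<le> kt e x z * f z + C * max 0 (ln (e / \<bar>x - z\<bar>))"
        using mult_left_mono[OF f_le[of z], of "max 0 (ln (e / \<bar>x - z\<bar>))"] by (simp add: algebra_simps)
      finally have "ennreal (kt 0 x z * f z) \<le> ennreal (kt e x z * f z + C * max 0 (ln (e / \<bar>x - z\<bar>)))"
        by (rule ennreal_leI)
      also have "\<dots> = ennreal (kt e x z * f z) + ennreal C * ennreal (max 0 (ln (e / \<bar>x - z\<bar>)))"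
        using C_pos kt_nonneg[of e x z] e by (simp add: ennreal_mult)
      also have "ennreal (max 0 (ln (e / \<bar>x - z\<bar>))) = ennreal (ln (e / \<bar>x - z\<bar>))"
        by (simp add: max_def ennreal_neg)
      finally show "ennreal (kt 0 x z * f z) \<le> ennreal (kt e x z * f z) + ennreal C * ennreal (ln (e / \<bar>x - z\<bar>))" .
    qed
    also have "\<dots> = (\<integral>\<^sup>+z. ennreal (kt e x z * f z) \<partial>lborel) + ennreal C * (\<integral>\<^sup>+z. ennreal (ln (e / \<bar>x - z\<bar>)) \<partial>lborel)"
      by (simp add: nn_integral_add nn_integral_cmult)
    also have "(\<integral>\<^sup>+z. ennreal (kt e x z * f z) \<partial>lborel) = ennreal (V x)"
      unfolding V_def using kt_nonneg[of e] e by (intro nn_integral_eq_integral int_e) auto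
    also have "ennreal (V x) + ennreal C * (\<integral>\<^sup>+z. ennreal (ln (e / \<bar>x - z\<bar>)) \<partial>lborel) \<le> ennreal (V x) + ennreal C * ennreal (2 * e)"
      by (intro add_left_mono mult_left_mono nn_integral_ln_le e) auto
    also have "\<dots> = ennreal (V x + C * (2 * e))"
      using V0[of x] C_pos e by (simp only: ennreal_plus ennreal_mult mult_nonneg_nonneg less_imp_le zero_le_numeral)
    finally show ?thesis
      using V0[of x] C_pos e by (subst (asm) ennreal_le_iff) (auto simp: algebra_simps)
  qed
  have singm: "emeasure \<mu> {x} = 0" for x
  proof -
    have "absolutely_continuous lborel \<mu>" unfolding \<mu>_def by (intro absolutely_continuousI_density) measurable
    then have "{x} \<in> null_sets \<mu>"
      unfolding absolutely_continuous_def by (rule subsetD) (simp add: null_sets_def)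
    then show ?thesis by (rule null_setsD1)
  qed
  have fm: "(\<integral>\<^sup>+x. ennreal \<bar>x\<bar> \<partial>\<mu>) < \<infinity>" by (subst im) (auto intro: abs_f_integrable)
  have fn: "(\<integral>\<^sup>+x. ennreal \<bar>x\<bar> \<partial>\<nu>) < \<infinity>" by (subst iv) auto
  have T1: "(\<integral>\<^sup>+x. (\<integral>\<^sup>+z. ennreal (kt e x z) \<partial>\<mu>) \<partial>\<nu>) = ennreal ((\<Sum>j\<in>{1..n}. V (y j)) / real n)"
  proof -
    have "(\<integral>\<^sup>+z. ennreal (kt e x z) \<partial>\<mu>) = ennreal (V x)" for x
      unfolding V_def using kt_nonneg[of e] e by (intro im int_e) auto
    then show ?thesis using V0 by (simp add: iv)
  qed
  have T2: "(\<integral>\<^sup>+x. (\<integral>\<^sup>+z. ennreal (kt e x z) \<partial>\<nu>) \<partial>\<nu>)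
    = ennreal ((\<Sum>i\<in>{1..n}. (\<Sum>j\<in>{1..n}. kt e (y i) (y j)) / real n) / real n)"
  proof -
    have "(\<integral>\<^sup>+z. ennreal (kt e x z) \<partial>\<nu>) = ennreal ((\<Sum>j\<in>{1..n}. kt e x (y j)) / real n)" for x
      using kt_nonneg[of e] e by (intro iv) auto
    moreover have "0 \<le> (\<Sum>j\<in>{1..n}. kt e x (y j)) / real n" for x
      using kt_nonneg[of e] e by (intro divide_nonneg_nonneg sum_nonneg) auto
    ultimately show ?thesis by (simp add: iv)
  qed
  \<comment> \<open>For a measure without atoms truncation lowers the energy, so the self-energy is
    bounded by the untruncated value.\<close>
  have T3: "(\<integral>\<^sup>+x. (\<integral>\<^sup>+z. ennreal (kt e x z) \<partial>\<mu>) \<partial>\<mu>) \<le> ennreal (E + 2 * m)"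
  proof -
    have "(\<integral>\<^sup>+z. ennreal (kt e x z) \<partial>\<mu>) \<le> ennreal (U x + theta x + m)" for x
    proof -
      have "{x} \<in> null_sets \<mu>" using singm by (auto simp: null_sets_def sm)
      then have "AE z in \<mu>. z \<notin> {x}" by (rule AE_not_in)
      then have "AE z in \<mu>. ennreal (kt e x z) \<le> ennreal (kt 0 x z)"
        by eventually_elim (intro ennreal_leI kt_le_kt0 e, auto)
      then have "(\<integral>\<^sup>+z. ennreal (kt e x z) \<partial>\<mu>) \<le> (\<integral>\<^sup>+z. ennreal (kt 0 x z) \<partial>\<mu>)" by (rule nn_integral_mono_AE)
      also have "\<dots> = ennreal (U x + theta x + m)"
        unfolding val_0[symmetric] using kt_nonneg[of 0] by (intro im int_0) auto
      finally show ?thesis .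
    qed
    then have "(\<integral>\<^sup>+x. (\<integral>\<^sup>+z. ennreal (kt e x z) \<partial>\<mu>) \<partial>\<mu>) \<le> (\<integral>\<^sup>+x. ennreal (U x + theta x + m) \<partial>\<mu>)"
      by (intro nn_integral_mono)
    also have "\<dots> = ennreal (\<integral>x. (U x + theta x + m) * f x \<partial>lborel)"
    proof (rule im)
      show "integrable lborel (\<lambda>x. (U x + theta x + m) * f x)"
        using U_f_integrable theta_f_integrable f_integrable by (simp add: distrib_right)
      show "0 \<le> U x + theta x + m" for x
        unfolding val_0[symmetric] using kt_nonneg[of 0] by (intro Bochner_Integration.integral_nonneg) auto
    qed measurable
    also have "(\<integral>x. (U x + theta x + m) * f x \<partial>lborel) = E + 2 * m"
      using U_f_integrable theta_f_integrable f_integrable f_integral by (simp add: distrib_right E_def m_def)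
    finally show ?thesis .
  qed
  have Em: "0 \<le> E + 2 * m"
  proof -
    have "E + 2 * m = (\<integral>x. (U x + theta x + m) * f x \<partial>lborel)"
      using U_f_integrable theta_f_integrable f_integrable f_integral by (simp add: distrib_right E_def m_def)
    also have "\<dots> \<ge> 0"
    proof (intro Bochner_Integration.integral_nonneg mult_nonneg_nonneg)
      show "0 \<le> U x + theta x + m" for x
        unfolding val_0[symmetric] using kt_nonneg[of 0] by (intro Bochner_Integration.integral_nonneg) auto
    qed simp
    finally show ?thesis .
  qed
  let ?K = "\<Sum>i\<in>{1..n}. (\<Sum>j\<in>{1..n}. kt e (y i) (y j)) / real n"
  have K0: "0 \<le> ?K" using kt_nonneg[of e] e by (intro sum_nonneg divide_nonneg_nonneg) auto
  have SV0: "0 \<le> (\<Sum>j\<in>{1..n}. V (y j))" using V0 by (intro sum_nonneg) auto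
  have "2 * (\<integral>\<^sup>+x. (\<integral>\<^sup>+z. ennreal (kt e x z) \<partial>\<mu>) \<partial>\<nu>)
    \<le> (\<integral>\<^sup>+x. (\<integral>\<^sup>+z. ennreal (kt e x z) \<partial>\<nu>) \<partial>\<nu>) + (\<integral>\<^sup>+x. (\<integral>\<^sup>+z. ennreal (kt e x z) \<partial>\<mu>) \<partial>\<mu>)"
    by (rule kt_energy_psd[OF pn sn fn pm sm fm]) (use e in auto)
  also have "\<dots> \<le> ennreal (?K / real n) + ennreal (E + 2 * m)"
    unfolding T2 by (intro add_left_mono T3)
  also have "\<dots> = ennreal (?K / real n + (E + 2 * m))" using K0 Em by simp
  finally have "ennreal (2 * ((\<Sum>j\<in>{1..n}. V (y j)) / real n)) \<le> ennreal (?K / real n + (E + 2 * m))"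
    unfolding T1 using SV0 ennreal_mult[of 2 "(\<Sum>j\<in>{1..n}. V (y j)) / real n"] by simp
  then have main: "2 * ((\<Sum>j\<in>{1..n}. V (y j)) / real n) \<le> ?K / real n + (E + 2 * m)"
    using K0 Em by (subst (asm) ennreal_le_iff) auto
  define ST where "ST = (\<Sum>j\<in>{1..n}. theta (y j))"
  define SU where "SU = (\<Sum>j\<in>{1..n}. U (y j))"
  \<comment> \<open>Off the diagonal the points are distinct and the truncated kernel is below the
    full one. On the diagonal the truncated kernel exceeds the \<open>theta\<close> terms by 1 - ln
    e = 1 + ln n, which is added separately.\<close>
  have K_le: "?K \<le> (- 2 * pair_sum n y + real n * (1 + ln (real n))) / real n + 2 * ST"
  proof -
    have "kt e (y i) (y j) \<le> - ln \<bar>y i - y j\<bar> + theta (y i) + theta (y j) + (if i = j then 1 + ln (real n) else 0)"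
      if "i \<in> {1..n}" "j \<in> {1..n}" for i j
    proof (cases "i = j")
      case True
      then show ?thesis using e by (simp add: kt_def)
    next
      case False
      then have "kt e (y i) (y j) \<le> kt 0 (y i) (y j)" using y that e by (intro kt_le_kt0) auto
      then show ?thesis using False by (simp add: kt_def)
    qed
    then have "(\<Sum>i\<in>{1..n}. \<Sum>j\<in>{1..n}. kt e (y i) (y j))
      \<le> (\<Sum>i\<in>{1..n}. \<Sum>j\<in>{1..n}. - ln \<bar>y i - y j\<bar> + theta (y i) + theta (y j) + (if i = j then 1 + ln (real n) else 0))"
      by (intro sum_mono) blast
    also have "\<dots> = - 2 * pair_sum n y + 2 * real n * ST + real n * (1 + ln (real n))"
      by (simp add: sum.distrib sum_negf sum_subtractf pair_sum_def ST_def sum_distrib_left[symmetric])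
    finally have "(\<Sum>i\<in>{1..n}. \<Sum>j\<in>{1..n}. kt e (y i) (y j)) / real n
      \<le> (- 2 * pair_sum n y + 2 * real n * ST + real n * (1 + ln (real n))) / real n"
      by (intro divide_right_mono) auto
    also have "\<dots> = (- 2 * pair_sum n y + real n * (1 + ln (real n))) / real n + 2 * ST"
      using n by (simp add: field_simps)
    finally show ?thesis by (simp add: sum_divide_distrib)
  qed
  have V_sum: "SU + ST + real n * m - 2 * C \<le> (\<Sum>j\<in>{1..n}. V (y j))"
  proof -
    have "(\<Sum>j\<in>{1..n}. U (y j) + theta (y j) + m - 2 * C * e) \<le> (\<Sum>j\<in>{1..n}. V (y j))"
      by (intro sum_mono V_low)
    moreover have "(\<Sum>j\<in>{1..n}. U (y j) + theta (y j) + m - 2 * C * e) = SU + ST + real n * m - 2 * C"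
      using n by (simp add: sum.distrib sum_subtractf SU_def ST_def e_def)
    ultimately show ?thesis by simp
  qed
  have n0: "0 < real n" using n by simp
  have "2 * (SU + ST + real n * m - 2 * C) \<le> 2 * (\<Sum>j\<in>{1..n}. V (y j))" using V_sum by simp
  also have "\<dots> \<le> ?K + real n * (E + 2 * m)"
    using main n0 by (simp add: field_simps)
  also have "\<dots> \<le> (- 2 * pair_sum n y + real n * (1 + ln (real n))) / real n + 2 * ST + real n * (E + 2 * m)"
    by (intro add_right_mono K_le)
  finally have "2 * (SU - 2 * C) - real n * E \<le> (- 2 * pair_sum n y + real n * (1 + ln (real n))) / real n"
    by (simp add: algebra_simps)
  then have "(2 * (SU - 2 * C) - real n * E) * real n \<le> - 2 * pair_sum n y + real n * (1 + ln (real n))"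
    using n0 by (simp add: pos_le_divide_eq)
  then show ?thesis unfolding SU_def[symmetric] by (simp add: field_simps power2_eq_square)
qed

text \<open>The logarithm of the factor lost in comparing the ensemble with a product measure: the
  exponent from \<open>pair_sum_upper_bound\<close> minus that from
  \<open>partition_lower_bound\<close>. The terms in n E cancel up to b n - \<gamma> - b / 2, so the
  cost is o(n) in the mean-field regime.\<close>

definition cost :: "real \<Rightarrow> nat \<Rightarrow> real" where
  "cost b n = b * (real n * (1 + ln (real n)) / 2 + 2 * C * real n) + real n * E * (b * real n - \<gamma> - b / 2)"

lemma gauss_weight_eq:
  "gauss_weight b n y = L ^ n * ((\<Prod>j\<in>{1..n}. f (y j)) * exp (b * pair_sum n y + \<gamma> * (\<Sum>j\<in>{1..n}. U (y j))))"
proof -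
  have "L ^ n * (\<Prod>j\<in>{1..n}. f (y j)) = (\<Prod>j\<in>{1..n}. L * f (y j))"
    by (simp add: prod.distrib)
  also have "\<dots> = (\<Prod>j\<in>{1..n}. exp (- \<gamma> * U (y j) - (y j)\<^sup>2))"
    using L_pos by (simp add: f_eq)
  also have "\<dots> = exp (- \<gamma> * (\<Sum>j\<in>{1..n}. U (y j)) - (\<Sum>j\<in>{1..n}. (y j)\<^sup>2))"
    by (simp add: exp_sum[symmetric] sum_subtractf sum_negf sum_distrib_left)
  finally have "L ^ n * ((\<Prod>j\<in>{1..n}. f (y j)) * exp (b * pair_sum n y + \<gamma> * (\<Sum>j\<in>{1..n}. U (y j))))
    = exp (- \<gamma> * (\<Sum>j\<in>{1..n}. U (y j)) - (\<Sum>j\<in>{1..n}. (y j)\<^sup>2)) * exp (b * pair_sum n y + \<gamma> * (\<Sum>j\<in>{1..n}. U (y j)))"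
    by (simp add: mult.assoc[symmetric])
  then show ?thesis by (simp add: gauss_weight_def exp_add[symmetric])
qed

lemma partition_lower_bound:
  assumes "0 \<le> b"
  shows "L ^ n * exp (\<gamma> * real n * E - b * (real n * (real n - 1)) / 2 * E) \<le> partition b n"
proof -
  have "ennreal (L ^ n * exp (\<gamma> * real n * E - b * (real n * (real n - 1)) / 2 * E))
    = ennreal (L ^ n) * ennreal (exp (\<gamma> * real n * E - b * (real n * (real n - 1)) / 2 * E))"
    using L_pos by (intro ennreal_mult) auto
  also have "\<dots> \<le> ennreal (L ^ n) * (\<integral>\<^sup>+y. ennreal ((\<Prod>j\<in>{1..n}. f (y j)) * exp (b * pair_sum n y + \<gamma> * (\<Sum>j\<in>{1..n}. U (y j)))) \<partial>RN n)"
    by (intro mult_left_mono pair_lower_bound) auto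
  also have "\<dots> = (\<integral>\<^sup>+y. ennreal (L ^ n) * ennreal ((\<Prod>j\<in>{1..n}. f (y j)) * exp (b * pair_sum n y + \<gamma> * (\<Sum>j\<in>{1..n}. U (y j)))) \<partial>RN n)"
  proof (rule nn_integral_cmult[symmetric])
    have [measurable]: "(\<lambda>y. \<Prod>j\<in>{1..n}. f (y j)) \<in> borel_measurable (RN n)"
    proof (rule borel_measurable_prod)
      fix i assume "i \<in> {1..n}"
      note [measurable] = measurable_coord[OF this]
      show "(\<lambda>y. f (y i)) \<in> borel_measurable (RN n)" by measurable
    qed
    show "(\<lambda>y. ennreal ((\<Prod>j\<in>{1..n}. f (y j)) * exp (b * pair_sum n y + \<gamma> * (\<Sum>j\<in>{1..n}. U (y j))))) \<in> borel_measurable (RN n)"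
      by measurable
  qed
  also have "\<dots> = (\<integral>\<^sup>+y. ennreal (gauss_weight b n y) \<partial>RN n)"
    unfolding gauss_weight_eq using L_pos
    by (intro nn_integral_cong ennreal_mult[symmetric] mult_nonneg_nonneg prod_nonneg) auto
  also have "\<dots> = ennreal (partition b n)" by (rule nn_integral_gauss_weight[OF assms])
  finally show ?thesis using partition_pos[OF assms, of n] by (subst (asm) ennreal_le_iff) auto
qed

text \<open>For almost every configuration the density is at most exp (cost) times a product of
  factors f exp ((\<gamma> - b n) U), and under a product measure the exponential of a sum
  factorizes. The leftover field (\<gamma> - b n) U vanishes in the limit.\<close>

lemma ensemble_exp_sum_bound:
  assumes b: "0 \<le> b" and n: "1 \<le> n" and \<psi>[measurable]: "\<psi> \<in> borel_measurable borel"
  shows "(\<integral>\<^sup>+y. ennreal (exp (\<Sum>j\<in>{1..n}. \<psi> (y j))) \<partial>ensemble b n)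
    \<le> ennreal (exp (cost b n)) * (\<integral>\<^sup>+z. ennreal (f z * exp ((\<gamma> - b * real n) * U z + \<psi> z)) \<partial>lborel) ^ n"
proof -
  define g where "g = (\<lambda>z. f z * exp ((\<gamma> - b * real n) * U z + \<psi> z))"
  have g0: "0 \<le> g z" for z by (simp add: g_def)
  have gm: "(\<lambda>z. ennreal (g z)) \<in> borel_measurable borel" unfolding g_def by measurable
  define u where "u = b * (real n * (1 + ln (real n)) / 2 + (real n)\<^sup>2 * E / 2 + 2 * C * real n)"
  define l where "l = \<gamma> * real n * E - b * (real n * (real n - 1)) / 2 * E"
  have ul: "u - l = cost b n"
    by (simp add: u_def l_def cost_def field_simps power2_eq_square)
  have Z: "L ^ n * exp l \<le> partition b n" unfolding l_def by (rule partition_lower_bound[OF b])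
  have "(\<integral>\<^sup>+y. ennreal (exp (\<Sum>j\<in>{1..n}. \<psi> (y j))) \<partial>ensemble b n)
    = (\<integral>\<^sup>+y. ennreal (gauss_weight b n y / partition b n) * ennreal (exp (\<Sum>j\<in>{1..n}. \<psi> (y j))) \<partial>RN n)"
    unfolding ensemble_def by (rule nn_integral_density) measurable
  also have "\<dots> \<le> (\<integral>\<^sup>+y. ennreal (exp (cost b n)) * (\<Prod>j\<in>{1..n}. ennreal (g (y j))) \<partial>RN n)"
  proof (rule nn_integral_mono_AE)
    show "AE y in RN n. ennreal (gauss_weight b n y / partition b n) * ennreal (exp (\<Sum>j\<in>{1..n}. \<psi> (y j)))
      \<le> ennreal (exp (cost b n)) * (\<Prod>j\<in>{1..n}. ennreal (g (y j)))"
      using AE_RN_distinct[of n]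
    proof eventually_elim
      case (elim y)
      let ?P = "\<Prod>j\<in>{1..n}. f (y j)" and ?SU = "\<Sum>j\<in>{1..n}. U (y j)"
      have P0: "0 \<le> ?P" by (intro prod_nonneg) auto
      have "b * pair_sum n y \<le> b * (real n * (1 + ln (real n)) / 2 + (real n)\<^sup>2 * E / 2 - real n * ?SU + 2 * C * real n)"
        by (intro mult_left_mono b pair_sum_upper_bound n elim)
      also have "\<dots> = u - b * real n * ?SU" by (simp add: u_def algebra_simps)
      finally have "exp (b * pair_sum n y + \<gamma> * ?SU) \<le> exp (u + (\<gamma> - b * real n) * ?SU)"
        by (simp add: algebra_simps)
      then have "gauss_weight b n y \<le> L ^ n * (?P * exp (u + (\<gamma> - b * real n) * ?SU))"
        unfolding gauss_weight_eq using P0 L_pos by (intro mult_left_mono) auto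
      then have "gauss_weight b n y / partition b n \<le> L ^ n * (?P * exp (u + (\<gamma> - b * real n) * ?SU)) / (L ^ n * exp l)"
        using Z partition_pos[OF b, of n] L_pos P0 by (intro frac_le) auto
      also have "\<dots> = exp (cost b n) * (?P * exp ((\<gamma> - b * real n) * ?SU))"
        using L_pos by (simp add: ul[symmetric] exp_add exp_diff field_simps)
      finally have "gauss_weight b n y / partition b n * exp (\<Sum>j\<in>{1..n}. \<psi> (y j))
        \<le> exp (cost b n) * (?P * exp ((\<gamma> - b * real n) * ?SU)) * exp (\<Sum>j\<in>{1..n}. \<psi> (y j))"
        by (intro mult_right_mono) auto
      also have "\<dots> = exp (cost b n) * (\<Prod>j\<in>{1..n}. g (y j))"
        by (simp add: g_def prod.distrib exp_sum[symmetric] sum.distrib sum_distrib_left exp_add mult.assoc)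
      finally have "ennreal (gauss_weight b n y / partition b n * exp (\<Sum>j\<in>{1..n}. \<psi> (y j)))
        \<le> ennreal (exp (cost b n) * (\<Prod>j\<in>{1..n}. g (y j)))" by (rule ennreal_leI)
      then show ?case
        using partition_pos[OF b, of n] g0
        by (subst (asm) (1 2) ennreal_mult) (auto intro: prod_nonneg divide_nonneg_pos simp: prod_ennreal)
    qed
  qed
  also have "\<dots> = ennreal (exp (cost b n)) * (\<integral>\<^sup>+y. (\<Prod>j\<in>{1..n}. ennreal (g (y j))) \<partial>RN n)"
    by (rule nn_integral_cmult) (rule prod_coord_measurable[OF gm])
  also have "(\<integral>\<^sup>+y. (\<Prod>j\<in>{1..n}. ennreal (g (y j))) \<partial>RN n) = (\<integral>\<^sup>+z. ennreal (g z) \<partial>lborel) ^ n"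
    by (rule nn_integral_RN_prod[OF gm])
  finally show ?thesis by (simp add: g_def)
qed

end

section \<open>Law of large numbers for the logarithmic potential\<close>

lemma tendsto_0_ennrealI:
  fixes F :: "'a \<Rightarrow> ennreal"
  assumes "\<And>\<epsilon>::real. 0 < \<epsilon> \<Longrightarrow> \<forall>\<^sub>F k in net. F k \<le> ennreal \<epsilon>"
  shows "(F \<longlongrightarrow> 0) net"
proof (rule order_tendstoI)
  fix a :: ennreal assume "0 < a"
  then obtain r where r: "0 < r" "r < a" using dense by blast
  then have fin: "r < \<infinity>" using less_le_trans[OF r(2) top_greatest] by simp
  have "0 < enn2real r" using r(1) fin by (simp add: enn2real_positive_iff)
  then have "\<forall>\<^sub>F k in net. F k \<le> ennreal (enn2real r)" by (rule assms)
  then show "\<forall>\<^sub>F k in net. F k < a"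
    by eventually_elim (use r fin in \<open>auto simp: ennreal_enn2real\<close>)
qed simp

lemma exp_le_quadratic:
  fixes t :: real
  shows "exp t \<le> 1 + t + t\<^sup>2 * exp \<bar>t\<bar>"
proof -
  have ge: "1 - s \<le> exp (- s)" for s :: real using exp_ge_add_one_self[of "- s"] by simp
  have le: "exp s - 1 \<le> s * exp s" for s :: real
  proof -
    have "(1 - s) * exp s \<le> exp (- s) * exp s" by (intro mult_right_mono ge) simp
    then show ?thesis by (simp add: exp_minus algebra_simps)
  qed
  have abs: "\<bar>exp t - 1\<bar> \<le> \<bar>t\<bar> * exp \<bar>t\<bar>"
  proof (cases "0 \<le> t")
    case True
    then show ?thesis using le[of t] by simp
  next
    case False
    have "1 - exp t \<le> \<bar>t\<bar> * 1" using exp_ge_add_one_self[of t] False by linarith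
    also have "\<dots> \<le> \<bar>t\<bar> * exp \<bar>t\<bar>" by (intro mult_left_mono) auto
    finally show ?thesis using False by simp
  qed
  have "exp t - 1 - t \<le> t * (exp t - 1)" using le[of t] by (simp add: algebra_simps)
  also have "\<dots> \<le> \<bar>t\<bar> * \<bar>exp t - 1\<bar>" by (metis abs_ge_self abs_mult)
  also have "\<dots> \<le> \<bar>t\<bar> * (\<bar>t\<bar> * exp \<bar>t\<bar>)" by (intro mult_left_mono abs) simp
  also have "\<dots> = t\<^sup>2 * exp \<bar>t\<bar>" by (simp add: power2_eq_square mult.assoc[symmetric])
  finally show ?thesis by simp
qed

text \<open>Exponential moments of ln |x - z| of order at most 1/2 produce at worst the singularity
  |x - z|^(-1/2), which is integrable uniformly in x.\<close>

lemma nn_integral_inverse_sqrt_le: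
  "(\<integral>\<^sup>+z. ennreal (1 / sqrt \<bar>x - z\<bar>) * indicator {z. \<bar>x - z\<bar> < 1} z \<partial>lborel) \<le> 4"
proof -
  define h where "h = (\<lambda>u::real. ennreal (1 / sqrt u) * indicator {0<..<1} u)"
  have [measurable]: "h \<in> borel_measurable borel" unfolding h_def by measurable
  have ev: "einterval 0 1 = {0<..<1}"
    by (auto simp: einterval_def)
  have 1: "(0::ereal) < 1" by simp
  have 2: "DERIV (\<lambda>u. 2 * sqrt u) u :> 1 / sqrt u" if "0 < ereal u" "ereal u < 1" for u
    using that by (auto intro!: derivative_eq_intros simp: field_simps)
  have 3: "isCont (\<lambda>u. 1 / sqrt u) u" if "0 < ereal u" "ereal u < 1" for u
    using that by (auto intro!: continuous_intros)
  have 4: "AE u in lborel. 0 < ereal u \<longrightarrow> ereal u < 1 \<longrightarrow> 0 \<le> 1 / sqrt u"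
    by (intro AE_I2) auto
  have 5: "(((\<lambda>u. 2 * sqrt u) \<circ> real_of_ereal) \<longlongrightarrow> 0) (at_right 0)"
    unfolding zero_ereal_def by (subst ereal_tendsto_simps1) (auto intro!: tendsto_eq_intros)
  have 6: "(((\<lambda>u. 2 * sqrt u) \<circ> real_of_ereal) \<longlongrightarrow> 2) (at_left 1)"
    unfolding one_ereal_def by (subst ereal_tendsto_simps1) (auto intro!: tendsto_eq_intros)
  note FTC = interval_integral_FTC_nonneg[OF 1 2 3 4 5 6]
  have "(\<integral>\<^sup>+u. h u \<partial>lborel) = (\<integral>\<^sup>+u. ennreal (indicator {0<..<1} u *\<^sub>R (1 / sqrt u)) \<partial>lborel)"
    by (intro nn_integral_cong) (auto simp: h_def indicator_def)
  also have "\<dots> = ennreal (\<integral>u. indicator {0<..<1} u *\<^sub>R (1 / sqrt u) \<partial>lborel)"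
    using FTC(1) by (intro nn_integral_eq_integral) (auto simp: set_integrable_def ev indicator_def)
  also have "(\<integral>u. indicator {0<..<1} u *\<^sub>R (1 / sqrt u) \<partial>lborel) = 2"
    using FTC(2) by (simp add: interval_lebesgue_integral_def set_lebesgue_integral_def ev)
  finally have ih: "(\<integral>\<^sup>+u. h u \<partial>lborel) = 2" by simp
  have "(\<integral>\<^sup>+z. ennreal (1 / sqrt \<bar>x - z\<bar>) * indicator {z. \<bar>x - z\<bar> < 1} z \<partial>lborel)
    \<le> (\<integral>\<^sup>+z. h (x + (-1) * z) + h (- x + 1 * z) \<partial>lborel)"
  proof (rule nn_integral_mono)
    fix z
    show "ennreal (1 / sqrt \<bar>x - z\<bar>) * indicator {z. \<bar>x - z\<bar> < 1} z \<le> h (x + (-1) * z) + h (- x + 1 * z)"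
      by (cases "x = z"; cases "x < z") (auto simp: h_def indicator_def abs_if)
  qed
  also have "\<dots> = (\<integral>\<^sup>+z. h (x + (-1) * z) \<partial>lborel) + (\<integral>\<^sup>+z. h (- x + 1 * z) \<partial>lborel)"
    by (intro nn_integral_add) measurable
  also have "(\<integral>\<^sup>+z. h (x + (-1) * z) \<partial>lborel) = (\<integral>\<^sup>+u. h u \<partial>lborel)"
    by (subst nn_integral_real_affine[of h "-1" x]) simp_all
  also have "(\<integral>\<^sup>+z. h (- x + 1 * z) \<partial>lborel) = (\<integral>\<^sup>+u. h u \<partial>lborel)"
    by (subst nn_integral_real_affine[of h 1 "-x"]) simp_all
  finally show ?thesis using ih by simp
qed

lemma mult_le_mult_abs:
  fixes s v c :: real
  assumes "\<bar>s\<bar> \<le> c"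
  shows "s * v \<le> c * \<bar>v\<bar>"
proof -
  have "s * v \<le> \<bar>s\<bar> * \<bar>v\<bar>" by (metis abs_ge_self abs_mult)
  also have "\<dots> \<le> c * \<bar>v\<bar>" using assms by (intro mult_right_mono) auto
  finally show ?thesis .
qed

lemma exp_theta_gauss_le:
  assumes "0 \<le> c"
  shows "exp (a + c * theta x - x\<^sup>2) \<le> exp (a + c\<^sup>2 / 2) * exp (- x\<^sup>2 / 2)"
proof -
  have "(\<bar>x\<bar> - c)\<^sup>2 \<ge> 0" by simp
  then have "c * \<bar>x\<bar> - x\<^sup>2 / 2 \<le> c\<^sup>2 / 2" by (simp add: power2_diff algebra_simps)
  moreover have "c * theta x \<le> c * \<bar>x\<bar>" using assms theta_le_abs by (intro mult_left_mono)
  ultimately have "a + c * theta x - x\<^sup>2 \<le> (a + c\<^sup>2 / 2) + - x\<^sup>2 / 2" by (simp add: algebra_simps)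
  then show ?thesis by (simp only: exp_add[symmetric] exp_le_cancel_iff)
qed

section \<open>Exponential moments of the logarithm under the equilibrium density\<close>

context equilibrium
begin

lemma f_exp_theta_le:
  assumes "0 \<le> c"
  shows "f x * exp (a + c * theta x) \<le> exp (\<gamma> * C + a + (\<gamma> + c)\<^sup>2 / 2) / L * exp (- x\<^sup>2 / 2)"
proof -
  have "- \<gamma> * U x \<le> \<gamma> * (C + theta x)"
    using mult_left_mono[OF U_ge[of x] gamma_nonneg] by (simp add: algebra_simps)
  then have "- \<gamma> * U x - x\<^sup>2 + (a + c * theta x) \<le> \<gamma> * C + a + (\<gamma> + c) * theta x - x\<^sup>2"
    by (simp add: algebra_simps)
  then have "exp (- \<gamma> * U x - x\<^sup>2) * exp (a + c * theta x) \<le> exp (\<gamma> * C + a + (\<gamma> + c) * theta x - x\<^sup>2)"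
    by (simp only: exp_add[symmetric] exp_le_cancel_iff)
  also have "\<dots> \<le> exp (\<gamma> * C + a + (\<gamma> + c)\<^sup>2 / 2) * exp (- x\<^sup>2 / 2)"
    by (rule exp_theta_gauss_le) (use assms gamma_nonneg in simp)
  finally show ?thesis using L_pos by (simp add: f_eq divide_right_mono)
qed

text \<open>A dominating function common to all parameters |s| \<le> 1/2 and |\<eta>| \<le> 1 of
  \<open>tilted\<close>. The Gaussian tail of f beats the powers of 1 + |z| coming from U and from
  the logarithm, and the singularity at x is of order -1/2.\<close>

lemma integrable_exp_log:
  "integrable lborel (\<lambda>z. f z * exp (\<bar>U z\<bar> + \<bar>ln \<bar>x - z\<bar>\<bar> / 2))"
proof (rule integrableI_bounded)
  define K where "K = exp (\<gamma> * C + C + (\<gamma> + (C + 2))\<^sup>2 / 2) / L"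
  have K: "0 \<le> K" using L_pos by (simp add: K_def)
  have fU: "f z * exp \<bar>U z\<bar> * (1 + \<bar>z\<bar>) \<le> K * exp (- z\<^sup>2 / 2)" for z
  proof -
    have "exp \<bar>U z\<bar> * (1 + \<bar>z\<bar>) = exp (\<bar>U z\<bar> + theta z)"
      by (simp add: theta_def exp_add add_pos_nonneg)
    also have "\<dots> \<le> exp (C + (C + 2) * theta z)" using abs_U_le[of z] by (simp add: algebra_simps)
    finally have "f z * (exp \<bar>U z\<bar> * (1 + \<bar>z\<bar>)) \<le> f z * exp (C + (C + 2) * theta z)" by (intro mult_left_mono) auto
    also have "\<dots> \<le> K * exp (- z\<^sup>2 / 2)" unfolding K_def by (rule f_exp_theta_le) (use C_pos in simp)
    finally show ?thesis by (simp add: mult.assoc)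
  qed
  \<comment> \<open>The left side is 1 at d = 0, where ln 0 = 0; it is 1 / sqrt d for 0 < d < 1 and
    sqrt d \<le> d for d \<ge> 1.\<close>
  have el: "exp (\<bar>ln d\<bar> / 2) \<le> 2 + d + indicator {..<1} d * (1 / sqrt d)" if d: "0 \<le> d" for d :: real
  proof (cases "d < 1")
    case True
    show ?thesis
    proof (cases "d = 0")
      case False
      have "exp (\<bar>ln d\<bar> / 2) = 1 / exp (ln d / 2)" using True False d by (simp add: exp_minus[symmetric] inverse_eq_divide[symmetric])
      also have "exp (ln d / 2) = sqrt d" using False d by (simp add: ln_sqrt[symmetric])
      finally show ?thesis using True d by simp
    qed simp
  next
    case False
    have "exp (\<bar>ln d\<bar> / 2) = exp (ln (sqrt d))" using False by (simp add: ln_sqrt)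
    also have "\<dots> = sqrt d" using False by simp
    also have "\<dots> \<le> d" using False by (simp add: real_le_lsqrt power2_eq_square mult_le_cancel_left1)
    finally show ?thesis using False by simp
  qed
  have "(\<integral>\<^sup>+z. ennreal (norm (f z * exp (\<bar>U z\<bar> + \<bar>ln \<bar>x - z\<bar>\<bar> / 2))) \<partial>lborel)
    \<le> (\<integral>\<^sup>+z. ennreal ((2 + \<bar>x\<bar>) * K * exp (- z\<^sup>2 / 2)) + ennreal K * (ennreal (1 / sqrt \<bar>x - z\<bar>) * indicator {z. \<bar>x - z\<bar> < 1} z) \<partial>lborel)"
  proof (rule nn_integral_mono)
    fix z
    let ?i = "indicator {..<1} \<bar>x - z\<bar> * (1 / sqrt \<bar>x - z\<bar>)"
    have i0: "0 \<le> ?i" by simp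
    have "exp (\<bar>ln \<bar>x - z\<bar>\<bar> / 2) \<le> 2 + \<bar>x - z\<bar> + ?i" by (rule el) simp
    also have "\<dots> \<le> (2 + \<bar>x\<bar>) * (1 + \<bar>z\<bar>) + ?i * (1 + \<bar>z\<bar>)"
    proof (intro add_mono)
      have "\<bar>x - z\<bar> \<le> \<bar>x\<bar> + \<bar>z\<bar>" "0 \<le> \<bar>x\<bar> * \<bar>z\<bar>" by auto
      moreover have "(2 + \<bar>x\<bar>) * (1 + \<bar>z\<bar>) = 2 + 2 * \<bar>z\<bar> + \<bar>x\<bar> + \<bar>x\<bar> * \<bar>z\<bar>" by (simp add: algebra_simps)
      ultimately show "2 + \<bar>x - z\<bar> \<le> (2 + \<bar>x\<bar>) * (1 + \<bar>z\<bar>)" by linarith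
      show "?i \<le> ?i * (1 + \<bar>z\<bar>)" using mult_left_mono[of 1 "1 + \<bar>z\<bar>" ?i] i0 by simp
    qed
    finally have "f z * exp \<bar>U z\<bar> * exp (\<bar>ln \<bar>x - z\<bar>\<bar> / 2) \<le> f z * exp \<bar>U z\<bar> * ((2 + \<bar>x\<bar>) * (1 + \<bar>z\<bar>) + ?i * (1 + \<bar>z\<bar>))"
      by (intro mult_left_mono) auto
    also have "\<dots> = (2 + \<bar>x\<bar> + ?i) * (f z * exp \<bar>U z\<bar> * (1 + \<bar>z\<bar>))" by (simp add: algebra_simps add_divide_distrib)
    also have "\<dots> \<le> (2 + \<bar>x\<bar> + ?i) * (K * exp (- z\<^sup>2 / 2))"
      using i0 by (intro mult_left_mono fU) auto
    also have "\<dots> \<le> (2 + \<bar>x\<bar>) * K * exp (- z\<^sup>2 / 2) + K * ?i"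
    proof -
      have "?i * (K * exp (- z\<^sup>2 / 2)) \<le> ?i * (K * 1)" using i0 K by (intro mult_left_mono) auto
      then show ?thesis by (simp add: algebra_simps)
    qed
    finally have *: "f z * exp (\<bar>U z\<bar> + \<bar>ln \<bar>x - z\<bar>\<bar> / 2) \<le> (2 + \<bar>x\<bar>) * K * exp (- z\<^sup>2 / 2) + K * ?i"
      by (simp add: exp_add mult.assoc)
    have "ennreal (norm (f z * exp (\<bar>U z\<bar> + \<bar>ln \<bar>x - z\<bar>\<bar> / 2))) \<le> ennreal ((2 + \<bar>x\<bar>) * K * exp (- z\<^sup>2 / 2) + K * ?i)"
      using * by (intro ennreal_leI) (simp add: abs_mult)
    also have "\<dots> = ennreal ((2 + \<bar>x\<bar>) * K * exp (- z\<^sup>2 / 2)) + ennreal K * ennreal ?i"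
    proof -
      have "0 \<le> (2 + \<bar>x\<bar>) * K * exp (- z\<^sup>2 / 2)" "0 \<le> K * ?i" using K i0 by auto
      then show ?thesis unfolding ennreal_mult[OF K i0, symmetric] by (rule ennreal_plus)
    qed
    also have "ennreal ?i = ennreal (1 / sqrt \<bar>x - z\<bar>) * indicator {z. \<bar>x - z\<bar> < 1} z"
      by (auto simp: indicator_def)
    finally show "ennreal (norm (f z * exp (\<bar>U z\<bar> + \<bar>ln \<bar>x - z\<bar>\<bar> / 2)))
      \<le> ennreal ((2 + \<bar>x\<bar>) * K * exp (- z\<^sup>2 / 2)) + ennreal K * (ennreal (1 / sqrt \<bar>x - z\<bar>) * indicator {z. \<bar>x - z\<bar> < 1} z)" .
  qed
  also have "\<dots> = (\<integral>\<^sup>+z. ennreal ((2 + \<bar>x\<bar>) * K * exp (- z\<^sup>2 / 2)) \<partial>lborel)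
    + ennreal K * (\<integral>\<^sup>+z. ennreal (1 / sqrt \<bar>x - z\<bar>) * indicator {z. \<bar>x - z\<bar> < 1} z \<partial>lborel)"
    by (subst nn_integral_add) (auto simp: nn_integral_cmult)
  also have "\<dots> < \<infinity>"
  proof -
    have "integrable lborel (\<lambda>z. (2 + \<bar>x\<bar>) * K * exp (- z\<^sup>2 / 2))"
      using integrable_exp_minus_half_square by simp
    then have "(\<integral>\<^sup>+z. ennreal ((2 + \<bar>x\<bar>) * K * exp (- z\<^sup>2 / 2)) \<partial>lborel)
      = ennreal (\<integral>z. (2 + \<bar>x\<bar>) * K * exp (- z\<^sup>2 / 2) \<partial>lborel)"
      using K by (intro nn_integral_eq_integral) auto
    then have "(\<integral>\<^sup>+z. ennreal ((2 + \<bar>x\<bar>) * K * exp (- z\<^sup>2 / 2)) \<partial>lborel) < \<infinity>" by simp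
    moreover have "ennreal K * (\<integral>\<^sup>+z. ennreal (1 / sqrt \<bar>x - z\<bar>) * indicator {z. \<bar>x - z\<bar> < 1} z \<partial>lborel) < \<infinity>"
      using le_less_trans[OF nn_integral_inverse_sqrt_le[of x], of \<infinity>] by (simp add: ennreal_mult_less_top)
    ultimately show ?thesis by simp
  qed
  finally show "(\<integral>\<^sup>+z. ennreal (norm (f z * exp (\<bar>U z\<bar> + \<bar>ln \<bar>x - z\<bar>\<bar> / 2))) \<partial>lborel) < \<infinity>" .
qed measurable

text \<open>The moment generating function of ln |x - z| under f, centred at its mean -U x. The
  parameter \<eta> accounts for the mismatch \<gamma> - b n.\<close>

definition tilted :: "real \<Rightarrow> real \<Rightarrow> real \<Rightarrow> real" where
  "tilted x s \<eta> = (\<integral>z. f z * exp (\<eta> * U z + s * (ln \<bar>x - z\<bar> + U x)) \<partial>lborel)"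

lemma tilted_bound:
  assumes "\<bar>s\<bar> \<le> 1 / 2" "\<bar>\<eta>\<bar> \<le> 1"
  shows "norm (f z * exp (\<eta> * U z + s * (ln \<bar>x - z\<bar> + U x)))
    \<le> exp \<bar>U x\<bar> * (f z * exp (\<bar>U z\<bar> + \<bar>ln \<bar>x - z\<bar>\<bar> / 2))"
proof -
  have "\<eta> * U z \<le> 1 * \<bar>U z\<bar>" by (rule mult_le_mult_abs) (use assms in auto)
  moreover have "s * ln \<bar>x - z\<bar> \<le> 1 / 2 * \<bar>ln \<bar>x - z\<bar>\<bar>" by (rule mult_le_mult_abs) (use assms in auto)
  moreover have "s * U x \<le> 1 * \<bar>U x\<bar>" by (rule mult_le_mult_abs) (use assms in auto)
  ultimately have "exp (\<eta> * U z + s * (ln \<bar>x - z\<bar> + U x)) \<le> exp (\<bar>U x\<bar> + (\<bar>U z\<bar> + \<bar>ln \<bar>x - z\<bar>\<bar> / 2))"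
    by (simp add: algebra_simps)
  then have "f z * exp (\<eta> * U z + s * (ln \<bar>x - z\<bar> + U x)) \<le> f z * exp (\<bar>U x\<bar> + (\<bar>U z\<bar> + \<bar>ln \<bar>x - z\<bar>\<bar> / 2))"
    by (intro mult_left_mono) auto
  then show ?thesis by (simp add: exp_add mult.assoc mult.left_commute)
qed

lemma integrable_tilted:
  assumes "\<bar>s\<bar> \<le> 1 / 2" "\<bar>\<eta>\<bar> \<le> 1"
  shows "integrable lborel (\<lambda>z. f z * exp (\<eta> * U z + s * (ln \<bar>x - z\<bar> + U x)))"
proof (rule Bochner_Integration.integrable_bound)
  show "integrable lborel (\<lambda>z. exp \<bar>U x\<bar> * (f z * exp (\<bar>U z\<bar> + \<bar>ln \<bar>x - z\<bar>\<bar> / 2)))"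
    using integrable_exp_log by simp
  show "AE z in lborel. norm (f z * exp (\<eta> * U z + s * (ln \<bar>x - z\<bar> + U x)))
    \<le> norm (exp \<bar>U x\<bar> * (f z * exp (\<bar>U z\<bar> + \<bar>ln \<bar>x - z\<bar>\<bar> / 2)))"
    by (intro AE_I2 order_trans[OF tilted_bound[OF assms]]) simp
qed measurable

lemma tilted_tendsto:
  assumes s: "\<bar>s\<bar> \<le> 1 / 2" and \<eta>: "\<eta> \<longlonglongrightarrow> 0"
  shows "(\<lambda>k. tilted x s (\<eta> k)) \<longlonglongrightarrow> tilted x s 0"
proof -
  \<comment> \<open>Clamping makes the domination valid for every k and changes nothing
    eventually.\<close>
  define \<eta>' where "\<eta>' = (\<lambda>k::nat. max (- 1) (min 1 (\<eta> k)))"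
  have lim: "\<eta>' \<longlonglongrightarrow> 0"
    using tendsto_max[OF tendsto_const[of "-1"] tendsto_min[OF tendsto_const[of 1] \<eta>]] by (simp add: \<eta>'_def)
  have bd: "\<bar>\<eta>' k\<bar> \<le> 1" for k by (auto simp: \<eta>'_def)
  have "(\<lambda>k. tilted x s (\<eta>' k)) \<longlonglongrightarrow> tilted x s 0"
    unfolding tilted_def
  proof (rule integral_dominated_convergence)
    show "integrable lborel (\<lambda>z. exp \<bar>U x\<bar> * (f z * exp (\<bar>U z\<bar> + \<bar>ln \<bar>x - z\<bar>\<bar> / 2)))"
      using integrable_exp_log by simp
    show "AE z in lborel. (\<lambda>k. f z * exp (\<eta>' k * U z + s * (ln \<bar>x - z\<bar> + U x)))
      \<longlonglongrightarrow> f z * exp (0 * U z + s * (ln \<bar>x - z\<bar> + U x))"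
      by (intro AE_I2 tendsto_intros lim)
    show "AE z in lborel. norm (f z * exp (\<eta>' k * U z + s * (ln \<bar>x - z\<bar> + U x)))
      \<le> exp \<bar>U x\<bar> * (f z * exp (\<bar>U z\<bar> + \<bar>ln \<bar>x - z\<bar>\<bar> / 2))" for k
      by (intro AE_I2 tilted_bound s bd)
  qed measurable
  moreover have "\<forall>\<^sub>F k in sequentially. tilted x s (\<eta>' k) = tilted x s (\<eta> k)"
  proof -
    have "\<forall>\<^sub>F k in sequentially. dist (\<eta> k) 0 < 1" using \<eta> by (rule tendstoD) simp
    then show ?thesis by eventually_elim (auto simp: \<eta>'_def max_def min_def)
  qed
  ultimately show ?thesis by (rule Lim_transform_eventually)
qed

text \<open>Second-order expansion of exp, whose linear term integrates to 0 because the variable is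
  centred. The square is absorbed by t^2 / 2 \<le> e^t at t = |\<psi>| / 4, whence the 32; with |s|
  \<le> 1/4 the total exponent is at most |\<psi>| / 2, still in the integrable range.\<close>

lemma tilted_le:
  obtains B where "0 < B" "\<And>s. \<bar>s\<bar> \<le> 1 / 4 \<Longrightarrow> tilted x s 0 \<le> 1 + s\<^sup>2 * B"
proof -
  define \<psi> where "\<psi> = (\<lambda>z. ln \<bar>x - z\<bar> + U x)"
  have [measurable]: "\<psi> \<in> borel_measurable borel" unfolding \<psi>_def by measurable
  define g where "g = (\<lambda>z. exp \<bar>U x\<bar> * (f z * exp (\<bar>U z\<bar> + \<bar>ln \<bar>x - z\<bar>\<bar> / 2)))"
  have g: "integrable lborel g" unfolding g_def using integrable_exp_log by simp
  have g0: "0 \<le> g z" for z by (simp add: g_def)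
  define B where "B = 32 * (\<integral>z. g z \<partial>lborel) + 1"
  have "0 \<le> (\<integral>z. g z \<partial>lborel)" by (intro Bochner_Integration.integral_nonneg g0)
  then have B: "0 < B" by (simp add: B_def)
  have i\<psi>: "integrable lborel (\<lambda>z. f z * \<psi> z)" and v\<psi>: "(\<integral>z. f z * \<psi> z \<partial>lborel) = 0"
    unfolding \<psi>_def distrib_left using ln_f_integrable[of x] f_integrable U_eq[of x] f_integral
    by (simp_all add: mult.commute[of "f _"])
  have "tilted x s 0 \<le> 1 + s\<^sup>2 * B" if s: "\<bar>s\<bar> \<le> 1 / 4" for s
  proof -
    have "tilted x s 0 \<le> (\<integral>z. f z + s * (f z * \<psi> z) + s\<^sup>2 * (32 * g z) \<partial>lborel)"
      unfolding tilted_def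
    proof (rule integral_mono)
      show "integrable lborel (\<lambda>z. f z * exp (0 * U z + s * (ln \<bar>x - z\<bar> + U x)))"
        by (rule integrable_tilted) (use s in auto)
      show "integrable lborel (\<lambda>z. f z + s * (f z * \<psi> z) + s\<^sup>2 * (32 * g z))"
        using f_integrable i\<psi> g by simp
      fix z
      have "(\<bar>\<psi> z\<bar> / 4)\<^sup>2 / 2 \<le> exp (\<bar>\<psi> z\<bar> / 4)"
        using exp_lower_Taylor_quadratic[of "\<bar>\<psi> z\<bar> / 4"] abs_ge_zero[of "\<psi> z"] by linarith
      then have sq: "(\<psi> z)\<^sup>2 \<le> 32 * exp (\<bar>\<psi> z\<bar> / 4)" by (simp add: power_divide)
      have "exp (s * \<psi> z) \<le> 1 + s * \<psi> z + (s * \<psi> z)\<^sup>2 * exp \<bar>s * \<psi> z\<bar>" by (rule exp_le_quadratic)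
      also have "\<bar>s * \<psi> z\<bar> \<le> 1 / 4 * \<bar>\<psi> z\<bar>" unfolding abs_mult using s by (intro mult_right_mono) auto
      then have "(s * \<psi> z)\<^sup>2 * exp \<bar>s * \<psi> z\<bar> \<le> s\<^sup>2 * (32 * exp (\<bar>\<psi> z\<bar> / 4)) * exp (1 / 4 * \<bar>\<psi> z\<bar>)"
        unfolding power_mult_distrib using sq by (intro mult_mono mult_left_mono) auto
      also have "\<dots> = s\<^sup>2 * (32 * exp (\<bar>\<psi> z\<bar> / 2))" by (simp add: exp_add[symmetric])
      finally have "exp (s * \<psi> z) \<le> 1 + s * \<psi> z + s\<^sup>2 * (32 * exp (\<bar>\<psi> z\<bar> / 2))" by simp
      then have "f z * exp (s * \<psi> z) \<le> f z * (1 + s * \<psi> z + s\<^sup>2 * (32 * exp (\<bar>\<psi> z\<bar> / 2)))"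
        by (intro mult_left_mono) auto
      also have "\<dots> = f z + s * (f z * \<psi> z) + s\<^sup>2 * (32 * (f z * exp (\<bar>\<psi> z\<bar> / 2)))" by (simp add: algebra_simps)
      also have "f z * exp (\<bar>\<psi> z\<bar> / 2) \<le> g z"
      proof -
        have "\<bar>\<psi> z\<bar> \<le> \<bar>ln \<bar>x - z\<bar>\<bar> + \<bar>U x\<bar>" unfolding \<psi>_def by (rule abs_triangle_ineq)
        then have "exp (\<bar>\<psi> z\<bar> / 2) \<le> exp (\<bar>U x\<bar> + (\<bar>U z\<bar> + \<bar>ln \<bar>x - z\<bar>\<bar> / 2))" by simp
        then have "f z * exp (\<bar>\<psi> z\<bar> / 2) \<le> f z * exp (\<bar>U x\<bar> + (\<bar>U z\<bar> + \<bar>ln \<bar>x - z\<bar>\<bar> / 2))" by (intro mult_left_mono) auto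
        then show ?thesis by (simp add: g_def exp_add mult.assoc mult.left_commute)
      qed
      then have "f z + s * (f z * \<psi> z) + s\<^sup>2 * (32 * (f z * exp (\<bar>\<psi> z\<bar> / 2))) \<le> f z + s * (f z * \<psi> z) + s\<^sup>2 * (32 * g z)"
        by (intro add_left_mono mult_left_mono) auto
      finally show "f z * exp (0 * U z + s * (ln \<bar>x - z\<bar> + U x)) \<le> f z + s * (f z * \<psi> z) + s\<^sup>2 * (32 * g z)"
        by (simp add: \<psi>_def)
    qed
    also have "\<dots> = 1 + s\<^sup>2 * (32 * (\<integral>z. g z \<partial>lborel))"
      using f_integrable i\<psi> g v\<psi> f_integral by simp
    also have "\<dots> \<le> 1 + s\<^sup>2 * B" unfolding B_def by (intro add_left_mono mult_left_mono) auto
    finally show ?thesis .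
  qed
  then show ?thesis using B by (intro that[of B]) auto
qed

end

text \<open>Temperatures and sizes are separate sequences, so that one b can be combined with
  neighbouring sizes. \<open>b_half\<close> is the range in which
  \<open>ensemble_exp_square_bound\<close> applies with parameter b, and \<open>bn_le\<close> makes
  its bounds uniform in k.\<close>

locale mean_field_sequence = equilibrium +
  fixes b :: "nat \<Rightarrow> real" and n :: "nat \<Rightarrow> nat"
  assumes b0: "\<And>k. 0 \<le> b k" and b_half: "\<And>k. b k \<le> 1 / 2" and n1: "\<And>k. 1 \<le> n k"
    and bn_le: "\<And>k. b k * real (n k) \<le> \<gamma> + 1"
    and n_lim: "filterlim n at_top sequentially"
    and bn_lim: "(\<lambda>k. b k * real (n k)) \<longlonglongrightarrow> \<gamma>"
begin

lemma b_lim: "b \<longlonglongrightarrow> 0"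
proof -
  have "((\<lambda>m::nat. 1 / real m) \<longlongrightarrow> 0) at_top" by real_asymp
  from filterlim_compose[OF this n_lim] have "(\<lambda>k. 1 / real (n k)) \<longlonglongrightarrow> 0" .
  from tendsto_mult[OF bn_lim this] have "(\<lambda>k. b k * real (n k) * (1 / real (n k))) \<longlonglongrightarrow> 0" by simp
  moreover have "b k * real (n k) * (1 / real (n k)) = b k" for k using n1[of k] by simp
  ultimately show ?thesis by simp
qed

lemma cost_lim: "(\<lambda>k. cost (b k) (n k) / real (n k)) \<longlonglongrightarrow> 0"
proof -
  have "((\<lambda>m::nat. (1 + ln (real m)) / real m) \<longlongrightarrow> 0) at_top" by real_asymp
  from filterlim_compose[OF this n_lim] have l1: "(\<lambda>k. (1 + ln (real (n k))) / real (n k)) \<longlonglongrightarrow> 0" .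
  have "(\<lambda>k. b k * real (n k) * ((1 + ln (real (n k))) / real (n k)) / 2 + 2 * C * b k
    + E * (b k * real (n k) - \<gamma> - b k / 2)) \<longlonglongrightarrow> \<gamma> * 0 / 2 + 2 * C * 0 + E * (\<gamma> - \<gamma> - 0 / 2)"
    by (intro tendsto_intros bn_lim l1 b_lim) auto
  moreover have "b k * real (n k) * ((1 + ln (real (n k))) / real (n k)) / 2 + 2 * C * b k
    + E * (b k * real (n k) - \<gamma> - b k / 2) = cost (b k) (n k) / real (n k)" for k
    using n1[of k] by (simp add: cost_def add_divide_distrib distrib_left)
  ultimately show ?thesis by simp
qed

text \<open>A Chernoff bound: the deviation \<delta> n contributes exp (-s \<delta> n), the moment
  generating function at most exp (3 s \<delta> n / 4) and the comparison with a product at most exp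
  (s \<delta> n / 8), which leaves exp (-s \<delta> n / 8). That the deviation is linear in n is
  essential, as the cost of the comparison is merely o(n).\<close>

lemma log_sum_LLN:
  assumes \<delta>: "0 < \<delta>"
  shows "(\<lambda>k. emeasure (ensemble (b k) (n k))
    {y \<in> space (RN (n k)). \<delta> * real (n k) \<le> \<bar>log_sum (n k) x y + real (n k) * U x\<bar>}) \<longlonglongrightarrow> 0"
proof -
  obtain B where B: "0 < B" "\<And>s. \<bar>s\<bar> \<le> 1 / 4 \<Longrightarrow> tilted x s 0 \<le> 1 + s\<^sup>2 * B"
    using tilted_le by metis
  \<comment> \<open>Small enough for the quadratic term s^2 B of \<open>tilted_le\<close> to be at
    most s \<delta> / 2, strictly below the allowed 3 s \<delta> / 4; the gap absorbs the passage
    from \<eta> = 0 to \<eta> k.\<close>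
  define s where "s = min (1 / 4) (\<delta> / (2 * B))"
  have s: "0 < s" "s \<le> 1 / 4" "s * B \<le> \<delta> / 2" using \<delta> B(1) by (auto simp: s_def min_def field_simps)
  have small: "tilted x \<sigma> 0 < exp (3 * s * \<delta> / 4)" if "\<bar>\<sigma>\<bar> = s" for \<sigma>
  proof -
    have "tilted x \<sigma> 0 \<le> 1 + \<sigma>\<^sup>2 * B" using B(2)[of \<sigma>] that s by simp
    also have "\<sigma>\<^sup>2 = s * s" using that by (metis power2_abs power2_eq_square)
    also have "1 + s * s * B \<le> 1 + s * \<delta> / 2" using mult_left_mono[OF s(3), of s] s(1) by (simp add: mult.assoc)
    also have "\<dots> \<le> exp (s * \<delta> / 2)" by (rule exp_ge_add_one_self)
    also have "\<dots> < exp (3 * s * \<delta> / 4)" using s \<delta> by simp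
    finally show ?thesis .
  qed
  define \<eta> where "\<eta> = (\<lambda>k. \<gamma> - b k * real (n k))"
  have \<eta>: "\<eta> \<longlonglongrightarrow> 0" unfolding \<eta>_def using tendsto_diff[OF tendsto_const bn_lim, of \<gamma>] by simp
  have ev: "\<forall>\<^sub>F k in sequentially. tilted x \<sigma> (\<eta> k) < exp (3 * s * \<delta> / 4)" if "\<bar>\<sigma>\<bar> = s" for \<sigma>
    using tilted_tendsto[of \<sigma>, OF _ \<eta>, of x] small[OF that] that s by (intro order_tendstoD(2)) auto
  have evc: "\<forall>\<^sub>F k in sequentially. cost (b k) (n k) / real (n k) < s * \<delta> / 8"
    using cost_lim s \<delta> by (intro order_tendstoD(2)) auto
  have ev\<eta>: "\<forall>\<^sub>F k in sequentially. dist (\<eta> k) 0 < 1" using \<eta> by (rule tendstoD) simp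
  define P where "P = (\<lambda>k. emeasure (ensemble (b k) (n k))
    {y \<in> space (RN (n k)). \<delta> * real (n k) \<le> \<bar>log_sum (n k) x y + real (n k) * U x\<bar>})"
  have bound: "P k \<le> ennreal (2 * exp (- (s * \<delta> / 8) * real (n k)))"
    if t1: "tilted x s (\<eta> k) < exp (3 * s * \<delta> / 4)" and t2: "tilted x (- s) (\<eta> k) < exp (3 * s * \<delta> / 4)"
      and c: "cost (b k) (n k) / real (n k) < s * \<delta> / 8" and e: "dist (\<eta> k) 0 < 1" for k
  proof -
    let ?S = "\<lambda>y. log_sum (n k) x y + real (n k) * U x"
    let ?e = "exp (- s * \<delta> * real (n k))"
    have n0: "0 < real (n k)" using n1[of k] by simp
    have m[measurable]: "{y \<in> space (RN (n k)). \<delta> * real (n k) \<le> \<bar>?S y\<bar>} \<in> sets (RN (n k))" by measurable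
    have sumS: "(\<Sum>j\<in>{1..n k}. \<sigma> * (ln \<bar>x - y j\<bar> + U x)) = \<sigma> * ?S y" for \<sigma> y
      by (simp add: log_sum_def sum.distrib sum_distrib_left[symmetric])
    have E: "(\<integral>\<^sup>+y. ennreal (exp (\<sigma> * ?S y)) \<partial>ensemble (b k) (n k)) \<le> ennreal (exp (7 * s * \<delta> / 8 * real (n k)))"
      if \<sigma>: "\<bar>\<sigma>\<bar> = s" and t: "tilted x \<sigma> (\<eta> k) < exp (3 * s * \<delta> / 4)" for \<sigma>
    proof -
      have it: "integrable lborel (\<lambda>z. f z * exp (\<eta> k * U z + \<sigma> * (ln \<bar>x - z\<bar> + U x)))"
        by (rule integrable_tilted) (use \<sigma> s e in auto)
      have t0: "0 \<le> tilted x \<sigma> (\<eta> k)" unfolding tilted_def by (intro Bochner_Integration.integral_nonneg) simp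
      have "(\<integral>\<^sup>+y. ennreal (exp (\<sigma> * ?S y)) \<partial>ensemble (b k) (n k))
        = (\<integral>\<^sup>+y. ennreal (exp (\<Sum>j\<in>{1..n k}. \<sigma> * (ln \<bar>x - y j\<bar> + U x))) \<partial>ensemble (b k) (n k))"
        unfolding sumS ..
      also have "\<dots> \<le> ennreal (exp (cost (b k) (n k)))
        * (\<integral>\<^sup>+z. ennreal (f z * exp ((\<gamma> - b k * real (n k)) * U z + \<sigma> * (ln \<bar>x - z\<bar> + U x))) \<partial>lborel) ^ n k"
        by (rule ensemble_exp_sum_bound[OF b0 n1]) measurable
      also have "(\<integral>\<^sup>+z. ennreal (f z * exp ((\<gamma> - b k * real (n k)) * U z + \<sigma> * (ln \<bar>x - z\<bar> + U x))) \<partial>lborel)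
        = ennreal (tilted x \<sigma> (\<eta> k))"
        unfolding tilted_def using it by (simp add: \<eta>_def nn_integral_eq_integral)
      also have "ennreal (exp (cost (b k) (n k))) * ennreal (tilted x \<sigma> (\<eta> k)) ^ n k
        = ennreal (exp (cost (b k) (n k)) * tilted x \<sigma> (\<eta> k) ^ n k)"
        using t0 by (simp add: ennreal_power ennreal_mult)
      also have "\<dots> \<le> ennreal (exp (s * \<delta> / 8 * real (n k)) * exp (3 * s * \<delta> / 4) ^ n k)"
      proof (intro ennreal_leI mult_mono power_mono)
        show "exp (cost (b k) (n k)) \<le> exp (s * \<delta> / 8 * real (n k))"
          using c n0 by (simp add: field_simps)
      qed (use t t0 in auto)
      also have "exp (s * \<delta> / 8 * real (n k)) * exp (3 * s * \<delta> / 4) ^ n k = exp (7 * s * \<delta> / 8 * real (n k))"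
        by (simp add: exp_of_nat_mult[symmetric] exp_add[symmetric] field_simps)
      finally show ?thesis .
    qed
    have "P k = (\<integral>\<^sup>+y. indicator {y \<in> space (RN (n k)). \<delta> * real (n k) \<le> \<bar>?S y\<bar>} y \<partial>ensemble (b k) (n k))"
      unfolding P_def by (rule nn_integral_indicator[symmetric]) measurable
    also have "\<dots> \<le> (\<integral>\<^sup>+y. ennreal ?e * (ennreal (exp (s * ?S y)) + ennreal (exp (- s * ?S y))) \<partial>ensemble (b k) (n k))"
    proof (rule nn_integral_mono)
      fix y
      have "1 \<le> ?e * (exp (s * ?S y) + exp (- s * ?S y))" if d: "\<delta> * real (n k) \<le> \<bar>?S y\<bar>"
      proof -
        have "s * (\<delta> * real (n k)) \<le> s * \<bar>?S y\<bar>" using d s by (intro mult_left_mono) auto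
        then have "1 \<le> ?e * exp (s * \<bar>?S y\<bar>)" by (simp add: exp_add[symmetric] mult.assoc)
        also have "exp (s * \<bar>v\<bar>) \<le> exp (s * v) + exp (- s * v)" for v
          by (cases "0 \<le> v") auto
        then have "?e * exp (s * \<bar>?S y\<bar>) \<le> ?e * (exp (s * ?S y) + exp (- s * ?S y))"
          by (rule mult_left_mono) simp
        finally show ?thesis .
      qed
      then have "ennreal 1 \<le> ennreal (?e * (exp (s * ?S y) + exp (- s * ?S y)))" if "\<delta> * real (n k) \<le> \<bar>?S y\<bar>"
        using that by (intro ennreal_leI) auto
      then show "indicator {y \<in> space (RN (n k)). \<delta> * real (n k) \<le> \<bar>?S y\<bar>} y
        \<le> ennreal ?e * (ennreal (exp (s * ?S y)) + ennreal (exp (- s * ?S y)))"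
        by (auto simp: indicator_def ennreal_mult)
    qed
    also have "\<dots> = ennreal ?e * ((\<integral>\<^sup>+y. ennreal (exp (s * ?S y)) \<partial>ensemble (b k) (n k))
      + (\<integral>\<^sup>+y. ennreal (exp (- s * ?S y)) \<partial>ensemble (b k) (n k)))"
      by (subst nn_integral_cmult) (auto simp: nn_integral_add)
    also have "\<dots> \<le> ennreal ?e * (ennreal (exp (7 * s * \<delta> / 8 * real (n k))) + ennreal (exp (7 * s * \<delta> / 8 * real (n k))))"
      using s t1 t2 by (intro mult_left_mono add_mono E) auto
    also have "\<dots> = ennreal (?e * (2 * exp (7 * s * \<delta> / 8 * real (n k))))"
      by (simp add: ennreal_mult ennreal_plus[symmetric] del: ennreal_plus)
    also have "?e * (2 * exp (7 * s * \<delta> / 8 * real (n k))) = 2 * exp (- (s * \<delta> / 8) * real (n k))"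
      by (simp add: exp_add[symmetric] field_simps)
    finally show ?thesis .
  qed
  have lim: "(\<lambda>k. ennreal (2 * exp (- (s * \<delta> / 8) * real (n k)))) \<longlonglongrightarrow> ennreal 0"
  proof (rule tendsto_ennrealI)
    have "((\<lambda>m::nat. 2 * exp (- c * real m)) \<longlongrightarrow> 0) at_top" if "0 < c" for c :: real
      using that by real_asymp
    from filterlim_compose[OF this[of "s * \<delta> / 8"] n_lim] s \<delta>
    show "(\<lambda>k. 2 * exp (- (s * \<delta> / 8) * real (n k))) \<longlonglongrightarrow> 0" by simp
  qed
  have ev1: "\<forall>\<^sub>F k in sequentially. tilted x s (\<eta> k) < exp (3 * s * \<delta> / 4)" using s by (intro ev) simp
  have ev2: "\<forall>\<^sub>F k in sequentially. tilted x (- s) (\<eta> k) < exp (3 * s * \<delta> / 4)" using s by (intro ev) simp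
  have "\<forall>\<^sub>F k in sequentially. P k \<le> ennreal (2 * exp (- (s * \<delta> / 8) * real (n k)))"
    using ev1 ev2 evc ev\<eta> by eventually_elim (rule bound)
  with lim have "P \<longlonglongrightarrow> 0"
    by (intro tendsto_sandwich[where f = "\<lambda>_. 0" and g = P and h = "\<lambda>k. ennreal (2 * exp (- (s * \<delta> / 8) * real (n k)))"])
      (auto simp: always_eventually)
  then show ?thesis by (simp add: P_def)
qed

end

section \<open>Ratios of partition functions\<close>

lemma two_theta_le: "2 * theta x \<le> 1 + x\<^sup>2"
proof -
  have "0 \<le> (\<bar>x\<bar> - 1)\<^sup>2" by simp
  then have "2 * \<bar>x\<bar> \<le> 1 + x\<^sup>2" by (simp add: power2_diff)
  then show ?thesis using theta_le_abs[of x] by linarith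
qed

section \<open>Uniform integrability and L1 convergence of exp (b log_sum)\<close>

context mean_field_sequence
begin

definition tilt_bound :: "real \<Rightarrow> real" where
  "tilt_bound x = exp (2 * (\<gamma> + 1) + (\<gamma> + 1)\<^sup>2 / 2 + 2 * (\<gamma> + 1) * theta x)"

text \<open>A second moment bounded uniformly in k upgrades convergence in probability to
  convergence in L1. Through ln |x - y| \<le> theta x + theta y and 2 theta y \<le> 1 + y^2 it
  reduces to the exponential moment of sum y_j^2 with parameter b, which stays bounded because b n
  does.\<close>

lemma nn_integral_exp_log_sum_square:
  "(\<integral>\<^sup>+y. ennreal ((exp (b k * log_sum (n k) x y))\<^sup>2) \<partial>ensemble (b k) (n k)) \<le> ennreal (tilt_bound x)"
proof -
  define B where "B = b k * real (n k)"
  have B: "0 \<le> B" "B \<le> \<gamma> + 1" using b0[of k] bn_le[of k] by (auto simp: B_def)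
  have "(\<integral>\<^sup>+y. ennreal ((exp (b k * log_sum (n k) x y))\<^sup>2) \<partial>ensemble (b k) (n k))
    \<le> (\<integral>\<^sup>+y. ennreal (exp (2 * B * theta x + B)) * ennreal (exp (b k * (\<Sum>j\<in>{1..n k}. (y j)\<^sup>2))) \<partial>ensemble (b k) (n k))"
  proof (rule nn_integral_mono)
    fix y
    have "log_sum (n k) x y \<le> (\<Sum>j\<in>{1..n k}. theta x + theta (y j))"
      unfolding log_sum_def by (intro sum_mono ln_abs_diff_le)
    then have "2 * log_sum (n k) x y \<le> (\<Sum>j\<in>{1..n k}. 2 * theta x + 2 * theta (y j))"
      by (simp add: sum_distrib_left[symmetric] sum.distrib)
    also have "\<dots> \<le> (\<Sum>j\<in>{1..n k}. 2 * theta x + (1 + (y j)\<^sup>2))"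
      by (intro sum_mono add_left_mono two_theta_le)
    also have "\<dots> = real (n k) * (2 * theta x + 1) + (\<Sum>j\<in>{1..n k}. (y j)\<^sup>2)"
      by (simp add: sum.distrib algebra_simps)
    finally have "b k * (2 * log_sum (n k) x y) \<le> b k * (real (n k) * (2 * theta x + 1) + (\<Sum>j\<in>{1..n k}. (y j)\<^sup>2))"
      by (intro mult_left_mono b0)
    then have "exp (2 * (b k * log_sum (n k) x y)) \<le> exp ((2 * B * theta x + B) + b k * (\<Sum>j\<in>{1..n k}. (y j)\<^sup>2))"
      by (simp add: B_def algebra_simps)
    then show "ennreal ((exp (b k * log_sum (n k) x y))\<^sup>2)
      \<le> ennreal (exp (2 * B * theta x + B)) * ennreal (exp (b k * (\<Sum>j\<in>{1..n k}. (y j)\<^sup>2)))"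
      by (subst ennreal_mult[symmetric]) (auto simp: exp_double[symmetric] exp_add[symmetric] intro!: ennreal_leI)
  qed
  also have "\<dots> = ennreal (exp (2 * B * theta x + B)) * (\<integral>\<^sup>+y. ennreal (exp (b k * (\<Sum>j\<in>{1..n k}. (y j)\<^sup>2))) \<partial>ensemble (b k) (n k))"
    by (rule nn_integral_cmult) measurable
  also have "\<dots> \<le> ennreal (exp (2 * B * theta x + B)) * ennreal (exp (b k * (real (n k) + b k * (real (n k))\<^sup>2 / 2)))"
    by (intro mult_left_mono ensemble_exp_square_bound b0 b_half) auto
  also have "\<dots> = ennreal (exp (2 * B + B\<^sup>2 / 2 + 2 * B * theta x))"
    by (simp add: ennreal_mult[symmetric] exp_add[symmetric] B_def power2_eq_square algebra_simps)
  also have "\<dots> \<le> ennreal (tilt_bound x)"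
  proof -
    have "B\<^sup>2 \<le> (\<gamma> + 1)\<^sup>2" using B by (intro power_mono) auto
    moreover have "2 * B * theta x \<le> 2 * (\<gamma> + 1) * theta x" using B by (intro mult_right_mono) auto
    ultimately have "2 * B + B\<^sup>2 / 2 + 2 * B * theta x \<le> 2 * (\<gamma> + 1) + (\<gamma> + 1)\<^sup>2 / 2 + 2 * (\<gamma> + 1) * theta x"
      using B by (intro add_mono divide_right_mono mult_left_mono) auto
    then show ?thesis unfolding tilt_bound_def by (intro ennreal_leI) simp
  qed
  finally show ?thesis .
qed

lemma prob_space_P: "prob_space (ensemble (b k) (n k))"
  by (rule prob_space_ensemble[OF b0])

lemma emeasure_P [simp]: "emeasure (ensemble (b k) (n k)) (space (RN (n k))) = 1"
  using prob_space.emeasure_space_1[OF prob_space_P[of k]] by simp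

lemma nn_integral_exp_log_sum:
  "(\<integral>\<^sup>+y. ennreal (exp (b k * log_sum (n k) x y)) \<partial>ensemble (b k) (n k)) \<le> ennreal (1 + tilt_bound x)"
proof -
  have le: "r \<le> 1 + r\<^sup>2" for r :: real
  proof -
    have "0 \<le> (r - 1)\<^sup>2" "0 \<le> r\<^sup>2" by auto
    then show ?thesis unfolding power2_diff power_one mult_1_right by linarith
  qed
  have "(\<integral>\<^sup>+y. ennreal (exp (b k * log_sum (n k) x y)) \<partial>ensemble (b k) (n k))
    \<le> (\<integral>\<^sup>+y. 1 + ennreal ((exp (b k * log_sum (n k) x y))\<^sup>2) \<partial>ensemble (b k) (n k))"
  proof (rule nn_integral_mono)
    fix y
    have "ennreal (exp (b k * log_sum (n k) x y)) \<le> ennreal (1 + (exp (b k * log_sum (n k) x y))\<^sup>2)"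
      by (intro ennreal_leI le)
    then show "ennreal (exp (b k * log_sum (n k) x y)) \<le> 1 + ennreal ((exp (b k * log_sum (n k) x y))\<^sup>2)"
      by simp
  qed
  also have "\<dots> = 1 + (\<integral>\<^sup>+y. ennreal ((exp (b k * log_sum (n k) x y))\<^sup>2) \<partial>ensemble (b k) (n k))"
    by (subst nn_integral_add) auto
  also have "\<dots> \<le> 1 + ennreal (tilt_bound x)"
    by (intro add_left_mono nn_integral_exp_log_sum_square)
  finally show ?thesis by (simp add: tilt_bound_def)
qed

definition L1_dist :: "nat \<Rightarrow> real \<Rightarrow> ennreal" where
  "L1_dist k x = (\<integral>\<^sup>+y. ennreal \<bar>exp (b k * log_sum (n k) x y) - exp (- \<gamma> * U x)\<bar> \<partial>ensemble (b k) (n k))"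

text \<open>Outside the exceptional event of the law of large numbers the two exponents differ by
  less than \<rho>, using b n \<le> \<gamma> + 1 and b n -> \<gamma>. On that event d \<le> l d^2 +
  1 / (4 l) trades the second moment, with a small weight l, against the small probability.\<close>

lemma L1_dist_tendsto: "(\<lambda>k. L1_dist k x) \<longlonglongrightarrow> 0"
proof (rule tendsto_0_ennrealI)
  fix \<epsilon> :: real assume \<epsilon>: "0 < \<epsilon>"
  define a where "a = exp (- \<gamma> * U x)"
  define M2 where "M2 = tilt_bound x + a\<^sup>2"
  have M2: "0 < M2" by (simp add: M2_def a_def tilt_bound_def add_pos_pos)
  \<comment> \<open>The second moments then contribute \<epsilon> / 4, and an event of probability
    below \<epsilon> l another \<epsilon> / 4.\<close>
  define l where "l = \<epsilon> / (8 * M2)"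
  have l: "0 < l" "2 * l * M2 = \<epsilon> / 4" using \<epsilon> M2 by (auto simp: l_def)
  have "isCont exp (- \<gamma> * U x)" by simp
  then obtain \<rho> where \<rho>: "0 < \<rho>" "\<And>t. \<bar>t - (- \<gamma> * U x)\<bar> < \<rho> \<Longrightarrow> \<bar>exp t - a\<bar> < \<epsilon> / 4"
    using \<epsilon> unfolding continuous_at_eps_delta dist_real_def a_def by (metis zero_less_divide_iff zero_less_numeral)
  \<comment> \<open>Half of \<rho> is for the fluctuation of \<open>log_sum\<close>, the other half
    for (b n - \<gamma>) U x.\<close>
  define \<delta> where "\<delta> = \<rho> / (2 * (\<gamma> + 1))"
  have \<delta>: "0 < \<delta>" "(\<gamma> + 1) * \<delta> = \<rho> / 2"
    using \<rho>(1) gamma_nonneg by (auto simp: \<delta>_def field_simps)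
  define Ev where "Ev = (\<lambda>k. {y \<in> space (RN (n k)). \<delta> * real (n k) \<le> \<bar>log_sum (n k) x y + real (n k) * U x\<bar>})"
  have "(\<lambda>k. (b k * real (n k) - \<gamma>) * U x) \<longlonglongrightarrow> (\<gamma> - \<gamma>) * U x"
    by (intro tendsto_intros bn_lim)
  then have "(\<lambda>k. (b k * real (n k) - \<gamma>) * U x) \<longlonglongrightarrow> 0" by simp
  then have ev1: "\<forall>\<^sub>F k in sequentially. dist ((b k * real (n k) - \<gamma>) * U x) 0 < \<rho> / 2"
    using \<rho>(1) by (intro tendstoD) auto
  have ev2: "\<forall>\<^sub>F k in sequentially. emeasure (ensemble (b k) (n k)) (Ev k) < ennreal (\<epsilon> * l)"
    using log_sum_LLN[OF \<delta>(1), of x] \<epsilon> l unfolding Ev_def by (intro order_tendstoD(2)) auto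
  show "\<forall>\<^sub>F k in sequentially. L1_dist k x \<le> ennreal \<epsilon>"
    using ev1 ev2
  proof eventually_elim
    case (elim k)
    let ?A = "\<lambda>y. exp (b k * log_sum (n k) x y)"
    have mEv[measurable]: "Ev k \<in> sets (RN (n k))" unfolding Ev_def by measurable
    have "L1_dist k x \<le> (\<integral>\<^sup>+y. (ennreal (\<epsilon> / 4) + ennreal (1 / (4 * l)) * indicator (Ev k) y)
      + (ennreal (2 * l) * ennreal ((?A y)\<^sup>2) + ennreal (2 * l * a\<^sup>2)) \<partial>ensemble (b k) (n k))"
      unfolding L1_dist_def a_def[symmetric]
    proof (rule nn_integral_mono)
      fix y assume "y \<in> space (ensemble (b k) (n k))"
      then have y: "y \<in> space (RN (n k))" by simp
      have base: "\<bar>?A y - a\<bar> \<le> \<epsilon> / 4 + 1 / (4 * l) * indicator (Ev k) y + (2 * l * (?A y)\<^sup>2 + 2 * l * a\<^sup>2)"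
      proof (cases "y \<in> Ev k")
        case True
        define d where "d = \<bar>?A y - a\<bar>"
        have "d \<le> l * d\<^sup>2 + 1 / (4 * l)"
        proof -
          have "0 \<le> (2 * l * d - 1)\<^sup>2" by simp
          then have "4 * l * d \<le> 4 * l * (l * d\<^sup>2) + 1" by (simp add: power2_diff power2_eq_square algebra_simps)
          then show ?thesis using l(1) by (simp add: field_simps)
        qed
        moreover have "d\<^sup>2 \<le> 2 * (?A y)\<^sup>2 + 2 * a\<^sup>2"
        proof -
          have "0 \<le> (?A y + a)\<^sup>2" by simp
          then show ?thesis unfolding d_def power2_abs by (simp add: power2_diff power2_sum)
        qed
        then have "l * d\<^sup>2 \<le> l * (2 * (?A y)\<^sup>2 + 2 * a\<^sup>2)" using l by (intro mult_left_mono) auto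
        ultimately show ?thesis using True \<epsilon> by (simp add: d_def[symmetric] algebra_simps)
      next
        case False
        define B where "B = b k * real (n k)"
        have n0: "0 < real (n k)" using n1[of k] by simp
        have "\<bar>log_sum (n k) x y + real (n k) * U x\<bar> < \<delta> * real (n k)" using False y by (simp add: Ev_def not_le)
        then have "b k * \<bar>log_sum (n k) x y + real (n k) * U x\<bar> \<le> b k * (\<delta> * real (n k))"
          using b0[of k] by (intro mult_left_mono) auto
        also have "\<dots> = B * \<delta>" by (simp add: B_def)
        also have "\<dots> \<le> (\<gamma> + 1) * \<delta>" using bn_le[of k] \<delta> by (intro mult_right_mono) (auto simp: B_def)
        finally have le: "b k * \<bar>log_sum (n k) x y + real (n k) * U x\<bar> \<le> (\<gamma> + 1) * \<delta>" .
        have "\<bar>b k * log_sum (n k) x y + B * U x\<bar> \<le> \<rho> / 2"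
        proof -
          have "b k * log_sum (n k) x y + B * U x = b k * (log_sum (n k) x y + real (n k) * U x)"
            by (simp add: B_def algebra_simps)
          then have "\<bar>b k * log_sum (n k) x y + B * U x\<bar> = b k * \<bar>log_sum (n k) x y + real (n k) * U x\<bar>"
            using b0[of k] by (simp add: abs_mult)
          then show ?thesis using le \<delta>(2) by simp
        qed
        moreover have "\<bar>(B - \<gamma>) * U x\<bar> < \<rho> / 2" using elim(1) by (simp add: B_def)
        moreover have "b k * log_sum (n k) x y - (- \<gamma> * U x) = (b k * log_sum (n k) x y + B * U x) - (B - \<gamma>) * U x"
          by (simp add: algebra_simps)
        ultimately have "\<bar>b k * log_sum (n k) x y - (- \<gamma> * U x)\<bar> < \<rho>" by linarith
        then have "\<bar>?A y - a\<bar> < \<epsilon> / 4" by (rule \<rho>(2))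
        moreover have "0 \<le> 2 * l * (?A y)\<^sup>2 + 2 * l * a\<^sup>2" using l by simp
        ultimately show ?thesis using False by simp
      qed
      have "ennreal \<bar>?A y - a\<bar> \<le> ennreal (\<epsilon> / 4 + 1 / (4 * l) * indicator (Ev k) y + (2 * l * (?A y)\<^sup>2 + 2 * l * a\<^sup>2))"
        using base by (rule ennreal_leI)
      also have "\<dots> = (ennreal (\<epsilon> / 4) + ennreal (1 / (4 * l)) * indicator (Ev k) y) + (ennreal (2 * l) * ennreal ((?A y)\<^sup>2) + ennreal (2 * l * a\<^sup>2))"
      proof -
        have "ennreal (2 * l * (?A y)\<^sup>2) = ennreal (2 * l) * ennreal ((?A y)\<^sup>2)" using l by (intro ennreal_mult) auto
        moreover have "ennreal (1 / (4 * l) * indicator (Ev k) y) = ennreal (1 / (4 * l)) * indicator (Ev k) y"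
          by (auto simp: indicator_def)
        moreover have "0 \<le> \<epsilon> / 4" "0 \<le> 1 / (4 * l) * indicator (Ev k) y" "0 \<le> 2 * l * (?A y)\<^sup>2" "0 \<le> 2 * l * a\<^sup>2"
          using \<epsilon> l by auto
        ultimately show ?thesis by (simp only: ennreal_plus add_nonneg_nonneg)
      qed
      finally show "ennreal \<bar>?A y - a\<bar> \<le> (ennreal (\<epsilon> / 4) + ennreal (1 / (4 * l)) * indicator (Ev k) y) + (ennreal (2 * l) * ennreal ((?A y)\<^sup>2) + ennreal (2 * l * a\<^sup>2))" .
    qed
    also have "\<dots> = (ennreal (\<epsilon> / 4) + ennreal (1 / (4 * l)) * emeasure (ensemble (b k) (n k)) (Ev k))
      + (ennreal (2 * l) * (\<integral>\<^sup>+y. ennreal ((?A y)\<^sup>2) \<partial>ensemble (b k) (n k)) + ennreal (2 * l * a\<^sup>2))"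
      by (subst nn_integral_add, measurable, subst nn_integral_add, measurable, subst nn_integral_add, measurable)
        (simp add: nn_integral_cmult)
    also have "\<dots> \<le> (ennreal (\<epsilon> / 4) + ennreal (1 / (4 * l)) * ennreal (\<epsilon> * l))
      + (ennreal (2 * l) * ennreal (tilt_bound x) + ennreal (2 * l * a\<^sup>2))"
      using elim(2) by (intro add_mono mult_left_mono nn_integral_exp_log_sum_square order_refl) auto
    also have "\<dots> = ennreal ((\<epsilon> / 4 + 1 / (4 * l) * (\<epsilon> * l)) + (2 * l * tilt_bound x + 2 * l * a\<^sup>2))"
    proof -
      have nn: "0 \<le> \<epsilon> / 4" "0 \<le> 1 / (4 * l)" "0 \<le> \<epsilon> * l" "0 \<le> 2 * l" "0 \<le> tilt_bound x" "0 \<le> 2 * l * a\<^sup>2"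
        using \<epsilon> l by (auto simp: tilt_bound_def)
      show ?thesis by (simp only: ennreal_plus ennreal_mult add_nonneg_nonneg mult_nonneg_nonneg nn)
    qed
    also have "(\<epsilon> / 4 + 1 / (4 * l) * (\<epsilon> * l)) + (2 * l * tilt_bound x + 2 * l * a\<^sup>2) = \<epsilon> / 4 + \<epsilon> / 4 + 2 * l * M2"
      using l(1) by (simp add: M2_def algebra_simps)
    also have "\<dots> \<le> \<epsilon>" unfolding l(2) using \<epsilon> by simp
    finally show ?case using \<epsilon> by (simp add: ennreal_leI order_trans)
  qed
qed

lemma exp_U_le: "exp (- \<gamma> * U x) \<le> exp (\<gamma> * C + \<gamma> * theta x)"
  using mult_left_mono[OF U_ge[of x] gamma_nonneg] by (simp add: algebra_simps)

lemma nn_integral_gauss_theta_finite: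
  assumes "0 \<le> c"
  shows "(\<integral>\<^sup>+x. ennreal (exp (a + c * theta x - x\<^sup>2)) \<partial>lborel) < \<infinity>"
proof -
  have "(\<integral>\<^sup>+x. ennreal (exp (a + c * theta x - x\<^sup>2)) \<partial>lborel) \<le> (\<integral>\<^sup>+x. ennreal (exp (a + c\<^sup>2 / 2) * exp (- x\<^sup>2 / 2)) \<partial>lborel)"
    by (intro nn_integral_mono ennreal_leI exp_theta_gauss_le assms)
  also have "\<dots> = ennreal (\<integral>x. exp (a + c\<^sup>2 / 2) * exp (- x\<^sup>2 / 2) \<partial>lborel)"
    using integrable_exp_minus_half_square by (intro nn_integral_eq_integral) auto
  finally show ?thesis by (simp add: le_less_trans)
qed

lemma nn_integral_ensemble_measurable:
  assumes [measurable]: "(\<lambda>p. F (fst p) (snd p)) \<in> borel_measurable (borel \<Otimes>\<^sub>M RN (n k))"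
  shows "(\<lambda>x. \<integral>\<^sup>+y. F x y \<partial>ensemble (b k) (n k)) \<in> borel_measurable borel"
proof -
  interpret prob_space "ensemble (b k) (n k)" by (rule prob_space_P)
  have "(\<lambda>p. F (fst p) (snd p)) \<in> borel_measurable (borel \<Otimes>\<^sub>M ensemble (b k) (n k))" by measurable
  then show ?thesis by measurable
qed

lemma L1_dist_measurable [measurable]: "L1_dist k \<in> borel_measurable borel"
  unfolding L1_dist_def[abs_def] by (rule nn_integral_ensemble_measurable) measurable

definition total_dist :: "nat \<Rightarrow> ennreal" where
  "total_dist k = (\<integral>\<^sup>+x. ennreal (exp (- x\<^sup>2)) * L1_dist k x \<partial>lborel)"

text \<open>Dominated convergence in x: the moment bound and exp (-\<gamma> U x) grow at most
  polynomially in |x|, against the Gaussian weight.\<close>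

lemma total_dist_tendsto: "total_dist \<longlonglongrightarrow> 0"
proof -
  define w where "w = (\<lambda>x. ennreal (exp (0 + 0 * theta x - x\<^sup>2))
    + ennreal (exp (2 * (\<gamma> + 1) + (\<gamma> + 1)\<^sup>2 / 2 + 2 * (\<gamma> + 1) * theta x - x\<^sup>2))
    + ennreal (exp (\<gamma> * C + \<gamma> * theta x - x\<^sup>2)))"
  have "(\<lambda>k. \<integral>\<^sup>+x. ennreal (exp (- x\<^sup>2)) * L1_dist k x \<partial>lborel) \<longlonglongrightarrow> (\<integral>\<^sup>+(x::real). 0 \<partial>lborel)"
  proof (rule nn_integral_dominated_convergence)
    show "w \<in> borel_measurable lborel" unfolding w_def by measurable
    show "(\<integral>\<^sup>+x. w x \<partial>lborel) < \<infinity>"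
    proof -
      have "(\<integral>\<^sup>+x. w x \<partial>lborel) = (\<integral>\<^sup>+x. ennreal (exp (0 + 0 * theta x - x\<^sup>2)) \<partial>lborel)
        + (\<integral>\<^sup>+x. ennreal (exp (2 * (\<gamma> + 1) + (\<gamma> + 1)\<^sup>2 / 2 + 2 * (\<gamma> + 1) * theta x - x\<^sup>2)) \<partial>lborel)
        + (\<integral>\<^sup>+x. ennreal (exp (\<gamma> * C + \<gamma> * theta x - x\<^sup>2)) \<partial>lborel)"
        unfolding w_def by (simp add: nn_integral_add)
      also have "\<dots> < \<infinity>"
      proof -
        have "2 * (\<gamma> + 1) \<ge> 0" using gamma_nonneg by simp
        from nn_integral_gauss_theta_finite[OF order_refl, of 0] nn_integral_gauss_theta_finite[OF gamma_nonneg, of "\<gamma> * C"]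
          nn_integral_gauss_theta_finite[OF this, of "2 * (\<gamma> + 1) + (\<gamma> + 1)\<^sup>2 / 2"]
        show ?thesis by (simp only: ennreal_add_less_top infinity_ennreal_def)
      qed
      finally show ?thesis .
    qed
    show "AE x in lborel. ennreal (exp (- x\<^sup>2)) * L1_dist k x \<le> w x" for k
    proof (rule AE_I2)
      fix x
      have "L1_dist k x \<le> (\<integral>\<^sup>+y. ennreal (exp (b k * log_sum (n k) x y)) + ennreal (exp (- \<gamma> * U x)) \<partial>ensemble (b k) (n k))"
        unfolding L1_dist_def
      proof (rule nn_integral_mono)
        fix y
        have "\<bar>exp (b k * log_sum (n k) x y) - exp (- \<gamma> * U x)\<bar> \<le> exp (b k * log_sum (n k) x y) + exp (- \<gamma> * U x)"
          using exp_gt_zero[of "b k * log_sum (n k) x y"] exp_gt_zero[of "- \<gamma> * U x"] by linarith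
        then have "ennreal \<bar>exp (b k * log_sum (n k) x y) - exp (- \<gamma> * U x)\<bar>
          \<le> ennreal (exp (b k * log_sum (n k) x y) + exp (- \<gamma> * U x))" by (rule ennreal_leI)
        then show "ennreal \<bar>exp (b k * log_sum (n k) x y) - exp (- \<gamma> * U x)\<bar>
          \<le> ennreal (exp (b k * log_sum (n k) x y)) + ennreal (exp (- \<gamma> * U x))" by simp
      qed
      also have "\<dots> = (\<integral>\<^sup>+y. ennreal (exp (b k * log_sum (n k) x y)) \<partial>ensemble (b k) (n k)) + ennreal (exp (- \<gamma> * U x))"
        by (subst nn_integral_add) auto
      also have "\<dots> \<le> ennreal (1 + tilt_bound x) + ennreal (exp (\<gamma> * C + \<gamma> * theta x))"
        by (intro add_mono nn_integral_exp_log_sum ennreal_leI exp_U_le)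
      finally have "ennreal (exp (- x\<^sup>2)) * L1_dist k x
        \<le> ennreal (exp (- x\<^sup>2)) * (ennreal (1 + tilt_bound x) + ennreal (exp (\<gamma> * C + \<gamma> * theta x)))"
        by (intro mult_left_mono) auto
      also have "\<dots> = ennreal (exp (- x\<^sup>2) * (1 + tilt_bound x + exp (\<gamma> * C + \<gamma> * theta x)))"
        by (simp add: ennreal_mult tilt_bound_def)
      also have "exp (- x\<^sup>2) * (1 + tilt_bound x + exp (\<gamma> * C + \<gamma> * theta x))
        = exp (0 + 0 * theta x - x\<^sup>2) + exp (2 * (\<gamma> + 1) + (\<gamma> + 1)\<^sup>2 / 2 + 2 * (\<gamma> + 1) * theta x - x\<^sup>2)
          + exp (\<gamma> * C + \<gamma> * theta x - x\<^sup>2)"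
        proof -
          have "exp (- x\<^sup>2) * exp u = exp (u - x\<^sup>2)" for u by (simp add: exp_add[symmetric])
          then show ?thesis by (simp only: tilt_bound_def distrib_left mult_1_right) simp
        qed
      also have "ennreal \<dots> = w x" by (simp add: w_def)
      finally show "ennreal (exp (- x\<^sup>2)) * L1_dist k x \<le> w x" .
    qed
    show "AE x in lborel. (\<lambda>k. ennreal (exp (- x\<^sup>2)) * L1_dist k x) \<longlonglongrightarrow> 0"
    proof (rule AE_I2)
      fix x
      have "(\<lambda>k. ennreal (exp (- x\<^sup>2)) * L1_dist k x) \<longlonglongrightarrow> ennreal (exp (- x\<^sup>2)) * 0"
        by (intro ennreal_tendsto_cmult L1_dist_tendsto) simp
      then show "(\<lambda>k. ennreal (exp (- x\<^sup>2)) * L1_dist k x) \<longlonglongrightarrow> 0" by simp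
    qed
  qed measurable
  then show ?thesis by (simp add: total_dist_def[abs_def])
qed

section \<open>The limit of the ratios of partition functions, and removal of one particle\<close>

definition ratio :: "nat \<Rightarrow> real" where
  "ratio k = partition (b k) (Suc (n k)) / partition (b k) (n k)"

lemma ratio_pos: "0 < ratio k"
  using partition_pos[OF b0] by (simp add: ratio_def)

lemma ensemble_Suc:
  assumes "F \<in> borel_measurable (RN (Suc (n k)))"
  shows "(\<integral>\<^sup>+y. F y \<partial>ensemble (b k) (Suc (n k)))
    = (\<integral>\<^sup>+x. ennreal (exp (- x\<^sup>2) / ratio k)
        * (\<integral>\<^sup>+y. ennreal (exp (b k * log_sum (n k) x y)) * F (y(Suc (n k) := x)) \<partial>ensemble (b k) (n k)) \<partial>lborel)"
  by (subst nn_integral_ensemble_Suc[OF b0 assms]) (simp add: ratio_def mult.commute)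

text \<open>The ensemble with one more particle has total mass 1; this is that mass after splitting
  off the additional particle.\<close>

lemma ennreal_ratio:
  "ennreal (ratio k) = (\<integral>\<^sup>+x. ennreal (exp (- x\<^sup>2)) * (\<integral>\<^sup>+y. ennreal (exp (b k * log_sum (n k) x y)) \<partial>ensemble (b k) (n k)) \<partial>lborel)"
proof -
  have [measurable]: "(\<lambda>x. \<integral>\<^sup>+y. ennreal (exp (b k * log_sum (n k) x y)) \<partial>ensemble (b k) (n k)) \<in> borel_measurable borel"
    by (rule nn_integral_ensemble_measurable) measurable
  have "ennreal (ratio k) = ennreal (ratio k) * (\<integral>\<^sup>+y. 1 \<partial>ensemble (b k) (Suc (n k)))"
    using prob_space.emeasure_space_1[OF prob_space_ensemble[OF b0]] by simp
  also have "\<dots> = ennreal (ratio k) * (\<integral>\<^sup>+x. ennreal (exp (- x\<^sup>2) / ratio k)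
        * (\<integral>\<^sup>+y. ennreal (exp (b k * log_sum (n k) x y)) \<partial>ensemble (b k) (n k)) \<partial>lborel)"
    by (subst ensemble_Suc) auto
  also have "\<dots> = (\<integral>\<^sup>+x. ennreal (ratio k) * (ennreal (exp (- x\<^sup>2) / ratio k)
        * (\<integral>\<^sup>+y. ennreal (exp (b k * log_sum (n k) x y)) \<partial>ensemble (b k) (n k))) \<partial>lborel)"
    by (rule nn_integral_cmult[symmetric]) measurable
  also have "\<dots> = (\<integral>\<^sup>+x. ennreal (exp (- x\<^sup>2)) * (\<integral>\<^sup>+y. ennreal (exp (b k * log_sum (n k) x y)) \<partial>ensemble (b k) (n k)) \<partial>lborel)"
    using ratio_pos[of k] by (intro nn_integral_cong) (simp add: mult.assoc[symmetric] ennreal_mult[symmetric])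
  finally show ?thesis .
qed

lemma ennreal_L: "ennreal L = (\<integral>\<^sup>+x. ennreal (exp (- x\<^sup>2)) * ennreal (exp (- \<gamma> * U x)) \<partial>lborel)"
proof -
  have "(\<integral>\<^sup>+x. ennreal (exp (- x\<^sup>2)) * ennreal (exp (- \<gamma> * U x)) \<partial>lborel) = (\<integral>\<^sup>+x. ennreal (L * f x) \<partial>lborel)"
    using L_pos by (intro nn_integral_cong) (simp add: f_eq ennreal_mult[symmetric] exp_add[symmetric] algebra_simps)
  also have "\<dots> = ennreal (\<integral>x. L * f x \<partial>lborel)"
    using f_integrable L_pos by (intro nn_integral_eq_integral) auto
  finally show ?thesis by (simp add: f_integral)
qed

lemma ratio_bounds:
  "ennreal (ratio k) \<le> ennreal L + total_dist k" "ennreal L \<le> ennreal (ratio k) + total_dist k"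
proof -
  let ?I = "\<lambda>x. \<integral>\<^sup>+y. ennreal (exp (b k * log_sum (n k) x y)) \<partial>ensemble (b k) (n k)"
  have [measurable]: "?I \<in> borel_measurable borel"
    by (rule nn_integral_ensemble_measurable) measurable
  have 1: "?I x \<le> ennreal (exp (- \<gamma> * U x)) + L1_dist k x" for x
  proof -
    have "?I x \<le> (\<integral>\<^sup>+y. ennreal (exp (- \<gamma> * U x)) + ennreal \<bar>exp (b k * log_sum (n k) x y) - exp (- \<gamma> * U x)\<bar> \<partial>ensemble (b k) (n k))"
      by (intro nn_integral_mono) (simp add: ennreal_plus[symmetric] ennreal_leI del: ennreal_plus)
    also have "\<dots> = ennreal (exp (- \<gamma> * U x)) + L1_dist k x"
      unfolding L1_dist_def by (subst nn_integral_add) auto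
    finally show ?thesis .
  qed
  have 2: "ennreal (exp (- \<gamma> * U x)) \<le> ?I x + L1_dist k x" for x
  proof -
    have "ennreal (exp (- \<gamma> * U x)) = (\<integral>\<^sup>+y. ennreal (exp (- \<gamma> * U x)) \<partial>ensemble (b k) (n k))" by simp
    also have "\<dots> \<le> (\<integral>\<^sup>+y. ennreal (exp (b k * log_sum (n k) x y)) + ennreal \<bar>exp (b k * log_sum (n k) x y) - exp (- \<gamma> * U x)\<bar> \<partial>ensemble (b k) (n k))"
      by (intro nn_integral_mono) (simp add: ennreal_plus[symmetric] ennreal_leI del: ennreal_plus)
    also have "\<dots> = ?I x + L1_dist k x"
      unfolding L1_dist_def by (subst nn_integral_add) auto
    finally show ?thesis .
  qed
  have "ennreal (ratio k) \<le> (\<integral>\<^sup>+x. ennreal (exp (- x\<^sup>2)) * ennreal (exp (- \<gamma> * U x)) + ennreal (exp (- x\<^sup>2)) * L1_dist k x \<partial>lborel)"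
    unfolding ennreal_ratio distrib_left[symmetric] by (intro nn_integral_mono mult_left_mono 1) simp
  also have "\<dots> = ennreal L + total_dist k"
    unfolding total_dist_def ennreal_L by (rule nn_integral_add) measurable
  finally show "ennreal (ratio k) \<le> ennreal L + total_dist k" .
  have "ennreal L \<le> (\<integral>\<^sup>+x. ennreal (exp (- x\<^sup>2)) * ?I x + ennreal (exp (- x\<^sup>2)) * L1_dist k x \<partial>lborel)"
    unfolding ennreal_L distrib_left[symmetric] by (intro nn_integral_mono mult_left_mono 2) simp
  also have "\<dots> = ennreal (ratio k) + total_dist k"
    unfolding total_dist_def ennreal_ratio by (rule nn_integral_add) measurable
  finally show "ennreal L \<le> ennreal (ratio k) + total_dist k" .
qed

lemma ratio_tendsto: "ratio \<longlonglongrightarrow> L"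
proof (rule LIMSEQ_I)
  fix r :: real assume r: "0 < r"
  have "\<forall>\<^sub>F k in sequentially. total_dist k < ennreal r"
    using total_dist_tendsto r by (intro order_tendstoD(2)) auto
  then have "\<forall>\<^sub>F k in sequentially. norm (ratio k - L) < r"
  proof eventually_elim
    case (elim k)
    then obtain t where t: "total_dist k = ennreal t" "0 \<le> t" "t < r"
      by (cases "total_dist k") (auto simp: ennreal_less_iff)
    have le: "ennreal (ratio k) \<le> ennreal (L + t)" "ennreal L \<le> ennreal (ratio k + t)"
      using ratio_bounds[of k] t L_pos ratio_pos[of k] by (auto simp: ennreal_plus[symmetric] simp del: ennreal_plus)
    have "ratio k \<le> L + t" using le(1) t L_pos by (subst (asm) ennreal_le_iff) auto
    moreover have "L \<le> ratio k + t" using le(2) t ratio_pos[of k] by (subst (asm) ennreal_le_iff) auto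
    ultimately show ?case using t by (auto simp: abs_less_iff)
  qed
  then show "\<exists>no. \<forall>k\<ge>no. norm (ratio k - L) < r" by (simp add: eventually_sequentially)
qed

text \<open>Closeness in total variation, stated with test functions \<open>F'\<close> that ignore the last
  coordinate.\<close>

lemma remove_particle:
  obtains \<epsilon> :: "nat \<Rightarrow> ennreal" where "\<epsilon> \<longlonglongrightarrow> 0"
    "\<And>k F F'. F \<in> borel_measurable (RN (n k)) \<Longrightarrow> F' \<in> borel_measurable (RN (Suc (n k))) \<Longrightarrow>
      (\<And>y. F y \<le> 1) \<Longrightarrow> (\<And>y x. y \<in> space (RN (n k)) \<Longrightarrow> F' (y(Suc (n k) := x)) = F y) \<Longrightarrow>
      (\<integral>\<^sup>+y. F' y \<partial>ensemble (b k) (Suc (n k))) \<le> (\<integral>\<^sup>+y. F y \<partial>ensemble (b k) (n k)) + \<epsilon> k \<and>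
      (\<integral>\<^sup>+y. F y \<partial>ensemble (b k) (n k)) \<le> (\<integral>\<^sup>+y. F' y \<partial>ensemble (b k) (Suc (n k))) + \<epsilon> k"
proof -
  \<comment> \<open>The two errors are the L1 distance of the unnormalized conditional densities and
    the discrepancy between the normalizations 1 / ratio and 1 / L.\<close>
  define \<epsilon> where "\<epsilon> = (\<lambda>k. ennreal (1 / ratio k) * total_dist k + ennreal (\<bar>1 / ratio k - 1 / L\<bar> * L))"
  have i: "(\<lambda>k. 1 / ratio k) \<longlonglongrightarrow> 1 / L" using L_pos by (intro tendsto_intros ratio_tendsto) auto
  have "\<epsilon> \<longlonglongrightarrow> ennreal (1 / L) * 0 + ennreal (\<bar>1 / L - 1 / L\<bar> * L)"
    unfolding \<epsilon>_def
    by (intro tendsto_add tendsto_ennrealI tendsto_mult_ennreal tendsto_intros i total_dist_tendsto) (use L_pos in auto)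
  then have \<epsilon>: "\<epsilon> \<longlonglongrightarrow> 0" by simp
  show ?thesis
  proof (rule that[OF \<epsilon>])
    fix k and F F' :: "(nat \<Rightarrow> real) \<Rightarrow> ennreal"
    assume F[measurable]: "F \<in> borel_measurable (RN (n k))" and F': "F' \<in> borel_measurable (RN (Suc (n k)))"
      and F1: "\<And>y. F y \<le> 1" and eq: "\<And>y x. y \<in> space (RN (n k)) \<Longrightarrow> F' (y(Suc (n k) := x)) = F y"
    let ?P = "ensemble (b k) (n k)"
    let ?A = "\<lambda>x y. exp (b k * log_sum (n k) x y)" and ?a = "\<lambda>x. exp (- \<gamma> * U x)"
    note R = ratio_pos[of k]
    define D where "D = (\<lambda>x. ennreal (1 / ratio k) * L1_dist k x + ennreal (\<bar>1 / ratio k - 1 / L\<bar> * ?a x))"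
    have [measurable]: "D \<in> borel_measurable borel" unfolding D_def by measurable
    have Dint: "(\<integral>\<^sup>+x. ennreal (exp (- x\<^sup>2)) * D x \<partial>lborel) = \<epsilon> k"
    proof -
      have "(\<integral>\<^sup>+x. ennreal (exp (- x\<^sup>2)) * D x \<partial>lborel)
        = (\<integral>\<^sup>+x. ennreal (1 / ratio k) * (ennreal (exp (- x\<^sup>2)) * L1_dist k x)
          + ennreal \<bar>1 / ratio k - 1 / L\<bar> * (ennreal (exp (- x\<^sup>2)) * ennreal (?a x)) \<partial>lborel)"
        by (intro nn_integral_cong) (simp add: D_def distrib_left ennreal_mult mult_ac)
      also have "\<dots> = ennreal (1 / ratio k) * total_dist k + ennreal \<bar>1 / ratio k - 1 / L\<bar> * ennreal L"
        unfolding total_dist_def ennreal_L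
        by (subst nn_integral_add, measurable, subst nn_integral_cmult, measurable, subst nn_integral_cmult, measurable)
      finally show ?thesis using L_pos by (simp add: \<epsilon>_def ennreal_mult)
    qed
    have Dle: "(\<integral>\<^sup>+y. ennreal \<bar>?A x y / ratio k - ?a x / L\<bar> \<partial>?P) \<le> D x" for x
    proof -
      have "(\<integral>\<^sup>+y. ennreal \<bar>?A x y / ratio k - ?a x / L\<bar> \<partial>?P)
        \<le> (\<integral>\<^sup>+y. ennreal (1 / ratio k) * ennreal \<bar>?A x y - ?a x\<bar> + ennreal (\<bar>1 / ratio k - 1 / L\<bar> * ?a x) \<partial>?P)"
      proof (rule nn_integral_mono)
        fix y
        have "?A x y / ratio k - ?a x / L = 1 / ratio k * (?A x y - ?a x) + (1 / ratio k - 1 / L) * ?a x"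
          by (simp add: algebra_simps)
        then have "\<bar>?A x y / ratio k - ?a x / L\<bar> \<le> \<bar>1 / ratio k * (?A x y - ?a x)\<bar> + \<bar>(1 / ratio k - 1 / L) * ?a x\<bar>"
          using abs_triangle_ineq[of "1 / ratio k * (?A x y - ?a x)" "(1 / ratio k - 1 / L) * ?a x"] by argo
        also have "\<dots> = 1 / ratio k * \<bar>?A x y - ?a x\<bar> + \<bar>1 / ratio k - 1 / L\<bar> * ?a x"
          unfolding abs_mult using R by simp
        finally have "ennreal \<bar>?A x y / ratio k - ?a x / L\<bar> \<le> ennreal (1 / ratio k * \<bar>?A x y - ?a x\<bar> + \<bar>1 / ratio k - 1 / L\<bar> * ?a x)"
          by (rule ennreal_leI)
        also have "\<dots> = ennreal (1 / ratio k) * ennreal \<bar>?A x y - ?a x\<bar> + ennreal (\<bar>1 / ratio k - 1 / L\<bar> * ?a x)"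
        proof -
          have nn: "0 \<le> 1 / ratio k" "0 \<le> \<bar>?A x y - ?a x\<bar>" "0 \<le> \<bar>1 / ratio k - 1 / L\<bar> * ?a x"
            using R by auto
          show ?thesis
            unfolding ennreal_plus[OF mult_nonneg_nonneg[OF nn(1,2)] nn(3)] ennreal_mult[OF nn(1,2)] ..
        qed
        finally show "ennreal \<bar>?A x y / ratio k - ?a x / L\<bar>
          \<le> ennreal (1 / ratio k) * ennreal \<bar>?A x y - ?a x\<bar> + ennreal (\<bar>1 / ratio k - 1 / L\<bar> * ?a x)" .
      qed
      also have "\<dots> = D x"
        unfolding D_def L1_dist_def by (simp add: nn_integral_add nn_integral_cmult)
      finally show ?thesis .
    qed
    have mA: "(\<lambda>x. \<integral>\<^sup>+y. ennreal (?A x y / ratio k) * F y \<partial>?P) \<in> borel_measurable borel"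
    proof (rule nn_integral_ensemble_measurable)
      have "(\<lambda>p. F (snd p)) \<in> borel_measurable (borel \<Otimes>\<^sub>M RN (n k))"
        by (rule measurable_compose[OF measurable_snd F])
      then show "(\<lambda>p. ennreal (?A (fst p) (snd p) / ratio k) * F (snd p)) \<in> borel_measurable (borel \<Otimes>\<^sub>M RN (n k))"
        by measurable
    qed
    have E1: "(\<integral>\<^sup>+y. F' y \<partial>ensemble (b k) (Suc (n k)))
      = (\<integral>\<^sup>+x. ennreal (exp (- x\<^sup>2)) * (\<integral>\<^sup>+y. ennreal (?A x y / ratio k) * F y \<partial>?P) \<partial>lborel)"
      unfolding ensemble_Suc[OF F']
    proof (rule nn_integral_cong)
      fix x
      have "(\<integral>\<^sup>+y. ennreal (?A x y / ratio k) * F y \<partial>?P) = (\<integral>\<^sup>+y. ennreal (1 / ratio k) * (ennreal (?A x y) * F' (y(Suc (n k) := x))) \<partial>?P)"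
        using R by (intro nn_integral_cong) (simp add: eq divide_inverse ennreal_mult mult_ac)
      also have "\<dots> = ennreal (1 / ratio k) * (\<integral>\<^sup>+y. ennreal (?A x y) * F' (y(Suc (n k) := x)) \<partial>?P)"
        using measurable_compose[OF upd_measurable F'] by (intro nn_integral_cmult) measurable
      finally show "ennreal (exp (- x\<^sup>2) / ratio k) * (\<integral>\<^sup>+y. ennreal (?A x y) * F' (y(Suc (n k) := x)) \<partial>?P)
        = ennreal (exp (- x\<^sup>2)) * (\<integral>\<^sup>+y. ennreal (?A x y / ratio k) * F y \<partial>?P)"
        using R by (simp add: mult.assoc[symmetric] ennreal_mult[symmetric])
    qed
    \<comment> \<open>The n-particle expectation is multiplied by 1, written as the integral of f.
      Both ensembles thereby become integrals over the removed coordinate with the same test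
      function F.\<close>
    have E2: "(\<integral>\<^sup>+y. F y \<partial>?P) = (\<integral>\<^sup>+x. ennreal (exp (- x\<^sup>2)) * (\<integral>\<^sup>+y. ennreal (?a x / L) * F y \<partial>?P) \<partial>lborel)"
    proof -
      have "(\<integral>\<^sup>+x. ennreal (exp (- x\<^sup>2)) * (\<integral>\<^sup>+y. ennreal (?a x / L) * F y \<partial>?P) \<partial>lborel)
        = (\<integral>\<^sup>+x. ennreal (f x) * (\<integral>\<^sup>+y. F y \<partial>?P) \<partial>lborel)"
      proof (rule nn_integral_cong)
        fix x
        have "(\<integral>\<^sup>+y. ennreal (?a x / L) * F y \<partial>?P) = ennreal (?a x / L) * (\<integral>\<^sup>+y. F y \<partial>?P)"
          by (rule nn_integral_cmult) measurable
        moreover have "ennreal (exp (- x\<^sup>2)) * ennreal (?a x / L) = ennreal (f x)"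
          using L_pos by (subst ennreal_mult[symmetric]) (auto simp: f_eq exp_diff exp_minus field_simps)
        ultimately show "ennreal (exp (- x\<^sup>2)) * (\<integral>\<^sup>+y. ennreal (?a x / L) * F y \<partial>?P) = ennreal (f x) * (\<integral>\<^sup>+y. F y \<partial>?P)"
          by (simp only: mult.assoc[symmetric])
      qed
      also have "\<dots> = (\<integral>\<^sup>+x. ennreal (f x) \<partial>lborel) * (\<integral>\<^sup>+y. F y \<partial>?P)"
        by (rule nn_integral_multc) measurable
      also have "(\<integral>\<^sup>+x. ennreal (f x) \<partial>lborel) = 1"
        using nn_integral_eq_integral[OF f_integrable] by (simp add: f_integral)
      finally show ?thesis by simp
    qed
    have le: "(\<integral>\<^sup>+y. ennreal (u y) * F y \<partial>?P) \<le> (\<integral>\<^sup>+y. ennreal (v y) * F y \<partial>?P) + (\<integral>\<^sup>+y. ennreal \<bar>u y - v y\<bar> \<partial>?P)"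
      if [measurable]: "u \<in> borel_measurable (RN (n k))" "v \<in> borel_measurable (RN (n k))" and uv: "\<And>y. 0 \<le> v y" for u v
    proof -
      have "(\<integral>\<^sup>+y. ennreal (u y) * F y \<partial>?P) \<le> (\<integral>\<^sup>+y. ennreal (v y) * F y + ennreal \<bar>u y - v y\<bar> \<partial>?P)"
      proof (rule nn_integral_mono)
        fix y
        have "ennreal (u y) \<le> ennreal (v y + \<bar>u y - v y\<bar>)" by (intro ennreal_leI) simp
        also have "\<dots> = ennreal (v y) + ennreal \<bar>u y - v y\<bar>" using uv by simp
        finally have "ennreal (u y) * F y \<le> (ennreal (v y) + ennreal \<bar>u y - v y\<bar>) * F y" by (rule mult_right_mono) simp
        also have "\<dots> = ennreal (v y) * F y + ennreal \<bar>u y - v y\<bar> * F y" by (rule distrib_right)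
        also have "\<dots> \<le> ennreal (v y) * F y + ennreal \<bar>u y - v y\<bar> * 1" by (intro add_left_mono mult_left_mono F1) simp
        finally show "ennreal (u y) * F y \<le> ennreal (v y) * F y + ennreal \<bar>u y - v y\<bar>" by simp
      qed
      also have "\<dots> = (\<integral>\<^sup>+y. ennreal (v y) * F y \<partial>?P) + (\<integral>\<^sup>+y. ennreal \<bar>u y - v y\<bar> \<partial>?P)"
        by (rule nn_integral_add) measurable
      finally show ?thesis .
    qed
    show "(\<integral>\<^sup>+y. F' y \<partial>ensemble (b k) (Suc (n k))) \<le> (\<integral>\<^sup>+y. F y \<partial>?P) + \<epsilon> k \<and>
      (\<integral>\<^sup>+y. F y \<partial>?P) \<le> (\<integral>\<^sup>+y. F' y \<partial>ensemble (b k) (Suc (n k))) + \<epsilon> k"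
    proof
      note [measurable] = mA
      have [measurable]: "(\<lambda>x. \<integral>\<^sup>+y. ennreal (?a x / L) * F y \<partial>?P) \<in> borel_measurable borel"
        by (subst nn_integral_cmult) measurable
      have "(\<integral>\<^sup>+y. F' y \<partial>ensemble (b k) (Suc (n k)))
        \<le> (\<integral>\<^sup>+x. ennreal (exp (- x\<^sup>2)) * (\<integral>\<^sup>+y. ennreal (?a x / L) * F y \<partial>?P) + ennreal (exp (- x\<^sup>2)) * D x \<partial>lborel)"
        unfolding E1 distrib_left[symmetric]
      proof (intro nn_integral_mono mult_left_mono)
        fix x
        show "(\<integral>\<^sup>+y. ennreal (?A x y / ratio k) * F y \<partial>?P) \<le> (\<integral>\<^sup>+y. ennreal (?a x / L) * F y \<partial>?P) + D x"
          by (rule order_trans[OF le add_left_mono[OF Dle]]) (use L_pos in auto)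
      qed simp
      also have "\<dots> = (\<integral>\<^sup>+y. F y \<partial>?P) + \<epsilon> k"
        unfolding E2 Dint[symmetric] by (rule nn_integral_add) measurable
      finally show "(\<integral>\<^sup>+y. F' y \<partial>ensemble (b k) (Suc (n k))) \<le> (\<integral>\<^sup>+y. F y \<partial>?P) + \<epsilon> k" .
      have "(\<integral>\<^sup>+y. F y \<partial>?P)
        \<le> (\<integral>\<^sup>+x. ennreal (exp (- x\<^sup>2)) * (\<integral>\<^sup>+y. ennreal (?A x y / ratio k) * F y \<partial>?P) + ennreal (exp (- x\<^sup>2)) * D x \<partial>lborel)"
        unfolding E2 distrib_left[symmetric]
      proof (intro nn_integral_mono mult_left_mono)
        fix x
        have "(\<integral>\<^sup>+y. ennreal \<bar>?a x / L - ?A x y / ratio k\<bar> \<partial>?P) \<le> D x"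
          using Dle[of x] by (simp only: abs_minus_commute)
        then show "(\<integral>\<^sup>+y. ennreal (?a x / L) * F y \<partial>?P) \<le> (\<integral>\<^sup>+y. ennreal (?A x y / ratio k) * F y \<partial>?P) + D x"
          by (intro order_trans[OF le add_left_mono]) (use R in \<open>auto simp: less_imp_le\<close>)
      qed simp
      also have "\<dots> = (\<integral>\<^sup>+y. F' y \<partial>ensemble (b k) (Suc (n k))) + \<epsilon> k"
        unfolding E1 Dint[symmetric] by (rule nn_integral_add) measurable
      finally show "(\<integral>\<^sup>+y. F y \<partial>?P) \<le> (\<integral>\<^sup>+y. F' y \<partial>ensemble (b k) (Suc (n k))) + \<epsilon> k" .
    qed
  qed
qed

text \<open>The density of the last of n + 1 particles is exp (-x^2) times a moment bounded by
  \<open>nn_integral_exp_log_sum\<close>, divided by the ratio, which converges to L > 0. Half of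
  the Gaussian absorbs the polynomial growth of the moment.\<close>

lemma last_particle_density_bound:
  obtains K where "0 < K" "\<And>k h. h \<in> borel_measurable borel \<Longrightarrow>
    (\<integral>\<^sup>+y. h (y (Suc (n k))) \<partial>ensemble (b k) (Suc (n k))) \<le> ennreal K * (\<integral>\<^sup>+x. h x * ennreal (exp (- x\<^sup>2 / 2)) \<partial>lborel)"
proof -
  have "(\<lambda>k. 1 / ratio k) \<longlonglongrightarrow> 1 / L" using L_pos by (intro tendsto_intros ratio_tendsto) auto
  then have "Bseq (\<lambda>k. 1 / ratio k)" by (intro convergent_imp_Bseq) (auto simp: convergent_def)
  then obtain R where R: "0 < R" "\<And>k. \<bar>1 / ratio k\<bar> \<le> R" by (auto simp: Bseq_def)
  define c where "c = 2 * (\<gamma> + 1)"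
  define a where "a = 2 * (\<gamma> + 1) + (\<gamma> + 1)\<^sup>2 / 2"
  define K where "K = R * (1 + exp (a + c\<^sup>2 / 2))"
  have K: "0 < K" using R by (simp add: K_def add_pos_pos)
  show ?thesis
  proof (rule that[OF K])
    fix k and h :: "real \<Rightarrow> ennreal" assume h[measurable]: "h \<in> borel_measurable borel"
    have mh: "(\<lambda>y. h (y (Suc (n k)))) \<in> borel_measurable (RN (Suc (n k)))"
      by (rule measurable_compose[OF measurable_coord h]) simp
    have "(\<integral>\<^sup>+y. h (y (Suc (n k))) \<partial>ensemble (b k) (Suc (n k)))
      = (\<integral>\<^sup>+x. ennreal (exp (- x\<^sup>2) / ratio k) * (\<integral>\<^sup>+y. ennreal (exp (b k * log_sum (n k) x y)) * h x \<partial>ensemble (b k) (n k)) \<partial>lborel)"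
      by (subst ensemble_Suc[OF mh]) simp
    also have "\<dots> \<le> (\<integral>\<^sup>+x. ennreal K * (h x * ennreal (exp (- x\<^sup>2 / 2))) \<partial>lborel)"
    proof (rule nn_integral_mono)
      fix x
      have "(\<integral>\<^sup>+y. ennreal (exp (b k * log_sum (n k) x y)) * h x \<partial>ensemble (b k) (n k)) \<le> ennreal (1 + tilt_bound x) * h x"
        by (subst nn_integral_multc) (auto intro!: mult_right_mono nn_integral_exp_log_sum)
      then have "ennreal (exp (- x\<^sup>2) / ratio k) * (\<integral>\<^sup>+y. ennreal (exp (b k * log_sum (n k) x y)) * h x \<partial>ensemble (b k) (n k))
        \<le> ennreal (exp (- x\<^sup>2) / ratio k) * (ennreal (1 + tilt_bound x) * h x)" by (intro mult_left_mono) auto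
      also have "\<dots> = ennreal (exp (- x\<^sup>2) / ratio k * (1 + tilt_bound x)) * h x"
      proof -
        have nn: "0 \<le> exp (- x\<^sup>2) / ratio k" "0 \<le> 1 + tilt_bound x"
          using ratio_pos[of k] by (simp_all add: tilt_bound_def less_imp_le)
        show ?thesis by (simp only: ennreal_mult[OF nn] mult.assoc)
      qed
      also have "\<dots> \<le> ennreal (K * exp (- x\<^sup>2 / 2)) * h x"
      proof (intro mult_right_mono ennreal_leI)
        have "exp (- x\<^sup>2) * (1 + tilt_bound x) = exp (- x\<^sup>2) + exp (a + c * theta x - x\<^sup>2)"
          by (simp add: tilt_bound_def a_def c_def algebra_simps exp_add[symmetric])
        also have "\<dots> \<le> exp (- x\<^sup>2 / 2) + exp (a + c\<^sup>2 / 2) * exp (- x\<^sup>2 / 2)"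
          using gamma_nonneg by (intro add_mono exp_theta_gauss_le) (auto simp: c_def)
        also have "\<dots> = (1 + exp (a + c\<^sup>2 / 2)) * exp (- x\<^sup>2 / 2)" by (simp add: algebra_simps)
        finally have 1: "exp (- x\<^sup>2) * (1 + tilt_bound x) \<le> (1 + exp (a + c\<^sup>2 / 2)) * exp (- x\<^sup>2 / 2)" .
        have "1 / ratio k * (exp (- x\<^sup>2) * (1 + tilt_bound x)) \<le> R * ((1 + exp (a + c\<^sup>2 / 2)) * exp (- x\<^sup>2 / 2))"
          using R(2)[of k] ratio_pos[of k] R(1) by (intro mult_mono[OF _ 1]) (auto simp: tilt_bound_def)
        then show "exp (- x\<^sup>2) / ratio k * (1 + tilt_bound x) \<le> K * exp (- x\<^sup>2 / 2)"
          by (simp add: K_def mult.assoc)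
      qed simp
      also have "\<dots> = ennreal K * (h x * ennreal (exp (- x\<^sup>2 / 2)))"
        using K by (simp add: ennreal_mult mult_ac)
      finally show "ennreal (exp (- x\<^sup>2) / ratio k) * (\<integral>\<^sup>+y. ennreal (exp (b k * log_sum (n k) x y)) * h x \<partial>ensemble (b k) (n k))
        \<le> ennreal K * (h x * ennreal (exp (- x\<^sup>2 / 2)))" .
    qed
    also have "\<dots> = ennreal K * (\<integral>\<^sup>+x. h x * ennreal (exp (- x\<^sup>2 / 2)) \<partial>lborel)"
      by (rule nn_integral_cmult) measurable
    finally show "(\<integral>\<^sup>+y. h (y (Suc (n k))) \<partial>ensemble (b k) (Suc (n k))) \<le> ennreal K * (\<integral>\<^sup>+x. h x * ennreal (exp (- x\<^sup>2 / 2)) \<partial>lborel)" .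
  qed
qed

end

section \<open>The edge of the spectrum\<close>

lemma log_ratio_le:
  fixes x z :: real
  assumes x: "1 \<le> x"
  shows "ln \<bar>x - z\<bar> - ln x \<le> (1 + z\<^sup>2) / (2 * x)"
proof -
  have "2 * \<bar>z\<bar> \<le> 1 + z\<^sup>2" using zero_le_power2[of "\<bar>z\<bar> - 1"] by (simp add: power2_diff)
  then have z: "\<bar>z\<bar> / x \<le> (1 + z\<^sup>2) / (2 * x)" using x by (simp add: field_simps)
  show ?thesis
  proof (cases "x = z")
    case True
    have "0 \<le> (1 + z\<^sup>2) / (2 * x)" using x by simp
    moreover have "ln \<bar>x - z\<bar> - ln x \<le> 0" using True x by simp
    ultimately show ?thesis by linarith
  next
    case False
    have "\<bar>x - z\<bar> \<le> x * (1 + \<bar>z\<bar> / x)" using x by (simp add: algebra_simps abs_le_iff) linarith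
    then have "ln \<bar>x - z\<bar> \<le> ln (x * (1 + \<bar>z\<bar> / x))" using False by simp
    also have "\<dots> = ln x + ln (1 + \<bar>z\<bar> / x)" using x by (intro ln_mult_pos) (auto intro: add_pos_nonneg)
    also have "ln (1 + \<bar>z\<bar> / x) \<le> \<bar>z\<bar> / x" using x by (intro ln_add_one_self_le_self) simp
    finally show ?thesis using z by linarith
  qed
qed

text \<open>For |z| \<le> x / 2 the logarithm is at most 2 |z| / x. For |z| > x / 2 the Gaussian is
  at most 8 / x, which multiplies the singular term, while ln x \<le> x \<le> 4 z^2 / x. After
  integration every contribution is O(1/x).\<close>

lemma log_ratio_ge:
  fixes x z :: real
  assumes x: "1 \<le> x"
  shows "ennreal (ln x - ln \<bar>x - z\<bar>) * ennreal (exp (- z\<^sup>2 / 2))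
    \<le> ennreal (1 / x * ((1 + 5 * z\<^sup>2) * exp (- z\<^sup>2 / 2))) + ennreal (8 / x) * ennreal (ln (1 / \<bar>x - z\<bar>))"
proof (cases "\<bar>z\<bar> \<le> x / 2")
  case True
  have xz: "x / 2 \<le> \<bar>x - z\<bar>" "0 < \<bar>x - z\<bar>" using True x by (auto simp: abs_if split: if_splits)
  have "ln (x / \<bar>x - z\<bar>) \<le> x / \<bar>x - z\<bar> - 1" using x xz by (intro ln_le_minus_one) auto
  also have "\<dots> = (x - \<bar>x - z\<bar>) / \<bar>x - z\<bar>" using xz by (simp add: field_simps)
  also have "\<dots> \<le> \<bar>z\<bar> / (x / 2)" using xz x by (intro frac_le) auto
  also have "\<dots> = 2 * \<bar>z\<bar> / x" by simp
  also have "\<dots> \<le> (1 + 5 * z\<^sup>2) / x"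
  proof (intro divide_right_mono)
    have "2 * \<bar>z\<bar> \<le> 1 + z\<^sup>2" using zero_le_power2[of "\<bar>z\<bar> - 1"] by (simp add: power2_diff)
    then show "2 * \<bar>z\<bar> \<le> 1 + 5 * z\<^sup>2" using zero_le_power2[of z] by linarith
  qed (use x in simp)
  finally have "ln x - ln \<bar>x - z\<bar> \<le> (1 + 5 * z\<^sup>2) / x" using x xz by (simp add: ln_div)
  then have "(ln x - ln \<bar>x - z\<bar>) * exp (- z\<^sup>2 / 2) \<le> (1 + 5 * z\<^sup>2) / x * exp (- z\<^sup>2 / 2)"
    by (intro mult_right_mono) auto
  then have "ennreal ((ln x - ln \<bar>x - z\<bar>) * exp (- z\<^sup>2 / 2)) \<le> ennreal (1 / x * ((1 + 5 * z\<^sup>2) * exp (- z\<^sup>2 / 2)))"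
    by (intro ennreal_leI) simp
  then show ?thesis by (simp add: ennreal_mult'' add_increasing2)
next
  case False
  define w where "w = ln x - ln \<bar>x - z\<bar>"
  have zz: "x\<^sup>2 / 4 \<le> z\<^sup>2"
  proof -
    have "(x / 2)\<^sup>2 \<le> \<bar>z\<bar>\<^sup>2" using False x by (intro power_mono) auto
    then show ?thesis by (simp add: power_divide)
  qed
  have "ln x \<le> x" using x ln_le_minus_one[of x] by simp
  also have "x \<le> 4 * z\<^sup>2 / x" using zz x by (simp add: field_simps power2_eq_square)
  also have "\<dots> \<le> (1 + 5 * z\<^sup>2) / x" using x by (intro divide_right_mono) auto
  finally have lx: "ln x \<le> (1 + 5 * z\<^sup>2) / x" .
  have e8: "exp (- z\<^sup>2 / 2) \<le> 8 / x"
  proof -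
    have "x / 8 \<le> x\<^sup>2 / 8" using x by (simp add: power2_eq_square)
    also have "\<dots> \<le> z\<^sup>2 / 2" using zz by simp
    also have "\<dots> \<le> exp (z\<^sup>2 / 2)" using exp_ge_add_one_self[of "z\<^sup>2 / 2"] by linarith
    finally have "x / 8 \<le> exp (z\<^sup>2 / 2)" .
    then have "1 / exp (z\<^sup>2 / 2) \<le> 1 / (x / 8)" using x by (intro divide_left_mono) auto
    then show ?thesis by (simp add: exp_minus inverse_eq_divide)
  qed
  have "w \<le> ln x + max 0 (ln (1 / \<bar>x - z\<bar>))" by (cases "x = z") (auto simp: w_def ln_div)
  then have "w * exp (- z\<^sup>2 / 2) \<le> (ln x + max 0 (ln (1 / \<bar>x - z\<bar>))) * exp (- z\<^sup>2 / 2)"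
    by (intro mult_right_mono) auto
  also have "\<dots> = ln x * exp (- z\<^sup>2 / 2) + exp (- z\<^sup>2 / 2) * max 0 (ln (1 / \<bar>x - z\<bar>))" by (simp add: algebra_simps)
  also have "\<dots> \<le> (1 + 5 * z\<^sup>2) / x * exp (- z\<^sup>2 / 2) + 8 / x * max 0 (ln (1 / \<bar>x - z\<bar>))"
    using lx e8 by (intro add_mono mult_right_mono) auto
  finally have "ennreal (w * exp (- z\<^sup>2 / 2)) \<le> ennreal ((1 + 5 * z\<^sup>2) / x * exp (- z\<^sup>2 / 2) + 8 / x * max 0 (ln (1 / \<bar>x - z\<bar>)))"
    by (rule ennreal_leI)
  also have "\<dots> = ennreal ((1 + 5 * z\<^sup>2) / x * exp (- z\<^sup>2 / 2)) + ennreal (8 / x * max 0 (ln (1 / \<bar>x - z\<bar>)))"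
    using x by (intro ennreal_plus) auto
  also have "ennreal (8 / x * max 0 (ln (1 / \<bar>x - z\<bar>))) = ennreal (8 / x) * ennreal (max 0 (ln (1 / \<bar>x - z\<bar>)))"
    using x by (intro ennreal_mult) auto
  also have "ennreal (max 0 (ln (1 / \<bar>x - z\<bar>))) = ennreal (ln (1 / \<bar>x - z\<bar>))"
    by (simp add: max_def ennreal_neg)
  finally show ?thesis by (simp add: w_def ennreal_mult'')
qed

lemma integrable_gauss_quadratic: "integrable lborel (\<lambda>z::real. (1 + 5 * z\<^sup>2) * exp (- z\<^sup>2 / 2))"
proof -
  have "integrable lborel (\<lambda>z. sqrt (2 * pi) * (std_normal_density z * z ^ 0) + 5 * sqrt (2 * pi) * (std_normal_density z * z ^ 2))"
    using integrable_std_normal_moment[of 0] integrable_std_normal_moment[of 2]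
    by (intro Bochner_Integration.integrable_add integrable_mult_right) auto
  then show ?thesis by (simp add: std_normal_density_def algebra_simps)
qed

lemma nn_integral_log_ratio_le:
  obtains c where "0 \<le> c" "\<And>x. 1 \<le> x \<Longrightarrow>
    (\<integral>\<^sup>+z. ennreal (ln x - ln \<bar>x - z\<bar>) * ennreal (exp (- z\<^sup>2 / 2)) \<partial>lborel) \<le> ennreal (c / x)"
proof -
  define m where "m = (\<integral>(z::real). (1 + 5 * z\<^sup>2) * exp (- z\<^sup>2 / 2) \<partial>lborel)"
  have m: "0 \<le> m" unfolding m_def by (intro Bochner_Integration.integral_nonneg) auto
  show ?thesis
  proof (rule that[of "m + 16"])
    fix x :: real assume x: "1 \<le> x"
    have "(\<integral>\<^sup>+z. ennreal (ln x - ln \<bar>x - z\<bar>) * ennreal (exp (- z\<^sup>2 / 2)) \<partial>lborel)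
      \<le> (\<integral>\<^sup>+z. ennreal (1 / x * ((1 + 5 * z\<^sup>2) * exp (- z\<^sup>2 / 2))) + ennreal (8 / x) * ennreal (ln (1 / \<bar>x - z\<bar>)) \<partial>lborel)"
      by (intro nn_integral_mono log_ratio_ge x)
    also have "\<dots> = (\<integral>\<^sup>+z. ennreal (1 / x * ((1 + 5 * z\<^sup>2) * exp (- z\<^sup>2 / 2))) \<partial>lborel)
      + (\<integral>\<^sup>+z. ennreal (8 / x) * ennreal (ln (1 / \<bar>x - z\<bar>)) \<partial>lborel)"
      by (rule nn_integral_add) measurable
    also have "(\<integral>\<^sup>+z. ennreal (8 / x) * ennreal (ln (1 / \<bar>x - z\<bar>)) \<partial>lborel)
      = ennreal (8 / x) * (\<integral>\<^sup>+z. ennreal (ln (1 / \<bar>x - z\<bar>)) \<partial>lborel)"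
      by (rule nn_integral_cmult) measurable
    also have "\<dots> \<le> ennreal (8 / x) * ennreal (2 * 1)"
      by (intro mult_left_mono nn_integral_ln_le) auto
    also have "\<dots> = ennreal (16 / x)" using x ennreal_mult[of "8 / x" "2 * 1"] by simp
    also have "(\<integral>\<^sup>+z. ennreal (1 / x * ((1 + 5 * z\<^sup>2) * exp (- z\<^sup>2 / 2))) \<partial>lborel) = ennreal (m / x)"
    proof -
      have "(\<integral>\<^sup>+z. ennreal (1 / x * ((1 + 5 * z\<^sup>2) * exp (- z\<^sup>2 / 2))) \<partial>lborel)
        = ennreal (\<integral>z. 1 / x * ((1 + 5 * z\<^sup>2) * exp (- z\<^sup>2 / 2)) \<partial>lborel)"
        using x integrable_gauss_quadratic
        by (intro nn_integral_eq_integral integrable_mult_right) (auto intro!: AE_I2 divide_nonneg_nonneg mult_nonneg_nonneg)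
      also have "(\<integral>z. 1 / x * ((1 + 5 * z\<^sup>2) * exp (- z\<^sup>2 / 2)) \<partial>lborel) = 1 / x * m"
        unfolding m_def by (rule integral_mult_right_zero)
      finally show ?thesis by simp
    qed
    also have "ennreal (m / x) + ennreal (16 / x) = ennreal (m / x + 16 / x)"
      using m x by (intro ennreal_plus[symmetric]) auto
    also have "m / x + 16 / x = (m + 16) / x" by (simp add: add_divide_distrib)
    finally show "(\<integral>\<^sup>+z. ennreal (ln x - ln \<bar>x - z\<bar>) * ennreal (exp (- z\<^sup>2 / 2)) \<partial>lborel) \<le> ennreal ((m + 16) / x)"
      by (simp add: add_left_mono order_trans)
  qed (use m in simp)
qed

lemma nn_integral_coord_exchange:
  assumes b: "0 \<le> b" and j: "j \<in> {1..n}" and h: "h \<in> borel_measurable borel"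
  shows "(\<integral>\<^sup>+y. h (y j) \<partial>ensemble b n) = (\<integral>\<^sup>+y. h (y n) \<partial>ensemble b n)"
proof -
  have n: "n \<in> {1..n}" using j by auto
  have "(\<integral>\<^sup>+y. h ((\<lambda>k\<in>{1..n}. y (Transposition.transpose j n k)) n) \<partial>ensemble b n) = (\<integral>\<^sup>+y. h (y n) \<partial>ensemble b n)"
    by (rule nn_integral_ensemble_swap[OF b j n]) (rule measurable_compose[OF measurable_coord[OF n] h])
  then show ?thesis using n by simp
qed

context mean_field_sequence
begin

text \<open>Let r = b sum (ln |x - y_j| - ln x). From |v - 1| = v - 1 + 2 (1 - v)_+ and 1 - e^r
  \<le> -r the claim reduces to upper bounds for the mean of e^r and for the mean of the negative
  part of r. The second is linear in the particles, so by exchangeability a density bound for one of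
  them suffices. Such a bound comes from an ensemble with one particle less, hence the hypothesis
  \<open>dens\<close>.\<close>

lemma edge_L1_bound:
  assumes K: "0 < K" and dens: "\<And>k h. h \<in> borel_measurable borel \<Longrightarrow>
    (\<integral>\<^sup>+y. h (y (n k)) \<partial>ensemble (b k) (n k)) \<le> ennreal K * (\<integral>\<^sup>+x. h x * ennreal (exp (- x\<^sup>2 / 2)) \<partial>lborel)"
  obtains c where "0 \<le> c" "\<And>k x. 1 \<le> x \<Longrightarrow>
    (\<integral>\<^sup>+y. ennreal \<bar>exp (b k * log_sum (n k) x y) / exp (b k * real (n k) * ln x) - 1\<bar> \<partial>ensemble (b k) (n k))
      \<le> ennreal (exp (c / x) - 1 + c / x)"
proof -
  obtain c0 where c0: "0 \<le> c0" "\<And>x. 1 \<le> x \<Longrightarrow>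
    (\<integral>\<^sup>+z. ennreal (ln x - ln \<bar>x - z\<bar>) * ennreal (exp (- z\<^sup>2 / 2)) \<partial>lborel) \<le> ennreal (c0 / x)"
    using nn_integral_log_ratio_le by blast
  define c1 where "c1 = (\<gamma> + 1) + (\<gamma> + 1)\<^sup>2 / 4"
  define c2 where "c2 = 2 * ((\<gamma> + 1) * (K * c0))"
  define c where "c = c1 + c2"
  have c12: "0 \<le> c1" "0 \<le> c2" using gamma_nonneg K c0(1) by (auto simp: c1_def c2_def)
  show ?thesis
  proof (rule that[of c])
    show "0 \<le> c" using c12 by (simp add: c_def)
    fix k and x :: real assume x: "1 \<le> x"
    let ?P = "ensemble (b k) (n k)"
    define B where "B = b k * real (n k)"
    have B: "0 \<le> B" "B \<le> \<gamma> + 1" using b0[of k] bn_le[of k] by (auto simp: B_def)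
    define r where "r = (\<lambda>y. b k * (\<Sum>j\<in>{1..n k}. ln \<bar>x - y j\<bar> - ln x))"
    have [measurable]: "r \<in> borel_measurable (RN (n k))" unfolding r_def by measurable
    have re: "exp (b k * log_sum (n k) x y) / exp (b k * real (n k) * ln x) = exp (r y)" for y
      by (simp add: r_def log_sum_def sum_subtractf exp_diff[symmetric] algebra_simps)
    have up: "(\<integral>\<^sup>+y. ennreal (exp (r y)) \<partial>?P) \<le> ennreal (exp (c1 / x))"
    proof -
      \<comment> \<open>The parameter of the exponential moment after ln |x - z| - ln x \<le> (1 +
        z^2) / (2 x).\<close>
      define a where "a = b k / (2 * x)"
      have a: "0 \<le> a" "a \<le> 1 / 2"
      proof -
        show "0 \<le> a" using b0[of k] x by (simp add: a_def)
        have "b k / (2 * x) \<le> b k / 1" using b0[of k] x by (intro divide_left_mono) auto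
        then show "a \<le> 1 / 2" using b_half[of k] by (simp add: a_def)
      qed
      have "(\<integral>\<^sup>+y. ennreal (exp (r y)) \<partial>?P) \<le> (\<integral>\<^sup>+y. ennreal (exp (a * real (n k))) * ennreal (exp (a * (\<Sum>j\<in>{1..n k}. (y j)\<^sup>2))) \<partial>?P)"
      proof (rule nn_integral_mono)
        fix y
        have "(\<Sum>j\<in>{1..n k}. ln \<bar>x - y j\<bar> - ln x) \<le> (\<Sum>j\<in>{1..n k}. (1 + (y j)\<^sup>2) / (2 * x))"
          by (intro sum_mono log_ratio_le x)
        also have "\<dots> = (real (n k) + (\<Sum>j\<in>{1..n k}. (y j)\<^sup>2)) / (2 * x)"
          by (simp add: sum_divide_distrib[symmetric] sum.distrib)
        finally have "r y \<le> b k * ((real (n k) + (\<Sum>j\<in>{1..n k}. (y j)\<^sup>2)) / (2 * x))"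
          unfolding r_def by (intro mult_left_mono b0)
        also have "\<dots> = a * real (n k) + a * (\<Sum>j\<in>{1..n k}. (y j)\<^sup>2)" by (simp add: a_def algebra_simps add_divide_distrib)
        finally have "ennreal (exp (r y)) \<le> ennreal (exp (a * real (n k)) * exp (a * (\<Sum>j\<in>{1..n k}. (y j)\<^sup>2)))"
          by (intro ennreal_leI) (simp add: exp_add[symmetric])
        then show "ennreal (exp (r y)) \<le> ennreal (exp (a * real (n k))) * ennreal (exp (a * (\<Sum>j\<in>{1..n k}. (y j)\<^sup>2)))"
          by (simp only: ennreal_mult exp_ge_zero)
      qed
      also have "\<dots> = ennreal (exp (a * real (n k))) * (\<integral>\<^sup>+y. ennreal (exp (a * (\<Sum>j\<in>{1..n k}. (y j)\<^sup>2))) \<partial>?P)"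
        by (rule nn_integral_cmult) measurable
      also have "\<dots> \<le> ennreal (exp (a * real (n k))) * ennreal (exp (a * (real (n k) + b k * (real (n k))\<^sup>2 / 2)))"
        by (intro mult_left_mono ensemble_exp_square_bound b0 a) auto
      also have "\<dots> = ennreal (exp ((B + B\<^sup>2 / 4) / x))"
      proof -
        have "a * real (n k) + a * (real (n k) + b k * (real (n k))\<^sup>2 / 2) = (B + B\<^sup>2 / 4) / x"
          using x by (simp add: a_def B_def field_simps power2_eq_square)
        then show ?thesis by (simp only: ennreal_mult[symmetric] exp_ge_zero exp_add[symmetric])
      qed
      also have "\<dots> \<le> ennreal (exp (c1 / x))"
      proof -
        have "B\<^sup>2 \<le> (\<gamma> + 1)\<^sup>2" using B by (intro power_mono) auto
        then have "B + B\<^sup>2 / 4 \<le> c1" unfolding c1_def using B by (intro add_mono divide_right_mono) auto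
        then have "(B + B\<^sup>2 / 4) / x \<le> c1 / x" using x by (intro divide_right_mono) auto
        then show ?thesis by (intro ennreal_leI) simp
      qed
      finally show ?thesis .
    qed
    define g where "g = (\<lambda>z. ennreal (ln x - ln \<bar>x - z\<bar>))"
    have gm[measurable]: "g \<in> borel_measurable borel" unfolding g_def by measurable
    have gj: "(\<lambda>y. g (y j)) \<in> borel_measurable (RN (n k))" if "j \<in> {1..n k}" for j
      by (rule measurable_compose[OF measurable_coord[OF that] gm])
    have down: "(\<integral>\<^sup>+y. ennreal (- r y) \<partial>?P) \<le> ennreal (c2 / (2 * x))"
    proof -
      have "(\<integral>\<^sup>+y. ennreal (- r y) \<partial>?P) \<le> (\<integral>\<^sup>+y. ennreal (b k) * (\<Sum>j\<in>{1..n k}. g (y j)) \<partial>?P)"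
      proof (rule nn_integral_mono)
        fix y
        have "- r y = b k * (\<Sum>j\<in>{1..n k}. ln x - ln \<bar>x - y j\<bar>)"
          by (simp add: r_def sum_subtractf algebra_simps)
        also have "\<dots> \<le> b k * (\<Sum>j\<in>{1..n k}. max 0 (ln x - ln \<bar>x - y j\<bar>))"
          by (intro mult_left_mono sum_mono b0) auto
        finally have "ennreal (- r y) \<le> ennreal (b k * (\<Sum>j\<in>{1..n k}. max 0 (ln x - ln \<bar>x - y j\<bar>)))"
          by (rule ennreal_leI)
        also have "\<dots> = ennreal (b k) * ennreal (\<Sum>j\<in>{1..n k}. max 0 (ln x - ln \<bar>x - y j\<bar>))"
          by (intro ennreal_mult b0 sum_nonneg) auto
        also have "ennreal (\<Sum>j\<in>{1..n k}. max 0 (ln x - ln \<bar>x - y j\<bar>)) = (\<Sum>j\<in>{1..n k}. ennreal (max 0 (ln x - ln \<bar>x - y j\<bar>)))"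
          by (intro sum_ennreal[symmetric]) auto
        also have "\<dots> = (\<Sum>j\<in>{1..n k}. g (y j))"
          by (intro sum.cong refl) (auto simp: g_def max_def ennreal_neg)
        finally show "ennreal (- r y) \<le> ennreal (b k) * (\<Sum>j\<in>{1..n k}. g (y j))" .
      qed
      also have "\<dots> = ennreal (b k) * (\<Sum>j\<in>{1..n k}. (\<integral>\<^sup>+y. g (y j) \<partial>?P))"
      proof -
        have "(\<integral>\<^sup>+y. ennreal (b k) * (\<Sum>j\<in>{1..n k}. g (y j)) \<partial>?P) = ennreal (b k) * (\<integral>\<^sup>+y. (\<Sum>j\<in>{1..n k}. g (y j)) \<partial>?P)"
          using gj by (intro nn_integral_cmult borel_measurable_sum) auto
        also have "(\<integral>\<^sup>+y. (\<Sum>j\<in>{1..n k}. g (y j)) \<partial>?P) = (\<Sum>j\<in>{1..n k}. (\<integral>\<^sup>+y. g (y j) \<partial>?P))"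
          using gj by (intro nn_integral_sum) auto
        finally show ?thesis .
      qed
      also have "(\<Sum>j\<in>{1..n k}. (\<integral>\<^sup>+y. g (y j) \<partial>?P)) = (\<Sum>j\<in>{1..n k}. (\<integral>\<^sup>+y. g (y (n k)) \<partial>?P))"
        by (intro sum.cong refl nn_integral_coord_exchange b0 gm)
      also have "\<dots> = ennreal (real (n k)) * (\<integral>\<^sup>+y. g (y (n k)) \<partial>?P)"
        by (simp add: ennreal_of_nat_eq_real_of_nat)
      also have "ennreal (b k) * (ennreal (real (n k)) * (\<integral>\<^sup>+y. g (y (n k)) \<partial>?P)) = ennreal B * (\<integral>\<^sup>+y. g (y (n k)) \<partial>?P)"
        using b0[of k] by (simp add: B_def ennreal_mult mult.assoc)
      also have "\<dots> \<le> ennreal (\<gamma> + 1) * (ennreal K * ennreal (c0 / x))"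
      proof (intro mult_mono ennreal_leI B)
        have "(\<integral>\<^sup>+y. g (y (n k)) \<partial>?P) \<le> ennreal K * (\<integral>\<^sup>+z. g z * ennreal (exp (- z\<^sup>2 / 2)) \<partial>lborel)"
          by (rule dens[OF gm])
        also have "\<dots> \<le> ennreal K * ennreal (c0 / x)"
          unfolding g_def by (intro mult_left_mono c0(2) x) simp
        finally show "(\<integral>\<^sup>+y. g (y (n k)) \<partial>?P) \<le> ennreal K * ennreal (c0 / x)" .
      qed auto
      also have "\<dots> = ennreal ((\<gamma> + 1) * (K * (c0 / x)))"
        using gamma_nonneg K c0(1) x by (simp only: ennreal_mult[symmetric] add_nonneg_nonneg zero_le_one mult_nonneg_nonneg less_imp_le divide_nonneg_nonneg order_trans[OF zero_le_one x])
      also have "(\<gamma> + 1) * (K * (c0 / x)) = c2 / (2 * x)" using x by (simp add: c2_def field_simps)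
      finally show ?thesis .
    qed
    \<comment> \<open>The 1 is carried along because the integrals are in \<open>ennreal\<close>,
      where it cannot be subtracted from the mean of e^r; it is cancelled at the end.\<close>
    have "(\<integral>\<^sup>+y. ennreal \<bar>exp (r y) - 1\<bar> \<partial>?P) + 1 = (\<integral>\<^sup>+y. ennreal \<bar>exp (r y) - 1\<bar> + 1 \<partial>?P)"
      by (subst nn_integral_add) auto
    also have "\<dots> \<le> (\<integral>\<^sup>+y. ennreal (exp (r y)) + 2 * ennreal (- r y) \<partial>?P)"
    proof (rule nn_integral_mono)
      fix y
      have "\<bar>exp (r y) - 1\<bar> + 1 \<le> exp (r y) + 2 * max 0 (- r y)"
        using exp_ge_add_one_self[of "r y"] by linarith
      then have "ennreal (\<bar>exp (r y) - 1\<bar> + 1) \<le> ennreal (exp (r y) + 2 * max 0 (- r y))" by (rule ennreal_leI)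
      also have "\<dots> = ennreal (exp (r y)) + ennreal (2 * max 0 (- r y))" by (intro ennreal_plus) auto
      also have "ennreal (2 * max 0 (- r y)) = 2 * ennreal (- r y)"
        using ennreal_mult[of 2 "max 0 (- r y)"] by (simp add: max_def ennreal_neg split: if_splits)
      finally show "ennreal \<bar>exp (r y) - 1\<bar> + 1 \<le> ennreal (exp (r y)) + 2 * ennreal (- r y)" by simp
    qed
    also have "\<dots> = (\<integral>\<^sup>+y. ennreal (exp (r y)) \<partial>?P) + 2 * (\<integral>\<^sup>+y. ennreal (- r y) \<partial>?P)"
      by (simp add: nn_integral_add nn_integral_cmult)
    also have "\<dots> \<le> ennreal (exp (c1 / x)) + 2 * ennreal (c2 / (2 * x))"
      by (intro add_mono mult_left_mono up down) auto
    also have "2 * ennreal (c2 / (2 * x)) = ennreal (c2 / x)"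
      using ennreal_mult[of 2 "c2 / (2 * x)"] c12 x by simp
    also have "ennreal (exp (c1 / x)) + ennreal (c2 / x) = ennreal (exp (c1 / x) + c2 / x)"
      using c12 x by (intro ennreal_plus[symmetric]) auto
    also have "\<dots> \<le> ennreal ((exp (c / x) - 1 + c / x) + 1)"
    proof (intro ennreal_leI)
      have "c1 / x \<le> c / x" "c2 / x \<le> c / x" using c12 x by (auto simp: c_def divide_right_mono)
      then show "exp (c1 / x) + c2 / x \<le> (exp (c / x) - 1 + c / x) + 1" by (simp add: add_mono)
    qed
    also have "\<dots> = ennreal (exp (c / x) - 1 + c / x) + 1"
    proof -
      have "0 \<le> c / x" using c12 x by (simp add: c_def)
      then have "0 \<le> exp (c / x) - 1 + c / x" by simp
      then show ?thesis by (subst ennreal_plus) auto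
    qed
    finally have "1 + (\<integral>\<^sup>+y. ennreal \<bar>exp (r y) - 1\<bar> \<partial>?P) \<le> 1 + ennreal (exp (c / x) - 1 + c / x)"
      by (simp only: add.commute)
    then have "(\<integral>\<^sup>+y. ennreal \<bar>exp (r y) - 1\<bar> \<partial>?P) \<le> ennreal (exp (c / x) - 1 + c / x)"
      unfolding ennreal_add_left_cancel_le by simp
    then show "(\<integral>\<^sup>+y. ennreal \<bar>exp (b k * log_sum (n k) x y) / exp (b k * real (n k) * ln x) - 1\<bar> \<partial>?P)
      \<le> ennreal (exp (c / x) - 1 + c / x)" unfolding re .
  qed
qed

end

text \<open>Integration by parts: the derivative of \<open>- x\<^sup>a\<^sup>-\<^sup>1 e\<^sup>-\<^sup>x\<^sup>2 / 2\<close> is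
  \<open>x\<^sup>a e\<^sup>-\<^sup>x\<^sup>2 (1 - (a - 1) / (2 x\<^sup>2))\<close>.\<close>

lemma gauss_tail_bounds:
  fixes a D t :: real
  assumes t: "1 \<le> t" and D: "\<bar>a - 1\<bar> / 2 \<le> D" "D < t\<^sup>2"
  defines "G \<equiv> \<integral>\<^sup>+x. ennreal (exp (a * ln x - x\<^sup>2)) * indicator {t<..} x \<partial>lborel"
    and "\<phi> \<equiv> exp ((a - 1) * ln t - t\<^sup>2) / 2"
  shows "ennreal (\<phi> / (1 + D / t\<^sup>2)) \<le> G" "G \<le> ennreal (\<phi> / (1 - D / t\<^sup>2))"
proof -
  have D0: "0 \<le> D" using D(1) by (rule order_trans[rotated]) simp
  have t2: "0 < t\<^sup>2" using t by simp
  define g where "g = (\<lambda>x. exp (a * ln x - x\<^sup>2) * (1 - (a - 1) / (2 * x\<^sup>2)))"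
  \<comment> \<open>The correction factor is controlled at once for all x \<ge> t and for all
    exponents a at distance at most 2 D from 1, as these vary along the sequence.\<close>
  have q: "\<bar>(a - 1) / (2 * x\<^sup>2)\<bar> \<le> D / t\<^sup>2" if x: "t \<le> x" for x
  proof -
    have "t\<^sup>2 \<le> x\<^sup>2" using x t by (intro power_mono) auto
    then have "\<bar>a - 1\<bar> / 2 / x\<^sup>2 \<le> D / t\<^sup>2" using D(1) t2 by (intro frac_le) auto
    then show ?thesis by (simp add: abs_mult)
  qed
  have "D / t\<^sup>2 < 1" using D(2) t2 by simp
  have g0: "0 \<le> g x" if "t \<le> x" for x
  proof -
    have "(a - 1) / (2 * x\<^sup>2) \<le> 1" using abs_le_D1[OF q[OF that]] \<open>D / t\<^sup>2 < 1\<close> by linarith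
    then show ?thesis unfolding g_def by (intro mult_nonneg_nonneg) auto
  qed
  have FTC: "(\<integral>\<^sup>+x. ennreal (g x) * indicator {t..} x \<partial>lborel) = ennreal (0 - (- \<phi>))"
    unfolding \<phi>_def
  proof (rule nn_integral_FTC_atLeast[where F = "\<lambda>x. - (exp ((a - 1) * ln x - x\<^sup>2) / 2)", simplified minus_divide_left[symmetric]])
    show "g \<in> borel_measurable borel" unfolding g_def by measurable
    show "DERIV (\<lambda>x. - (exp ((a - 1) * ln x - x\<^sup>2) / 2)) x :> g x" if "t \<le> x" for x
    proof -
      have x: "0 < x" using that t by simp
      have e: "exp ((a - 1) * ln x - x\<^sup>2) = exp (a * ln x - x\<^sup>2) / x"
        using x by (simp add: left_diff_distrib exp_diff)
      have "DERIV (\<lambda>x. - (exp ((a - 1) * ln x - x\<^sup>2) / 2)) x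
        :> - (exp ((a - 1) * ln x - x\<^sup>2) * ((a - 1) / x - 2 * x) / 2)"
        using x by (auto intro!: derivative_eq_intros)
      also have "- (exp ((a - 1) * ln x - x\<^sup>2) * ((a - 1) / x - 2 * x) / 2) = g x"
        unfolding e g_def using x by (simp add: field_simps power2_eq_square)
      finally show ?thesis .
    qed
    show "0 \<le> g x" if "t \<le> x" for x by (rule g0[OF that])
    show "((\<lambda>x. - (exp ((a - 1) * ln x - x\<^sup>2) / 2)) \<longlongrightarrow> 0) at_top" by real_asymp
  qed
  have ae: "AE x in lborel. x \<noteq> t" by (rule AE_lborel_singleton)
  have g_eq: "(\<integral>\<^sup>+x. ennreal (g x) * indicator {t<..} x \<partial>lborel) = ennreal \<phi>"
  proof -
    have "(\<integral>\<^sup>+x. ennreal (g x) * indicator {t<..} x \<partial>lborel) = (\<integral>\<^sup>+x. ennreal (g x) * indicator {t..} x \<partial>lborel)"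
      by (intro nn_integral_cong_AE, use ae in eventually_elim) (auto simp: indicator_def)
    then show ?thesis using FTC by simp
  qed
  let ?h = "\<lambda>x. exp (a * ln x - x\<^sup>2)"
  define u where "u = 1 + D / t\<^sup>2"
  define l where "l = 1 - D / t\<^sup>2"
  have u: "0 < u" using D0 t2 by (simp add: u_def add_pos_nonneg)
  have l: "0 < l" using D(2) t2 by (simp add: l_def)
  have gu: "g x \<le> u * ?h x" and gl: "l * ?h x \<le> g x" if "t < x" for x
  proof -
    have "1 - (a - 1) / (2 * x\<^sup>2) \<le> u" "l \<le> 1 - (a - 1) / (2 * x\<^sup>2)"
      using abs_le_D1[OF q[of x]] abs_le_D2[OF q[of x]] that unfolding u_def l_def by linarith+
    then show "g x \<le> u * ?h x" "l * ?h x \<le> g x"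
      unfolding g_def by (simp_all add: mult.commute)
  qed
  have "ennreal \<phi> \<le> (\<integral>\<^sup>+x. ennreal u * (ennreal (?h x) * indicator {t<..} x) \<partial>lborel)"
    unfolding g_eq[symmetric]
  proof (rule nn_integral_mono)
    fix x
    show "ennreal (g x) * indicator {t<..} x \<le> ennreal u * (ennreal (?h x) * indicator {t<..} x)"
      using gu[of x] u by (cases "t < x") (auto simp: ennreal_mult[symmetric] intro!: ennreal_leI)
  qed
  also have "\<dots> = ennreal u * G" unfolding G_def by (rule nn_integral_cmult) measurable
  finally have 1: "ennreal \<phi> \<le> ennreal u * G" .
  have "ennreal l * G = (\<integral>\<^sup>+x. ennreal l * (ennreal (?h x) * indicator {t<..} x) \<partial>lborel)"
    unfolding G_def by (rule nn_integral_cmult[symmetric]) measurable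
  also have "\<dots> \<le> ennreal \<phi>"
    unfolding g_eq[symmetric]
  proof (rule nn_integral_mono)
    fix x
    show "ennreal l * (ennreal (?h x) * indicator {t<..} x) \<le> ennreal (g x) * indicator {t<..} x"
      using gl[of x] l by (cases "t < x") (auto simp: ennreal_mult[symmetric] intro!: ennreal_leI)
  qed
  finally have 2: "ennreal l * G \<le> ennreal \<phi>" .
  have \<phi>: "0 \<le> \<phi>" by (simp add: \<phi>_def)
  have "ennreal (\<phi> / u) = ennreal (1 / u) * ennreal \<phi>" using u \<phi> by (simp add: ennreal_mult[symmetric])
  also have "\<dots> \<le> ennreal (1 / u) * (ennreal u * G)" by (intro mult_left_mono 1) simp
  also have "\<dots> = G" using u by (simp add: mult.assoc[symmetric] ennreal_mult[symmetric])
  finally show "ennreal (\<phi> / (1 + D / t\<^sup>2)) \<le> G" by (simp add: u_def)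
  have "G = ennreal (1 / l) * (ennreal l * G)" using l by (simp add: mult.assoc[symmetric] ennreal_mult[symmetric])
  also have "\<dots> \<le> ennreal (1 / l) * ennreal \<phi>" by (intro mult_left_mono 2) simp
  also have "\<dots> = ennreal (\<phi> / l)" using l \<phi> by (simp add: ennreal_mult[symmetric])
  finally show "G \<le> ennreal (\<phi> / (1 - D / t\<^sup>2))" by (simp add: l_def)
qed

text \<open>The value of \<open>max x\<^sub>j\<close> for which \<open>\<xi>\<^sub>N = \<tau>\<close>.\<close>

definition threshold :: "real \<Rightarrow> real \<Rightarrow> nat \<Rightarrow> real \<Rightarrow> real" where
  "threshold L b N \<tau> = sqrt (ln (real N))
    + (\<tau> + (b * real N - 1) / 2 * ln (ln (real N)) - ln (2 * L)) / (2 * sqrt (ln (real N)))"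

text \<open>With l = ln N, c = (b N - 1) / 2 and s = \<tau> - ln (2 L) + c ln l the threshold is
  sqrt l (1 + s / (2 l)), so t^2 = l + s + s^2 / (4 l). Hence N e^(-t^2) is about e^(-s) = 2 L
  e^(-\<tau>) l^(-c); the power l^(-c) is cancelled by t^(b N - 1), about l^c, and 2 L by the
  prefactor. A particle interacts with only N - 1 others, which changes the exponent of t by b; this
  is harmless because b ln ln N tends to 0.\<close>

lemma threshold_asymptotics:
  fixes b :: "nat \<Rightarrow> real" and N :: "nat \<Rightarrow> nat" and \<gamma> \<tau> :: real
  assumes L: "0 < L" and N: "filterlim N at_top sequentially"
    and bN: "(\<lambda>k. b k * real (N k)) \<longlonglongrightarrow> \<gamma>"
  defines "t \<equiv> \<lambda>k. threshold L (b k) (N k) \<tau>"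
  shows "filterlim t at_top sequentially"
    and "(\<lambda>k. real (N k) / L * (exp ((b k * (real (N k) - 1) - 1) * ln (t k) - (t k)\<^sup>2) / 2)) \<longlonglongrightarrow> exp (- \<tau>)"
proof -
  define l where "l = (\<lambda>k. ln (real (N k)))"
  define c where "c = (\<lambda>k. (b k * real (N k) - 1) / 2)"
  define p where "p = \<tau> - ln (2 * L)"
  define s where "s = (\<lambda>k. p + c k * ln (l k))"
  have lim: "filterlim (\<lambda>k. h (N k)) F sequentially" if "filterlim h F at_top" for h :: "nat \<Rightarrow> real" and F
    using filterlim_compose[OF that N] .
  have l_lim: "filterlim l at_top sequentially" unfolding l_def by (rule lim) real_asymp
  have c_lim: "c \<longlonglongrightarrow> (\<gamma> - 1) / 2" unfolding c_def by (intro tendsto_intros bN) auto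
  have i1: "(\<lambda>k. 1 / l k) \<longlonglongrightarrow> 0" unfolding l_def by (rule lim) real_asymp
  have i2: "(\<lambda>k. ln (l k) / l k) \<longlonglongrightarrow> 0" unfolding l_def by (rule lim) real_asymp
  have i3: "(\<lambda>k. (ln (l k))\<^sup>2 / l k) \<longlonglongrightarrow> 0" unfolding l_def by (rule lim) real_asymp
  have i4: "(\<lambda>k. ln (l k) / real (N k)) \<longlonglongrightarrow> 0" unfolding l_def by (rule lim) real_asymp
  have s1: "(\<lambda>k. s k / l k) \<longlonglongrightarrow> 0"
  proof -
    have "(\<lambda>k. p * (1 / l k) + c k * (ln (l k) / l k)) \<longlonglongrightarrow> p * 0 + (\<gamma> - 1) / 2 * 0"
      by (intro tendsto_intros i1 i2 c_lim)
    then show ?thesis by (simp add: s_def add_divide_distrib)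
  qed
  have s2: "(\<lambda>k. (s k)\<^sup>2 / l k) \<longlonglongrightarrow> 0"
  proof -
    have "(\<lambda>k. p\<^sup>2 * (1 / l k) + 2 * p * (c k * (ln (l k) / l k)) + (c k)\<^sup>2 * ((ln (l k))\<^sup>2 / l k))
      \<longlonglongrightarrow> p\<^sup>2 * 0 + 2 * p * ((\<gamma> - 1) / 2 * 0) + ((\<gamma> - 1) / 2)\<^sup>2 * 0"
      by (intro tendsto_intros i1 i2 i3 c_lim)
    then show ?thesis by (simp add: s_def power2_sum power_mult_distrib add_divide_distrib mult_ac add_ac)
  qed
  have ev: "\<forall>\<^sub>F k in sequentially. 1 < l k \<and> \<bar>s k / l k\<bar> < 1"
  proof -
    have "\<forall>\<^sub>F k in sequentially. dist (s k / l k) 0 < 1" using s1 by (rule tendstoD) simp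
    moreover have "\<forall>\<^sub>F k in sequentially. 1 < l k" using l_lim by (simp add: filterlim_at_top_dense)
    ultimately show ?thesis by eventually_elim simp
  qed
  have half: "1 / 2 \<le> 1 + q / 2" if "- 1 < q" for q :: real using that by simp
  have t_eq: "t k = sqrt (l k) * (1 + s k / l k / 2)" if "1 < l k" for k
  proof -
    have "sqrt (l k) * (s k / l k / 2) = s k / (2 * sqrt (l k))"
      using that by (simp add: real_div_sqrt field_simps)
    then show ?thesis by (simp add: t_def threshold_def l_def s_def c_def p_def distrib_left algebra_simps)
  qed
  show "filterlim t at_top sequentially"
  proof (rule filterlim_at_top_mono)
    have "filterlim (\<lambda>k. 1 / 2 * sqrt (l k)) at_top sequentially"
      unfolding l_def by (rule lim) real_asymp
    then show "filterlim (\<lambda>k. 1 / 2 * sqrt (l k)) at_top sequentially" .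
    show "\<forall>\<^sub>F k in sequentially. 1 / 2 * sqrt (l k) \<le> t k"
      using ev
    proof eventually_elim
      case (elim k)
      then have "- 1 < s k / l k" by linarith
      then have "1 / 2 \<le> 1 + s k / l k / 2" by (rule half)
      then have "sqrt (l k) * (1 / 2) \<le> sqrt (l k) * (1 + s k / l k / 2)" using elim by (intro mult_left_mono) auto
      then show ?case using t_eq elim by simp
    qed
  qed
  \<comment> \<open>The exact logarithm of the expression, arranged so that every term except
    -\<tau> tends to 0.\<close>
  define e where "e = (\<lambda>k. - \<tau> - 1 / 2 * (b k * real (N k) * (ln (l k) / real (N k)))
    + (b k * real (N k) - b k - 1) * ln (1 + s k / l k / 2) - (s k)\<^sup>2 / l k / 4)"
  have b_lim: "b \<longlonglongrightarrow> 0"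
  proof -
    have "(\<lambda>k. b k * real (N k) * (1 / real (N k))) \<longlonglongrightarrow> \<gamma> * 0"
      by (intro tendsto_mult bN lim) real_asymp
    moreover have "\<forall>\<^sub>F k in sequentially. b k * real (N k) * (1 / real (N k)) = b k"
      using ev by eventually_elim (auto simp: l_def)
    ultimately show ?thesis by (simp add: tendsto_cong)
  qed
  have "(\<lambda>k. exp (e k)) \<longlonglongrightarrow> exp (- \<tau> - 1 / 2 * (\<gamma> * 0) + (\<gamma> - 0 - 1) * ln (1 + 0 / 2) - 0 / 4)"
    unfolding e_def by (intro tendsto_intros bN b_lim i4 s1 s2) auto
  then have "(\<lambda>k. exp (e k)) \<longlonglongrightarrow> exp (- \<tau>)" by simp
  moreover have "\<forall>\<^sub>F k in sequentially. exp (e k)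
    = real (N k) / L * (exp ((b k * (real (N k) - 1) - 1) * ln (t k) - (t k)\<^sup>2) / 2)"
    using ev
  proof eventually_elim
    case (elim k)
    have N0: "0 < real (N k)" using elim by (auto simp: l_def intro: gr0I)
    have "- 1 < s k / l k" using elim by linarith
    from half[OF this] have q: "0 < 1 + s k / l k / 2" by (rule less_le_trans[rotated]) simp
    have tk: "t k = sqrt (l k) * (1 + s k / l k / 2)" using t_eq elim by simp
    have lnt: "ln (t k) = ln (l k) / 2 + ln (1 + s k / l k / 2)"
      unfolding tk using elim q by (simp add: ln_mult_pos ln_sqrt)
    have tsq: "(t k)\<^sup>2 = l k + s k + (s k)\<^sup>2 / l k / 4"
    proof -
      have "(t k)\<^sup>2 = l k * (1 + s k / l k / 2)\<^sup>2" unfolding tk power_mult_distrib using elim by simp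
      also have "(1 + s k / l k / 2)\<^sup>2 = 1 + s k / l k + (s k / l k)\<^sup>2 / 4"
        unfolding power2_sum by (simp add: power_divide)
      also have "l k * (1 + s k / l k + (s k / l k)\<^sup>2 / 4) = l k + s k + (s k)\<^sup>2 / l k / 4"
        using elim by (simp add: field_simps power2_eq_square)
      finally show ?thesis .
    qed
    have "real (N k) / L * (exp ((b k * (real (N k) - 1) - 1) * ln (t k) - (t k)\<^sup>2) / 2)
      = exp (l k - ln (2 * L)) * exp ((b k * (real (N k) - 1) - 1) * ln (t k) - (t k)\<^sup>2)"
      using N0 L by (simp add: l_def exp_diff)
    also have "\<dots> = exp (l k - ln (2 * L) + ((b k * (real (N k) - 1) - 1) * ln (t k) - (t k)\<^sup>2))"
      by (rule exp_add[symmetric])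
    also have "l k - ln (2 * L) + ((b k * (real (N k) - 1) - 1) * ln (t k) - (t k)\<^sup>2) = e k"
    proof -
      have "b k * real (N k) * (ln (l k) / real (N k)) = b k * ln (l k)" using N0 by simp
      then show ?thesis
        unfolding e_def lnt tsq by (simp add: s_def p_def c_def field_simps)
    qed
    finally show ?case by simp
  qed
  ultimately show "(\<lambda>k. real (N k) / L * (exp ((b k * (real (N k) - 1) - 1) * ln (t k) - (t k)\<^sup>2) / 2)) \<longlonglongrightarrow> exp (- \<tau>)"
    by (rule Lim_transform_eventually)
qed

section \<open>Poisson statistics at the edge\<close>

definition exceedances :: "nat \<Rightarrow> real \<Rightarrow> (nat \<Rightarrow> real) \<Rightarrow> nat" where
  "exceedances m s y = card {j \<in> {1..m}. s < y j}"

lemma exceedances_eq_sum: "real (exceedances m s y) = (\<Sum>j\<in>{1..m}. indicator {s<..} (y j))"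
proof -
  have "(\<Sum>j\<in>{1..m}. indicator {s<..} (y j) :: real) = (\<Sum>j\<in>{1..m}. if s < y j then 1 else 0)"
    by (intro sum.cong) (auto simp: indicator_def)
  also have "\<dots> = (\<Sum>j\<in>{j \<in> {1..m}. s < y j}. 1)" by (rule sum.inter_filter[symmetric]) simp
  finally show ?thesis by (simp add: exceedances_def)
qed

lemma exceedances_measurable:
  assumes "m \<le> M"
  shows "(\<lambda>y. H (exceedances m s y)) \<in> borel_measurable (RN M)"
proof -
  have S: "(\<lambda>y. \<Sum>j\<in>{1..m}. indicator {s<..} (y j) :: real) \<in> borel_measurable (RN M)"
  proof (rule borel_measurable_sum)
    fix j assume "j \<in> {1..m}"
    then have "j \<in> {1..M}" using assms by auto
    note [measurable] = measurable_coord[OF this]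
    show "(\<lambda>y. indicator {s<..} (y j) :: real) \<in> borel_measurable (RN M)" by measurable
  qed
  \<comment> \<open>The count is recovered from the real sum of indicators by \<open>floor\<close>,
    so every function H of it is measurable.\<close>
  have fl: "(floor :: real \<Rightarrow> int) \<in> measurable borel (count_space UNIV)" by measurable
  have "(\<lambda>i. H (nat i)) \<in> borel_measurable (count_space UNIV)" by simp
  from measurable_compose[OF S measurable_compose[OF fl this]]
  have "(\<lambda>y. H (nat \<lfloor>\<Sum>j\<in>{1..m}. indicator {s<..} (y j) :: real\<rfloor>)) \<in> borel_measurable (RN M)" .
  then show ?thesis unfolding exceedances_eq_sum[symmetric] by simp
qed

lemma exceedances_Suc:
  "exceedances (Suc m) s y = exceedances m s y + (if s < y (Suc m) then 1 else 0)"
proof -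
  have "real (exceedances (Suc m) s y) = real (exceedances m s y + (if s < y (Suc m) then 1 else 0))"
    by (simp add: exceedances_eq_sum indicator_def)
  then show ?thesis by (simp only: of_nat_eq_iff)
qed

lemma exceedances_upd: "exceedances m s (y(Suc m := x)) = exceedances m s y"
  unfolding exceedances_def by (intro arg_cong[where f = card]) auto

lemma exceedances_swap:
  assumes "i \<in> {1..m}" "j \<in> {1..m}"
  shows "exceedances m s (\<lambda>k\<in>{1..m}. y (Transposition.transpose i j k)) = exceedances m s y"
proof -
  have bij: "bij_betw (Transposition.transpose i j) {1..m} {1..m}"
    using assms by (intro bij_betwI[where g = "Transposition.transpose i j"]) (auto simp: Transposition.transpose_def)
  have "real (exceedances m s (\<lambda>k\<in>{1..m}. y (Transposition.transpose i j k)))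
    = (\<Sum>k\<in>{1..m}. indicator {s<..} (y (Transposition.transpose i j k)))"
    unfolding exceedances_eq_sum by (intro sum.cong) auto
  also have "\<dots> = real (exceedances m s y)"
    unfolding exceedances_eq_sum by (rule sum.reindex_bij_betw[OF bij])
  finally show ?thesis by simp
qed

lemma exceedances_eq_0_iff: "exceedances m s y = 0 \<longleftrightarrow> (\<forall>j\<in>{1..m}. y j \<le> s)"
  by (auto simp: exceedances_def not_less)

text \<open>The solution of Stein's equation for the Poisson distribution of mean \<open>l\<close> and the indicator
  of \<open>0\<close>. The value at \<open>k = 0\<close> is irrelevant, since the equation multiplies it by \<open>k\<close>.\<close>

definition stein :: "real \<Rightarrow> nat \<Rightarrow> real" where
  "stein l k = integral {0..1} (\<lambda>s. exp (l * (s - 1)) * (1 - s) ^ (k - 1))"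

lemma stein_bounds:
  assumes "0 \<le> l"
  shows "0 \<le> stein l k" "stein l k \<le> 1"
proof -
  have i: "(\<lambda>s. exp (l * (s - 1)) * (1 - s) ^ (k - 1)) integrable_on {0..1}"
    by (intro integrable_continuous_real continuous_intros)
  show "0 \<le> stein l k" unfolding stein_def by (rule integral_nonneg[OF i]) auto
  have "stein l k \<le> integral {0..1} (\<lambda>s::real. 1)"
    unfolding stein_def
  proof (rule integral_le[OF i])
    fix s :: real assume s: "s \<in> {0..1}"
    have "exp (l * (s - 1)) \<le> 1" using s assms by (simp add: mult_nonneg_nonpos)
    moreover have "(1 - s) ^ (k - 1) \<le> 1" using s by (intro power_le_one) auto
    ultimately show "exp (l * (s - 1)) * (1 - s) ^ (k - 1) \<le> 1" using s by (intro mult_le_one) auto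
  qed auto
  then show "stein l k \<le> 1" by simp
qed

text \<open>The fundamental theorem of calculus for -exp (l (s - 1)) (1 - s)^k on [0, 1]: the end s
  = 1 contributes 0^k, the indicator of k = 0, and the end s = 0 contributes exp (-l). For k = 0 the
  truncated difference k - 1 is multiplied by 0.\<close>

lemma stein_equation:
  "l * stein l (k + 1) + exp (- l) = real k * stein l k + (if k = 0 then 1 else 0)"
proof -
  let ?F = "\<lambda>s. - (exp (l * (s - 1)) * (1 - s) ^ k)"
  let ?a = "\<lambda>k s. exp (l * (s - 1)) * (1 - s) ^ k :: real"
  have i: "(?a j) integrable_on {0..1}" for j
    by (intro integrable_continuous_real continuous_intros)
  have "((\<lambda>s. real k * ?a (k - 1) s - l * ?a k s) has_integral (?F 1 - ?F 0)) {0..1}"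
  proof (rule fundamental_theorem_of_calculus)
    fix s :: real assume "s \<in> {0..1}"
    have "(?F has_real_derivative (real k * ?a (k - 1) s - l * ?a k s)) (at s within {0..1})"
      by (auto intro!: derivative_eq_intros simp: algebra_simps)
    then show "(?F has_vector_derivative (real k * ?a (k - 1) s - l * ?a k s)) (at s within {0..1})"
      by (simp add: has_real_derivative_iff_has_vector_derivative)
  qed simp
  then have "integral {0..1} (\<lambda>s. real k * ?a (k - 1) s - l * ?a k s) = ?F 1 - ?F 0"
    by (rule integral_unique)
  moreover have "integral {0..1} (\<lambda>s. real k * ?a (k - 1) s - l * ?a k s) = real k * stein l k - l * stein l (k + 1)"
  proof -
    have "(\<lambda>s. c * ?a j s) integrable_on {0..1}" for c :: real and j
      by (intro integrable_continuous_real continuous_intros)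
    from integral_diff[OF this this] show ?thesis by (simp add: stein_def)
  qed
  moreover have "?F 1 - ?F 0 = exp (- l) - (if k = 0 then 1 else 0)" by simp
  ultimately show ?thesis by linarith
qed

section \<open>Approximate independence of the last particle and the Poisson limit\<close>

context mean_field_sequence
begin

abbreviation Q :: "nat \<Rightarrow> (nat \<Rightarrow> real) measure" where "Q k \<equiv> ensemble (b k) (Suc (n k))"

text \<open>The approximate probability that the last of n + 1 particles lies above t, with its
  interaction factor replaced by x^(b n).\<close>

definition tail_mass :: "nat \<Rightarrow> real \<Rightarrow> ennreal" where
  "tail_mass k t = ennreal (1 / ratio k) *
    (\<integral>\<^sup>+x. ennreal (exp (b k * real (n k) * ln x - x\<^sup>2)) * indicator {t<..} x \<partial>lborel)"

text \<open>Above t the conditional density of the last particle is nearly independent of the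
  others, by \<open>edge\<close>, so the indicator of its exceedance nearly decouples from F. The
  error is proportional to \<open>tail_mass\<close> and therefore remains small after multiplication
  by the number of particles.\<close>

lemma last_particle_exceeds:
  assumes c: "0 \<le> c" and edge: "\<And>k x. 1 \<le> x \<Longrightarrow>
    (\<integral>\<^sup>+y. ennreal \<bar>exp (b k * log_sum (n k) x y) / exp (b k * real (n k) * ln x) - 1\<bar> \<partial>ensemble (b k) (n k))
      \<le> ennreal (exp (c / x) - 1 + c / x)"
    and t: "1 \<le> t" and F[measurable]: "F \<in> borel_measurable (RN (n k))" and F1: "\<And>y. F y \<le> 1"
    and F': "F' \<in> borel_measurable (RN (Suc (n k)))"
    and eq: "\<And>y x. y \<in> space (RN (n k)) \<Longrightarrow> F' (y(Suc (n k) := x)) = indicator {t<..} x * F y"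
  shows "(\<integral>\<^sup>+y. F' y \<partial>Q k) \<le> tail_mass k t * ((\<integral>\<^sup>+y. F y \<partial>ensemble (b k) (n k)) + ennreal (exp (c / t) - 1 + c / t))"
    and "tail_mass k t * (\<integral>\<^sup>+y. F y \<partial>ensemble (b k) (n k)) \<le> (\<integral>\<^sup>+y. F' y \<partial>Q k) + tail_mass k t * ennreal (exp (c / t) - 1 + c / t)"
proof -
  let ?P = "ensemble (b k) (n k)"
  let ?A = "\<lambda>x y. exp (b k * log_sum (n k) x y)" and ?q = "\<lambda>x. exp (b k * real (n k) * ln x)"
  define e where "e = ennreal (exp (c / t) - 1 + c / t)"
  define I where "I = (\<integral>\<^sup>+y. F y \<partial>?P)"
  define J where "J = (\<lambda>x. \<integral>\<^sup>+y. ennreal (?A x y) * F y \<partial>?P)"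
  have [measurable]: "J \<in> borel_measurable borel"
    unfolding J_def
  proof (rule nn_integral_ensemble_measurable)
    have [measurable]: "(\<lambda>p. F (snd p)) \<in> borel_measurable (borel \<Otimes>\<^sub>M RN (n k))"
      by (rule measurable_compose[OF measurable_snd F])
    show "(\<lambda>p. ennreal (?A (fst p) (snd p)) * F (snd p)) \<in> borel_measurable (borel \<Otimes>\<^sub>M RN (n k))"
      by measurable
  qed
  have J: "J x \<le> ennreal (?q x) * (I + e)" "ennreal (?q x) * I \<le> J x + ennreal (?q x) * e" if x: "t < x" for x
  proof -
    have x1: "1 \<le> x" using t x by simp
    define D where "D = (\<integral>\<^sup>+y. ennreal \<bar>?A x y / ?q x - 1\<bar> \<partial>?P)"
    have De: "D \<le> e"
    proof -
      have "D \<le> ennreal (exp (c / x) - 1 + c / x)" unfolding D_def by (rule edge[OF x1])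
      also have "\<dots> \<le> e"
      proof -
        have "c / x \<le> c / t" using c t x by (intro divide_left_mono) auto
        then show ?thesis unfolding e_def by (intro ennreal_leI) (simp add: add_mono)
      qed
      finally show ?thesis .
    qed
    have A: "ennreal (?A x y) = ennreal (?q x) * ennreal (?A x y / ?q x)" for y
      by (subst ennreal_mult[symmetric]) auto
    have "J x = ennreal (?q x) * (\<integral>\<^sup>+y. ennreal (?A x y / ?q x) * F y \<partial>?P)"
      unfolding J_def by (subst nn_integral_cmult[symmetric]) (auto simp: A mult.assoc intro!: nn_integral_cong)
    moreover have "(\<integral>\<^sup>+y. ennreal (?A x y / ?q x) * F y \<partial>?P) \<le> I + D"
    proof -
      have "(\<integral>\<^sup>+y. ennreal (?A x y / ?q x) * F y \<partial>?P) \<le> (\<integral>\<^sup>+y. F y + ennreal \<bar>?A x y / ?q x - 1\<bar> \<partial>?P)"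
      proof (rule nn_integral_mono)
        fix y
        have "ennreal (?A x y / ?q x) \<le> ennreal (1 + \<bar>?A x y / ?q x - 1\<bar>)" by (intro ennreal_leI) simp
        also have "\<dots> = 1 + ennreal \<bar>?A x y / ?q x - 1\<bar>" by simp
        finally have "ennreal (?A x y / ?q x) * F y \<le> (1 + ennreal \<bar>?A x y / ?q x - 1\<bar>) * F y" by (rule mult_right_mono) simp
        also have "\<dots> = F y + ennreal \<bar>?A x y / ?q x - 1\<bar> * F y" by (simp add: distrib_right)
        also have "\<dots> \<le> F y + ennreal \<bar>?A x y / ?q x - 1\<bar> * 1" by (intro add_left_mono mult_left_mono F1) simp
        finally show "ennreal (?A x y / ?q x) * F y \<le> F y + ennreal \<bar>?A x y / ?q x - 1\<bar>" by simp
      qed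
      also have "\<dots> = I + D" unfolding I_def D_def by (rule nn_integral_add) measurable
      finally show ?thesis .
    qed
    moreover have "I \<le> (\<integral>\<^sup>+y. ennreal (?A x y / ?q x) * F y \<partial>?P) + D"
    proof -
      have "I \<le> (\<integral>\<^sup>+y. ennreal (?A x y / ?q x) * F y + ennreal \<bar>?A x y / ?q x - 1\<bar> \<partial>?P)"
        unfolding I_def
      proof (rule nn_integral_mono)
        fix y
        have "ennreal 1 \<le> ennreal (?A x y / ?q x + \<bar>?A x y / ?q x - 1\<bar>)" by (intro ennreal_leI) simp
        also have "\<dots> = ennreal (?A x y / ?q x) + ennreal \<bar>?A x y / ?q x - 1\<bar>" by (intro ennreal_plus) auto
        finally have "1 * F y \<le> (ennreal (?A x y / ?q x) + ennreal \<bar>?A x y / ?q x - 1\<bar>) * F y"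
          by (intro mult_right_mono) simp_all
        also have "\<dots> = ennreal (?A x y / ?q x) * F y + ennreal \<bar>?A x y / ?q x - 1\<bar> * F y" by (rule distrib_right)
        also have "\<dots> \<le> ennreal (?A x y / ?q x) * F y + ennreal \<bar>?A x y / ?q x - 1\<bar> * 1"
          by (intro add_left_mono mult_left_mono F1) simp
        finally show "F y \<le> ennreal (?A x y / ?q x) * F y + ennreal \<bar>?A x y / ?q x - 1\<bar>" by simp
      qed
      also have "\<dots> = (\<integral>\<^sup>+y. ennreal (?A x y / ?q x) * F y \<partial>?P) + D"
        unfolding D_def by (rule nn_integral_add) measurable
      finally show ?thesis .
    qed
    ultimately show "J x \<le> ennreal (?q x) * (I + e)" "ennreal (?q x) * I \<le> J x + ennreal (?q x) * e"
      using De
      by (auto simp: distrib_left[symmetric] intro!: mult_left_mono intro: order_trans[OF _ add_left_mono])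
  qed
  let ?w = "\<lambda>x. ennreal (exp (- x\<^sup>2) / ratio k) * indicator {t<..} x"
  have T: "(\<integral>\<^sup>+y. F' y \<partial>Q k) = (\<integral>\<^sup>+x. ?w x * J x \<partial>lborel)"
    unfolding ensemble_Suc[OF F']
  proof (rule nn_integral_cong)
    fix x
    have "(\<integral>\<^sup>+y. ennreal (?A x y) * F' (y(Suc (n k) := x)) \<partial>?P) = (\<integral>\<^sup>+y. indicator {t<..} x * (ennreal (?A x y) * F y) \<partial>?P)"
      by (intro nn_integral_cong) (simp add: eq mult_ac)
    also have "\<dots> = indicator {t<..} x * J x" unfolding J_def by (rule nn_integral_cmult) measurable
    finally show "ennreal (exp (- x\<^sup>2) / ratio k) * (\<integral>\<^sup>+y. ennreal (?A x y) * F' (y(Suc (n k) := x)) \<partial>?P) = ?w x * J x"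
      by (simp add: mult.assoc)
  qed
  have M: "(\<integral>\<^sup>+x. ?w x * ennreal (?q x) \<partial>lborel) = tail_mass k t"
  proof -
    have "(\<integral>\<^sup>+x. ?w x * ennreal (?q x) \<partial>lborel)
      = (\<integral>\<^sup>+x. ennreal (1 / ratio k) * (ennreal (exp (b k * real (n k) * ln x - x\<^sup>2)) * indicator {t<..} x) \<partial>lborel)"
    proof (rule nn_integral_cong)
      fix x
      have "ennreal (exp (- x\<^sup>2) / ratio k) * ennreal (?q x) = ennreal (1 / ratio k) * ennreal (exp (b k * real (n k) * ln x - x\<^sup>2))"
        using ratio_pos[of k] by (simp add: ennreal_mult[symmetric] exp_diff exp_minus field_simps)
      then show "?w x * ennreal (?q x) = ennreal (1 / ratio k) * (ennreal (exp (b k * real (n k) * ln x - x\<^sup>2)) * indicator {t<..} x)"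
        by (simp add: indicator_def)
    qed
    also have "\<dots> = tail_mass k t" unfolding tail_mass_def by (rule nn_integral_cmult) measurable
    finally show ?thesis .
  qed
  have "(\<integral>\<^sup>+y. F' y \<partial>Q k) \<le> (\<integral>\<^sup>+x. ?w x * ennreal (?q x) * (I + e) \<partial>lborel)"
    unfolding T
  proof (rule nn_integral_mono)
    fix x
    show "?w x * J x \<le> ?w x * ennreal (?q x) * (I + e)"
      using J(1)[of x] by (cases "t < x") (auto simp: mult.assoc intro!: mult_left_mono)
  qed
  also have "\<dots> = tail_mass k t * (I + e)"
    by (subst nn_integral_multc) (auto simp: M)
  finally show "(\<integral>\<^sup>+y. F' y \<partial>Q k) \<le> tail_mass k t * ((\<integral>\<^sup>+y. F y \<partial>ensemble (b k) (n k)) + ennreal (exp (c / t) - 1 + c / t))"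
    by (simp add: I_def e_def)
  have "tail_mass k t * I = (\<integral>\<^sup>+x. ?w x * ennreal (?q x) * I \<partial>lborel)"
    by (subst nn_integral_multc) (auto simp: M)
  also have "\<dots> \<le> (\<integral>\<^sup>+x. ?w x * J x + ?w x * ennreal (?q x) * e \<partial>lborel)"
  proof (rule nn_integral_mono)
    fix x
    show "?w x * ennreal (?q x) * I \<le> ?w x * J x + ?w x * ennreal (?q x) * e"
      using J(2)[of x] by (cases "t < x") (auto simp: mult.assoc distrib_left[symmetric] intro!: mult_left_mono)
  qed
  also have "\<dots> = (\<integral>\<^sup>+x. ?w x * J x \<partial>lborel) + (\<integral>\<^sup>+x. ?w x * ennreal (?q x) * e \<partial>lborel)"
    by (rule nn_integral_add) measurable
  also have "(\<integral>\<^sup>+x. ?w x * ennreal (?q x) * e \<partial>lborel) = tail_mass k t * e"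
    by (subst nn_integral_multc) (auto simp: M)
  finally show "tail_mass k t * (\<integral>\<^sup>+y. F y \<partial>ensemble (b k) (n k)) \<le> (\<integral>\<^sup>+y. F' y \<partial>Q k) + tail_mass k t * ennreal (exp (c / t) - 1 + c / t)"
    by (simp add: I_def e_def T)
qed

text \<open>This is the limit of the expected number of exceedances.
  \<open>gauss_tail_bounds\<close> squeezes it between multiples of the expression in
  \<open>threshold_asymptotics\<close>, taken at N = n + 1, and L / ratio tends to 1.\<close>

lemma tail_mass_threshold:
  fixes \<tau> :: real
  defines "t \<equiv> \<lambda>k. threshold L (b k) (Suc (n k)) \<tau>"
  shows "filterlim t at_top sequentially"
    and "(\<lambda>k. ennreal (real (Suc (n k))) * tail_mass k (t k)) \<longlonglongrightarrow> ennreal (exp (- \<tau>))"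
proof -
  have N_lim: "filterlim (\<lambda>k. Suc (n k)) at_top sequentially"
    by (rule filterlim_compose[OF filterlim_Suc n_lim])
  have bN: "(\<lambda>k. b k * real (Suc (n k))) \<longlonglongrightarrow> \<gamma>"
    using tendsto_add[OF bn_lim b_lim] by (simp add: distrib_left add.commute)
  note asym = threshold_asymptotics[OF L_pos N_lim bN, of \<tau>, folded t_def]
  show t_lim: "filterlim t at_top sequentially" using asym(1) by (simp add: t_def)
  define \<phi> where "\<phi> = (\<lambda>k. exp ((b k * real (n k) - 1) * ln (t k) - (t k)\<^sup>2) / 2)"
  have \<phi>_lim: "(\<lambda>k. real (Suc (n k)) / L * \<phi> k) \<longlonglongrightarrow> exp (- \<tau>)"
    using asym(2) by (simp add: \<phi>_def t_def)
  \<comment> \<open>Since 0 \<le> b n \<le> \<gamma> + 1, one D serves all k.\<close>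
  define D where "D = (\<gamma> + 2) / 2"
  have D: "\<bar>b k * real (n k) - 1\<bar> / 2 \<le> D" for k
  proof -
    have "0 \<le> b k * real (n k)" using b0[of k] by simp
    then have "\<bar>b k * real (n k) - 1\<bar> \<le> \<gamma> + 2" using bn_le[of k] gamma_nonneg by linarith
    then show ?thesis by (simp add: D_def)
  qed
  have t2: "(\<lambda>k. D / (t k)\<^sup>2) \<longlonglongrightarrow> 0"
  proof -
    have "((\<lambda>x::real. D / x\<^sup>2) \<longlongrightarrow> 0) at_top" by real_asymp
    from filterlim_compose[OF this t_lim] show ?thesis .
  qed
  have ev: "\<forall>\<^sub>F k in sequentially. 1 \<le> t k \<and> D < (t k)\<^sup>2"
  proof -
    have "\<forall>\<^sub>F k in sequentially. dist (D / (t k)\<^sup>2) 0 < 1" using t2 by (rule tendstoD) simp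
    moreover have "\<forall>\<^sub>F k in sequentially. 1 \<le> t k" using t_lim by (simp add: filterlim_at_top)
    ultimately show ?thesis
    proof eventually_elim
      case (elim k)
      have "0 < (t k)\<^sup>2" using elim by simp
      moreover have "0 < D" using gamma_nonneg by (simp add: D_def)
      ultimately show ?case using elim by (simp add: field_simps)
    qed
  qed
  define lo where "lo = (\<lambda>k. L / ratio k * (real (Suc (n k)) / L * \<phi> k) / (1 + D / (t k)\<^sup>2))"
  define hi where "hi = (\<lambda>k. L / ratio k * (real (Suc (n k)) / L * \<phi> k) / (1 - D / (t k)\<^sup>2))"
  have lo: "lo \<longlonglongrightarrow> L / L * exp (- \<tau>) / (1 + 0)"
    unfolding lo_def using L_pos by (intro tendsto_intros ratio_tendsto \<phi>_lim t2) auto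
  have hi: "hi \<longlonglongrightarrow> L / L * exp (- \<tau>) / (1 - 0)"
    unfolding hi_def using L_pos by (intro tendsto_intros ratio_tendsto \<phi>_lim t2) auto
  have bounds: "ennreal (lo k) \<le> ennreal (real (Suc (n k))) * tail_mass k (t k)
      \<and> ennreal (real (Suc (n k))) * tail_mass k (t k) \<le> ennreal (hi k)"
    if k: "1 \<le> t k" "D < (t k)\<^sup>2" for k
  proof -
    let ?G = "\<integral>\<^sup>+x. ennreal (exp (b k * real (n k) * ln x - x\<^sup>2)) * indicator {t k<..} x \<partial>lborel"
    let ?N = "real (Suc (n k))"
    note g = gauss_tail_bounds[OF k(1) D k(2), folded \<phi>_def]
    have \<phi>0: "0 \<le> \<phi> k" by (simp add: \<phi>_def)
    have D0: "0 \<le> D" using gamma_nonneg by (simp add: D_def)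
    have d: "0 < 1 + D / (t k)\<^sup>2" "0 < 1 - D / (t k)\<^sup>2"
      using D0 k by (auto intro: add_pos_nonneg simp: field_simps)
    have Nr: "ennreal ?N * ennreal (1 / ratio k) = ennreal (?N / ratio k)"
      using ratio_pos[of k] by (subst ennreal_mult[symmetric]) auto
    have v: "ennreal ?N * tail_mass k (t k) = ennreal (?N / ratio k) * ?G"
      unfolding tail_mass_def mult.assoc[symmetric] Nr ..
    have "ennreal (lo k) = ennreal (?N / ratio k) * ennreal (\<phi> k / (1 + D / (t k)\<^sup>2))"
      using \<phi>0 d ratio_pos[of k] L_pos by (subst ennreal_mult[symmetric]) (auto simp: lo_def)
    also have "\<dots> \<le> ennreal (?N / ratio k) * ?G" using g(1) by (intro mult_left_mono) (auto simp: \<phi>_def)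
    finally have 1: "ennreal (lo k) \<le> ennreal (?N / ratio k) * ?G" .
    have "ennreal (?N / ratio k) * ?G \<le> ennreal (?N / ratio k) * ennreal (\<phi> k / (1 - D / (t k)\<^sup>2))"
      using g(2) by (intro mult_left_mono) (auto simp: \<phi>_def)
    also have "\<dots> = ennreal (hi k)"
      using \<phi>0 d ratio_pos[of k] L_pos by (subst ennreal_mult[symmetric]) (auto simp: hi_def)
    finally show ?thesis unfolding v using 1 by blast
  qed
  show "(\<lambda>k. ennreal (real (Suc (n k))) * tail_mass k (t k)) \<longlonglongrightarrow> ennreal (exp (- \<tau>))"
  proof (rule tendsto_sandwich)
    show "(\<lambda>k. ennreal (lo k)) \<longlonglongrightarrow> ennreal (exp (- \<tau>))" using tendsto_ennrealI[OF lo] L_pos by simp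
    show "(\<lambda>k. ennreal (hi k)) \<longlonglongrightarrow> ennreal (exp (- \<tau>))" using tendsto_ennrealI[OF hi] L_pos by simp
    show "\<forall>\<^sub>F k in sequentially. ennreal (lo k) \<le> ennreal (real (Suc (n k))) * tail_mass k (t k)"
      using ev by eventually_elim (use bounds in blast)
    show "\<forall>\<^sub>F k in sequentially. ennreal (real (Suc (n k))) * tail_mass k (t k) \<le> ennreal (hi k)"
      using ev by eventually_elim (use bounds in blast)
  qed
qed

text \<open>The count is a sum of indicators, and exchangeability moves each of them to the last
  coordinate. Where the last particle exceeds s, the full count is 1 plus the count of the others,
  so h becomes a function of the others alone and \<open>last_particle_exceeds\<close> can be
  applied.\<close>

lemma exceedances_size_bias:
  assumes h: "\<And>k. 0 \<le> h k" and N: "N = Suc (n k)"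
  shows "(\<integral>\<^sup>+y. ennreal (real (exceedances N s y) * h (exceedances N s y)) \<partial>Q k)
    = ennreal (real N) * (\<integral>\<^sup>+y. indicator {s<..} (y N) * ennreal (h (1 + exceedances (n k) s y)) \<partial>Q k)"
proof -
  let ?F = "\<lambda>j y. indicator {s<..} (y j) * ennreal (h (exceedances N s y))"
  have mF: "?F j \<in> borel_measurable (RN N)" if "j \<in> {1..N}" for j
  proof -
    note [measurable] = measurable_coord[OF that] exceedances_measurable[OF order_refl, of "\<lambda>k. ennreal (h k)"]
    show ?thesis by measurable
  qed
  have NN: "N \<in> {1..N}" using N by simp
  have "(\<integral>\<^sup>+y. ennreal (real (exceedances N s y) * h (exceedances N s y)) \<partial>Q k) = (\<integral>\<^sup>+y. (\<Sum>j\<in>{1..N}. ?F j y) \<partial>Q k)"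
  proof (rule nn_integral_cong)
    fix y
    have "ennreal (real (exceedances N s y) * h (exceedances N s y)) = ennreal (real (exceedances N s y)) * ennreal (h (exceedances N s y))"
      using h by (intro ennreal_mult) auto
    also have "ennreal (real (exceedances N s y)) = (\<Sum>j\<in>{1..N}. ennreal (indicator {s<..} (y j)))"
      unfolding exceedances_eq_sum by (intro sum_ennreal[symmetric]) auto
    finally show "ennreal (real (exceedances N s y) * h (exceedances N s y)) = (\<Sum>j\<in>{1..N}. ?F j y)"
      by (simp add: sum_distrib_right ennreal_indicator)
  qed
  also have "\<dots> = (\<Sum>j\<in>{1..N}. \<integral>\<^sup>+y. ?F j y \<partial>Q k)"
    using mF N by (intro nn_integral_sum) auto
  also have "\<dots> = (\<Sum>j\<in>{1..N}. \<integral>\<^sup>+y. ?F N y \<partial>Q k)"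
  proof (rule sum.cong[OF refl])
    fix j assume j: "j \<in> {1..N}"
    have "(\<integral>\<^sup>+y. ?F N (\<lambda>i\<in>{1..N}. y (Transposition.transpose j N i)) \<partial>ensemble (b k) N) = (\<integral>\<^sup>+y. ?F N y \<partial>ensemble (b k) N)"
      by (rule nn_integral_ensemble_swap[OF b0 j NN mF[OF NN]])
    moreover have "?F N (\<lambda>i\<in>{1..N}. y (Transposition.transpose j N i)) = ?F j y" for y
      unfolding exceedances_swap[OF j NN] using NN by simp
    ultimately show "(\<integral>\<^sup>+y. ?F j y \<partial>Q k) = (\<integral>\<^sup>+y. ?F N y \<partial>Q k)" by (simp only: N[symmetric])
  qed
  also have "\<dots> = ennreal (real N) * (\<integral>\<^sup>+y. ?F N y \<partial>Q k)" by (simp add: ennreal_of_nat_eq_real_of_nat)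
  also have "(\<integral>\<^sup>+y. ?F N y \<partial>Q k) = (\<integral>\<^sup>+y. indicator {s<..} (y N) * ennreal (h (1 + exceedances (n k) s y)) \<partial>Q k)"
    unfolding N by (intro nn_integral_cong) (auto simp: exceedances_Suc indicator_def)
  finally show ?thesis .
qed

text \<open>Let X and Y count exceedances among all N particles and among the first n. Stein's
  equation integrates to l E h(1 + X) + e^(-l) = E X h(X) + P(X = 0). Size biasing and
  \<open>last_particle_exceeds\<close> give E X h(X) = \<Lambda> E h(1 + Y), up to \<Lambda> d, with
  Y taken in the n-particle ensemble. \<open>remove_particle\<close> carries this expectation to N
  particles, where Y differs from X only if the last particle exceeds, with probability O(1/N). As
  \<Lambda> tends to l, what remains is P(X = 0) -> e^(-l).\<close>

lemma no_exceedance_tendsto: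
  fixes \<tau> :: real
  assumes K: "0 < K" and dens: "\<And>k h. h \<in> borel_measurable borel \<Longrightarrow>
    (\<integral>\<^sup>+y. h (y (n k)) \<partial>ensemble (b k) (n k)) \<le> ennreal K * (\<integral>\<^sup>+x. h x * ennreal (exp (- x\<^sup>2 / 2)) \<partial>lborel)"
  defines "t \<equiv> \<lambda>k. threshold L (b k) (Suc (n k)) \<tau>"
  shows "(\<lambda>k. measure (Q k) {y \<in> space (RN (Suc (n k))). exceedances (Suc (n k)) (t k) y = 0}) \<longlonglongrightarrow> exp (- exp (- \<tau>))"
proof -
  obtain c where c: "0 \<le> c" and edge: "\<And>k x. 1 \<le> x \<Longrightarrow>
    (\<integral>\<^sup>+y. ennreal \<bar>exp (b k * log_sum (n k) x y) / exp (b k * real (n k) * ln x) - 1\<bar> \<partial>ensemble (b k) (n k))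
      \<le> ennreal (exp (c / x) - 1 + c / x)"
    using edge_L1_bound[OF K dens] by blast
  obtain \<epsilon> where \<epsilon>: "\<epsilon> \<longlonglongrightarrow> 0" and remove: "\<And>k F F'. F \<in> borel_measurable (RN (n k)) \<Longrightarrow> F' \<in> borel_measurable (RN (Suc (n k))) \<Longrightarrow>
      (\<And>y. F y \<le> 1) \<Longrightarrow> (\<And>y x. y \<in> space (RN (n k)) \<Longrightarrow> F' (y(Suc (n k) := x)) = F y) \<Longrightarrow>
      (\<integral>\<^sup>+y. F' y \<partial>ensemble (b k) (Suc (n k))) \<le> (\<integral>\<^sup>+y. F y \<partial>ensemble (b k) (n k)) + \<epsilon> k \<and>
      (\<integral>\<^sup>+y. F y \<partial>ensemble (b k) (n k)) \<le> (\<integral>\<^sup>+y. F' y \<partial>ensemble (b k) (Suc (n k))) + \<epsilon> k"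
    by (rule remove_particle) blast
  define l where "l = exp (- \<tau>)"
  have l: "0 < l" by (simp add: l_def)
  define h where "h = stein l"
  have h: "0 \<le> h k" "h k \<le> 1" for k using stein_bounds[of l k] l by (auto simp: h_def)
  have lims: "filterlim t at_top sequentially"
    "(\<lambda>k. ennreal (real (Suc (n k))) * tail_mass k (t k)) \<longlonglongrightarrow> ennreal l"
    unfolding t_def l_def by (rule tail_mass_threshold)+
  define \<Lambda> where "\<Lambda> = (\<lambda>k. enn2real (ennreal (real (Suc (n k))) * tail_mass k (t k)))"
  have \<Lambda>_lim: "\<Lambda> \<longlonglongrightarrow> l"
    unfolding \<Lambda>_def using l by (intro tendsto_enn2real lims(2)) auto
  define d where "d = (\<lambda>k. exp (c / t k) - 1 + c / t k)"
  have d_lim: "d \<longlonglongrightarrow> 0"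
  proof -
    have "((\<lambda>x::real. exp (c / x) - 1 + c / x) \<longlongrightarrow> 0) at_top" by real_asymp
    from filterlim_compose[OF this lims(1)] show ?thesis by (simp add: d_def[abs_def])
  qed
  define p where "p = (\<lambda>k. measure (Q k) {y \<in> space (RN (Suc (n k))). exceedances (Suc (n k)) (t k) y = 0})"
  have main: "\<bar>p k - exp (- l)\<bar> \<le> l * (\<Lambda> k * (1 + d k) / real (Suc (n k)) + enn2real (\<epsilon> k)) + \<bar>\<Lambda> k - l\<bar> + \<Lambda> k * d k"
    if t1: "1 \<le> t k" and fin: "ennreal (real (Suc (n k))) * tail_mass k (t k) < \<infinity>" and ef: "\<epsilon> k < \<infinity>" for k
  proof -
    let ?N = "Suc (n k)" and ?P = "ensemble (b k) (n k)"
    interpret Q: prob_space "Q k" by (rule prob_space_ensemble[OF b0])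
    let ?X = "exceedances ?N (t k)" and ?Y = "exceedances (n k) (t k)"
    have N0: "0 < real ?N" by simp
    have d0: "0 \<le> d k"
    proof -
      have "0 \<le> c / t k" using c t1 by simp
      then show ?thesis unfolding d_def using exp_ge_add_one_self[of "c / t k"] by linarith
    qed
    have \<Lambda>0: "0 \<le> \<Lambda> k" by (simp add: \<Lambda>_def)
    have tm: "tail_mass k (t k) = ennreal (\<Lambda> k / real ?N)"
    proof -
      have "ennreal (\<Lambda> k) = ennreal (real ?N) * tail_mass k (t k)" using fin by (simp add: \<Lambda>_def)
      then have "ennreal (1 / real ?N) * ennreal (\<Lambda> k) = ennreal (1 / real ?N) * ennreal (real ?N) * tail_mass k (t k)"
        by (simp only: mult.assoc)
      also have "ennreal (1 / real ?N) * ennreal (real ?N) = 1"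
        using ennreal_mult[of "1 / real ?N" "real ?N"] by (simp del: of_nat_Suc)
      finally show ?thesis using \<Lambda>0 ennreal_mult[of "1 / real ?N" "\<Lambda> k"] by simp
    qed
    have mX: "(\<lambda>y. H (?X y)) \<in> borel_measurable (RN ?N)" and mY: "(\<lambda>y. H (?Y y)) \<in> borel_measurable (RN (n k))"
      and mY': "(\<lambda>y. H (?Y y)) \<in> borel_measurable (RN ?N)" for H :: "nat \<Rightarrow> ennreal"
      by (auto intro: exceedances_measurable)
    have mN: "(\<lambda>y. indicator {t k<..} (y ?N) :: ennreal) \<in> borel_measurable (RN ?N)"
      by (rule measurable_compose[OF measurable_coord]) auto
    define e1 where "e1 = enn2real (\<integral>\<^sup>+y. ennreal (h (1 + ?X y)) \<partial>Q k)"
    define e2 where "e2 = enn2real (\<integral>\<^sup>+y. ennreal (h (1 + ?Y y)) \<partial>?P)"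
    \<comment> \<open>The intermediate between e1 and e2: it differs from e2 by the cost of removing
      a particle, and from e1 by at most the probability \<pi> that the last particle
      exceeds.\<close>
    define e3 where "e3 = enn2real (\<integral>\<^sup>+y. ennreal (h (1 + ?Y y)) \<partial>Q k)"
    define \<pi> where "\<pi> = enn2real (\<integral>\<^sup>+y. indicator {t k<..} (y ?N) \<partial>Q k)"
    define S where "S = (\<integral>\<^sup>+y. ennreal (real (?X y) * h (?X y)) \<partial>Q k)"
    have le1: "(\<integral>\<^sup>+y. F y \<partial>M) \<le> 1" if "prob_space M" "\<And>y. F y \<le> 1" for M :: "(nat \<Rightarrow> real) measure" and F
    proof -
      have "(\<integral>\<^sup>+y. F y \<partial>M) \<le> (\<integral>\<^sup>+y. 1 \<partial>M)" using that(2) by (intro nn_integral_mono)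
      then show ?thesis using prob_space.emeasure_space_1[OF that(1)] by simp
    qed
    have real1: "x = ennreal (enn2real x)" "enn2real x \<le> 1" if "x \<le> 1" for x
    proof -
      have "x < \<infinity>" using that by (rule le_less_trans) simp
      then show "x = ennreal (enn2real x)" by simp
      show "enn2real x \<le> 1" using enn2real_mono[OF that] by simp
    qed
    have h1: "ennreal (h j) \<le> 1" for j using ennreal_leI[OF h(2)[of j]] by simp
    have E1: "(\<integral>\<^sup>+y. ennreal (h (1 + ?X y)) \<partial>Q k) = ennreal e1" "0 \<le> e1" "e1 \<le> 1"
      unfolding e1_def using real1[OF le1[OF Q.prob_space_axioms h1]] by auto
    have E2: "(\<integral>\<^sup>+y. ennreal (h (1 + ?Y y)) \<partial>?P) = ennreal e2" "0 \<le> e2" "e2 \<le> 1"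
      unfolding e2_def using real1[OF le1[OF prob_space_P h1]] by auto
    have E3: "(\<integral>\<^sup>+y. ennreal (h (1 + ?Y y)) \<partial>Q k) = ennreal e3" "0 \<le> e3" "e3 \<le> 1"
      unfolding e3_def using real1[OF le1[OF Q.prob_space_axioms h1]] by auto
    have Pi: "(\<integral>\<^sup>+y. indicator {t k<..} (y ?N) \<partial>Q k) = ennreal \<pi>" "0 \<le> \<pi>"
      unfolding \<pi>_def using real1[OF le1[OF Q.prob_space_axioms, of "\<lambda>y. indicator {t k<..} (y ?N)"]] by (auto simp: indicator_def)
    have eqY: "indicator {t k<..} ((y(?N := x)) ?N) * ennreal (h (1 + ?Y (y(?N := x)))) = indicator {t k<..} x * ennreal (h (1 + ?Y y))"
      for x and y :: "nat \<Rightarrow> real"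
      by (simp add: exceedances_upd)
    note T = last_particle_exceeds[OF c edge t1 mY[of "\<lambda>j. ennreal (h (1 + j))"] h1
        borel_measurable_times_ennreal[OF mN mY'[of "\<lambda>j. ennreal (h (1 + j))"]] eqY]
    have S_eq: "S = ennreal (real ?N) * (\<integral>\<^sup>+y. indicator {t k<..} (y ?N) * ennreal (h (1 + ?Y y)) \<partial>Q k)"
      unfolding S_def by (rule exceedances_size_bias[OF h(1) refl])
    have Nt: "ennreal (real ?N) * tail_mass k (t k) = ennreal (\<Lambda> k)" using fin by (simp add: \<Lambda>_def)
    have S_le: "S \<le> ennreal (\<Lambda> k * (e2 + d k))"
    proof -
      have "S \<le> ennreal (real ?N) * (tail_mass k (t k) * (ennreal e2 + ennreal (d k)))"
        unfolding S_eq d_def by (rule mult_left_mono[OF T(1)[unfolded E2(1)] zero_le])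
      also have "\<dots> = ennreal (\<Lambda> k) * (ennreal e2 + ennreal (d k))" by (simp only: mult.assoc[symmetric] Nt)
      also have "\<dots> = ennreal (\<Lambda> k * (e2 + d k))"
        using \<Lambda>0 d0 E2(2) by (simp add: ennreal_mult)
      finally show ?thesis .
    qed
    then obtain s where s: "S = ennreal s" "0 \<le> s" "s \<le> \<Lambda> k * (e2 + d k)"
      using \<Lambda>0 d0 E2(2) by (cases S) (auto simp: ennreal_le_iff top_unique)
    have S_ge: "\<Lambda> k * e2 \<le> s + \<Lambda> k * d k"
    proof -
      have "ennreal (real ?N) * (tail_mass k (t k) * ennreal e2)
        \<le> ennreal (real ?N) * ((\<integral>\<^sup>+y. indicator {t k<..} (y ?N) * ennreal (h (1 + ?Y y)) \<partial>Q k) + tail_mass k (t k) * ennreal (d k))"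
        unfolding d_def by (rule mult_left_mono[OF T(2)[unfolded E2(1)] zero_le])
      then have "ennreal (\<Lambda> k) * ennreal e2 \<le> S + ennreal (\<Lambda> k) * ennreal (d k)"
        unfolding distrib_left S_eq[symmetric] by (simp only: mult.assoc[symmetric] Nt)
      then have "ennreal (\<Lambda> k * e2) \<le> ennreal (s + \<Lambda> k * d k)"
        using \<Lambda>0 d0 E2(2) s by (simp add: ennreal_mult)
      then show ?thesis using s(2) \<Lambda>0 d0 by (subst (asm) ennreal_le_iff) auto
    qed
    have \<pi>_le: "\<pi> \<le> \<Lambda> k * (1 + d k) / real ?N"
    proof -
      have eq1: "indicator {t k<..} ((y(?N := x)) ?N) = indicator {t k<..} x * (1 :: ennreal)" for x and y :: "nat \<Rightarrow> real" by simp
      have "ennreal \<pi> \<le> tail_mass k (t k) * ((\<integral>\<^sup>+y. 1 \<partial>?P) + ennreal (d k))"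
        unfolding Pi(1)[symmetric] d_def
        by (rule last_particle_exceeds(1)[OF c edge t1 _ _ mN eq1]) auto
      also have "\<dots> = ennreal (\<Lambda> k / real ?N) * ennreal (1 + d k)"
        using d0 by (simp add: tm)
      also have "\<dots> = ennreal (\<Lambda> k / real ?N * (1 + d k))"
        using \<Lambda>0 d0 by (intro ennreal_mult[symmetric]) auto
      finally show ?thesis using \<Lambda>0 d0 by (subst (asm) ennreal_le_iff) auto
    qed
    obtain \<epsilon>' where \<epsilon>': "\<epsilon> k = ennreal \<epsilon>'" "0 \<le> \<epsilon>'" "enn2real (\<epsilon> k) = \<epsilon>'" using ef by (cases "\<epsilon> k") auto
    have "\<bar>e3 - e2\<bar> \<le> \<epsilon>'"
    proof -
      have "(\<integral>\<^sup>+y. ennreal (h (1 + ?Y y)) \<partial>Q k) \<le> (\<integral>\<^sup>+y. ennreal (h (1 + ?Y y)) \<partial>?P) + \<epsilon> k \<and>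
        (\<integral>\<^sup>+y. ennreal (h (1 + ?Y y)) \<partial>?P) \<le> (\<integral>\<^sup>+y. ennreal (h (1 + ?Y y)) \<partial>Q k) + \<epsilon> k"
        by (rule remove[OF mY[of "\<lambda>j. ennreal (h (1 + j))"] mY'[of "\<lambda>j. ennreal (h (1 + j))"] h1]) (simp add: exceedances_upd)
      then have "ennreal e3 \<le> ennreal (e2 + \<epsilon>')" "ennreal e2 \<le> ennreal (e3 + \<epsilon>')"
        using E2 E3 \<epsilon>' by auto
      then show ?thesis using E2(2) E3(2) \<epsilon>'(2) by (subst (asm) (1 2) ennreal_le_iff) auto
    qed
    moreover have "\<bar>e1 - e3\<bar> \<le> \<pi>"
    proof -
      have "ennreal (h (1 + ?X y)) \<le> ennreal (h (1 + ?Y y)) + indicator {t k<..} (y ?N)"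
        "ennreal (h (1 + ?Y y)) \<le> ennreal (h (1 + ?X y)) + indicator {t k<..} (y ?N)" for y
        using h1 by (auto simp: exceedances_Suc indicator_def intro: add_increasing)
      then have "(\<integral>\<^sup>+y. ennreal (h (1 + ?X y)) \<partial>Q k) \<le> (\<integral>\<^sup>+y. ennreal (h (1 + ?Y y)) + indicator {t k<..} (y ?N) \<partial>Q k)"
        "(\<integral>\<^sup>+y. ennreal (h (1 + ?Y y)) \<partial>Q k) \<le> (\<integral>\<^sup>+y. ennreal (h (1 + ?X y)) + indicator {t k<..} (y ?N) \<partial>Q k)"
        by (intro nn_integral_mono; blast)+
      moreover have "(\<integral>\<^sup>+y. ennreal (h (1 + ?Y y)) + indicator {t k<..} (y ?N) \<partial>Q k) = ennreal e3 + ennreal \<pi>"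
        "(\<integral>\<^sup>+y. ennreal (h (1 + ?X y)) + indicator {t k<..} (y ?N) \<partial>Q k) = ennreal e1 + ennreal \<pi>"
        unfolding E1(1)[symmetric] E3(1)[symmetric] Pi(1)[symmetric]
        using mX[of "\<lambda>j. ennreal (h (1 + j))"] mY'[of "\<lambda>j. ennreal (h (1 + j))"] mN
        by (auto intro: nn_integral_add)
      ultimately have "ennreal e1 \<le> ennreal e3 + ennreal \<pi>" "ennreal e3 \<le> ennreal e1 + ennreal \<pi>"
        unfolding E1(1) E3(1) by argo+
      then have "ennreal e1 \<le> ennreal (e3 + \<pi>)" "ennreal e3 \<le> ennreal (e1 + \<pi>)"
        using E1(2) E3(2) Pi(2) by auto
      then show ?thesis using E1(2) E3(2) Pi(2) by (subst (asm) (1 2) ennreal_le_iff) auto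
    qed
    ultimately have e12: "\<bar>e1 - e2\<bar> \<le> \<Lambda> k * (1 + d k) / real ?N + enn2real (\<epsilon> k)"
      using \<pi>_le \<epsilon>'(3) by linarith
    have stein: "l * e1 + exp (- l) = s + p k"
    proof -
      have mp: "{y \<in> space (RN ?N). ?X y = 0} \<in> sets (RN ?N)"
      proof -
        have "(\<lambda>y. (if ?X y = 0 then 1 else 0) :: ennreal) -` {1} \<inter> space (RN ?N) \<in> sets (RN ?N)"
          by (rule measurable_sets[OF mX[of "\<lambda>j. if j = 0 then 1 else 0"]]) auto
        also have "(\<lambda>y. (if ?X y = 0 then 1 else 0) :: ennreal) -` {1} \<inter> space (RN ?N) = {y \<in> space (RN ?N). ?X y = 0}"
          by (auto split: if_splits)
        finally show ?thesis .
      qed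
      have "(\<integral>\<^sup>+y. ennreal l * ennreal (h (1 + ?X y)) + ennreal (exp (- l)) \<partial>Q k)
        = (\<integral>\<^sup>+y. ennreal (real (?X y) * h (?X y)) + indicator {y \<in> space (RN ?N). ?X y = 0} y \<partial>Q k)"
      proof (rule nn_integral_cong)
        fix y assume "y \<in> space (Q k)"
        then have y: "y \<in> space (RN ?N)" by simp
        have "ennreal l * ennreal (h (1 + ?X y)) + ennreal (exp (- l)) = ennreal (l * h (?X y + 1) + exp (- l))"
          using l h by (simp add: ennreal_mult add.commute)
        also have "l * h (?X y + 1) + exp (- l) = real (?X y) * h (?X y) + (if ?X y = 0 then 1 else 0)"
          unfolding h_def by (rule stein_equation)
        also have "ennreal \<dots> = ennreal (real (?X y) * h (?X y)) + ennreal (if ?X y = 0 then 1 else 0)"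
          using h by (intro ennreal_plus) auto
        finally show "ennreal l * ennreal (h (1 + ?X y)) + ennreal (exp (- l))
          = ennreal (real (?X y) * h (?X y)) + indicator {y \<in> space (RN ?N). ?X y = 0} y"
          using y by (auto simp: indicator_def)
      qed
      moreover have "(\<integral>\<^sup>+y. ennreal l * ennreal (h (1 + ?X y)) + ennreal (exp (- l)) \<partial>Q k) = ennreal (l * e1 + exp (- l))"
        using mX[of "\<lambda>j. ennreal (h (1 + j))"] l E1(2) Q.emeasure_space_1
        by (simp add: nn_integral_add nn_integral_cmult E1(1)[unfolded plus_1_eq_Suc] ennreal_mult)
      moreover have "(\<integral>\<^sup>+y. ennreal (real (?X y) * h (?X y)) + indicator {y \<in> space (RN ?N). ?X y = 0} y \<partial>Q k) = ennreal (s + p k)"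
      proof -
        have "(\<integral>\<^sup>+y. ennreal (real (?X y) * h (?X y)) + indicator {y \<in> space (RN ?N). ?X y = 0} y \<partial>Q k)
          = S + (\<integral>\<^sup>+y. indicator {y \<in> space (RN ?N). ?X y = 0} y \<partial>Q k)"
          unfolding S_def using mX[of "\<lambda>j. ennreal (real j * h j)"] mp
          by (intro nn_integral_add) auto
        also have "(\<integral>\<^sup>+y. indicator {y \<in> space (RN ?N). ?X y = 0} y \<partial>Q k) = ennreal (p k)"
          using mp by (simp add: p_def Q.emeasure_eq_measure)
        finally show ?thesis using s by (simp add: p_def)
      qed
      ultimately have "ennreal (l * e1 + exp (- l)) = ennreal (s + p k)" by simp
      moreover have "0 \<le> l * e1 + exp (- l)" "0 \<le> s + p k"
        using l E1(2) s(2) by (auto simp: p_def)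
      ultimately show ?thesis by (simp only: ennreal_inj)
    qed
    \<comment> \<open>Stein's equation solved for p k; the three errors come from the change of the
      ensemble and the count, from the mean \<Lambda>, and from the density at the edge.\<close>
    have "p k - exp (- l) = l * (e1 - e2) + (l - \<Lambda> k) * e2 + (\<Lambda> k * e2 - s)"
      using stein by (simp add: algebra_simps)
    moreover have "\<bar>l * (e1 - e2)\<bar> \<le> l * (\<Lambda> k * (1 + d k) / real ?N + enn2real (\<epsilon> k))"
      unfolding abs_mult using e12 l by (intro mult_mono) auto
    moreover have "\<bar>(l - \<Lambda> k) * e2\<bar> \<le> \<bar>\<Lambda> k - l\<bar>"
      unfolding abs_mult using mult_left_mono[OF E2(3), of "\<bar>l - \<Lambda> k\<bar>"] E2(2) by (simp add: abs_minus_commute)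
    moreover have "\<bar>\<Lambda> k * e2 - s\<bar> \<le> \<Lambda> k * d k"
      using S_ge s(3) by (simp add: abs_le_iff algebra_simps)
    ultimately show ?thesis by linarith
  qed
  define B where "B = (\<lambda>k. l * (\<Lambda> k * (1 + d k) * (1 / real (Suc (n k))) + enn2real (\<epsilon> k)) + \<bar>\<Lambda> k - l\<bar> + \<Lambda> k * d k)"
  have "B \<longlonglongrightarrow> l * (l * (1 + 0) * 0 + 0) + \<bar>l - l\<bar> + l * 0"
  proof -
    have "((\<lambda>m::nat. 1 / real (Suc m)) \<longlongrightarrow> 0) at_top" by real_asymp
    from filterlim_compose[OF this n_lim] have 1: "(\<lambda>k. 1 / real (Suc (n k))) \<longlonglongrightarrow> 0" .
    have 2: "(\<lambda>k. enn2real (\<epsilon> k)) \<longlonglongrightarrow> 0"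
      using tendsto_enn2real[of \<epsilon> 0 sequentially] \<epsilon> by simp
    show ?thesis unfolding B_def by (intro tendsto_intros \<Lambda>_lim d_lim 1 2)
  qed
  then have B: "B \<longlonglongrightarrow> 0" by simp
  have "\<forall>\<^sub>F k in sequentially. norm (p k - exp (- l)) \<le> B k"
  proof -
    have "\<forall>\<^sub>F k in sequentially. 1 \<le> t k" using lims(1) by (simp add: filterlim_at_top)
    moreover have "\<forall>\<^sub>F k in sequentially. ennreal (real (Suc (n k))) * tail_mass k (t k) < \<infinity>"
      using lims(2) by (intro order_tendstoD(2)) auto
    moreover have "\<forall>\<^sub>F k in sequentially. \<epsilon> k < \<infinity>" using \<epsilon> by (intro order_tendstoD(2)) auto
    ultimately show ?thesis
    proof eventually_elim
      case (elim k)
      show ?case using main[OF elim] by (simp add: B_def)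
    qed
  qed
  then have "(\<lambda>k. p k - exp (- l)) \<longlonglongrightarrow> 0" by (rule Lim_null_comparison[OF _ B])
  then have "p \<longlonglongrightarrow> exp (- l)" by (simp add: LIM_zero_iff)
  then show ?thesis by (simp add: p_def l_def)
qed

end

section \<open>Convergence to the Gumbel distribution\<close>

lemma cdf_standard_gumbel: "cdf standard_gumbel = (\<lambda>t. exp (- exp (- t)))"
  unfolding standard_gumbel_def
proof (rule cdf_interval_measure)
  show "exp (- exp (- x)) \<le> exp (- exp (- y))" if "x \<le> y" for x y :: real using that by simp
  show "continuous (at_right a) (\<lambda>t. exp (- exp (- t)))" for a :: real by (intro continuous_intros)
  show "((\<lambda>t. exp (- exp (- t))) \<longlongrightarrow> (0::real)) at_bot" by real_asymp
qed

lemma xi_measurable [measurable]: "xi \<gamma> b N \<in> borel_measurable (RN N)"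
proof (cases "N = 0")
  case False
  have "(\<lambda>y. Max ((\<lambda>j. y j) ` {1..N})) \<in> borel_measurable (RN N)"
    by (rule borel_measurable_Max) (auto intro: measurable_coord)
  then have [measurable]: "(\<lambda>y. Max (y ` {1..N})) \<in> borel_measurable (RN N)" by simp
  show ?thesis unfolding xi_def[abs_def] by measurable
qed (simp add: xi_def[abs_def])

text \<open>N \<ge> 2 makes ln N positive, so solving for the maximum divides by a positive
  number.\<close>

lemma xi_le_iff:
  assumes N: "2 \<le> N"
  shows "xi \<gamma> b N y \<le> \<tau> \<longleftrightarrow> exceedances N (threshold (L_const \<gamma>) b N \<tau>) y = 0"
proof -
  define l where "l = ln (real N)"
  have l: "0 < l" using N by (simp add: l_def)
  define r where "r = sqrt l"
  have r: "0 < r" "l = r * r" using l by (auto simp: r_def)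
  define m where "m = Max (y ` {1..N})"
  define z where "z = (b * real N - 1) / 2 * ln l"
  have "xi \<gamma> b N y \<le> \<tau> \<longleftrightarrow> 2 * (r * m - r * r) - z + ln (2 * L_const \<gamma>) \<le> \<tau>"
    unfolding xi_def m_def[symmetric] l_def[symmetric] r_def[symmetric] z_def[symmetric] unfolding r(2) ..
  also have "\<dots> \<longleftrightarrow> (m - r) * (2 * r) \<le> \<tau> + z - ln (2 * L_const \<gamma>)" by (auto simp: algebra_simps)
  also have "\<dots> \<longleftrightarrow> m - r \<le> (\<tau> + z - ln (2 * L_const \<gamma>)) / (2 * r)" using r by (simp add: pos_le_divide_eq)
  also have "\<dots> \<longleftrightarrow> m \<le> threshold (L_const \<gamma>) b N \<tau>"
    unfolding threshold_def l_def[symmetric] r_def[symmetric] z_def[symmetric] by linarith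
  also have "\<dots> \<longleftrightarrow> exceedances N (threshold (L_const \<gamma>) b N \<tau>) y = 0"
    unfolding exceedances_eq_0_iff m_def using N by (subst Max_le_iff) auto
  finally show ?thesis .
qed

theorem corollary1p9:
  fixes \<beta> :: "nat \<Rightarrow> real" and \<gamma> :: real
  assumes beta_pos: "\<And>N. N \<ge> 1 \<Longrightarrow> \<beta> N > 0"
    and gamma_nonneg: "\<gamma> \<ge> 0"
    and regime: "(\<lambda>N. \<beta> N * real N) \<longlonglongrightarrow> \<gamma>"
  shows "weak_conv_m
           (\<lambda>N. distr (beta_ensemble (\<lambda>x. x\<^sup>2) (\<beta> N) N) borel (xi \<gamma> (\<beta> N) N))
           standard_gumbel"
proof -
  interpret high_temperature \<gamma> by standard (rule gamma_nonneg)
  obtain U f C where *: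
    "0 < L_const \<gamma>" "\<And>x. f x = exp (- \<gamma> * U x - x\<^sup>2) / L_const \<gamma>"
    "U \<in> borel_measurable borel" "integrable lborel f" "(\<integral>x. f x \<partial>lborel) = 1"
    "0 < C" "\<And>x. f x \<le> C" "\<And>x. - (C + theta x) \<le> U x" "\<And>x. U x \<le> C * (1 + theta x)"
    "\<And>x. integrable lborel (\<lambda>z. ln \<bar>x - z\<bar> * f z)" "\<And>x. U x = - (\<integral>z. ln \<bar>x - z\<bar> * f z \<partial>lborel)"
    "integrable lborel (\<lambda>x. \<bar>x\<bar> * f x)"
    by (rule equilibrium_density_exists) blast
  interpret equilibrium \<gamma> "L_const \<gamma>" C U f
    by standard (fact gamma_nonneg *)+
  have "\<forall>\<^sub>F N in sequentially. \<beta> N * real N < \<gamma> + 1"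
    using regime by (intro order_tendstoD(2)) auto
  \<comment> \<open>Together with the preceding bound this gives \<beta>_N \<le> 1/2.\<close>
  moreover have "\<forall>\<^sub>F N in sequentially. 2 * (\<gamma> + 1) \<le> real N"
    by (intro eventually_sequentiallyI[of "nat \<lceil>2 * (\<gamma> + 1)\<rceil>"]) linarith
  ultimately obtain M where M: "\<And>N. M \<le> N \<Longrightarrow> \<beta> N * real N < \<gamma> + 1 \<and> 2 * (\<gamma> + 1) \<le> real N"
    unfolding eventually_sequentially by (metis le_trans linear)
  define b where "b = (\<lambda>k. \<beta> (k + (M + 3)))"
  \<comment> \<open>n k = N - 2 for N = k + M + 3, the smallest of the three sizes. The shift by M
    reaches the range in which the uniform bounds hold, and the further 1 keeps n k
    positive.\<close>
  define n where "n = (\<lambda>k. k + (M + 1))"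
  have b0: "0 < b k" for k unfolding b_def by (rule beta_pos) simp
  have N3: "real (k + (M + 3)) = real k + real M + 3" for k by simp
  have bN: "b k * (real k + real M + 3) \<le> \<gamma> + 1" for k using M[of "k + (M + 3)"] unfolding b_def N3 by simp
  have bh: "b k \<le> 1 / 2" for k
  proof -
    have "2 * (\<gamma> + 1) \<le> real k + real M + 3" using M[of "k + (M + 3)"] unfolding N3 by simp
    then have "b k * (2 * (\<gamma> + 1)) \<le> b k * (real k + real M + 3)" using b0[of k] by (intro mult_left_mono) auto
    with bN[of k] have "b k * 2 * (\<gamma> + 1) \<le> 1 * (\<gamma> + 1)" by (simp add: mult.assoc)
    then have "b k * 2 \<le> 1" by (rule mult_right_le_imp_le) (use gamma_nonneg in simp)
    then show ?thesis by simp
  qed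
  have bm: "b k * real m \<le> \<gamma> + 1" if "real m \<le> real k + real M + 3" for k m
    using mult_left_mono[OF that, of "b k"] b0[of k] bN[of k] by linarith
  have lim3: "(\<lambda>k. b k * (real k + real M + 3)) \<longlonglongrightarrow> \<gamma>"
    using LIMSEQ_ignore_initial_segment[OF regime, of "M + 3"] unfolding b_def N3[symmetric] .
  have "(\<lambda>k. b k * (real k + real M + 3) * (1 / (real k + real M + 3))) \<longlonglongrightarrow> \<gamma> * 0"
    by (intro tendsto_mult lim3) real_asymp
  moreover have "b k * (real k + real M + 3) * (1 / (real k + real M + 3)) = b k" for k by simp
  ultimately have bl: "b \<longlonglongrightarrow> 0" by simp
  have "(\<lambda>k. b k * (real k + real M + 3) - 2 * b k) \<longlonglongrightarrow> \<gamma> - 2 * 0" "(\<lambda>k. b k * (real k + real M + 3) - b k) \<longlonglongrightarrow> \<gamma> - 0"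
    by (intro tendsto_intros lim3 bl)+
  then have lims: "(\<lambda>k. b k * real (n k)) \<longlonglongrightarrow> \<gamma>" "(\<lambda>k. b k * real (Suc (n k))) \<longlonglongrightarrow> \<gamma>"
    by (simp_all add: n_def algebra_simps)
  have nl: "filterlim n at_top sequentially" "filterlim (\<lambda>k. Suc (n k)) at_top sequentially"
    unfolding n_def by (auto intro!: filterlim_at_top_mono[OF filterlim_ident] always_eventually)
  have bn: "b k * real (n k) \<le> \<gamma> + 1" "b k * real (Suc (n k)) \<le> \<gamma> + 1" "b k * real (Suc (Suc (n k))) \<le> \<gamma> + 1" for k
    by (intro bm; simp add: n_def)+
  have n_pos: "1 \<le> n k" for k by (simp add: n_def)
  \<comment> \<open>At the common temperature b k = \<beta>_N, \<open>s1\<close> has N - 2 particles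
    and yields the density bound for one of N - 1; \<open>s2\<close> has N - 1 particles and needs
    exactly that bound to treat the exceedances among N.\<close>
  interpret s1: mean_field_sequence \<gamma> "L_const \<gamma>" C U f b n
    by standard (use b0 bh bn nl lims bl in \<open>simp_all add: less_imp_le n_pos[simplified]\<close>)
  interpret s2: mean_field_sequence \<gamma> "L_const \<gamma>" C U f b "\<lambda>k. Suc (n k)"
    by standard (use b0 bh bn nl lims bl in \<open>simp_all add: less_imp_le n_pos[simplified]\<close>)
  obtain K where K: "0 < K" "\<And>k h. h \<in> borel_measurable borel \<Longrightarrow>
    (\<integral>\<^sup>+y. h (y (Suc (n k))) \<partial>ensemble (b k) (Suc (n k))) \<le> ennreal K * (\<integral>\<^sup>+x. h x * ennreal (exp (- x\<^sup>2 / 2)) \<partial>lborel)"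
    by (rule s1.last_particle_density_bound) blast
  have N_eq: "Suc (Suc (n k)) = k + (M + 3)" for k by (simp add: n_def)
  show ?thesis
    unfolding weak_conv_m_def weak_conv_def cdf_standard_gumbel
  proof (intro allI impI)
    fix \<tau> :: real
    have cdf: "cdf (distr (beta_ensemble (\<lambda>x. x\<^sup>2) (\<beta> N) N) borel (xi \<gamma> (\<beta> N) N)) \<tau>
      = measure (ensemble (\<beta> N) N) {y \<in> space (RN N). exceedances N (threshold (L_const \<gamma>) (\<beta> N) N \<tau>) y = 0}"
      if "2 \<le> N" for N
    proof -
      have "xi \<gamma> (\<beta> N) N -` {..\<tau>} \<inter> space (ensemble (\<beta> N) N)
        = {y \<in> space (RN N). exceedances N (threshold (L_const \<gamma>) (\<beta> N) N \<tau>) y = 0}"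
        using xi_le_iff[OF that] by auto
      then show ?thesis unfolding ensemble_eq_beta_ensemble cdf_def
        by (subst measure_distr) auto
    qed
    have "(\<lambda>k. measure (ensemble (b k) (Suc (Suc (n k))))
      {y \<in> space (RN (Suc (Suc (n k)))). exceedances (Suc (Suc (n k))) (threshold (L_const \<gamma>) (b k) (Suc (Suc (n k))) \<tau>) y = 0})
      \<longlonglongrightarrow> exp (- exp (- \<tau>))"
      by (rule s2.no_exceedance_tendsto[OF K])
    then have "(\<lambda>k. cdf (distr (beta_ensemble (\<lambda>x. x\<^sup>2) (\<beta> (k + (M + 3))) (k + (M + 3))) borel
        (xi \<gamma> (\<beta> (k + (M + 3))) (k + (M + 3)))) \<tau>) \<longlonglongrightarrow> exp (- exp (- \<tau>))"
      unfolding N_eq b_def by (subst cdf) auto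
    then show "(\<lambda>N. cdf (distr (beta_ensemble (\<lambda>x. x\<^sup>2) (\<beta> N) N) borel (xi \<gamma> (\<beta> N) N)) \<tau>) \<longlonglongrightarrow> exp (- exp (- \<tau>))"
      by (rule LIMSEQ_offset)
  qed
qed

end
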